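(* Let $n\ge 1$ be an integer. The pure braid group $P_n$ admits a mild presentation if and only if $n\le 3$. Likewise, the pure virtual braid group $vP_n$ admits a mild presentation if and only if $n\le 3$, and the upper pure virtual braid group $vP_n^+$ admits a mild presentation if and only if $n\leq 3$.
   Context: $P_n$ is the Artin pure braid group on $n$ strings. The pure virtual braid group $vP_n$ is the group with generators $x_{ij}$ ($1\le i\ne j\le n$) and relations $x_{ij}x_{ik}x_{jk}=x_{jk}x_{ik}x_{ij}$ for distinct $i,j,k$, and $x_{ij}x_{kl}=x_{kl}x_{ij}$ for distinct $i,j,k,l$. The upper pure virtual braid group $vP_n^+$ is the subgroup of $vP_n$ generated by the $x_{ij}$ with $i<j$; it has a presentation with these generators and relations $x_{ij}x_{ik}x_{jk}=x_{jk}x_{ik}x_{ij}$ for $i<j<k$, and $x_{ij}x_{kl}=x_{kl}x_{ij}$ for $i,j,k,l$ distinct, $i<j$, $k<l$. Mild presentation: let $G=F/R=\langle x_1,\dots,x_q\mid r_1,\dots,r_m\rangle$ be a finite presentation, with $F$ free on the $x_i$ and the $r_i$ nontrivial words. Let $\{\Gamma_kF\}$ be the lower central series. The weight of $r\in F$ is $\omega(r)=\sup\{k\mid r\in\Gamma_kF\}$, and the initial form $\mathrm{in}(r)$ is the image of $r$ in $\mathrm{gr}_{\omega(r)}(F)=(\Gamma_{\omega(r)}F/\Gamma_{\omega(r)+1}F)\otimes\mathbb{C}$. Here $\mathrm{gr}(F)$ is the free complex Lie algebra $\mathbf{L}$ on $x_1,\dots,x_q$ (equivalently, on $H_1(G,\mathbb{C})$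 when all relators lie in $[F,F]$). Let $J\subset\mathbf{L}$ be the Lie ideal generated by $\mathrm{in}(r_1),\dots,\mathrm{in}(r_m)$ and put $\mathfrak{L}(G)=\mathbf{L}/J$. Via the adjoint representation, $J/[J,J]$ is a module over the universal enveloping algebra $U(\mathfrak{L}(G))$. The presentation is called mild if $J/[J,J]$ is a free $U(\mathfrak{L}(G))$-module on the images of $\mathrm{in}(r_1),\dots,\mathrm{in}(r_m)$. *)

theory Defs
  imports
    Complex_Main
    "HOL-Algebra.Elementary_Groups"
    "HOL-Algebra.Module"
    "HOL-Algebra.QuotRing"
    "HOL-Algebra.Sym_Groups"
begin

section \<open>Free groups and groups given by generators and relators\<close>

text \<open>The letter \<open>(s, True)\<close> stands for the generator \<open>s\<close>, and \<open>(s, False)\<close> for its inverse.\<close>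

type_synonym 'a gword = "('a \<times> bool) list"

definition flip :: "'a \<times> bool \<Rightarrow> 'a \<times> bool" where
  "flip x = (fst x, \<not> snd x)"

fun reduced :: "'a gword \<Rightarrow> bool" where
  "reduced [] = True"
| "reduced [x] = True"
| "reduced (x # y # w) = (y \<noteq> flip x \<and> reduced (y # w))"

definition push :: "'a \<times> bool \<Rightarrow> 'a gword \<Rightarrow> 'a gword" where
  "push x w = (case w of [] \<Rightarrow> [x] | y # v \<Rightarrow> if y = flip x then v else x # w)"

text \<open>Elements are the reduced words. Pushing the letters of \<open>u\<close> one after the other onto the
  reduced word \<open>v\<close> computes the reduced form of \<open>u @ v\<close>.\<close>

definition free_group :: "'a set \<Rightarrow> 'a gword monoid" where
  "free_group S = \<lparr>carrier = {w. reduced w \<and> fst ` set w \<subseteq> S},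
                   monoid.mult = foldr push, monoid.one = []\<rparr>"

definition letter :: "'a \<Rightarrow> 'a gword" where
  "letter s = [(s, True)]"

lemma flip_flip [simp]: "flip (flip x) = x"
  by (simp add: flip_def)

lemma fst_flip [simp]: "fst (flip x) = fst x"
  by (simp add: flip_def)

lemma flip_neq [simp]: "flip x \<noteq> x"
  by (cases x) (auto simp: flip_def)

lemma reduced_tl: "reduced (x # w) \<Longrightarrow> reduced w"
  by (cases w) auto

lemma reduced_push: "reduced w \<Longrightarrow> reduced (push x w)"
  by (auto simp: push_def split: list.splits dest: reduced_tl)

lemma push_push_flip: "reduced w \<Longrightarrow> push (flip x) (push x w) = w"
  by (cases w rule: reduced.cases) (auto simp: push_def)

lemma push_flip_push: "reduced w \<Longrightarrow> push x (push (flip x) w) = w"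
  using push_push_flip[of w "flip x"] by simp

lemma reduced_foldr_push: "reduced w \<Longrightarrow> reduced (foldr push u w)"
  by (induction u) (auto intro: reduced_push)

lemma foldr_push_push: "reduced w \<Longrightarrow> foldr push (push x u) w = push x (foldr push u w)"
proof (cases u)
  case (Cons y v)
  assume "reduced w"
  then show ?thesis
    using Cons push_flip_push[of "foldr push v w" x] reduced_foldr_push[of w v]
    by (auto simp: push_def[of x "y # v"])
qed (simp add: push_def[of x "[]"])

lemma foldr_push_assoc:
  "reduced w \<Longrightarrow> foldr push (foldr push u v) w = foldr push u (foldr push v w)"
  by (induction u) (auto simp: foldr_push_push)

lemma foldr_push_Nil: "reduced w \<Longrightarrow> foldr push w [] = w"
proof (induction w rule: reduced.induct)
  case (3 x y w)
  then show ?case by (simp add: push_def[of x])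
qed (auto simp: push_def)

lemma letters_push: "fst ` set (push x w) \<subseteq> insert (fst x) (fst ` set w)"
  by (auto simp: push_def split: list.splits)

lemma letters_foldr_push:
  "fst ` set u \<subseteq> S \<Longrightarrow> fst ` set v \<subseteq> S \<Longrightarrow> fst ` set (foldr push u v) \<subseteq> S"
proof (induction u)
  case (Cons x u)
  then have "insert (fst x) (fst ` set (foldr push u v)) \<subseteq> S" by simp
  with letters_push have "fst ` set (push x (foldr push u v)) \<subseteq> S" by (rule order_trans)
  then show ?case by simp
qed simp

lemma foldr_push_inverse:
  "reduced w \<Longrightarrow> foldr push (map flip (rev u)) (foldr push u w) = w"
  by (induction u) (auto simp: push_push_flip reduced_foldr_push)

lemma group_free_group: "group (free_group S)"
proof (rule groupI, goal_cases)
  case (5 w)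
  define v where "v = foldr push (map flip (rev w)) []"
  have "v \<in> carrier (free_group S)"
    using 5 letters_foldr_push[of "map flip (rev w)" S "[]"]
    by (simp add: v_def free_group_def reduced_foldr_push image_image)
  moreover have "v \<otimes>\<^bsub>free_group S\<^esub> w = \<one>\<^bsub>free_group S\<^esub>"
    using 5 foldr_push_inverse[of "[]" w]
    by (simp add: v_def free_group_def foldr_push_assoc foldr_push_Nil)
  ultimately show ?case by blast
qed (auto simp: free_group_def reduced_foldr_push foldr_push_assoc
      dest: subsetD[OF letters_foldr_push])

definition normal_closure :: "('a, 'x) monoid_scheme \<Rightarrow> 'a set \<Rightarrow> 'a set" where
  "normal_closure G R =
     generate G {g \<otimes>\<^bsub>G\<^esub> r \<otimes>\<^bsub>G\<^esub> inv\<^bsub>G\<^esub> g | g r. g \<in> carrier G \<and> r \<in> R}"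

definition presented_group :: "'a set \<Rightarrow> 'a gword set \<Rightarrow> 'a gword set monoid" where
  "presented_group S R = free_group S Mod normal_closure (free_group S) R"

definition presented_gen :: "'a set \<Rightarrow> 'a gword set \<Rightarrow> 'a \<Rightarrow> 'a gword set" where
  "presented_gen S R s = normal_closure (free_group S) R #>\<^bsub>free_group S\<^esub> letter s"

definition relator :: "'a set \<Rightarrow> 'a gword \<Rightarrow> 'a gword \<Rightarrow> 'a gword" where
  "relator S u v = foldr push u [] \<otimes>\<^bsub>free_group S\<^esub> inv\<^bsub>free_group S\<^esub> (foldr push v [])"

definition word_eval :: "('g, 'x) monoid_scheme \<Rightarrow> ('a \<Rightarrow> 'g) \<Rightarrow> 'a gword \<Rightarrow> 'g" where
  "word_eval G f w =
     foldr (\<lambda>(s, e) y. (if e then f s else inv\<^bsub>G\<^esub> (f s)) \<otimes>\<^bsub>G\<^esub> y) w \<one>\<^bsub>G\<^esub>"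

section \<open>The groups\<close>

subsection \<open>Pure braid groups\<close>

definition braid_relators :: "nat \<Rightarrow> nat gword set" where
  "braid_relators n =
     {relator {1..<n} (letter i @ letter j) (letter j @ letter i) | i j.
        i \<in> {1..<n} \<and> j \<in> {1..<n} \<and> i + 2 \<le> j}
   \<union> {relator {1..<n} (letter i @ letter (Suc i) @ letter i)
                       (letter (Suc i) @ letter i @ letter (Suc i)) | i.
        i \<in> {1..<n} \<and> Suc i \<in> {1..<n}}"

definition braid_group :: "nat \<Rightarrow> nat gword set monoid" where
  "braid_group n = presented_group {1..<n} (braid_relators n)"

text \<open>The homomorphism to the symmetric group sending the \<open>i\<close>-th Artin generator to the
  transposition \<open>(i, i + 1)\<close>: all the words of a coset have the same value.\<close>

definition braid_perm :: "nat \<Rightarrow> nat gword set \<Rightarrow> nat \<Rightarrow> nat" where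
  "braid_perm n C = the_elem (word_eval (sym_group n) (\<lambda>i. transpose i (Suc i)) ` C)"

definition pure_braid_group :: "nat \<Rightarrow> nat gword set monoid" where
  "pure_braid_group n =
     (braid_group n)\<lparr>carrier := kernel (braid_group n) (sym_group n) (braid_perm n)\<rparr>"

subsection \<open>Pure virtual braid groups\<close>

definition virt_gens :: "nat \<Rightarrow> (nat \<times> nat) set" where
  "virt_gens n = {(i, j). i \<in> {1..n} \<and> j \<in> {1..n} \<and> i \<noteq> j}"

definition virt_relators :: "nat \<Rightarrow> (nat \<times> nat) gword set" where
  "virt_relators n =
     {relator (virt_gens n) (letter (i, j) @ letter (i, k) @ letter (j, k))
                            (letter (j, k) @ letter (i, k) @ letter (i, j)) | i j k.
        {i, j, k} \<subseteq> {1..n} \<and> distinct [i, j, k]}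
   \<union> {relator (virt_gens n) (letter (i, j) @ letter (k, l)) (letter (k, l) @ letter (i, j))
        | i j k l. {i, j, k, l} \<subseteq> {1..n} \<and> distinct [i, j, k, l]}"

definition pure_virtual_braid_group :: "nat \<Rightarrow> (nat \<times> nat) gword set monoid" where
  "pure_virtual_braid_group n = presented_group (virt_gens n) (virt_relators n)"

definition upper_pure_virtual_braid_group :: "nat \<Rightarrow> (nat \<times> nat) gword set monoid" where
  "upper_pure_virtual_braid_group n =
     subgroup_generated (pure_virtual_braid_group n)
       {presented_gen (virt_gens n) (virt_relators n) (i, j) | i j. 1 \<le> i \<and> i < j \<and> j \<le> n}"

section \<open>Algebras over the complex numbers\<close>

definition complex_ring :: "complex ring" where
  "complex_ring = \<lparr>carrier = UNIV, monoid.mult = (*), monoid.one = 1, ring.zero = 0, ring.add = (+)\<rparr>"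

text \<open>A complex algebra, not necessarily associative or unital, is a value of the library's record
  type \<^typ>\<open>(complex, 'a) module\<close>. For a Lie algebra, \<^const>\<open>monoid.mult\<close> is the bracket
  and \<^const>\<open>monoid.one\<close> has no meaning.\<close>

definition supp :: "('b \<Rightarrow> complex) \<Rightarrow> 'b set" where
  "supp f = {b. f b \<noteq> 0}"

definition basis_vec :: "'b \<Rightarrow> 'b \<Rightarrow> complex" where
  "basis_vec b = (\<lambda>c. if c = b then 1 else 0)"

text \<open>The complex vector space with basis \<open>B\<close>, with the bilinear extension of the operation
  \<open>m\<close> on \<open>B\<close>; \<open>e\<close> is the intended unit, if there is one.\<close>

definition magma_algebra ::
    "'b set \<Rightarrow> ('b \<Rightarrow> 'b \<Rightarrow> 'b) \<Rightarrow> 'b \<Rightarrow> (complex, 'b \<Rightarrow> complex) module" where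
  "magma_algebra B m e =
     \<lparr>carrier = {f. finite (supp f) \<and> supp f \<subseteq> B},
      monoid.mult = (\<lambda>f g c. \<Sum>a\<in>supp f. \<Sum>b\<in>supp g. if m a b = c then f a * g b else 0),
      monoid.one = basis_vec e,
      ring.zero = (\<lambda>_. 0),
      ring.add = (\<lambda>f g c. f c + g c),
      smult = (\<lambda>z f c. z * f c)\<rparr>"

definition lin_span :: "(complex, 'a, 'x) module_scheme \<Rightarrow> 'a set \<Rightarrow> 'a set" where
  "lin_span M X = \<Inter>{V. submodule V complex_ring M \<and> X \<subseteq> V}"

text \<open>The quotient of an algebra \<open>L\<close> by a two-sided ideal \<open>I\<close>, extending
  \<^const>\<open>FactRing\<close> by the multiplication with scalars. If \<open>L\<close> is a Lie algebra and
  \<open>I\<close> a Lie ideal, this is the quotient Lie algebra.\<close>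

definition alg_quot :: "(complex, 'a, 'x) module_scheme \<Rightarrow> 'a set \<Rightarrow> (complex, 'a set) module" where
  "alg_quot L I =
     \<lparr>carrier = carrier (L Quot I),
      monoid.mult = monoid.mult (L Quot I),
      monoid.one = monoid.one (L Quot I),
      ring.zero = ring.zero (L Quot I),
      ring.add = ring.add (L Quot I),
      smult = (\<lambda>c X. \<Union>x\<in>X. I +>\<^bsub>L\<^esub> (c \<odot>\<^bsub>L\<^esub> x))\<rparr>"

definition lie_ideal :: "(complex, 'a, 'x) module_scheme \<Rightarrow> 'a set \<Rightarrow> bool" where
  "lie_ideal L I \<longleftrightarrow>
     submodule I complex_ring L \<and> (\<forall>x\<in>carrier L. \<forall>y\<in>I. x \<otimes>\<^bsub>L\<^esub> y \<in> I)"

definition lie_ideal_gen :: "(complex, 'a, 'x) module_scheme \<Rightarrow> 'a set \<Rightarrow> 'a set" where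
  "lie_ideal_gen L X = \<Inter>{I. lie_ideal L I \<and> X \<subseteq> I}"

definition lie_derived :: "(complex, 'a, 'x) module_scheme \<Rightarrow> 'a set \<Rightarrow> 'a set" where
  "lie_derived L J = lin_span L {x \<otimes>\<^bsub>L\<^esub> y | x y. x \<in> J \<and> y \<in> J}"

subsection \<open>Free associative algebras\<close>

definition free_assoc_algebra :: "'a set \<Rightarrow> (complex, 'a list \<Rightarrow> complex) module" where
  "free_assoc_algebra S = magma_algebra (lists S) (@) []"

lemma supp_basis_vec [simp]: "supp (basis_vec b) = {b}"
  by (auto simp: supp_def basis_vec_def)

lemma abelian_group_magma_algebra: "abelian_group (magma_algebra B m e)"
proof (rule abelian_groupI, goal_cases)
  case (1 f g)
  have "supp (\<lambda>c. f c + g c) \<subseteq> supp f \<union> supp g"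
    by (auto simp: supp_def)
  moreover have "finite (supp f \<union> supp g)" "supp f \<union> supp g \<subseteq> B"
    using 1 by (auto simp: magma_algebra_def)
  ultimately show ?case
    by (auto simp: magma_algebra_def intro: finite_subset)
next
  case (6 f)
  have "supp (\<lambda>c. - f c) = supp f"
    by (auto simp: supp_def)
  then show ?case
    using 6 by (intro bexI[of _ "\<lambda>c. - f c"]) (auto simp: magma_algebra_def)
qed (auto simp: magma_algebra_def supp_def add.assoc add.commute)

lemma magma_mult_eq:
  assumes "finite S" "finite T" "supp f \<subseteq> S" "supp g \<subseteq> T"
  shows "monoid.mult (magma_algebra B m e) f g c =
    (\<Sum>a\<in>S. \<Sum>b\<in>T. if m a b = c then f a * g b else 0)"
proof -
  have f: "f a = 0" if "a \<notin> supp f" for a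
    using that by (simp add: supp_def)
  have g: "g b = 0" if "b \<notin> supp g" for b
    using that by (simp add: supp_def)
  have *: "(\<Sum>b\<in>supp g. if m a b = c then f a * g b else 0) =
      (\<Sum>b\<in>T. if m a b = c then f a * g b else 0)" for a
    by (rule sum.mono_neutral_left) (use assms g in auto)
  have "(\<Sum>a\<in>supp f. \<Sum>b\<in>T. if m a b = c then f a * g b else 0) =
      (\<Sum>a\<in>S. \<Sum>b\<in>T. if m a b = c then f a * g b else 0)"
    by (rule sum.mono_neutral_left) (use assms f in \<open>auto intro!: sum.neutral\<close>)
  then show ?thesis
    by (simp add: magma_algebra_def *)
qed

lemma supp_magma_mult:
  "supp (monoid.mult (magma_algebra B m e) f g) \<subseteq> (\<lambda>(a, b). m a b) ` (supp f \<times> supp g)"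
proof
  fix c assume c: "c \<in> supp (monoid.mult (magma_algebra B m e) f g)"
  show "c \<in> (\<lambda>(a, b). m a b) ` (supp f \<times> supp g)"
  proof (rule ccontr)
    assume "c \<notin> (\<lambda>(a, b). m a b) ` (supp f \<times> supp g)"
    then have "m a b \<noteq> c" if "a \<in> supp f" "b \<in> supp g" for a b
      using that by force
    then have "(\<Sum>a\<in>supp f. \<Sum>b\<in>supp g. if m a b = c then f a * g b else 0) = 0"
      by (intro sum.neutral ballI) simp
    moreover have "monoid.mult (magma_algebra B m e) f g c \<noteq> 0"
      using c by (simp only: supp_def mem_Collect_eq) simp
    ultimately show False
      by (simp add: magma_algebra_def)
  qed
qed

lemma ring_magma_algebra:
  assumes closed: "\<And>a b. a \<in> B \<Longrightarrow> b \<in> B \<Longrightarrow> m a b \<in> B"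
    and assoc: "\<And>a b c. m (m a b) c = m a (m b c)"
    and e: "e \<in> B" "\<And>a. m e a = a" "\<And>a. m a e = a"
  shows "ring (magma_algebra B m e)" (is "ring ?A")
proof (rule ringI[OF abelian_group_magma_algebra])
  have mult_closed: "f \<otimes>\<^bsub>?A\<^esub> g \<in> carrier ?A" if "f \<in> carrier ?A" "g \<in> carrier ?A" for f g
  proof -
    have fin: "finite ((\<lambda>(a, b). m a b) ` (supp f \<times> supp g))"
      using that by (auto simp: magma_algebra_def)
    have "(\<lambda>(a, b). m a b) ` (supp f \<times> supp g) \<subseteq> B"
      using that closed by (auto simp: magma_algebra_def)
    with supp_magma_mult[of B m e f g] fin
    have "finite (supp (f \<otimes>\<^bsub>?A\<^esub> g))" "supp (f \<otimes>\<^bsub>?A\<^esub> g) \<subseteq> B"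
      by (auto dest: finite_subset)
    moreover have "carrier ?A = {f. finite (supp f) \<and> supp f \<subseteq> B}"
      by (simp add: magma_algebra_def)
    ultimately show ?thesis by blast
  qed
  show "monoid ?A"
  proof (rule monoidI)
    show "\<one>\<^bsub>?A\<^esub> \<in> carrier ?A" using e by (simp add: magma_algebra_def)
  next
    fix f g h assume f: "f \<in> carrier ?A" and g: "g \<in> carrier ?A" and h: "h \<in> carrier ?A"
    define P where "P = (\<lambda>(a, b). m a b) ` (supp f \<times> supp g)"
    define Q where "Q = (\<lambda>(a, b). m a b) ` (supp g \<times> supp h)"
    have fin: "finite (supp f)" "finite (supp g)" "finite (supp h)"
      using f g h by (auto simp: magma_algebra_def)
    then have finPQ: "finite P" "finite Q" by (auto simp: P_def Q_def)
    show "f \<otimes>\<^bsub>?A\<^esub> g \<otimes>\<^bsub>?A\<^esub> h = f \<otimes>\<^bsub>?A\<^esub> (g \<otimes>\<^bsub>?A\<^esub> h)"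
    proof
      fix d
      let ?t = "\<lambda>a b c. if m a (m b c) = d then f a * g b * h c else 0"
      have fg: "(f \<otimes>\<^bsub>?A\<^esub> g) p =
          (\<Sum>a\<in>supp f. \<Sum>b\<in>supp g. if m a b = p then f a * g b else 0)" for p
        by (simp add: magma_algebra_def)
      have gh: "(g \<otimes>\<^bsub>?A\<^esub> h) q =
          (\<Sum>b\<in>supp g. \<Sum>c\<in>supp h. if m b c = q then g b * h c else 0)" for q
        by (simp add: magma_algebra_def)
      have "(f \<otimes>\<^bsub>?A\<^esub> g \<otimes>\<^bsub>?A\<^esub> h) d = (\<Sum>p\<in>P. \<Sum>c\<in>supp h.
              if m p c = d then (f \<otimes>\<^bsub>?A\<^esub> g) p * h c else 0)"
        unfolding P_def
        using finPQ(1) fin(3) by (intro magma_mult_eq supp_magma_mult) (auto simp: P_def)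
      also have "\<dots> = (\<Sum>p\<in>P. \<Sum>c\<in>supp h. \<Sum>a\<in>supp f. \<Sum>b\<in>supp g.
              if p = m a b then (if m p c = d then f a * g b * h c else 0) else 0)"
        unfolding fg by (intro sum.cong refl) (auto simp: sum_distrib_right intro!: sum.cong sum.neutral)
      also have "\<dots> = (\<Sum>c\<in>supp h. \<Sum>a\<in>supp f. \<Sum>b\<in>supp g. \<Sum>p\<in>P.
              if p = m a b then (if m p c = d then f a * g b * h c else 0) else 0)"
        by (subst sum.swap, rule sum.cong[OF refl], subst sum.swap, rule sum.cong[OF refl],
            rule sum.swap)
      also have "\<dots> = (\<Sum>c\<in>supp h. \<Sum>a\<in>supp f. \<Sum>b\<in>supp g. ?t a b c)"
        using finPQ by (intro sum.cong refl) (auto simp: P_def assoc)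
      also have "\<dots> = (\<Sum>a\<in>supp f. \<Sum>b\<in>supp g. \<Sum>c\<in>supp h. ?t a b c)"
        by (subst sum.swap, rule sum.cong[OF refl], rule sum.swap)
      also have "\<dots> = (\<Sum>a\<in>supp f. \<Sum>b\<in>supp g. \<Sum>c\<in>supp h. \<Sum>q\<in>Q.
              if q = m b c then (if m a q = d then f a * (g b * h c) else 0) else 0)"
        using finPQ by (intro sum.cong refl) (auto simp: Q_def)
      also have "\<dots> = (\<Sum>a\<in>supp f. \<Sum>q\<in>Q. \<Sum>b\<in>supp g. \<Sum>c\<in>supp h.
              if q = m b c then (if m a q = d then f a * (g b * h c) else 0) else 0)"
        by (rule sum.cong[OF refl], subst (2) sum.swap, rule sum.cong[OF refl], rule sum.swap)
      also have "\<dots> = (\<Sum>a\<in>supp f. \<Sum>q\<in>Q.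
              if m a q = d then f a * (g \<otimes>\<^bsub>?A\<^esub> h) q else 0)"
        unfolding gh by (intro sum.cong refl) (auto simp: sum_distrib_left intro!: sum.cong sum.neutral)
      also have "\<dots> = (f \<otimes>\<^bsub>?A\<^esub> (g \<otimes>\<^bsub>?A\<^esub> h)) d"
        unfolding Q_def
        using finPQ(2) fin(1)
        by (intro magma_mult_eq[symmetric] supp_magma_mult) (auto simp: Q_def)
      finally show "(f \<otimes>\<^bsub>?A\<^esub> g \<otimes>\<^bsub>?A\<^esub> h) d = (f \<otimes>\<^bsub>?A\<^esub> (g \<otimes>\<^bsub>?A\<^esub> h)) d" .
    qed
  next
    fix f assume "f \<in> carrier ?A"
    then have "finite (supp f)" by (simp add: magma_algebra_def)
    then have fin: "finite (supp f)" "finite {e}" by simp_all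
    have f: "f c = 0" if "c \<notin> supp f" for c
      using that by (simp add: supp_def)
    have "(\<one>\<^bsub>?A\<^esub> \<otimes>\<^bsub>?A\<^esub> f) c = f c" for c
    proof -
      have "(\<one>\<^bsub>?A\<^esub> \<otimes>\<^bsub>?A\<^esub> f) c =
          (\<Sum>a\<in>{e}. \<Sum>b\<in>supp f. if m a b = c then \<one>\<^bsub>?A\<^esub> a * f b else 0)"
        by (rule magma_mult_eq[OF fin(2,1)]) (simp_all add: magma_algebra_def)
      then show ?thesis
        using fin f by (simp add: e magma_algebra_def basis_vec_def)
    qed
    moreover have "(f \<otimes>\<^bsub>?A\<^esub> \<one>\<^bsub>?A\<^esub>) c = f c" for c
    proof -
      have "(f \<otimes>\<^bsub>?A\<^esub> \<one>\<^bsub>?A\<^esub>) c =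
          (\<Sum>a\<in>supp f. \<Sum>b\<in>{e}. if m a b = c then f a * \<one>\<^bsub>?A\<^esub> b else 0)"
        by (rule magma_mult_eq[OF fin]) (simp_all add: magma_algebra_def)
      then show ?thesis
        using fin f by (simp add: e magma_algebra_def basis_vec_def)
    qed
    ultimately show "\<one>\<^bsub>?A\<^esub> \<otimes>\<^bsub>?A\<^esub> f = f" "f \<otimes>\<^bsub>?A\<^esub> \<one>\<^bsub>?A\<^esub> = f"
      by blast+
  qed (rule mult_closed)
next
  fix f g h assume f: "f \<in> carrier ?A" and g: "g \<in> carrier ?A" and h: "h \<in> carrier ?A"
  have fin: "finite (supp f \<union> supp g)" "finite (supp h)"
    using f g h by (auto simp: magma_algebra_def)
  have sub: "supp (f \<oplus>\<^bsub>?A\<^esub> g) \<subseteq> supp f \<union> supp g"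
    by (auto simp: supp_def magma_algebra_def)
  have add: "(u \<oplus>\<^bsub>?A\<^esub> v) c = u c + v c" for u v c
    by (simp add: magma_algebra_def)
  show "(f \<oplus>\<^bsub>?A\<^esub> g) \<otimes>\<^bsub>?A\<^esub> h = (f \<otimes>\<^bsub>?A\<^esub> h) \<oplus>\<^bsub>?A\<^esub> (g \<otimes>\<^bsub>?A\<^esub> h)"
  proof
    fix c
    have "((f \<oplus>\<^bsub>?A\<^esub> g) \<otimes>\<^bsub>?A\<^esub> h) c = (\<Sum>a\<in>supp f \<union> supp g. \<Sum>b\<in>supp h.
            if m a b = c then (f \<oplus>\<^bsub>?A\<^esub> g) a * h b else 0)"
      by (rule magma_mult_eq[OF fin sub order.refl])
    also have "\<dots> = (\<Sum>a\<in>supp f \<union> supp g. \<Sum>b\<in>supp h.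
            (if m a b = c then f a * h b else 0) + (if m a b = c then g a * h b else 0))"
      unfolding add by (intro sum.cong refl) (simp add: distrib_right)
    also have "\<dots> = (f \<otimes>\<^bsub>?A\<^esub> h) c + (g \<otimes>\<^bsub>?A\<^esub> h) c"
      unfolding sum.distrib
      by (intro arg_cong2[where f = "(+)"] magma_mult_eq[OF fin, symmetric]) auto
    finally show "((f \<oplus>\<^bsub>?A\<^esub> g) \<otimes>\<^bsub>?A\<^esub> h) c = ((f \<otimes>\<^bsub>?A\<^esub> h) \<oplus>\<^bsub>?A\<^esub> (g \<otimes>\<^bsub>?A\<^esub> h)) c"
      unfolding add .
  qed
  show "h \<otimes>\<^bsub>?A\<^esub> (f \<oplus>\<^bsub>?A\<^esub> g) = (h \<otimes>\<^bsub>?A\<^esub> f) \<oplus>\<^bsub>?A\<^esub> (h \<otimes>\<^bsub>?A\<^esub> g)"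
  proof
    fix c
    have "(h \<otimes>\<^bsub>?A\<^esub> (f \<oplus>\<^bsub>?A\<^esub> g)) c = (\<Sum>a\<in>supp h. \<Sum>b\<in>supp f \<union> supp g.
            if m a b = c then h a * (f \<oplus>\<^bsub>?A\<^esub> g) b else 0)"
      by (rule magma_mult_eq[OF fin(2,1) order.refl sub])
    also have "\<dots> = (\<Sum>a\<in>supp h. \<Sum>b\<in>supp f \<union> supp g.
            (if m a b = c then h a * f b else 0) + (if m a b = c then h a * g b else 0))"
      unfolding add by (intro sum.cong refl) (simp add: distrib_left)
    also have "\<dots> = (h \<otimes>\<^bsub>?A\<^esub> f) c + (h \<otimes>\<^bsub>?A\<^esub> g) c"
      unfolding sum.distrib
      by (intro arg_cong2[where f = "(+)"] magma_mult_eq[OF fin(2,1), symmetric]) auto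
    finally show "(h \<otimes>\<^bsub>?A\<^esub> (f \<oplus>\<^bsub>?A\<^esub> g)) c = ((h \<otimes>\<^bsub>?A\<^esub> f) \<oplus>\<^bsub>?A\<^esub> (h \<otimes>\<^bsub>?A\<^esub> g)) c"
      unfolding add .
  qed
qed

lemma ring_free_assoc_algebra: "ring (free_assoc_algebra S)"
  unfolding free_assoc_algebra_def by (rule ring_magma_algebra) auto

subsection \<open>Universal enveloping algebras\<close>

text \<open>\<open>U(g)\<close> is the free associative algebra on the set \<open>g\<close>, modulo the linearity of the
  inclusion of \<open>g\<close> (this gives the tensor algebra) and \<open>x y - y x = [x, y]\<close>.\<close>

definition uea_relations ::
    "(complex, 'a, 'x) module_scheme \<Rightarrow> ('a list \<Rightarrow> complex) set" where
  "uea_relations g =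
    (let A = free_assoc_algebra (carrier g); i = (\<lambda>x. basis_vec [x]) in
       {i (x \<oplus>\<^bsub>g\<^esub> y) \<ominus>\<^bsub>A\<^esub> (i x \<oplus>\<^bsub>A\<^esub> i y) | x y. x \<in> carrier g \<and> y \<in> carrier g}
     \<union> {i (c \<odot>\<^bsub>g\<^esub> x) \<ominus>\<^bsub>A\<^esub> (c \<odot>\<^bsub>A\<^esub> i x) | c x. x \<in> carrier g}
     \<union> {(i x \<otimes>\<^bsub>A\<^esub> i y \<ominus>\<^bsub>A\<^esub> i y \<otimes>\<^bsub>A\<^esub> i x) \<ominus>\<^bsub>A\<^esub> i (x \<otimes>\<^bsub>g\<^esub> y)
         | x y. x \<in> carrier g \<and> y \<in> carrier g})"

definition uea :: "(complex, 'a, 'x) module_scheme \<Rightarrow> ('a list \<Rightarrow> complex) set ring" where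
  "uea g = free_assoc_algebra (carrier g) Quot
             (Idl\<^bsub>free_assoc_algebra (carrier g)\<^esub> (uea_relations g))"

text \<open>The action of \<open>U(g)\<close> on \<open>M\<close> induced by a Lie algebra action \<open>\<rho>\<close> of \<open>g\<close>
  on \<open>M\<close>: a word acts by the composite of its letters, and all the elements of a coset
  \<open>X\<close> act in the same way.\<close>

definition uea_action ::
    "(complex, 'v, 'y) module_scheme \<Rightarrow> ('a \<Rightarrow> 'v \<Rightarrow> 'v) \<Rightarrow> ('a list \<Rightarrow> complex) set \<Rightarrow> 'v \<Rightarrow> 'v"
  where
  "uea_action M \<rho> X v =
     the_elem ((\<lambda>f. \<Oplus>\<^bsub>M\<^esub>w\<in>supp f. f w \<odot>\<^bsub>M\<^esub> foldr \<rho> w v) ` X)"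

text \<open>\<open>J / [J, J]\<close> as a module over \<open>U(L / J)\<close>, where the class of \<open>x\<close> in \<open>L / J\<close> sends
  the class of \<open>y\<close> to the class of \<open>[x, y]\<close>.\<close>

definition adjoint_module ::
    "(complex, 'a, 'x) module_scheme \<Rightarrow> 'a set \<Rightarrow> (('a set list \<Rightarrow> complex) set, 'a set) module"
  where
  "adjoint_module L J =
    (let M = alg_quot (L\<lparr>carrier := J\<rparr>) (lie_derived L J) in
     \<lparr>carrier = carrier M, monoid.mult = monoid.mult M, monoid.one = monoid.one M,
      ring.zero = ring.zero M, ring.add = ring.add M,
      smult = uea_action M (\<lambda>X Y. \<Union>x\<in>X. \<Union>y\<in>Y. lie_derived L J +>\<^bsub>L\<^esub> (x \<otimes>\<^bsub>L\<^esub> y))\<rparr>)"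

definition free_module_on ::
    "('u, 'x) ring_scheme \<Rightarrow> ('u, 'v, 'y) module_scheme \<Rightarrow> 'v list \<Rightarrow> bool" where
  "free_module_on U M bs \<longleftrightarrow>
     set bs \<subseteq> carrier M \<and>
     (\<forall>v\<in>carrier M. \<exists>!u. u \<in> {..<length bs} \<rightarrow>\<^sub>E carrier U \<and>
        v = (\<Oplus>\<^bsub>M\<^esub>i\<in>{..<length bs}. u i \<odot>\<^bsub>M\<^esub> bs ! i))"

section \<open>The associated graded Lie algebra of a group\<close>

definition commutator :: "('a, 'x) monoid_scheme \<Rightarrow> 'a \<Rightarrow> 'a \<Rightarrow> 'a" where
  "commutator G x y = x \<otimes>\<^bsub>G\<^esub> y \<otimes>\<^bsub>G\<^esub> inv\<^bsub>G\<^esub> x \<otimes>\<^bsub>G\<^esub> inv\<^bsub>G\<^esub> y"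

text \<open>Indexed so that the first term is \<open>G\<close> itself; the index \<open>0\<close> is not used.\<close>

fun lower_central :: "('a, 'x) monoid_scheme \<Rightarrow> nat \<Rightarrow> 'a set" where
  "lower_central G 0 = carrier G"
| "lower_central G (Suc 0) = carrier G"
| "lower_central G (Suc (Suc k)) =
     generate G {commutator G x y | x y. x \<in> lower_central G (Suc k) \<and> y \<in> carrier G}"

text \<open>The direct sum of the tensor products over the integers of
  \<open>lower_central G k / lower_central G (k + 1)\<close> with the complex numbers, over \<open>k \<ge> 1\<close>,
  is the complex vector space generated by the pairs \<open>(k, g)\<close> with \<open>g\<close> in
  \<open>lower_central G k\<close> (the pair stands for the tensor product of the class of \<open>g\<close> in degree
  \<open>k\<close> with \<open>1\<close>), modulo additivity in \<open>g\<close> and modulo the pairs with \<open>g\<close> in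
  \<open>lower_central G (k + 1)\<close>. The bracket is induced by the group commutator.\<close>

definition gr_pre :: "('a, 'x) monoid_scheme \<Rightarrow> (complex, nat \<times> 'a \<Rightarrow> complex) module" where
  "gr_pre G =
     magma_algebra {(k, g). 1 \<le> k \<and> g \<in> lower_central G k}
       (\<lambda>(k, g) (l, h). (k + l, commutator G g h)) (1, \<one>\<^bsub>G\<^esub>)"

definition gr_relations :: "('a, 'x) monoid_scheme \<Rightarrow> (nat \<times> 'a \<Rightarrow> complex) set" where
  "gr_relations G =
     {basis_vec (k, g \<otimes>\<^bsub>G\<^esub> h) \<ominus>\<^bsub>gr_pre G\<^esub> (basis_vec (k, g) \<oplus>\<^bsub>gr_pre G\<^esub> basis_vec (k, h))
        | k g h. 1 \<le> k \<and> g \<in> lower_central G k \<and> h \<in> lower_central G k}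
   \<union> {basis_vec (k, g) | k g. 1 \<le> k \<and> g \<in> lower_central G (Suc k)}"

definition gr_null :: "('a, 'x) monoid_scheme \<Rightarrow> (nat \<times> 'a \<Rightarrow> complex) set" where
  "gr_null G = lin_span (gr_pre G) (gr_relations G)"

definition gr :: "('a, 'x) monoid_scheme \<Rightarrow> (complex, (nat \<times> 'a \<Rightarrow> complex) set) module" where
  "gr G = alg_quot (gr_pre G) (gr_null G)"

text \<open>In a free group, only the trivial element lies in all terms of the lower central series, so
  the set below is finite and nonempty when \<open>r\<close> is not trivial.\<close>

definition weight :: "('a, 'x) monoid_scheme \<Rightarrow> 'a \<Rightarrow> nat" where
  "weight G r = Sup {k. 1 \<le> k \<and> r \<in> lower_central G k}"

definition initial_form :: "('a, 'x) monoid_scheme \<Rightarrow> 'a \<Rightarrow> (nat \<times> 'a \<Rightarrow> complex) set" where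
  "initial_form G r = gr_null G +>\<^bsub>gr_pre G\<^esub> basis_vec (weight G r, r)"

section \<open>Mild presentations\<close>

text \<open>The free complex Lie algebra on the generators is \<open>gr F\<close>, for the free group \<open>F\<close>.\<close>

definition mild :: "nat \<Rightarrow> nat gword list \<Rightarrow> bool" where
  "mild q rs \<longleftrightarrow>
    (let F = free_group {1..q};
         L = gr F;
         J = lie_ideal_gen L (initial_form F ` set rs)
     in free_module_on (uea (alg_quot L J)) (adjoint_module L J)
          (map (\<lambda>r. lie_derived L J +>\<^bsub>L\<^esub> initial_form F r) rs))"

definition admits_mild_presentation :: "('g, 'x) monoid_scheme \<Rightarrow> bool" where
  "admits_mild_presentation G \<longleftrightarrow>
    (\<exists>q rs. set rs \<subseteq> carrier (free_group {1..q}) - {\<one>\<^bsub>free_group {1..q}\<^esub>} \<and>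
       G \<cong> presented_group {1..q} (set rs) \<and> mild q rs)"

end

theory Submission
  imports Defs
begin

section \<open>Homomorphisms out of free and presented groups\<close>

text \<open>The two directions use the freeness of J/[J,J] in different ways. Here J is the ideal of
  the free Lie algebra L = gr F generated by the initial forms of the relators.

  For n \<le> 3 each group is presented by commutators [b_i, w_i]. The letters b_i lie outside a set
  C of letters, the exponent sums of w_i at the letters of C are 1 at one letter a_i and 0 at the
  others, and the pairs (b_i, a_i) are distinct. The initial form of such a relator is [b_i, l_i],
  with l_i the linear part of w_i. In the free associative algebra T the words b_i a_i can be taken
  as leading words of these elements. No two of them overlap, so rewriting computes normal forms
  modulo the ideal I that they generate. With T_+ the augmentation ideal,
  \<open>relators_independent\<close> shows that a sum of t_i [b_i, l_i] lying in I T_+ has every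
  t_i in I. The Magnus expansion gives a Lie map from L to T that sends J into I and [J,J] into I
  T_+, and modulo I T_+ it turns iterated brackets acting on J into left multiplication. A relation
  in J/[J,J] therefore has coefficients in I, and these vanish in U(L/J). This is
  \<open>relators_free\<close>, restated as \<open>mild_commutator_relators\<close>. The
  presentations are those of the product of F_2 and Z for P_3, of the free product of Z^2 and Z for
  vP_3^+, and for vP_3 six commutators after the change of generators in
  \<open>three_strands\<close>; for n \<le> 2 the groups are free.

  An isomorphism with a presented group is built from homomorphisms in both directions
  (\<open>iso_presented\<close>). For vP_n the one out of the group is given on generators. P_n is
  defined as a kernel, so there it comes from labels on crossings, a cocycle on the symmetric group
  (\<open>braid_cocycle\<close>), and surjectivity comes from explicit coset representatives
  (\<open>cosets_exhaust\<close>).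

  For n \<ge> 4 each group contains commuting elements a, b, c and admits three homomorphisms to the
  complex numbers whose determinant on a, b, c is nonzero. Mildness excludes this
  (\<open>not_mild\<close>). The brackets of lifts of a, b, c lie in J by
  \<open>normal_closure_quadratic\<close>, so they are combinations of initial forms. The Jacobi
  identity becomes a relation between initial forms, whose coefficients vanish in U(L/J). Evaluating
  them at the characters z f of L/J and dividing by z gives, as z tends to 0, a linear relation
  between the constant terms of the combinations; pairing it with the other two homomorphisms makes
  the determinant vanish (\<open>determinant_zero\<close>).\<close>

lemma letter_closed: "s \<in> S \<Longrightarrow> letter s \<in> carrier (free_group S)"
  by (simp add: letter_def free_group_def)

lemma free_group_mult: "monoid.mult (free_group S) = foldr push"
  and free_group_one: "\<one>\<^bsub>free_group S\<^esub> = []"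
  by (simp_all add: free_group_def)

lemma free_group_carrier: "w \<in> carrier (free_group S) \<longleftrightarrow> reduced w \<and> fst ` set w \<subseteq> S"
  by (simp add: free_group_def)

lemma foldr_push_closed: "fst ` set u \<subseteq> S \<Longrightarrow> foldr push u [] \<in> carrier (free_group S)"
  using letters_foldr_push[of u S "[]"] by (simp add: free_group_carrier reduced_foldr_push)

lemma relator_closed:
  assumes "fst ` set u \<subseteq> S" "fst ` set v \<subseteq> S"
  shows "relator S u v \<in> carrier (free_group S)"
  using assms group_free_group[of S]
  by (simp add: relator_def foldr_push_closed group.inv_closed monoid.m_closed group.is_monoid)

section \<open>Evaluation of words, normal closures and von Dyck's theorem\<close>

lemma word_eval_Nil [simp]: "word_eval G f [] = \<one>\<^bsub>G\<^esub>"
  by (simp add: word_eval_def)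

lemma word_eval_Cons:
  "word_eval G f ((s, e) # w) = (if e then f s else inv\<^bsub>G\<^esub> (f s)) \<otimes>\<^bsub>G\<^esub> word_eval G f w"
  by (simp add: word_eval_def)

context group
begin

lemma word_eval_closed:
  assumes "f \<in> S \<rightarrow> carrier G" "fst ` set w \<subseteq> S"
  shows "word_eval G f w \<in> carrier G"
  using assms(2)
proof (induction w)
  case (Cons x w)
  then show ?case using assms(1) by (cases x) (auto simp: word_eval_Cons)
qed simp

lemma word_eval_append:
  assumes "f \<in> S \<rightarrow> carrier G" "fst ` set u \<subseteq> S" "fst ` set v \<subseteq> S"
  shows "word_eval G f (u @ v) = word_eval G f u \<otimes> word_eval G f v"
  using assms(2)
proof (induction u)
  case Nil
  then show ?case using assms word_eval_closed[OF assms(1,3)] by simp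
next
  case (Cons x u)
  then show ?case
    using assms(1) word_eval_closed[OF assms(1,3)] word_eval_closed[OF assms(1), of u]
    by (cases x) (auto simp: word_eval_Cons m_assoc Pi_iff)
qed

text \<open>Free reduction cancels a letter against its \<open>flip\<close>, which evaluates to the
  inverse, so reduction is invisible in any group.\<close>

lemma word_eval_push:
  assumes "f \<in> S \<rightarrow> carrier G" "fst x \<in> S" "fst ` set w \<subseteq> S"
  shows "word_eval G f (push x w) = word_eval G f (x # w)"
proof (cases w)
  case (Cons y v)
  show ?thesis
  proof (cases "y = flip x")
    case True
    obtain s e where x: "x = (s, e)" by (cases x)
    have "f s \<in> carrier G" "word_eval G f v \<in> carrier G"
      using Cons assms x word_eval_closed[OF assms(1), of v] by auto
    then show ?thesis
      using Cons True x by (auto simp: push_def word_eval_Cons flip_def simp flip: m_assoc)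
  qed (simp add: push_def Cons)
qed (simp add: push_def)

lemma word_eval_foldr_push:
  assumes "f \<in> S \<rightarrow> carrier G" "fst ` set u \<subseteq> S" "fst ` set v \<subseteq> S"
  shows "word_eval G f (foldr push u v) = word_eval G f u \<otimes> word_eval G f v"
proof -
  have "word_eval G f (foldr push u v) = word_eval G f (u @ v)"
    using assms(2)
  proof (induction u)
    case (Cons x u)
    then have "fst ` set (foldr push u v) \<subseteq> S"
      using assms(3) by (intro letters_foldr_push) auto
    then show ?case
      using Cons word_eval_push[OF assms(1)] by (cases x) (simp add: word_eval_Cons)
  qed simp
  then show ?thesis using word_eval_append[OF assms] by simp
qed

lemma word_eval_hom: "f \<in> S \<rightarrow> carrier G \<Longrightarrow> word_eval G f \<in> hom (free_group S) G"
  by (rule homI) (auto simp: free_group_carrier free_group_mult intro: word_eval_closed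
      word_eval_foldr_push)

lemma word_eval_letter: "f s \<in> carrier G \<Longrightarrow> word_eval G f (letter s) = f s"
  by (simp add: letter_def word_eval_Cons)

lemma word_eval_relator:
  assumes "f \<in> S \<rightarrow> carrier G" "fst ` set u \<subseteq> S" "fst ` set v \<subseteq> S"
  shows "word_eval G f (relator S u v) = word_eval G f u \<otimes> inv (word_eval G f v)"
proof -
  interpret h: group_hom "free_group S" G "word_eval G f"
    using word_eval_hom[OF assms(1)] group_free_group is_group
    by (simp add: group_hom_def group_hom_axioms_def)
  show ?thesis
    using assms word_eval_closed[OF assms(1)] foldr_push_closed[OF assms(2)]
      foldr_push_closed[OF assms(3)]
    by (simp add: relator_def word_eval_foldr_push[OF assms(1), of _ "[]"])
qed

lemma word_eval_relator_iff:
  assumes "f \<in> S \<rightarrow> carrier G" "fst ` set u \<subseteq> S" "fst ` set v \<subseteq> S"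
  shows "word_eval G f (relator S u v) = \<one> \<longleftrightarrow> word_eval G f u = word_eval G f v"
  using assms word_eval_closed[OF assms(1)]
  by (metis word_eval_relator inv_solve_right' l_one one_closed)

lemma normal_closure_normal:
  assumes "R \<subseteq> carrier G"
  shows "normal_closure G R \<lhd> G"
  unfolding normal_closure_def
proof (rule normal_generateI)
  fix h g
  assume h: "h \<in> {g \<otimes> r \<otimes> inv g | g r. g \<in> carrier G \<and> r \<in> R}" and g: "g \<in> carrier G"
  then obtain k r where k: "k \<in> carrier G" "r \<in> R" "h = k \<otimes> r \<otimes> inv k" by blast
  then have "g \<otimes> h \<otimes> inv g = (g \<otimes> k) \<otimes> r \<otimes> inv (g \<otimes> k)"
    using assms g by (auto simp: m_assoc inv_mult_group)
  then show "g \<otimes> h \<otimes> inv g \<in> {g \<otimes> r \<otimes> inv g | g r. g \<in> carrier G \<and> r \<in> R}"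
    using k g by blast
qed (use assms in auto)

lemma normal_closure_incl:
  assumes "R \<subseteq> carrier G" "r \<in> R"
  shows "r \<in> normal_closure G R"
proof -
  have "\<one> \<otimes> r \<otimes> inv \<one> = r" using assms by auto
  then show ?thesis
    unfolding normal_closure_def using assms(2) by (intro generate.incl) force
qed

lemma normal_closure_minimal:
  assumes "N \<lhd> G" "R \<subseteq> N"
  shows "normal_closure G R \<subseteq> N"
  unfolding normal_closure_def
proof (rule generate_subgroup_incl[OF _ normal_imp_subgroup[OF assms(1)]])
  show "{g \<otimes> r \<otimes> inv g |g r. g \<in> carrier G \<and> r \<in> R} \<subseteq> N"
    using assms normal.inv_op_closed2 by fastforce
qed

end

text \<open>In a reduced word \<open>x # w\<close> nothing cancels, so it equals the product of the
  letter and \<open>w\<close>. This is the induction for every statement that is multiplicative or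
  additive in a group element.\<close>

lemma free_group_induct [consumes 1, case_names one letter inverse]:
  assumes w: "w \<in> carrier (free_group S)"
    and one: "P \<one>\<^bsub>free_group S\<^esub>"
    and letter: "\<And>s v. s \<in> S \<Longrightarrow> v \<in> carrier (free_group S) \<Longrightarrow> P v \<Longrightarrow>
      P (letter s \<otimes>\<^bsub>free_group S\<^esub> v)"
    and inverse: "\<And>s v. s \<in> S \<Longrightarrow> v \<in> carrier (free_group S) \<Longrightarrow> P v \<Longrightarrow>
      P (inv\<^bsub>free_group S\<^esub> (letter s) \<otimes>\<^bsub>free_group S\<^esub> v)"
  shows "P w"
  using w
proof (induction w)
  case Nil
  then show ?case using one by (simp add: free_group_one)
next
  case (Cons x w)
  interpret group "free_group S" by (rule group_free_group)
  obtain s e where x: "x = (s, e)" by (cases x)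
  have s: "s \<in> S" and w: "w \<in> carrier (free_group S)" and red: "reduced (x # w)"
    using Cons.prems x by (auto simp: free_group_carrier dest: reduced_tl)
  have push: "push x w = x # w"
    using red by (cases w) (auto simp: push_def)
  have "[(s, False)] \<otimes>\<^bsub>free_group S\<^esub> letter s = \<one>\<^bsub>free_group S\<^esub>"
    by (simp add: free_group_mult free_group_one letter_def push_def flip_def)
  moreover have "[(s, False)] \<in> carrier (free_group S)"
    using s by (simp add: free_group_carrier)
  ultimately have "inv\<^bsub>free_group S\<^esub> (letter s) = [(s, False)]"
    using inv_equality[OF _ letter_closed[OF s]] by blast
  then have "x # w = (if e then letter s else inv\<^bsub>free_group S\<^esub> (letter s)) \<otimes>\<^bsub>free_group S\<^esub> w"
    using push x by (auto simp: free_group_mult letter_def)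
  then show ?case
    using Cons.IH[OF w] letter[OF s w] inverse[OF s w] by (simp split: if_splits)
qed

lemma free_group_hom_unique:
  assumes "group G" "h \<in> hom (free_group S) G" "k \<in> hom (free_group S) G"
    and eq: "\<And>s. s \<in> S \<Longrightarrow> h (letter s) = k (letter s)"
    and w: "w \<in> carrier (free_group S)"
  shows "h w = k w"
proof -
  interpret h: group_hom "free_group S" G h
    using assms group_free_group by (simp add: group_hom_def group_hom_axioms_def)
  interpret k: group_hom "free_group S" G k
    using assms group_free_group by (simp add: group_hom_def group_hom_axioms_def)
  show ?thesis
    using w by (induction rule: free_group_induct) (simp_all add: eq letter_closed)
qed

lemma word_eval_hom_comp:
  assumes "group G" "group H" "h \<in> hom G H" "f \<in> S \<rightarrow> carrier G" "fst ` set w \<subseteq> S"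
  shows "h (word_eval G f w) = word_eval H (h \<circ> f) w"
proof -
  interpret h: group_hom G H h
    using assms by (simp add: group_hom_def group_hom_axioms_def)
  show ?thesis
    using assms(5)
  proof (induction w)
    case (Cons x w)
    then show ?case
      using assms(4) h.G.word_eval_closed[OF assms(4), of w]
      by (cases x) (auto simp: word_eval_Cons Pi_iff)
  qed simp
qed

lemma word_eval_cong:
  "(\<And>s. s \<in> fst ` set w \<Longrightarrow> f s = g s) \<Longrightarrow> word_eval G f w = word_eval G g w"
  by (induction w) (auto simp: word_eval_Cons)

text \<open>An element of a presented group is a coset of words; the homomorphism is its common
  value on that coset. \<open>braid_perm\<close> has the same shape and is an instance.\<close>

definition pres_hom :: "('g, 'x) monoid_scheme \<Rightarrow> ('a \<Rightarrow> 'g) \<Rightarrow> 'a gword set \<Rightarrow> 'g" where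
  "pres_hom G f C = the_elem (word_eval G f ` C)"

locale presentation =
  fixes S :: "'a set" and R :: "'a gword set"
  assumes relators: "R \<subseteq> carrier (free_group S)"
begin

abbreviation "F \<equiv> free_group S"
abbreviation "N \<equiv> normal_closure F R"
abbreviation "P \<equiv> presented_group S R"
abbreviation "gen \<equiv> presented_gen S R"

sublocale F: group F by (rule group_free_group)

sublocale N: normal N F
  by (rule F.normal_closure_normal[OF relators])

sublocale P: group P
  unfolding presented_group_def by (rule N.factorgroup_is_group)

lemma proj_hom: "(\<lambda>w. N #>\<^bsub>F\<^esub> w) \<in> hom F P"
  unfolding presented_group_def by (rule N.r_coset_hom_Mod)

sublocale proj: group_hom F P "\<lambda>w. N #>\<^bsub>F\<^esub> w"
  using proj_hom by unfold_locales

lemma carrier_P: "carrier P = (\<lambda>w. N #>\<^bsub>F\<^esub> w) ` carrier F"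
  by (auto simp: presented_group_def FactGroup_def RCOSETS_def)

lemma gen_closed: "gen \<in> S \<rightarrow> carrier P"
  unfolding presented_gen_def by (auto simp: carrier_P letter_closed)

lemma word_eval_gen:
  assumes "w \<in> carrier F"
  shows "word_eval P gen w = N #>\<^bsub>F\<^esub> w"
proof -
  have "word_eval P gen \<in> hom F P"
    by (rule P.word_eval_hom[OF gen_closed])
  then show ?thesis
    by (rule free_group_hom_unique[OF P.is_group _ proj_hom])
      (use assms gen_closed in \<open>auto simp: P.word_eval_letter presented_gen_def Pi_iff\<close>)
qed

lemma P_cases:
  assumes "C \<in> carrier P"
  obtains w where "w \<in> carrier F" "C = word_eval P gen w"
  using assms word_eval_gen carrier_P by auto

lemma proj_eq_one_iff: "w \<in> carrier F \<Longrightarrow> N #>\<^bsub>F\<^esub> w = \<one>\<^bsub>P\<^esub> \<longleftrightarrow> w \<in> N"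
  by (metis F.coset_join1 F.coset_join2 FactGroup_def N.subgroup_axioms monoid.simps(2)
      N.subset presented_group_def)

lemma relator_eq_one: "r \<in> R \<Longrightarrow> word_eval P gen r = \<one>\<^bsub>P\<^esub>"
  using word_eval_gen proj_eq_one_iff F.normal_closure_incl[OF relators] relators by auto

lemma relation:
  assumes "relator S u v \<in> R" "fst ` set u \<subseteq> S" "fst ` set v \<subseteq> S"
  shows "word_eval P gen u = word_eval P gen v"
  using relator_eq_one[OF assms(1)] P.word_eval_relator_iff[OF gen_closed assms(2,3)] by simp

text \<open>Von Dyck's theorem: the kernel of evaluation is normal and contains the relators, hence
  their normal closure, so evaluation is constant on cosets.\<close>

lemma pres_hom:
  assumes G: "group G" and f: "f \<in> S \<rightarrow> carrier G"
    and rel: "\<And>r. r \<in> R \<Longrightarrow> word_eval G f r = \<one>\<^bsub>G\<^esub>"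
  shows pres_hom_in_hom: "pres_hom G f \<in> hom P G"
    and pres_hom_gen: "s \<in> S \<Longrightarrow> pres_hom G f (gen s) = f s"
proof -
  interpret G: group G by (rule G)
  interpret h: group_hom F G "word_eval G f"
    using G.word_eval_hom[OF f] by unfold_locales
  have "N \<subseteq> kernel F G (word_eval G f)"
    by (rule F.normal_closure_minimal[OF h.normal_kernel])
      (use rel relators in \<open>auto simp: kernel_def\<close>)
  then have ker: "word_eval G f n = \<one>\<^bsub>G\<^esub>" if "n \<in> N" for n
    using that by (auto simp: kernel_def)
  have *: "pres_hom G f (N #>\<^bsub>F\<^esub> w) = word_eval G f w" if w: "w \<in> carrier F" for w
  proof -
    have "word_eval G f ` (N #>\<^bsub>F\<^esub> w) = {word_eval G f w}"
    proof -
      have "word_eval G f (n \<otimes>\<^bsub>F\<^esub> w) = word_eval G f w" if "n \<in> N" for n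
        using that w ker[OF that] N.subset by auto
      moreover have "w \<in> N #>\<^bsub>F\<^esub> w"
        using w F.rcos_self N.subgroup_axioms by blast
      ultimately show ?thesis
        by (auto simp: r_coset_def)
    qed
    then show ?thesis by (simp add: pres_hom_def)
  qed
  show "pres_hom G f \<in> hom P G"
  proof (rule homI)
    show "pres_hom G f C \<in> carrier G" if "C \<in> carrier P" for C
      using that * by (auto simp: carrier_P)
    show "pres_hom G f (C \<otimes>\<^bsub>P\<^esub> D) = pres_hom G f C \<otimes>\<^bsub>G\<^esub> pres_hom G f D"
      if C: "C \<in> carrier P" and D: "D \<in> carrier P" for C D
    proof -
      obtain u where u: "u \<in> carrier F" "C = N #>\<^bsub>F\<^esub> u" using C by (auto simp: carrier_P)
      obtain v where v: "v \<in> carrier F" "D = N #>\<^bsub>F\<^esub> v" using D by (auto simp: carrier_P)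
      have "pres_hom G f (N #>\<^bsub>F\<^esub> (u \<otimes>\<^bsub>F\<^esub> v)) = word_eval G f (u \<otimes>\<^bsub>F\<^esub> v)"
        by (rule *[OF F.m_closed[OF u(1) v(1)]])
      moreover have "C \<otimes>\<^bsub>P\<^esub> D = N #>\<^bsub>F\<^esub> (u \<otimes>\<^bsub>F\<^esub> v)"
        using proj.hom_mult[OF u(1) v(1)] u(2) v(2) by simp
      moreover have "word_eval G f (u \<otimes>\<^bsub>F\<^esub> v) = word_eval G f u \<otimes>\<^bsub>G\<^esub> word_eval G f v"
        by (rule h.hom_mult[OF u(1) v(1)])
      ultimately show ?thesis
        unfolding u(2) v(2) *[OF u(1)] *[OF v(1)] by simp
    qed
  qed
  show "pres_hom G f (gen s) = f s" if "s \<in> S"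
    unfolding presented_gen_def *[OF letter_closed[OF that]]
    using f that by (intro G.word_eval_letter) auto
qed

lemma hom_unique:
  assumes "group G" "h \<in> hom P G" "k \<in> hom P G" "\<And>s. s \<in> S \<Longrightarrow> h (gen s) = k (gen s)"
    and "C \<in> carrier P"
  shows "h C = k C"
proof -
  obtain w where w: "w \<in> carrier F" "C = word_eval P gen w"
    using assms(5) by (rule P_cases)
  then have "fst ` set w \<subseteq> S" by (simp add: free_group_carrier)
  then have "h C = word_eval G (h \<circ> gen) w" "k C = word_eval G (k \<circ> gen) w"
    using w(2) word_eval_hom_comp[OF P.is_group assms(1) _ gen_closed] assms(2,3) by blast+
  moreover have "word_eval G (h \<circ> gen) w = word_eval G (k \<circ> gen) w"
    using assms(4) \<open>fst ` set w \<subseteq> S\<close> by (intro word_eval_cong) auto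
  ultimately show ?thesis by simp
qed

lemma pres_hom_word_eval:
  assumes G: "group G" and f: "f \<in> S \<rightarrow> carrier G"
    and rel: "\<And>r. r \<in> R \<Longrightarrow> word_eval G f r = \<one>\<^bsub>G\<^esub>"
    and w: "fst ` set w \<subseteq> S"
  shows "pres_hom G f (word_eval P gen w) = word_eval G f w"
  using word_eval_hom_comp[OF P.is_group G pres_hom_in_hom[OF G f rel] gen_closed w]
    pres_hom_gen[OF G f rel] w by (auto intro!: word_eval_cong)

text \<open>A left inverse only has to be a homomorphism on \<open>G\<close>; surjectivity is checked separately.\<close>

lemma iso_presented:
  assumes G: "group G" and f: "f \<in> S \<rightarrow> carrier G"
    and rel: "\<And>r. r \<in> R \<Longrightarrow> word_eval G f r = \<one>\<^bsub>G\<^esub>"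
    and k: "k \<in> hom G P" and kf: "\<And>s. s \<in> S \<Longrightarrow> k (f s) = gen s"
    and surj: "carrier G \<subseteq> word_eval G f ` carrier F"
  shows "G \<cong> P"
proof -
  let ?h = "pres_hom G f"
  have h: "?h \<in> hom P G" and hg: "\<And>s. s \<in> S \<Longrightarrow> ?h (gen s) = f s"
    using pres_hom[OF G f rel] by auto
  have "(k \<circ> ?h) C = C" if "C \<in> carrier P" for C
    by (rule hom_unique[OF P.is_group, where k = "\<lambda>x. x"])
      (use h k hg kf that in \<open>auto intro: hom_compose simp: hom_def Pi_iff\<close>)
  then have inj: "inj_on ?h (carrier P)"
    by (metis comp_apply inj_on_inverseI)
  have "carrier G \<subseteq> ?h ` carrier P"
  proof
    fix g assume "g \<in> carrier G"
    then obtain w where w: "w \<in> carrier F" "g = word_eval G f w" using surj by auto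
    then have "g = ?h (word_eval P gen w)"
      using pres_hom_word_eval[OF G f rel] by (auto simp: free_group_carrier)
    then show "g \<in> ?h ` carrier P"
      using w P.word_eval_closed[OF gen_closed] by (auto simp: free_group_carrier)
  qed
  then have "bij_betw ?h (carrier P) (carrier G)"
    using inj h by (auto simp: bij_betw_def hom_def)
  then have "?h \<in> iso P G" using h by (simp add: iso_def)
  then show ?thesis
    using P.iso_sym is_iso_def by blast
qed

end

section \<open>The lower central series\<close>

context group
begin

lemma inv_cancel [simp]:
  assumes "x \<in> carrier G" "y \<in> carrier G"
  shows "inv x \<otimes> (x \<otimes> y) = y" "x \<otimes> (inv x \<otimes> y) = y"
  using assms by (simp_all flip: m_assoc)

lemma commutator_closed [simp]:
  "x \<in> carrier G \<Longrightarrow> y \<in> carrier G \<Longrightarrow> commutator G x y \<in> carrier G"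
  by (simp add: commutator_def)

lemma inv_commutator:
  "x \<in> carrier G \<Longrightarrow> y \<in> carrier G \<Longrightarrow> inv (commutator G x y) = commutator G y x"
  by (simp add: commutator_def inv_mult_group m_assoc)

lemma commutator_eq_one:
  "x \<in> carrier G \<Longrightarrow> y \<in> carrier G \<Longrightarrow> commutator G x y = \<one> \<longleftrightarrow> x \<otimes> y = y \<otimes> x"
  using inv_solve_right'[of \<one> "x \<otimes> y" "y \<otimes> x"]
  by (simp add: commutator_def inv_mult_group m_assoc)

text \<open>The conjugation that arises is written as the factor
  \<open>commutator G x (commutator G x' y)\<close>, which lies deeper in the lower central series
  and becomes zero in the graded algebra.\<close>

lemma commutator_mult_left:
  "x \<in> carrier G \<Longrightarrow> x' \<in> carrier G \<Longrightarrow> y \<in> carrier G \<Longrightarrow>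
    commutator G (x \<otimes> x') y =
      commutator G x (commutator G x' y) \<otimes> (commutator G x' y \<otimes> commutator G x y)"
  by (simp add: commutator_def inv_mult_group m_assoc)

lemma commutator_mult_right:
  "x \<in> carrier G \<Longrightarrow> y \<in> carrier G \<Longrightarrow> y' \<in> carrier G \<Longrightarrow>
    commutator G x (y \<otimes> y') = commutator G x y \<otimes> (y \<otimes> commutator G x y' \<otimes> inv y)"
  by (simp add: commutator_def inv_mult_group m_assoc)

lemma commutator_inv_right:
  "x \<in> carrier G \<Longrightarrow> y \<in> carrier G \<Longrightarrow>
    commutator G x (inv y) = inv y \<otimes> commutator G y x \<otimes> y"
  by (simp add: commutator_def inv_mult_group m_assoc)

lemma conj_commutator:
  "g \<in> carrier G \<Longrightarrow> x \<in> carrier G \<Longrightarrow> y \<in> carrier G \<Longrightarrow>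
    g \<otimes> commutator G x y \<otimes> inv g = commutator G (g \<otimes> x \<otimes> inv g) (g \<otimes> y \<otimes> inv g)"
  by (simp add: commutator_def inv_mult_group m_assoc)

lemma conj_eq_commutator:
  "x \<in> carrier G \<Longrightarrow> y \<in> carrier G \<Longrightarrow> y \<otimes> x \<otimes> inv y = commutator G y x \<otimes> x"
  by (simp add: commutator_def m_assoc)

text \<open>The Hall-Witt identity with all conjugations placed on the second arguments. They
  disappear in the graded algebra, where the identity becomes the Jacobi identity.\<close>

lemma hall_witt:
  assumes "x \<in> carrier G" "y \<in> carrier G" "z \<in> carrier G"
  shows "commutator G (commutator G x y) (y \<otimes> z \<otimes> inv y) \<otimes>
    (commutator G (commutator G y z) (z \<otimes> x \<otimes> inv z) \<otimes>
     commutator G (commutator G z x) (x \<otimes> y \<otimes> inv x)) = \<one>"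
  using assms by (simp add: commutator_def inv_mult_group m_assoc)

lemma lower_central_normal: "lower_central G k \<lhd> G"
proof -
  have carrier: "carrier G \<lhd> G" by (simp add: normal_inv_iff subgroup_self)
  have "lower_central G (Suc l) \<lhd> G" for l
  proof (induction l)
    case 0
    then show ?case using carrier by simp
  next
    case (Suc l)
    interpret L: normal "lower_central G (Suc l)" G by (rule Suc.IH)
    show ?case unfolding lower_central.simps
    proof (rule normal_generateI)
      fix h g assume g: "g \<in> carrier G"
        and "h \<in> {commutator G x y |x y. x \<in> lower_central G (Suc l) \<and> y \<in> carrier G}"
      then obtain x y where h: "h = commutator G x y" "x \<in> lower_central G (Suc l)" "y \<in> carrier G"
        by blast
      then have "g \<otimes> h \<otimes> inv g = commutator G (g \<otimes> x \<otimes> inv g) (g \<otimes> y \<otimes> inv g)"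
        using g L.subset by (auto intro: conj_commutator)
      then show "g \<otimes> h \<otimes> inv g \<in>
          {commutator G x y |x y. x \<in> lower_central G (Suc l) \<and> y \<in> carrier G}"
        using g h L.inv_op_closed2 by blast
    qed (use L.subset in auto)
  qed
  then show ?thesis using carrier by (cases k) simp_all
qed

lemma lower_central_closed: "x \<in> lower_central G k \<Longrightarrow> x \<in> carrier G"
  using normal.axioms(1)[OF lower_central_normal] subgroup.subset by blast

lemma lower_central_subgroup: "subgroup (lower_central G k) G"
  by (rule normal_imp_subgroup[OF lower_central_normal])

lemma lower_central_mult:
  "x \<in> lower_central G k \<Longrightarrow> y \<in> lower_central G k \<Longrightarrow> x \<otimes> y \<in> lower_central G k"
  by (rule subgroup.m_closed[OF lower_central_subgroup])

lemma lower_central_inv: "x \<in> lower_central G k \<Longrightarrow> inv x \<in> lower_central G k"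
  by (rule subgroup.m_inv_closed[OF lower_central_subgroup])

lemma lower_central_one: "\<one> \<in> lower_central G k"
  by (rule subgroup.one_closed[OF lower_central_subgroup])

lemma lower_central_conj:
  "x \<in> lower_central G k \<Longrightarrow> g \<in> carrier G \<Longrightarrow> g \<otimes> x \<otimes> inv g \<in> lower_central G k"
  by (rule normal.inv_op_closed2[OF lower_central_normal])

lemma commutator_lower_central_Suc:
  "1 \<le> k \<Longrightarrow> x \<in> lower_central G k \<Longrightarrow> y \<in> carrier G \<Longrightarrow>
    commutator G x y \<in> lower_central G (Suc k)"
  by (cases k) (auto intro: generate.incl)

lemma lower_central_Suc_subset: "1 \<le> k \<Longrightarrow> lower_central G (Suc k) \<subseteq> lower_central G k"
proof (cases k)
  case (Suc l)
  have "commutator G x y \<in> lower_central G (Suc l)"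
    if "x \<in> lower_central G (Suc l)" "y \<in> carrier G" for x y
  proof -
    have "commutator G x y = x \<otimes> (y \<otimes> inv x \<otimes> inv y)"
      using that lower_central_closed[OF that(1)] by (simp add: commutator_def m_assoc)
    then show ?thesis
      using that lower_central_mult lower_central_conj lower_central_inv by simp
  qed
  then show ?thesis
    unfolding Suc lower_central.simps
    by (intro generate_subgroup_incl lower_central_subgroup) auto
qed simp

lemma lower_central_antimono:
  assumes "1 \<le> k" "k \<le> l"
  shows "lower_central G l \<subseteq> lower_central G k"
  using assms(2)
proof (induction l rule: dec_induct)
  case (step l)
  then show ?case using lower_central_Suc_subset[of l] assms(1) by simp
qed simp

text \<open>The three subgroups argument, by induction on \<open>l\<close> for all \<open>k\<close>
  at once. The next term is generated by commutators [u, v] with \<open>u\<close> in term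
  \<open>l\<close>. The Hall-Witt identity expresses [[u, v], x] through the other two rotations,
  and these are covered by the induction hypothesis for \<open>Suc k\<close> and for
  \<open>k\<close>.\<close>

lemma commutator_lower_central:
  assumes "1 \<le> k" "1 \<le> l" "x \<in> lower_central G k" "y \<in> lower_central G l"
  shows "commutator G x y \<in> lower_central G (k + l)"
  using assms(2,1,3,4)
proof (induction l arbitrary: k x y rule: dec_induct)
  case base
  then show ?case using commutator_lower_central_Suc lower_central_closed by simp
next
  case (step l)
  have closed: "\<And>x. x \<in> lower_central G k \<Longrightarrow> x \<in> carrier G" by (rule lower_central_closed)
  \<comment> \<open>Since the term with index \<open>k + Suc l\<close> is normal, \<open>Y\<close>
    is a subgroup, and only the generating commutators of term \<open>Suc l\<close> have to be
    placed in it.\<close>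
  define Y where "Y = {y \<in> carrier G. \<forall>x\<in>lower_central G k. commutator G x y \<in> lower_central G (k + Suc l)}"
  have comm_inv: "commutator G x y \<in> lower_central G n"
    if "commutator G y x \<in> lower_central G n" "x \<in> carrier G" "y \<in> carrier G" for x y n
    using lower_central_inv[OF that(1)] inv_commutator that by simp
  have "subgroup Y G"
  proof (rule subgroupI)
    show "Y \<noteq> {}"
      using lower_central_one closed by (auto simp: Y_def commutator_def intro!: exI[of _ \<one>])
    show "inv y \<in> Y" if y: "y \<in> Y" for y
    proof -
      have "commutator G x (inv y) \<in> lower_central G (k + Suc l)" if "x \<in> lower_central G k" for x
        using y that closed[OF that] lower_central_conj[of "commutator G y x" "k + Suc l" "inv y"]
          comm_inv[of x y]
        by (auto simp: Y_def commutator_inv_right comm_inv)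
      then show ?thesis using y by (simp add: Y_def)
    qed
    show "y \<otimes> y' \<in> Y" if "y \<in> Y" "y' \<in> Y" for y y'
      using that closed
      by (auto simp: Y_def commutator_mult_right intro!: lower_central_mult lower_central_conj)
  qed (auto simp: Y_def)
  moreover have "commutator G u v \<in> Y" if u: "u \<in> lower_central G l" and v: "v \<in> carrier G" for u v
  proof -
    have uc: "u \<in> carrier G" by (rule lower_central_closed[OF u])
    have "commutator G x (commutator G u v) \<in> lower_central G (k + Suc l)"
      if x: "x \<in> lower_central G k" for x
    proof -
      \<comment> \<open>The conjugate is chosen so that the entry
        \<open>v \<otimes> x' \<otimes> inv v\<close> of the Hall-Witt identity is \<open>x\<close>
        itself.\<close>
      define x' where "x' = inv v \<otimes> x \<otimes> inv (inv v)"
      have x': "x' \<in> lower_central G k" unfolding x'_def using x v by (intro lower_central_conj) auto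
      note xc = closed[OF x] closed[OF x']
      have xx': "v \<otimes> x' \<otimes> inv v = x" using v xc by (simp add: x'_def m_assoc)
      have 1: "commutator G (commutator G v x') (x' \<otimes> u \<otimes> inv x') \<in> lower_central G (k + Suc l)"
      proof -
        have "commutator G v x' \<in> lower_central G (Suc k)"
          using comm_inv commutator_lower_central_Suc[OF step.prems(1) x' v] v xc by simp
        then show ?thesis
          using step.IH[of "Suc k" "commutator G v x'" "x' \<otimes> u \<otimes> inv x'"]
            lower_central_conj[OF u xc(2)] by simp
      qed
      have 2: "commutator G (commutator G x' u) (u \<otimes> v \<otimes> inv u) \<in> lower_central G (k + Suc l)"
        using commutator_lower_central_Suc[OF _ step.IH[OF step.prems(1) x' u]] step.prems(1) uc v
        by simp
      have "commutator G (commutator G u v) x \<otimes>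
          (commutator G (commutator G v x') (x' \<otimes> u \<otimes> inv x') \<otimes>
           commutator G (commutator G x' u) (u \<otimes> v \<otimes> inv u)) = \<one>"
        using hall_witt[OF uc v xc(2)] xx' by simp
      then have "commutator G (commutator G u v) x =
          inv (commutator G (commutator G v x') (x' \<otimes> u \<otimes> inv x') \<otimes>
           commutator G (commutator G x' u) (u \<otimes> v \<otimes> inv u))"
        using uc v xc by (intro inv_equality[symmetric]) auto
      then show ?thesis
        using 1 2 lower_central_inv lower_central_mult comm_inv uc v xc by simp
    qed
    then show ?thesis using uc v by (simp add: Y_def)
  qed
  moreover obtain m where m: "l = Suc m" using step.hyps by (cases l) auto
  ultimately have "generate G {commutator G u v |u v. u \<in> lower_central G (Suc m) \<and> v \<in> carrier G} \<subseteq> Y"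
    by (intro generate_subgroup_incl) auto
  then have "lower_central G (Suc l) \<subseteq> Y" by (simp add: m)
  then show ?case using step.prems by (auto simp: Y_def)
qed

end

lemma hom_commutator:
  assumes "group_hom G H h" "x \<in> carrier G" "y \<in> carrier G"
  shows "h (commutator G x y) = commutator H (h x) (h y)"
proof -
  interpret group_hom G H h by (rule assms)
  show ?thesis using assms by (simp add: commutator_def)
qed

section \<open>Linear algebra over the complex numbers\<close>

locale cspace = abelian_group M for M :: "(complex, 'm, 'x) module_scheme" (structure) +
  assumes smult_closed [simp, intro]: "x \<in> carrier M \<Longrightarrow> c \<odot> x \<in> carrier M"
    and smult_l_distr: "x \<in> carrier M \<Longrightarrow> (c + d) \<odot> x = c \<odot> x \<oplus> d \<odot> x"
    and smult_r_distr: "x \<in> carrier M \<Longrightarrow> y \<in> carrier M \<Longrightarrow> c \<odot> (x \<oplus> y) = c \<odot> x \<oplus> c \<odot> y"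
    and smult_assoc: "x \<in> carrier M \<Longrightarrow> (c * d) \<odot> x = c \<odot> (d \<odot> x)"
    and smult_one [simp]: "x \<in> carrier M \<Longrightarrow> 1 \<odot> x = x"

text \<open>A submodule over \<open>complex_ring\<close> stripped to its closure conditions;
  \<open>submodule_iff\<close> identifies the two notions.\<close>

definition csub :: "(complex, 'm, 'x) module_scheme \<Rightarrow> 'm set \<Rightarrow> bool" where
  "csub M V \<longleftrightarrow> V \<subseteq> carrier M \<and> \<zero>\<^bsub>M\<^esub> \<in> V \<and>
     (\<forall>x\<in>V. \<forall>y\<in>V. x \<oplus>\<^bsub>M\<^esub> y \<in> V) \<and> (\<forall>c. \<forall>x\<in>V. c \<odot>\<^bsub>M\<^esub> x \<in> V)"

lemma csubI:
  assumes "V \<subseteq> carrier M" "\<zero>\<^bsub>M\<^esub> \<in> V" "\<And>x y. x \<in> V \<Longrightarrow> y \<in> V \<Longrightarrow> x \<oplus>\<^bsub>M\<^esub> y \<in> V"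
    "\<And>c x. x \<in> V \<Longrightarrow> c \<odot>\<^bsub>M\<^esub> x \<in> V"
  shows "csub M V"
  using assms by (simp add: csub_def)

lemma csubD:
  assumes "csub M V"
  shows "V \<subseteq> carrier M" "\<zero>\<^bsub>M\<^esub> \<in> V" "\<And>x y. x \<in> V \<Longrightarrow> y \<in> V \<Longrightarrow> x \<oplus>\<^bsub>M\<^esub> y \<in> V"
    "\<And>c x. x \<in> V \<Longrightarrow> c \<odot>\<^bsub>M\<^esub> x \<in> V" "\<And>x. x \<in> V \<Longrightarrow> x \<in> carrier M"
  using assms by (auto simp: csub_def)

lemma csub_Inter: "\<V> \<noteq> {} \<Longrightarrow> (\<And>V. V \<in> \<V> \<Longrightarrow> csub M V) \<Longrightarrow> csub M (\<Inter>\<V>)"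
  by (rule csubI) (auto dest: csubD)

definition clin :: "(complex, 'm, 'x) module_scheme \<Rightarrow> (complex, 'n, 'y) module_scheme \<Rightarrow>
    ('m \<Rightarrow> 'n) \<Rightarrow> bool" where
  "clin M N f \<longleftrightarrow> (\<forall>x\<in>carrier M. f x \<in> carrier N) \<and>
     (\<forall>x\<in>carrier M. \<forall>y\<in>carrier M. f (x \<oplus>\<^bsub>M\<^esub> y) = f x \<oplus>\<^bsub>N\<^esub> f y) \<and>
     (\<forall>c. \<forall>x\<in>carrier M. f (c \<odot>\<^bsub>M\<^esub> x) = c \<odot>\<^bsub>N\<^esub> f x)"

lemma clinI:
  assumes "\<And>x. x \<in> carrier M \<Longrightarrow> f x \<in> carrier N"
    "\<And>x y. x \<in> carrier M \<Longrightarrow> y \<in> carrier M \<Longrightarrow> f (x \<oplus>\<^bsub>M\<^esub> y) = f x \<oplus>\<^bsub>N\<^esub> f y"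
    "\<And>c x. x \<in> carrier M \<Longrightarrow> f (c \<odot>\<^bsub>M\<^esub> x) = c \<odot>\<^bsub>N\<^esub> f x"
  shows "clin M N f"
  using assms by (simp add: clin_def)

lemma clinD:
  assumes "clin M N f"
  shows "\<And>x. x \<in> carrier M \<Longrightarrow> f x \<in> carrier N"
    "\<And>x y. x \<in> carrier M \<Longrightarrow> y \<in> carrier M \<Longrightarrow> f (x \<oplus>\<^bsub>M\<^esub> y) = f x \<oplus>\<^bsub>N\<^esub> f y"
    "\<And>c x. x \<in> carrier M \<Longrightarrow> f (c \<odot>\<^bsub>M\<^esub> x) = c \<odot>\<^bsub>N\<^esub> f x"
  using assms by (simp_all add: clin_def)

lemma clin_comp: "clin M N f \<Longrightarrow> clin N K g \<Longrightarrow> clin M K (\<lambda>x. g (f x))"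
  by (simp add: clin_def)

context cspace
begin

lemma diff_eq_zero: "x \<in> carrier M \<Longrightarrow> y \<in> carrier M \<Longrightarrow> x \<ominus> y = \<zero> \<longleftrightarrow> x = y"
  using minus_equality[of x "\<ominus> y"] by (auto simp: a_minus_def r_neg)

lemma smult_zero_left [simp]: "x \<in> carrier M \<Longrightarrow> 0 \<odot> x = \<zero>"
  using smult_l_distr[of x 0 0] by (simp add: add.l_cancel_one')

lemma smult_zero_right [simp]: "c \<odot> \<zero> = \<zero>"
  using smult_r_distr[of \<zero> \<zero> c] by (simp add: add.l_cancel_one')

lemma smult_minus_one: "x \<in> carrier M \<Longrightarrow> (- 1) \<odot> x = \<ominus> x"
  using smult_l_distr[of x "-1" 1] by (simp add: add.inv_equality)

lemma smult_minus_left: "x \<in> carrier M \<Longrightarrow> (- c) \<odot> x = \<ominus> (c \<odot> x)"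
  using smult_assoc[of x "-1" c] by (simp add: smult_minus_one)

lemma smult_minus_right: "x \<in> carrier M \<Longrightarrow> c \<odot> (\<ominus> x) = \<ominus> (c \<odot> x)"
  using smult_assoc[of x c "-1"] by (simp add: smult_minus_one smult_minus_left)

lemma submodule_iff: "submodule V complex_ring M \<longleftrightarrow> csub M V"
proof
  assume "submodule V complex_ring M"
  then interpret V: submodule V complex_ring M .
  show "csub M V"
    using V.subset V.one_closed V.m_closed V.smult_closed
    by (auto simp: csub_def complex_ring_def)
next
  assume V: "csub M V"
  have "inv\<^bsub>add_monoid M\<^esub> x \<in> V" if "x \<in> V" for x
  proof -
    have "(- 1) \<odot> x \<in> V" using csubD(4)[OF V that] .
    then show ?thesis
      using smult_minus_one csubD(5)[OF V that] by (simp add: a_inv_def)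
  qed
  then show "submodule V complex_ring M"
    using V by (auto simp: csub_def intro!: submodule.intro subgroup.intro submodule_axioms.intro)
qed

lemma csub_carrier: "csub M (carrier M)"
  by (simp add: csub_def)

lemma csub_zero: "csub M {\<zero>}"
  by (auto simp: csub_def)

lemma csub_minus: "csub M V \<Longrightarrow> x \<in> V \<Longrightarrow> \<ominus> x \<in> V"
  by (metis csubD(4,5) smult_minus_one)

lemma csub_diff: "csub M V \<Longrightarrow> x \<in> V \<Longrightarrow> y \<in> V \<Longrightarrow> x \<ominus> y \<in> V"
  by (simp add: a_minus_def csub_minus csubD(3))

lemma csub_finsum: "csub M V \<Longrightarrow> finite A \<Longrightarrow> (\<And>a. a \<in> A \<Longrightarrow> f a \<in> V) \<Longrightarrow> finsum M f A \<in> V"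
proof (induction A rule: infinite_finite_induct)
  case (insert a A)
  then have "f \<in> insert a A \<rightarrow> carrier M" by (auto dest: csubD(5))
  then show ?case using insert by (simp add: csubD(3))
qed (auto dest: csubD)

lemma lin_span_eq: "lin_span M X = \<Inter>{V. csub M V \<and> X \<subseteq> V}"
  by (simp add: lin_span_def submodule_iff)

lemma csub_lin_span: "X \<subseteq> carrier M \<Longrightarrow> csub M (lin_span M X)"
  unfolding lin_span_eq by (rule csub_Inter) (use csub_carrier in auto)

lemma lin_span_incl: "X \<subseteq> lin_span M X"
  unfolding lin_span_eq by auto

lemma lin_span_minimal: "csub M V \<Longrightarrow> X \<subseteq> V \<Longrightarrow> lin_span M X \<subseteq> V"
  unfolding lin_span_eq by auto

lemma finsum_smult:
  assumes "f \<in> A \<rightarrow> carrier M"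
  shows "c \<odot> finsum M f A = finsum M (\<lambda>a. c \<odot> f a) A"
  using assms
proof (induction A rule: infinite_finite_induct)
  case (insert a A)
  then have "f \<in> A \<rightarrow> carrier M" "f a \<in> carrier M" by auto
  then show ?case using insert by (simp add: smult_r_distr Pi_iff)
qed auto

lemma csub_restrict:
  assumes V: "csub M V"
  shows "cspace (M\<lparr>carrier := V\<rparr>)"
proof -
  note mem = csubD(2-4)[OF V] csubD(5)[OF V]
  interpret V: abelian_group "M\<lparr>carrier := V\<rparr>"
  proof (rule abelian_groupI)
    show "\<exists>y\<in>carrier (M\<lparr>carrier := V\<rparr>). y \<oplus>\<^bsub>M\<lparr>carrier := V\<rparr>\<^esub> x = \<zero>\<^bsub>M\<lparr>carrier := V\<rparr>\<^esub>"
      if "x \<in> carrier (M\<lparr>carrier := V\<rparr>)" for x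
      using that csub_minus[OF V] mem(4) by (intro bexI[of _ "\<ominus> x"]) (auto simp: l_neg)
  qed (use mem in \<open>auto simp: a_assoc intro: a_comm\<close>)
  show ?thesis
    by unfold_locales (use mem in \<open>auto simp: smult_l_distr smult_r_distr smult_assoc\<close>)
qed

text \<open>The ideal J enters as the record of L with its carrier replaced, whose finite sums are
  formally different from those of L.\<close>

lemma finsum_restrict:
  assumes V: "csub M V" and f: "f \<in> A \<rightarrow> V"
  shows "finsum (M\<lparr>carrier := V\<rparr>) f A = finsum M f A"
proof -
  interpret V: cspace "M\<lparr>carrier := V\<rparr>" by (rule csub_restrict[OF V])
  show ?thesis
    using f
  proof (induction A rule: infinite_finite_induct)
    case (infinite A)
    then show ?case using V.finsum_infinite[of A f] by simp
  next
    case empty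
    then show ?case using V.finsum_empty[of f] by simp
  next
    case (insert a A)
    have "f \<in> A \<rightarrow> V" "f a \<in> V" "f \<in> A \<rightarrow> carrier M" "f a \<in> carrier M"
      using insert.prems csubD(5)[OF V] by auto
    then show ?case using insert V.finsum_insert[of A a f] by simp
  qed
qed

end

context
  fixes M :: "(complex, 'm, 'x) module_scheme" and N :: "(complex, 'n, 'y) module_scheme" and f
  assumes M: "cspace M" and N: "cspace N" and f: "clin M N f"
begin

interpretation M: cspace M by (rule M)
interpretation N: cspace N by (rule N)

lemma clin_zero: "f \<zero>\<^bsub>M\<^esub> = \<zero>\<^bsub>N\<^esub>"
  using clinD(3)[OF f, of "\<zero>\<^bsub>M\<^esub>" 0] clinD(1)[OF f] by simp

lemma clin_minus: "x \<in> carrier M \<Longrightarrow> f (\<ominus>\<^bsub>M\<^esub> x) = \<ominus>\<^bsub>N\<^esub> f x"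
  using clinD(3)[OF f, of x "-1"] clinD(1)[OF f] by (simp add: M.smult_minus_one N.smult_minus_one)

lemma clin_diff: "x \<in> carrier M \<Longrightarrow> y \<in> carrier M \<Longrightarrow> f (x \<ominus>\<^bsub>M\<^esub> y) = f x \<ominus>\<^bsub>N\<^esub> f y"
  by (simp add: a_minus_def clinD(2)[OF f] clin_minus)

lemma clin_finsum:
  assumes "g \<in> A \<rightarrow> carrier M"
  shows "f (finsum M g A) = finsum N (\<lambda>a. f (g a)) A"
  using assms
proof (induction A rule: infinite_finite_induct)
  case (insert a A)
  then have "g \<in> A \<rightarrow> carrier M" "g a \<in> carrier M" by auto
  then show ?case using insert clinD[OF f] by (simp add: Pi_iff)
qed (auto simp: clin_zero)

lemma csub_vimage: "csub N V \<Longrightarrow> csub M {x \<in> carrier M. f x \<in> V}"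
  by (rule csubI) (auto simp: clin_zero clinD[OF f] csubD)

lemma csub_image: "csub M V \<Longrightarrow> csub N (f ` V)"
proof (rule csubI)
  assume V: "csub M V"
  show "f ` V \<subseteq> carrier N" using V clinD(1)[OF f] csubD(5)[OF V] by auto
  show "\<zero>\<^bsub>N\<^esub> \<in> f ` V" using csubD(2)[OF V] clin_zero by force
  show "x \<oplus>\<^bsub>N\<^esub> y \<in> f ` V" if "x \<in> f ` V" "y \<in> f ` V" for x y
    using that clinD(2)[OF f] csubD(3,5)[OF V] by (auto simp flip: clinD(2)[OF f])
  show "c \<odot>\<^bsub>N\<^esub> x \<in> f ` V" if "x \<in> f ` V" for c x
    using that csubD(4,5)[OF V] by (auto simp flip: clinD(3)[OF f])
qed

end

locale calg = cspace M for M :: "(complex, 'm, 'x) module_scheme" (structure) +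
  assumes mult_closed [simp, intro]: "x \<in> carrier M \<Longrightarrow> y \<in> carrier M \<Longrightarrow> x \<otimes> y \<in> carrier M"
    and mult_l_distr: "x \<in> carrier M \<Longrightarrow> y \<in> carrier M \<Longrightarrow> z \<in> carrier M \<Longrightarrow>
      (x \<oplus> y) \<otimes> z = x \<otimes> z \<oplus> y \<otimes> z"
    and mult_r_distr: "x \<in> carrier M \<Longrightarrow> y \<in> carrier M \<Longrightarrow> z \<in> carrier M \<Longrightarrow>
      z \<otimes> (x \<oplus> y) = z \<otimes> x \<oplus> z \<otimes> y"
    and mult_smult_left: "x \<in> carrier M \<Longrightarrow> y \<in> carrier M \<Longrightarrow> (c \<odot> x) \<otimes> y = c \<odot> (x \<otimes> y)"
    and mult_smult_right: "x \<in> carrier M \<Longrightarrow> y \<in> carrier M \<Longrightarrow> x \<otimes> (c \<odot> y) = c \<odot> (x \<otimes> y)"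
begin

lemma clin_mult_left: "x \<in> carrier M \<Longrightarrow> clin M M (\<lambda>y. x \<otimes> y)"
  by (rule clinI) (simp_all add: mult_r_distr mult_smult_right)

lemma clin_mult_right: "y \<in> carrier M \<Longrightarrow> clin M M (\<lambda>x. x \<otimes> y)"
  by (rule clinI) (simp_all add: mult_l_distr mult_smult_left)

lemmas mult_zero_right = clin_zero[OF cspace_axioms cspace_axioms clin_mult_left]
lemmas mult_zero_left = clin_zero[OF cspace_axioms cspace_axioms clin_mult_right]
lemmas mult_minus_right = clin_minus[OF cspace_axioms cspace_axioms clin_mult_left]
lemmas mult_minus_left = clin_minus[OF cspace_axioms cspace_axioms clin_mult_right]
lemmas mult_diff_right = clin_diff[OF cspace_axioms cspace_axioms clin_mult_left]
lemmas mult_diff_left = clin_diff[OF cspace_axioms cspace_axioms clin_mult_right]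
lemmas mult_finsum_right = clin_finsum[OF cspace_axioms cspace_axioms clin_mult_left]
lemmas mult_finsum_left = clin_finsum[OF cspace_axioms cspace_axioms clin_mult_right]

end

subsection \<open>Spaces with a basis\<close>

lemma magma_simps:
  "carrier (magma_algebra B m e) = {f. finite (supp f) \<and> supp f \<subseteq> B}"
  "\<zero>\<^bsub>magma_algebra B m e\<^esub> = (\<lambda>_. 0)"
  "f \<oplus>\<^bsub>magma_algebra B m e\<^esub> g = (\<lambda>c. f c + g c)"
  "z \<odot>\<^bsub>magma_algebra B m e\<^esub> f = (\<lambda>c. z * f c)"
  "\<one>\<^bsub>magma_algebra B m e\<^esub> = basis_vec e"
  by (simp_all add: magma_algebra_def)

lemma basis_vec_closed: "b \<in> B \<Longrightarrow> basis_vec b \<in> carrier (magma_algebra B m e)"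
  by (simp add: magma_simps)

lemma cspace_magma: "cspace (magma_algebra B m e)"
proof -
  have "finite (supp (\<lambda>c. z * f c)) \<and> supp (\<lambda>c. z * f c) \<subseteq> B"
    if "finite (supp f)" "supp f \<subseteq> B" for z f
  proof -
    have "supp (\<lambda>c. z * f c) \<subseteq> supp f" by (auto simp: supp_def)
    then show ?thesis using that finite_subset by blast
  qed
  then show ?thesis
    using abelian_group_magma_algebra[of B m e]
    by (auto simp: cspace_def cspace_axioms_def magma_simps distrib_left distrib_right mult.assoc)
qed

lemma magma_minus:
  assumes "f \<in> carrier (magma_algebra B m e)"
  shows "\<ominus>\<^bsub>magma_algebra B m e\<^esub> f = (\<lambda>c. - f c)"
  using cspace.smult_minus_one[OF cspace_magma assms] by (simp add: magma_simps)

lemma magma_diff: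
  assumes "g \<in> carrier (magma_algebra B m e)"
  shows "f \<ominus>\<^bsub>magma_algebra B m e\<^esub> g = (\<lambda>c. f c - g c)"
  using assms by (simp add: a_minus_def magma_minus) (simp add: magma_simps)

lemma magma_finsum:
  assumes "g \<in> A \<rightarrow> carrier (magma_algebra B m e)"
  shows "finsum (magma_algebra B m e) g A c = (\<Sum>a\<in>A. g a c)"
proof -
  interpret cspace "magma_algebra B m e" by (rule cspace_magma)
  show ?thesis
    using assms
    by (induction A rule: infinite_finite_induct) (auto simp: magma_simps(2,3) Pi_iff)
qed

lemma magma_mult_basis:
  "monoid.mult (magma_algebra B m e) (basis_vec a) (basis_vec b) = basis_vec (m a b)"
proof
  fix c
  have "monoid.mult (magma_algebra B m e) (basis_vec a) (basis_vec b) c =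
      (if m a b = c then basis_vec a a * basis_vec b b else 0)"
    by (simp add: magma_algebra_def)
  then show "monoid.mult (magma_algebra B m e) (basis_vec a) (basis_vec b) c = basis_vec (m a b) c"
    by (auto simp: basis_vec_def)
qed

lemma calg_magma:
  assumes closed: "\<And>a b. a \<in> B \<Longrightarrow> b \<in> B \<Longrightarrow> m a b \<in> B"
  shows "calg (magma_algebra B m e)"
proof -
  let ?A = "magma_algebra B m e"
  interpret cspace ?A by (rule cspace_magma)
  have mult: "(f \<otimes>\<^bsub>?A\<^esub> g) c = (\<Sum>a\<in>S. \<Sum>b\<in>T. if m a b = c then f a * g b else 0)"
    if "finite S" "finite T" "supp f \<subseteq> S" "supp g \<subseteq> T" for S T f g c
    using that by (rule magma_mult_eq)
  have mult_closed: "f \<otimes>\<^bsub>?A\<^esub> g \<in> carrier ?A" if "f \<in> carrier ?A" "g \<in> carrier ?A" for f g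
  proof -
    have *: "finite ((\<lambda>(a, b). m a b) ` (supp f \<times> supp g))"
      "(\<lambda>(a, b). m a b) ` (supp f \<times> supp g) \<subseteq> B"
      using that closed by (auto simp: magma_simps)
    have "finite (supp (f \<otimes>\<^bsub>?A\<^esub> g))"
      by (rule finite_subset[OF supp_magma_mult *(1)])
    moreover have "supp (f \<otimes>\<^bsub>?A\<^esub> g) \<subseteq> B"
      by (rule order_trans[OF supp_magma_mult *(2)])
    ultimately show ?thesis by (simp add: magma_simps)
  qed
  have sup: "supp (\<lambda>c. f c + g c) \<subseteq> supp f \<union> supp g" "supp (\<lambda>c. z * f c) \<subseteq> supp f"
    for f g :: "'a \<Rightarrow> complex" and z by (auto simp: supp_def)
  show ?thesis
  proof (unfold_locales, goal_cases)
    case (1 f g)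
    then show ?case by (rule mult_closed)
  next
    case (2 f g h)
    then have fin: "finite (supp f \<union> supp g)" "finite (supp h)" by (auto simp: magma_simps)
    show ?case
      unfolding magma_simps(3) mult[OF fin sup(1) order.refl] mult[OF fin Un_upper1 order.refl]
        mult[OF fin Un_upper2 order.refl]
      by (simp add: sum.distrib[symmetric] distrib_right if_distrib cong: if_cong)
  next
    case (3 f g h)
    then have fin: "finite (supp h)" "finite (supp f \<union> supp g)" by (auto simp: magma_simps)
    show ?case
      unfolding magma_simps(3) mult[OF fin order.refl sup(1)] mult[OF fin order.refl Un_upper1]
        mult[OF fin order.refl Un_upper2]
      by (simp add: sum.distrib[symmetric] distrib_left if_distrib cong: if_cong)
  next
    case (4 f g z)
    then have fin: "finite (supp f)" "finite (supp g)" by (auto simp: magma_simps)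
    show ?case
      unfolding magma_simps(4) mult[OF fin sup(2) order.refl] mult[OF fin order.refl order.refl]
      by (auto simp: sum_distrib_left intro!: ext sum.cong)
  next
    case (5 f g z)
    then have fin: "finite (supp f)" "finite (supp g)" by (auto simp: magma_simps)
    show ?case
      unfolding magma_simps(4) mult[OF fin order.refl sup(2)] mult[OF fin order.refl order.refl]
      by (auto simp: sum_distrib_left intro!: ext sum.cong)
  qed
qed

text \<open>A finitely supported function is the combination of basis vectors weighted by its
  values. Applied to the equalizer of two linear maps, this reduces the multilinear identities below
  to basis vectors.\<close>

lemma magma_csub_induct:
  assumes V: "csub (magma_algebra B m e) V" and basis: "\<And>b. b \<in> B \<Longrightarrow> basis_vec b \<in> V"
    and f: "f \<in> carrier (magma_algebra B m e)"
  shows "f \<in> V"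
proof -
  interpret A: cspace "magma_algebra B m e" by (rule cspace_magma)
  have fin: "finite (supp f)" and sub: "supp f \<subseteq> B" using f by (auto simp: magma_simps)
  have "finsum (magma_algebra B m e) (\<lambda>b. f b \<odot>\<^bsub>magma_algebra B m e\<^esub> basis_vec b) (supp f) \<in> V"
    using fin sub csubD(4)[OF V basis] by (intro A.csub_finsum[OF V]) auto
  moreover have "finsum (magma_algebra B m e) (\<lambda>b. f b \<odot>\<^bsub>magma_algebra B m e\<^esub> basis_vec b) (supp f) = f"
  proof
    fix c
    have *: "(\<lambda>b. f b \<odot>\<^bsub>magma_algebra B m e\<^esub> basis_vec b) \<in> supp f \<rightarrow> carrier (magma_algebra B m e)"
      using sub by (intro Pi_I A.smult_closed basis_vec_closed) auto
    show "finsum (magma_algebra B m e) (\<lambda>b. f b \<odot>\<^bsub>magma_algebra B m e\<^esub> basis_vec b) (supp f) c = f c"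
      using fin by (subst magma_finsum[OF *])
        (auto simp: magma_simps basis_vec_def supp_def if_distrib cong: if_cong)
  qed
  ultimately show ?thesis by simp
qed

definition lin_ext :: "(complex, 'm, 'x) module_scheme \<Rightarrow> ('b \<Rightarrow> 'm) \<Rightarrow> ('b \<Rightarrow> complex) \<Rightarrow> 'm" where
  "lin_ext M h f = finsum M (\<lambda>b. f b \<odot>\<^bsub>M\<^esub> h b) (supp f)"

context cspace
begin

lemma lin_ext_eq:
  assumes "finite S" "supp f \<subseteq> S" "h \<in> S \<rightarrow> carrier M"
  shows "lin_ext M h f = finsum M (\<lambda>b. f b \<odot> h b) S"
  unfolding lin_ext_def
proof (rule add.finprod_mono_neutral_cong_left)
  show "f b \<odot> h b = \<zero>" if "b \<in> S - supp f" for b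
    using that assms by (auto simp: supp_def Pi_iff)
qed (use assms in auto)

lemma clin_lin_ext:
  assumes h: "h \<in> B \<rightarrow> carrier M"
  shows "clin (magma_algebra B m e) M (lin_ext M h)"
proof (rule clinI)
  fix f assume f: "f \<in> carrier (magma_algebra B m e)"
  then have fin: "finite (supp f)" and hf: "h \<in> supp f \<rightarrow> carrier M"
    using h by (auto simp: magma_simps)
  show "lin_ext M h f \<in> carrier M"
    unfolding lin_ext_def using hf by (intro finsum_closed) auto
  show "lin_ext M h (c \<odot>\<^bsub>magma_algebra B m e\<^esub> f) = c \<odot> lin_ext M h f" for c
  proof -
    have "lin_ext M h (\<lambda>x. c * f x) = finsum M (\<lambda>b. (c * f b) \<odot> h b) (supp f)"
      using fin hf by (intro lin_ext_eq) (auto simp: supp_def)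
    also have "\<dots> = finsum M (\<lambda>b. c \<odot> (f b \<odot> h b)) (supp f)"
      using hf by (intro finsum_cong') (auto simp: smult_assoc Pi_iff)
    also have "\<dots> = c \<odot> lin_ext M h f"
      unfolding lin_ext_def using hf by (intro finsum_smult[symmetric]) auto
    finally show ?thesis by (simp add: magma_simps)
  qed
  fix g assume g: "g \<in> carrier (magma_algebra B m e)"
  let ?S = "supp f \<union> supp g"
  have fin: "finite ?S" and hS: "h \<in> ?S \<rightarrow> carrier M"
    using f g h by (auto simp: magma_simps)
  have "lin_ext M h (\<lambda>c. f c + g c) = finsum M (\<lambda>b. (f b + g b) \<odot> h b) ?S"
    using fin hS by (intro lin_ext_eq) (auto simp: supp_def)
  also have "\<dots> = finsum M (\<lambda>b. f b \<odot> h b \<oplus> g b \<odot> h b) ?S"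
    using hS by (intro finsum_cong') (auto simp: smult_l_distr Pi_iff)
  also have "\<dots> = finsum M (\<lambda>b. f b \<odot> h b) ?S \<oplus> finsum M (\<lambda>b. g b \<odot> h b) ?S"
    using hS by (intro finsum_addf) auto
  also have "\<dots> = lin_ext M h f \<oplus> lin_ext M h g"
    using lin_ext_eq[OF fin Un_upper1 hS] lin_ext_eq[OF fin Un_upper2 hS] by simp
  finally show "lin_ext M h (f \<oplus>\<^bsub>magma_algebra B m e\<^esub> g) = lin_ext M h f \<oplus> lin_ext M h g"
    by (simp add: magma_simps)
qed

lemma lin_ext_basis: "h b \<in> carrier M \<Longrightarrow> lin_ext M h (basis_vec b) = h b"
  by (simp add: lin_ext_def) (simp add: basis_vec_def)

lemma csub_equalizer:
  assumes "cspace K" "clin K M f" "clin K M g"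
  shows "csub K {x \<in> carrier K. f x = g x}"
proof -
  interpret K: cspace K by (rule assms)
  show ?thesis
    using clin_zero[OF assms(1) cspace_axioms assms(2)] clin_zero[OF assms(1) cspace_axioms assms(3)]
      clinD[OF assms(2)] clinD[OF assms(3)]
    by (simp add: csub_def)
qed

lemma clin_eq_on_basis:
  assumes "clin (magma_algebra B m e) M f" "clin (magma_algebra B m e) M g"
    and "\<And>b. b \<in> B \<Longrightarrow> f (basis_vec b) = g (basis_vec b)"
    and "x \<in> carrier (magma_algebra B m e)"
  shows "f x = g x"
proof -
  have "x \<in> {x \<in> carrier (magma_algebra B m e). f x = g x}"
    by (rule magma_csub_induct[OF csub_equalizer[OF cspace_magma assms(1,2)] _ assms(4)])
      (simp add: assms(3) basis_vec_closed)
  then show ?thesis by simp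
qed

lemma clin_add_fun: "clin K M f \<Longrightarrow> clin K M g \<Longrightarrow> clin K M (\<lambda>x. f x \<oplus> g x)"
  by (rule clinI) (auto simp: clinD smult_r_distr a_ac)

lemma clin_smult_fun: "clin K M f \<Longrightarrow> clin K M (\<lambda>x. c \<odot> f x)"
  by (rule clinI) (auto simp: clinD smult_r_distr mult.commute simp flip: smult_assoc)

lemma clin_diff_fun: "clin K M f \<Longrightarrow> clin K M g \<Longrightarrow> clin K M (\<lambda>x. f x \<ominus> g x)"
  by (rule clinI) (auto simp: clinD a_minus_def smult_r_distr smult_minus_right minus_add a_ac)

lemma clin_finsum_fun:
  assumes "\<And>a. a \<in> A \<Longrightarrow> clin K M (f a)"
  shows "clin K M (\<lambda>x. finsum M (\<lambda>a. f a x) A)"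
proof (rule clinI)
  show "finsum M (\<lambda>a. f a (x \<oplus>\<^bsub>K\<^esub> y)) A = finsum M (\<lambda>a. f a x) A \<oplus> finsum M (\<lambda>a. f a y) A"
    if "x \<in> carrier K" "y \<in> carrier K" for x y
  proof -
    have "finsum M (\<lambda>a. f a (x \<oplus>\<^bsub>K\<^esub> y)) A = finsum M (\<lambda>a. f a x \<oplus> f a y) A"
      using that clinD[OF assms] by (intro finsum_cong') auto
    then show ?thesis using that clinD(1)[OF assms] by (simp add: finsum_addf)
  qed
  show "finsum M (\<lambda>a. f a (c \<odot>\<^bsub>K\<^esub> x)) A = c \<odot> finsum M (\<lambda>a. f a x) A" if "x \<in> carrier K" for x c
  proof -
    have "finsum M (\<lambda>a. f a (c \<odot>\<^bsub>K\<^esub> x)) A = finsum M (\<lambda>a. c \<odot> f a x) A"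
      using that clinD[OF assms] by (intro finsum_cong') auto
    then show ?thesis using that clinD(1)[OF assms] by (simp add: finsum_smult)
  qed
qed (use clinD(1)[OF assms] in auto)

end

subsection \<open>Quotients\<close>

text \<open>The induced map on a quotient, read off as the common value of \<open>f\<close> on a
  coset. The action \<open>uea_action\<close> of the enveloping algebra is an instance.\<close>

definition quot_lift :: "('m \<Rightarrow> 'n) \<Rightarrow> 'm set \<Rightarrow> 'n" where
  "quot_lift f X = the_elem (f ` X)"

context cspace
begin

context
  fixes I assumes I: "csub M I"
begin

lemma abelian_subgroup_csub: "abelian_subgroup I M"
  using I submodule_iff abelian_group_axioms
  by (auto intro!: abelian_subgroupI3 additive_subgroup.intro simp: submodule_def)

interpretation I: abelian_subgroup I M by (rule abelian_subgroup_csub)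

lemma coset_eq_iff:
  assumes "x \<in> carrier M" "y \<in> carrier M"
  shows "I +> x = I +> y \<longleftrightarrow> x \<ominus> y \<in> I"
proof -
  have "I +> x = I +> y \<longleftrightarrow> x \<in> I +> y"
    using assms I.a_repr_independence' I.a_rcos_self by metis
  then show ?thesis using I.a_rcos_module[OF assms(2,1)]
    by (simp add: a_minus_def)
qed

lemma coset_self: "x \<in> carrier M \<Longrightarrow> x \<in> I +> x"
  by (rule I.a_rcos_self)

lemma coset_eq_zero: "x \<in> carrier M \<Longrightarrow> I +> x = I \<longleftrightarrow> x \<in> I"
  using coset_eq_iff[of x \<zero>] minus_equality[of \<zero> \<zero>] a_coset_add_zero[OF csubD(1)[OF I]]
  by (simp add: a_minus_def)

lemma coset_mem:
  assumes "y \<in> I +> x" "x \<in> carrier M"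
  shows "y \<in> carrier M" "y \<ominus> x \<in> I" "I +> y = I +> x"
proof -
  show y: "y \<in> carrier M" using assms by (rule I.a_elemrcos_carrier[rotated])
  show "I +> y = I +> x" using assms by (metis I.a_repr_independence')
  then show "y \<ominus> x \<in> I" using coset_eq_iff y assms(2) by simp
qed

lemma quot_simps:
  "carrier (alg_quot M I) = (\<lambda>x. I +> x) ` carrier M"
  "\<zero>\<^bsub>alg_quot M I\<^esub> = I"
  by (auto simp: alg_quot_def FactRing_def A_RCOSETS_def')

lemma quot_add:
  assumes "x \<in> carrier M" "y \<in> carrier M"
  shows "(I +> x) \<oplus>\<^bsub>alg_quot M I\<^esub> (I +> y) = I +> (x \<oplus> y)"
  using assms by (simp add: alg_quot_def FactRing_def I.a_rcos_sum)

lemma quot_smult: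
  assumes "x \<in> carrier M"
  shows "c \<odot>\<^bsub>alg_quot M I\<^esub> (I +> x) = I +> (c \<odot> x)"
proof -
  have "I +> (c \<odot> y) = I +> (c \<odot> x)" if "y \<in> I +> x" for y
  proof -
    have "c \<odot> (y \<ominus> x) \<in> I" using coset_mem[OF that assms] csubD(4)[OF I] by blast
    then show ?thesis
      using coset_mem[OF that assms] assms coset_eq_iff[of "c \<odot> y" "c \<odot> x"]
      by (simp add: a_minus_def smult_r_distr smult_minus_right)
  qed
  then have "(\<Union>y\<in>I +> x. I +> (c \<odot> y)) = (\<Union>y\<in>I +> x. I +> (c \<odot> x))"
    by (intro SUP_cong) auto
  then show ?thesis using coset_self[OF assms] by (auto simp: alg_quot_def)
qed

lemma cspace_quot: "cspace (alg_quot M I)"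
proof -
  have zero: "\<zero>\<^bsub>alg_quot M I\<^esub> = I +> \<zero>" 
    using a_coset_add_zero[OF csubD(1)[OF I]] quot_simps(2) by simp
  interpret Q: abelian_group "alg_quot M I"
  proof (rule abelian_groupI)
    show "\<exists>y\<in>carrier (alg_quot M I). y \<oplus>\<^bsub>alg_quot M I\<^esub> x = \<zero>\<^bsub>alg_quot M I\<^esub>"
      if x: "x \<in> carrier (alg_quot M I)" for x
    proof -
      obtain y where y: "y \<in> carrier M" "x = I +> y" using x quot_simps(1) by auto
      then have "(I +> \<ominus> y) \<oplus>\<^bsub>alg_quot M I\<^esub> x = \<zero>\<^bsub>alg_quot M I\<^esub>"
        using quot_add[of "\<ominus> y" y] zero by (simp add: l_neg)
      moreover have "I +> \<ominus> y \<in> carrier (alg_quot M I)" using y(1) quot_simps(1) by auto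
      ultimately show ?thesis by blast
    qed
  next
    fix x y z
    assume "x \<in> carrier (alg_quot M I)" "y \<in> carrier (alg_quot M I)" "z \<in> carrier (alg_quot M I)"
    then obtain a b c where "a \<in> carrier M" "b \<in> carrier M" "c \<in> carrier M"
      "x = I +> a" "y = I +> b" "z = I +> c"
      unfolding quot_simps(1) by blast
    then show "x \<oplus>\<^bsub>alg_quot M I\<^esub> y \<oplus>\<^bsub>alg_quot M I\<^esub> z = x \<oplus>\<^bsub>alg_quot M I\<^esub> (y \<oplus>\<^bsub>alg_quot M I\<^esub> z)"
      by (simp add: quot_add a_assoc)
  next
    fix x y
    assume "x \<in> carrier (alg_quot M I)" "y \<in> carrier (alg_quot M I)"
    then obtain a b where ab: "a \<in> carrier M" "b \<in> carrier M" "x = I +> a" "y = I +> b"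
      unfolding quot_simps(1) by blast
    then show "x \<oplus>\<^bsub>alg_quot M I\<^esub> y = y \<oplus>\<^bsub>alg_quot M I\<^esub> x" "x \<oplus>\<^bsub>alg_quot M I\<^esub> y \<in> carrier (alg_quot M I)"
      using a_comm[of a b] by (auto simp: quot_add quot_simps(1))
  next
    fix x assume "x \<in> carrier (alg_quot M I)"
    then obtain a where a: "a \<in> carrier M" "x = I +> a" unfolding quot_simps(1) by blast
    then show "\<zero>\<^bsub>alg_quot M I\<^esub> \<oplus>\<^bsub>alg_quot M I\<^esub> x = x"
      using quot_add[of \<zero> a] zero by simp
  qed (use csubD(2)[OF csub_carrier] quot_simps(1) zero in auto)
  show ?thesis
  proof (unfold_locales, goal_cases)
    case (1 x c)
    then obtain a where "a \<in> carrier M" "x = I +> a" unfolding quot_simps(1) by blast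
    then show ?case by (simp add: quot_smult quot_simps(1))
  next
    case (2 x c d)
    then obtain a where "a \<in> carrier M" "x = I +> a" unfolding quot_simps(1) by blast
    then show ?case by (simp add: quot_smult quot_add smult_l_distr)
  next
    case (3 x y c)
    then obtain a b where "a \<in> carrier M" "x = I +> a" "b \<in> carrier M" "y = I +> b"
      unfolding quot_simps(1) by blast
    then show ?case by (simp add: quot_smult quot_add smult_r_distr)
  next
    case (4 x c d)
    then obtain a where "a \<in> carrier M" "x = I +> a" unfolding quot_simps(1) by blast
    then show ?case by (simp add: quot_smult smult_assoc)
  next
    case (5 x)
    then obtain a where "a \<in> carrier M" "x = I +> a" unfolding quot_simps(1) by blast
    then show ?case by (simp add: quot_smult)
  qed
qed

lemma clin_quot: "clin M (alg_quot M I) (\<lambda>x. I +> x)"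
  by (rule clinI) (auto simp: quot_simps quot_smult quot_add)

lemma quot_lift_coset:
  assumes K: "cspace K" and f: "clin M K f" and null: "\<And>x. x \<in> I \<Longrightarrow> f x = \<zero>\<^bsub>K\<^esub>"
    and x: "x \<in> carrier M"
  shows "quot_lift f (I +> x) = f x"
proof -
  interpret K: cspace K by (rule K)
  have "f y = f x" if "y \<in> I +> x" for y
  proof -
    have "f y \<ominus>\<^bsub>K\<^esub> f x = \<zero>\<^bsub>K\<^esub>"
      using clin_diff[OF cspace_axioms K f coset_mem(1)[OF that x] x] null[OF coset_mem(2)[OF that x]]
      by simp
    then show ?thesis
      using K.diff_eq_zero[OF clinD(1)[OF f coset_mem(1)[OF that x]] clinD(1)[OF f x]] by simp
  qed
  then have "f ` (I +> x) = (\<lambda>_. f x) ` (I +> x)" by (intro image_cong) auto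
  then have "f ` (I +> x) = {f x}" using coset_self[OF x] by auto
  then show ?thesis by (simp add: quot_lift_def)
qed

lemma clin_quot_lift:
  assumes K: "cspace K" and f: "clin M K f" and null: "\<And>x. x \<in> I \<Longrightarrow> f x = \<zero>\<^bsub>K\<^esub>"
  shows "clin (alg_quot M I) K (quot_lift f)"
  by (rule clinI)
    (auto simp: quot_simps quot_add quot_smult quot_lift_coset[OF K f null] clinD[OF f])

end

end

text \<open>Changing representatives alters the product by (x' - x) y' + x (y' - y), which stays in
  a two-sided ideal.\<close>

lemma (in calg) quot_mult:
  assumes I: "csub M I" and l: "\<And>x y. x \<in> carrier M \<Longrightarrow> y \<in> I \<Longrightarrow> x \<otimes> y \<in> I"
    and r: "\<And>x y. x \<in> carrier M \<Longrightarrow> y \<in> I \<Longrightarrow> y \<otimes> x \<in> I"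
    and x: "x \<in> carrier M" and y: "y \<in> carrier M"
  shows "(I +> x) \<otimes>\<^bsub>alg_quot M I\<^esub> (I +> y) = I +> (x \<otimes> y)"
proof -
  have "I +> (x' \<otimes> y') = I +> (x \<otimes> y)" if "x' \<in> I +> x" "y' \<in> I +> y" for x' y'
  proof -
    note x' = coset_mem[OF I that(1) x] and y' = coset_mem[OF I that(2) y]
    have "(x' \<ominus> x) \<otimes> y' \<oplus> x \<otimes> (y' \<ominus> y) \<in> I"
      using x' y' l r x csubD(3)[OF I] by simp
    also have "(x' \<ominus> x) \<otimes> y' \<oplus> x \<otimes> (y' \<ominus> y) = x' \<otimes> y' \<ominus> x \<otimes> y"
      using x y x'(1) y'(1) by (simp add: a_minus_def mult_l_distr mult_r_distr mult_minus_left mult_minus_right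
          a_assoc r_neg1)
    finally show ?thesis using x'(1) y'(1) x y coset_eq_iff[OF I] by simp
  qed
  then have "(\<Union>x'\<in>I +> x. \<Union>y'\<in>I +> y. I +> (x' \<otimes> y')) =
      (\<Union>x'\<in>I +> x. \<Union>y'\<in>I +> y. I +> (x \<otimes> y))"
    by (intro SUP_cong) auto
  then show ?thesis
    using coset_self[OF I x] coset_self[OF I y]
    by (auto simp: alg_quot_def FactRing_def rcoset_mult_def)
qed

lemma (in calg) calg_quot:
  assumes I: "csub M I" and l: "\<And>x y. x \<in> carrier M \<Longrightarrow> y \<in> I \<Longrightarrow> x \<otimes> y \<in> I"
    and r: "\<And>x y. x \<in> carrier M \<Longrightarrow> y \<in> I \<Longrightarrow> y \<otimes> x \<in> I"
  shows "calg (alg_quot M I)"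
proof -
  interpret Q: cspace "alg_quot M I" by (rule cspace_quot[OF I])
  show ?thesis
    by unfold_locales
      (auto simp: quot_simps[OF I] quot_mult[OF I l r] quot_add[OF I] quot_smult[OF I]
        mult_l_distr mult_r_distr mult_smult_left mult_smult_right)
qed

section \<open>The associated graded Lie algebra\<close>

text \<open>The Jacobi identity is written as the statement that bracketing with \<open>x\<close> is
  a derivation.\<close>

locale clie = calg L for L :: "(complex, 'm, 'x) module_scheme" (structure) +
  assumes antisym: "x \<in> carrier L \<Longrightarrow> y \<in> carrier L \<Longrightarrow> x \<otimes> y = \<ominus> (y \<otimes> x)"
    and jacobi: "x \<in> carrier L \<Longrightarrow> y \<in> carrier L \<Longrightarrow> z \<in> carrier L \<Longrightarrow>
      x \<otimes> (y \<otimes> z) = (x \<otimes> y) \<otimes> z \<oplus> y \<otimes> (x \<otimes> z)"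

definition gcls :: "('a, 'x) monoid_scheme \<Rightarrow> nat \<Rightarrow> 'a \<Rightarrow> (nat \<times> 'a \<Rightarrow> complex) set" where
  "gcls G k g = gr_null G +>\<^bsub>gr_pre G\<^esub> basis_vec (k, g)"

lemma initial_form_eq: "initial_form G r = gcls G (weight G r) r"
  by (simp add: initial_form_def gcls_def)

context group
begin

abbreviation "gr_basis \<equiv> {(k, g). 1 \<le> k \<and> g \<in> lower_central G k}"

lemma calg_gr_pre: "calg (gr_pre G)"
  unfolding gr_pre_def by (rule calg_magma) (auto intro: commutator_lower_central)

interpretation E: calg "gr_pre G" by (rule calg_gr_pre)

lemma gr_basis_closed: "1 \<le> k \<Longrightarrow> g \<in> lower_central G k \<Longrightarrow> basis_vec (k, g) \<in> carrier (gr_pre G)"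
  unfolding gr_pre_def by (rule basis_vec_closed) simp

lemma gr_relations_closed: "gr_relations G \<subseteq> carrier (gr_pre G)"
proof -
  have "g \<in> lower_central G k" if "1 \<le> k" "g \<in> lower_central G (Suc k)" for k g
    using lower_central_Suc_subset that by blast
  then show ?thesis
    by (auto simp: gr_relations_def intro!: gr_basis_closed E.minus_closed E.a_closed lower_central_mult)
qed

lemma csub_gr_null: "csub (gr_pre G) (gr_null G)"
  unfolding gr_null_def by (rule E.csub_lin_span[OF gr_relations_closed])

lemma gr_null_relations: "gr_relations G \<subseteq> gr_null G"
  unfolding gr_null_def by (rule E.lin_span_incl)

lemma cspace_gr: "cspace (gr G)"
  unfolding gr_def by (rule E.cspace_quot[OF csub_gr_null])

interpretation L: cspace "gr G" by (rule cspace_gr)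

lemma clin_gr_proj: "clin (gr_pre G) (gr G) (\<lambda>x. gr_null G +>\<^bsub>gr_pre G\<^esub> x)"
  unfolding gr_def by (rule E.clin_quot[OF csub_gr_null])

lemma gr_proj_null: "x \<in> gr_null G \<Longrightarrow> gr_null G +>\<^bsub>gr_pre G\<^esub> x = \<zero>\<^bsub>gr G\<^esub>"
  using E.coset_eq_zero[OF csub_gr_null csubD(5)[OF csub_gr_null]] E.quot_simps(2)[OF csub_gr_null]
  by (simp add: gr_def)

lemma gr_proj_eq_zero:
  "x \<in> carrier (gr_pre G) \<Longrightarrow> gr_null G +>\<^bsub>gr_pre G\<^esub> x = \<zero>\<^bsub>gr G\<^esub> \<longleftrightarrow> x \<in> gr_null G"
  using E.coset_eq_zero[OF csub_gr_null] E.quot_simps(2)[OF csub_gr_null] by (simp add: gr_def)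

lemma gcls_closed: "1 \<le> k \<Longrightarrow> g \<in> lower_central G k \<Longrightarrow> gcls G k g \<in> carrier (gr G)"
  unfolding gcls_def by (rule clinD(1)[OF clin_gr_proj gr_basis_closed])

lemma gcls_mult:
  assumes "1 \<le> k" "g \<in> lower_central G k" "h \<in> lower_central G k"
  shows "gcls G k (g \<otimes> h) = gcls G k g \<oplus>\<^bsub>gr G\<^esub> gcls G k h"
proof -
  note closed = gr_basis_closed[OF assms(1,2)] gr_basis_closed[OF assms(1,3)]
    gr_basis_closed[OF assms(1) lower_central_mult[OF assms(2,3)]]
  have "basis_vec (k, g \<otimes> h) \<ominus>\<^bsub>gr_pre G\<^esub> (basis_vec (k, g) \<oplus>\<^bsub>gr_pre G\<^esub> basis_vec (k, h)) \<in> gr_null G"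
    using assms by (intro subsetD[OF gr_null_relations]) (auto simp: gr_relations_def)
  then have "gr_null G +>\<^bsub>gr_pre G\<^esub> basis_vec (k, g \<otimes> h) =
      gr_null G +>\<^bsub>gr_pre G\<^esub> (basis_vec (k, g) \<oplus>\<^bsub>gr_pre G\<^esub> basis_vec (k, h))"
    using closed by (subst E.coset_eq_iff[OF csub_gr_null]) auto
  then show ?thesis
    unfolding gcls_def clinD(2)[OF clin_gr_proj closed(1,2)] .
qed

lemma gcls_zero:
  assumes "1 \<le> k" "g \<in> lower_central G (Suc k)"
  shows "gcls G k g = \<zero>\<^bsub>gr G\<^esub>"
  unfolding gcls_def
  by (rule gr_proj_null, rule subsetD[OF gr_null_relations])
    (use assms in \<open>auto simp: gr_relations_def\<close>)

lemma gcls_one: "1 \<le> k \<Longrightarrow> gcls G k \<one> = \<zero>\<^bsub>gr G\<^esub>"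
  by (rule gcls_zero) (auto simp: lower_central_one)

lemma gcls_inv:
  assumes "1 \<le> k" "g \<in> lower_central G k"
  shows "gcls G k (inv g) = \<ominus>\<^bsub>gr G\<^esub> gcls G k g"
proof -
  have "gcls G k (inv g) \<oplus>\<^bsub>gr G\<^esub> gcls G k g = \<zero>\<^bsub>gr G\<^esub>"
    using assms gcls_mult[OF assms(1) lower_central_inv assms(2), of g] gcls_one[OF assms(1)]
      lower_central_closed[OF assms(2)] by simp
  then show ?thesis
    using assms gcls_closed lower_central_inv by (intro L.minus_equality[symmetric]) auto
qed

text \<open>Conjugation by \<open>g\<close> multiplies \<open>x\<close> by the commutator of
  \<open>g\<close> and \<open>x\<close>, which lies one term deeper.\<close>

lemma gcls_conj:
  assumes "1 \<le> k" "x \<in> lower_central G k" "g \<in> carrier G"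
  shows "gcls G k (g \<otimes> x \<otimes> inv g) = gcls G k x"
proof -
  have x: "x \<in> carrier G" by (rule lower_central_closed[OF assms(2)])
  have "commutator G x g \<in> lower_central G (Suc k)"
    using commutator_lower_central_Suc assms by simp
  then have c: "commutator G g x \<in> lower_central G (Suc k)"
    using lower_central_inv[of "commutator G x g"] inv_commutator x assms(3) by simp
  then have "commutator G g x \<in> lower_central G k"
    using lower_central_Suc_subset assms(1) by blast
  then show ?thesis
    using x assms conj_eq_commutator[OF x assms(3)] gcls_mult gcls_zero[OF assms(1) c] gcls_closed
    by simp
qed

text \<open>The double commutator in \<open>commutator_mult_left\<close> lies in term
  \<open>k + (k + l)\<close>, hence in term \<open>Suc (k + l)\<close> because \<open>k\<close> is
  positive, so its class in degree \<open>k + l\<close> is zero.\<close>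

lemma gcls_commutator_mult_left:
  assumes "1 \<le> k" "1 \<le> l" "g \<in> lower_central G k" "g' \<in> lower_central G k" "h \<in> lower_central G l"
  shows "gcls G (k + l) (commutator G (g \<otimes> g') h) =
    gcls G (k + l) (commutator G g h) \<oplus>\<^bsub>gr G\<^esub> gcls G (k + l) (commutator G g' h)"
proof -
  note closed = lower_central_closed[OF assms(3)] lower_central_closed[OF assms(4)]
    lower_central_closed[OF assms(5)]
  have kl: "1 \<le> k + l" using assms(1) by simp
  have c: "commutator G g h \<in> lower_central G (k + l)" "commutator G g' h \<in> lower_central G (k + l)"
    using assms commutator_lower_central by auto
  have "commutator G g (commutator G g' h) \<in> lower_central G (k + (k + l))"
    using assms c commutator_lower_central by auto
  then have d: "commutator G g (commutator G g' h) \<in> lower_central G (Suc (k + l))"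
    using lower_central_antimono[of "Suc (k + l)" "k + (k + l)"] assms(1) by auto
  then have d': "commutator G g (commutator G g' h) \<in> lower_central G (k + l)"
    using lower_central_Suc_subset[OF kl] by blast
  show ?thesis
    unfolding commutator_mult_left[OF closed]
    using kl c d' gcls_zero[OF kl d] gcls_closed
    by (simp add: gcls_mult lower_central_mult L.a_comm)
qed

lemma gcls_commutator_antisym:
  assumes "1 \<le> k" "1 \<le> l" "g \<in> lower_central G k" "h \<in> lower_central G l"
  shows "gcls G (l + k) (commutator G h g) = \<ominus>\<^bsub>gr G\<^esub> gcls G (k + l) (commutator G g h)"
  using gcls_inv[of "k + l" "commutator G g h"] assms commutator_lower_central
    inv_commutator lower_central_closed by (simp add: add.commute)

lemma gcls_commutator_mult_right:
  assumes "1 \<le> k" "1 \<le> l" "g \<in> lower_central G k" "g' \<in> lower_central G k" "h \<in> lower_central G l"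
  shows "gcls G (l + k) (commutator G h (g \<otimes> g')) =
    gcls G (l + k) (commutator G h g) \<oplus>\<^bsub>gr G\<^esub> gcls G (l + k) (commutator G h g')"
  using assms gcls_closed[OF _ commutator_lower_central]
  by (simp add: gcls_commutator_antisym[of k l] gcls_commutator_mult_left lower_central_mult L.minus_add)

lemma gr_pre_mult_basis:
  "basis_vec (k, g) \<otimes>\<^bsub>gr_pre G\<^esub> basis_vec (l, h) = basis_vec (k + l, commutator G g h)"
  by (simp add: gr_pre_def magma_mult_basis)

lemma gr_pre_csub_induct:
  assumes "csub (gr_pre G) V" "\<And>k g. 1 \<le> k \<Longrightarrow> g \<in> lower_central G k \<Longrightarrow> basis_vec (k, g) \<in> V"
    and "x \<in> carrier (gr_pre G)"
  shows "x \<in> V"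
  using magma_csub_induct[OF assms(1)[unfolded gr_pre_def]] assms(2,3) by (auto simp: gr_pre_def)

lemma gr_null_csub_induct:
  assumes "csub (gr_pre G) V"
    and "\<And>k g h. 1 \<le> k \<Longrightarrow> g \<in> lower_central G k \<Longrightarrow> h \<in> lower_central G k \<Longrightarrow>
      basis_vec (k, g \<otimes> h) \<ominus>\<^bsub>gr_pre G\<^esub> (basis_vec (k, g) \<oplus>\<^bsub>gr_pre G\<^esub> basis_vec (k, h)) \<in> V"
    and "\<And>k g. 1 \<le> k \<Longrightarrow> g \<in> lower_central G (Suc k) \<Longrightarrow> basis_vec (k, g) \<in> V"
    and "x \<in> gr_null G"
  shows "x \<in> V"
proof -
  have "gr_relations G \<subseteq> V" using assms(2,3) by (auto simp: gr_relations_def)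
  then show ?thesis
    using E.lin_span_minimal[OF assms(1)] assms(4) by (auto simp: gr_null_def)
qed

text \<open>The kernel of a linear map is a subspace, so the two families of defining relations
  decide whether the map passes to \<open>gr G\<close>.\<close>

lemma gr_lift_null:
  assumes K: "cspace K" and f: "clin (gr_pre G) K f"
    and add: "\<And>k g h. 1 \<le> k \<Longrightarrow> g \<in> lower_central G k \<Longrightarrow> h \<in> lower_central G k \<Longrightarrow>
      f (basis_vec (k, g \<otimes> h)) = f (basis_vec (k, g)) \<oplus>\<^bsub>K\<^esub> f (basis_vec (k, h))"
    and zero: "\<And>k g. 1 \<le> k \<Longrightarrow> g \<in> lower_central G (Suc k) \<Longrightarrow> f (basis_vec (k, g)) = \<zero>\<^bsub>K\<^esub>"
    and x: "x \<in> gr_null G"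
  shows "f x = \<zero>\<^bsub>K\<^esub>"
proof -
  interpret K: cspace K by (rule K)
  have "x \<in> {x \<in> carrier (gr_pre G). f x \<in> {\<zero>\<^bsub>K\<^esub>}}"
  proof (rule gr_null_csub_induct[OF csub_vimage[OF E.cspace_axioms K f K.csub_zero] _ _ x])
    fix k g h assume *: "1 \<le> k" "g \<in> lower_central G k" "h \<in> lower_central G k"
    note closed = gr_basis_closed[OF *(1,2)] gr_basis_closed[OF *(1,3)]
      gr_basis_closed[OF *(1) lower_central_mult[OF *(2,3)]]
    let ?x = "basis_vec (k, g \<otimes> h)" and ?y = "basis_vec (k, g) \<oplus>\<^bsub>gr_pre G\<^esub> basis_vec (k, h)"
    have y: "?y \<in> carrier (gr_pre G)" using closed by simp
    have "f (?x \<ominus>\<^bsub>gr_pre G\<^esub> ?y) = f ?x \<ominus>\<^bsub>K\<^esub> f ?y"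
      using closed by (intro clin_diff[OF E.cspace_axioms K f]) auto
    also have "f ?x = f ?y"
      unfolding add[OF *] clinD(2)[OF f closed(1,2)] ..
    also have "f ?y \<ominus>\<^bsub>K\<^esub> f ?y = \<zero>\<^bsub>K\<^esub>"
      using K.diff_eq_zero clinD(1)[OF f y] by blast
    finally show "?x \<ominus>\<^bsub>gr_pre G\<^esub> ?y \<in> {x \<in> carrier (gr_pre G). f x \<in> {\<zero>\<^bsub>K\<^esub>}}"
      using closed(3) y E.minus_closed by simp
  next
    fix k g assume *: "1 \<le> k" "g \<in> lower_central G (Suc k)"
    then have "g \<in> lower_central G k" using lower_central_Suc_subset by blast
    then show "basis_vec (k, g) \<in> {x \<in> carrier (gr_pre G). f x \<in> {\<zero>\<^bsub>K\<^esub>}}"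
      using * zero gr_basis_closed by simp
  qed
  then show ?thesis by simp
qed

text \<open>Linearity first reduces \<open>x\<close> to a basis vector and then \<open>y\<close> to
  a defining relation. There the claim is the additivity of the commutator in one argument modulo
  deeper terms. It makes the bracket on \<open>gr G\<close> well defined.\<close>

lemma gr_null_ideal:
  assumes x: "x \<in> carrier (gr_pre G)" and y: "y \<in> gr_null G"
  shows "x \<otimes>\<^bsub>gr_pre G\<^esub> y \<in> gr_null G" "y \<otimes>\<^bsub>gr_pre G\<^esub> x \<in> gr_null G"
proof -
  let ?q = "\<lambda>x. gr_null G +>\<^bsub>gr_pre G\<^esub> x"
  have yc: "y \<in> carrier (gr_pre G)" by (rule csubD(5)[OF csub_gr_null y])
  have "x \<in> {x \<in> carrier (gr_pre G). x \<otimes>\<^bsub>gr_pre G\<^esub> y \<in> gr_null G}"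
  proof (rule gr_pre_csub_induct[OF csub_vimage[OF E.cspace_axioms E.cspace_axioms
        E.clin_mult_right[OF yc] csub_gr_null] _ x])
    fix l h assume h: "1 \<le> l" "h \<in> lower_central G l"
    note b = gr_basis_closed[OF h]
    have "?q (basis_vec (l, h) \<otimes>\<^bsub>gr_pre G\<^esub> y) = \<zero>\<^bsub>gr G\<^esub>"
    proof (rule gr_lift_null[OF cspace_gr clin_comp[OF E.clin_mult_left[OF b] clin_gr_proj] _ _ y])
      show "?q (basis_vec (l, h) \<otimes>\<^bsub>gr_pre G\<^esub> basis_vec (k, g \<otimes> g')) =
          ?q (basis_vec (l, h) \<otimes>\<^bsub>gr_pre G\<^esub> basis_vec (k, g)) \<oplus>\<^bsub>gr G\<^esub>
          ?q (basis_vec (l, h) \<otimes>\<^bsub>gr_pre G\<^esub> basis_vec (k, g'))"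
        if "1 \<le> k" "g \<in> lower_central G k" "g' \<in> lower_central G k" for k g g'
        using that h gcls_commutator_mult_right[of k l g g' h]
        by (simp add: gr_pre_mult_basis gcls_def)
      show "?q (basis_vec (l, h) \<otimes>\<^bsub>gr_pre G\<^esub> basis_vec (k, g)) = \<zero>\<^bsub>gr G\<^esub>"
        if "1 \<le> k" "g \<in> lower_central G (Suc k)" for k g
        using that h gcls_zero[of "l + k" "commutator G h g"] commutator_lower_central[of l "Suc k" h g]
        by (simp add: gr_pre_mult_basis gcls_def)
    qed
    then show "basis_vec (l, h) \<in> {x \<in> carrier (gr_pre G). x \<otimes>\<^bsub>gr_pre G\<^esub> y \<in> gr_null G}"
      using b yc gr_proj_eq_zero by simp
  qed
  then show "x \<otimes>\<^bsub>gr_pre G\<^esub> y \<in> gr_null G" by simp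
  have "x \<in> {x \<in> carrier (gr_pre G). y \<otimes>\<^bsub>gr_pre G\<^esub> x \<in> gr_null G}"
  proof (rule gr_pre_csub_induct[OF csub_vimage[OF E.cspace_axioms E.cspace_axioms
        E.clin_mult_left[OF yc] csub_gr_null] _ x])
    fix l h assume h: "1 \<le> l" "h \<in> lower_central G l"
    note b = gr_basis_closed[OF h]
    have "?q (y \<otimes>\<^bsub>gr_pre G\<^esub> basis_vec (l, h)) = \<zero>\<^bsub>gr G\<^esub>"
    proof (rule gr_lift_null[OF cspace_gr clin_comp[OF E.clin_mult_right[OF b] clin_gr_proj] _ _ y])
      show "?q (basis_vec (k, g \<otimes> g') \<otimes>\<^bsub>gr_pre G\<^esub> basis_vec (l, h)) =
          ?q (basis_vec (k, g) \<otimes>\<^bsub>gr_pre G\<^esub> basis_vec (l, h)) \<oplus>\<^bsub>gr G\<^esub>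
          ?q (basis_vec (k, g') \<otimes>\<^bsub>gr_pre G\<^esub> basis_vec (l, h))"
        if "1 \<le> k" "g \<in> lower_central G k" "g' \<in> lower_central G k" for k g g'
        using that h gcls_commutator_mult_left[of k l g g' h]
        by (simp add: gr_pre_mult_basis gcls_def)
      show "?q (basis_vec (k, g) \<otimes>\<^bsub>gr_pre G\<^esub> basis_vec (l, h)) = \<zero>\<^bsub>gr G\<^esub>"
        if "1 \<le> k" "g \<in> lower_central G (Suc k)" for k g
        using that h gcls_zero[of "k + l" "commutator G g h"] commutator_lower_central[of "Suc k" l g h]
        by (simp add: gr_pre_mult_basis gcls_def)
    qed
    then show "basis_vec (l, h) \<in> {x \<in> carrier (gr_pre G). y \<otimes>\<^bsub>gr_pre G\<^esub> x \<in> gr_null G}"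
      using b yc gr_proj_eq_zero by simp
  qed
  then show "y \<otimes>\<^bsub>gr_pre G\<^esub> x \<in> gr_null G" by simp
qed

lemma calg_gr: "calg (gr G)"
  unfolding gr_def by (rule E.calg_quot[OF csub_gr_null gr_null_ideal])

lemma gcls_bracket:
  assumes "1 \<le> k" "1 \<le> l" "g \<in> lower_central G k" "h \<in> lower_central G l"
  shows "gcls G k g \<otimes>\<^bsub>gr G\<^esub> gcls G l h = gcls G (k + l) (commutator G g h)"
  using E.quot_mult[OF csub_gr_null gr_null_ideal, of "basis_vec (k, g)" "basis_vec (l, h)"] assms
  by (simp add: gr_basis_closed gcls_def gr_def gr_pre_mult_basis)

lemma gr_csub_induct:
  assumes V: "csub (gr G) V" and cls: "\<And>k g. 1 \<le> k \<Longrightarrow> g \<in> lower_central G k \<Longrightarrow> gcls G k g \<in> V"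
    and x: "x \<in> carrier (gr G)"
  shows "x \<in> V"
proof -
  obtain y where y: "y \<in> carrier (gr_pre G)" "x = gr_null G +>\<^bsub>gr_pre G\<^esub> y"
    using x E.quot_simps(1)[OF csub_gr_null] by (auto simp: gr_def)
  have "y \<in> {y \<in> carrier (gr_pre G). gr_null G +>\<^bsub>gr_pre G\<^esub> y \<in> V}"
    by (rule gr_pre_csub_induct[OF csub_vimage[OF E.cspace_axioms cspace_gr clin_gr_proj V] _ y(1)])
      (use cls gr_basis_closed in \<open>simp add: gcls_def\<close>)
  then show ?thesis using y by simp
qed

lemma gr_clin_eq:
  assumes "cspace K" "clin (gr G) K f" "clin (gr G) K f'"
    and "\<And>k g. 1 \<le> k \<Longrightarrow> g \<in> lower_central G k \<Longrightarrow> f (gcls G k g) = f' (gcls G k g)"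
    and "x \<in> carrier (gr G)"
  shows "f x = f' x"
proof -
  have "x \<in> {x \<in> carrier (gr G). f x = f' x}"
    by (rule gr_csub_induct[OF cspace.csub_equalizer[OF assms(1) cspace_gr assms(2,3)] _ assms(5)])
      (simp add: assms(4) gcls_closed)
  then show ?thesis by simp
qed

text \<open>Both identities are multilinear, so \<open>gr_clin_eq\<close> reduces one variable after
  the other to classes of group elements. Antisymmetry then says that inverting a commutator swaps
  its entries, and Jacobi is the Hall-Witt identity.\<close>

lemma clie_gr: "clie (gr G)"
proof -
  interpret L: calg "gr G" by (rule calg_gr)
  let ?L = "gr G"
  note [intro] = L.clin_mult_left L.clin_mult_right L.clin_add_fun L.clin_smult_fun
  have neg: "\<ominus>\<^bsub>?L\<^esub> x = (- 1) \<odot>\<^bsub>?L\<^esub> x" if "x \<in> carrier ?L" for x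
    using L.smult_minus_one[OF that] by simp
  have antisym: "x \<otimes>\<^bsub>?L\<^esub> y = (- 1) \<odot>\<^bsub>?L\<^esub> (y \<otimes>\<^bsub>?L\<^esub> x)"
    if x: "x \<in> carrier ?L" and y: "y \<in> carrier ?L" for x y
  proof (rule gr_clin_eq[OF cspace_gr _ _ _ x])
    fix k g assume g: "1 \<le> k" "g \<in> lower_central G k"
    note gc = gcls_closed[OF g]
    show "gcls G k g \<otimes>\<^bsub>?L\<^esub> y = (- 1) \<odot>\<^bsub>?L\<^esub> (y \<otimes>\<^bsub>?L\<^esub> gcls G k g)"
    proof (rule gr_clin_eq[OF cspace_gr _ _ _ y])
      fix l h assume h: "1 \<le> l" "h \<in> lower_central G l"
      show "gcls G k g \<otimes>\<^bsub>?L\<^esub> gcls G l h = (- 1) \<odot>\<^bsub>?L\<^esub> (gcls G l h \<otimes>\<^bsub>?L\<^esub> gcls G k g)"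
        using g h gcls_commutator_antisym[OF h(1) g(1) h(2) g(2)] gcls_closed
          gcls_closed[OF _ commutator_lower_central]
        by (simp add: gcls_bracket neg)
    qed (use gc in auto)
  qed (use y in auto)
  have jacobi: "x \<otimes>\<^bsub>?L\<^esub> (y \<otimes>\<^bsub>?L\<^esub> z) = (x \<otimes>\<^bsub>?L\<^esub> y) \<otimes>\<^bsub>?L\<^esub> z \<oplus>\<^bsub>?L\<^esub> y \<otimes>\<^bsub>?L\<^esub> (x \<otimes>\<^bsub>?L\<^esub> z)"
    if x: "x \<in> carrier ?L" and y: "y \<in> carrier ?L" and z: "z \<in> carrier ?L" for x y z
  proof (rule gr_clin_eq[OF cspace_gr _ _ _ x])
    show "clin ?L ?L (\<lambda>x. (x \<otimes>\<^bsub>?L\<^esub> y) \<otimes>\<^bsub>?L\<^esub> z \<oplus>\<^bsub>?L\<^esub> y \<otimes>\<^bsub>?L\<^esub> (x \<otimes>\<^bsub>?L\<^esub> z))"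
      by (intro L.clin_add_fun clin_comp[OF L.clin_mult_right[OF y] L.clin_mult_right[OF z]]
          clin_comp[OF L.clin_mult_right[OF z] L.clin_mult_left[OF y]])
    fix k a assume a: "1 \<le> k" "a \<in> lower_central G k"
    define A where "A = gcls G k a"
    have A: "A \<in> carrier ?L" unfolding A_def by (rule gcls_closed[OF a])
    have "A \<otimes>\<^bsub>?L\<^esub> (y \<otimes>\<^bsub>?L\<^esub> z) = (A \<otimes>\<^bsub>?L\<^esub> y) \<otimes>\<^bsub>?L\<^esub> z \<oplus>\<^bsub>?L\<^esub> y \<otimes>\<^bsub>?L\<^esub> (A \<otimes>\<^bsub>?L\<^esub> z)"
    proof (rule gr_clin_eq[OF cspace_gr _ _ _ y])
      show "clin ?L ?L (\<lambda>y. A \<otimes>\<^bsub>?L\<^esub> (y \<otimes>\<^bsub>?L\<^esub> z))"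
        by (rule clin_comp[OF L.clin_mult_right[OF z] L.clin_mult_left[OF A]])
      show "clin ?L ?L (\<lambda>y. (A \<otimes>\<^bsub>?L\<^esub> y) \<otimes>\<^bsub>?L\<^esub> z \<oplus>\<^bsub>?L\<^esub> y \<otimes>\<^bsub>?L\<^esub> (A \<otimes>\<^bsub>?L\<^esub> z))"
        using A z by (intro L.clin_add_fun clin_comp[OF L.clin_mult_left[OF A] L.clin_mult_right[OF z]]
          L.clin_mult_right) auto
      fix l b assume b: "1 \<le> l" "b \<in> lower_central G l"
      define B where "B = gcls G l b"
      have B: "B \<in> carrier ?L" unfolding B_def by (rule gcls_closed[OF b])
      have "A \<otimes>\<^bsub>?L\<^esub> (B \<otimes>\<^bsub>?L\<^esub> z) = (A \<otimes>\<^bsub>?L\<^esub> B) \<otimes>\<^bsub>?L\<^esub> z \<oplus>\<^bsub>?L\<^esub> B \<otimes>\<^bsub>?L\<^esub> (A \<otimes>\<^bsub>?L\<^esub> z)"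
      proof (rule gr_clin_eq[OF cspace_gr _ _ _ z])
        show "clin ?L ?L (\<lambda>z. A \<otimes>\<^bsub>?L\<^esub> (B \<otimes>\<^bsub>?L\<^esub> z))"
          by (rule clin_comp[OF L.clin_mult_left[OF B] L.clin_mult_left[OF A]])
        show "clin ?L ?L (\<lambda>z. (A \<otimes>\<^bsub>?L\<^esub> B) \<otimes>\<^bsub>?L\<^esub> z \<oplus>\<^bsub>?L\<^esub> B \<otimes>\<^bsub>?L\<^esub> (A \<otimes>\<^bsub>?L\<^esub> z))"
          using A B by (intro L.clin_add_fun clin_comp[OF L.clin_mult_left[OF A] L.clin_mult_left[OF B]]
            L.clin_mult_left) auto
        fix m c assume c: "1 \<le> m" "c \<in> lower_central G m"
        define C where "C = gcls G m c"
        have C: "C \<in> carrier ?L" unfolding C_def by (rule gcls_closed[OF c])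
        \<comment> \<open>By \<open>gcls_conj\<close> the third entry may be conjugated freely; the
          conjugated form is the one that occurs in the Hall-Witt identity.\<close>
        have bracket3: "(gcls G i p \<otimes>\<^bsub>?L\<^esub> gcls G j q) \<otimes>\<^bsub>?L\<^esub> gcls G n r =
            gcls G (i + j + n) (commutator G (commutator G p q) (q \<otimes> r \<otimes> inv q))"
          if "1 \<le> i" "p \<in> lower_central G i" "1 \<le> j" "q \<in> lower_central G j"
            "1 \<le> n" "r \<in> lower_central G n" for i j n p q r
          using that gcls_conj[OF that(5,6) lower_central_closed[OF that(4)]]
            gcls_bracket[of "i + j" n "commutator G p q" "q \<otimes> r \<otimes> inv q"]
            commutator_lower_central[OF that(1,3,2,4)] lower_central_conj lower_central_closed
          by (simp add: gcls_bracket)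
        have mem: "commutator G (commutator G p q) (q \<otimes> r \<otimes> inv q) \<in> lower_central G (i + j + n)"
          if "1 \<le> i" "p \<in> lower_central G i" "1 \<le> j" "q \<in> lower_central G j"
            "1 \<le> n" "r \<in> lower_central G n" for i j n p q r
          using that commutator_lower_central[of "i + j" n "commutator G p q" "q \<otimes> r \<otimes> inv q"]
            commutator_lower_central[OF that(1,3,2,4)] lower_central_conj lower_central_closed
          by simp
        have deg: "l + m + k = k + l + m" "m + k + l = k + l + m" by simp_all
        have "(A \<otimes>\<^bsub>?L\<^esub> B) \<otimes>\<^bsub>?L\<^esub> C \<oplus>\<^bsub>?L\<^esub> ((B \<otimes>\<^bsub>?L\<^esub> C) \<otimes>\<^bsub>?L\<^esub> A \<oplus>\<^bsub>?L\<^esub> (C \<otimes>\<^bsub>?L\<^esub> A) \<otimes>\<^bsub>?L\<^esub> B) =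
            gcls G (k + l + m) (commutator G (commutator G a b) (b \<otimes> c \<otimes> inv b) \<otimes>
              (commutator G (commutator G b c) (c \<otimes> a \<otimes> inv c) \<otimes>
               commutator G (commutator G c a) (a \<otimes> b \<otimes> inv a)))"
          unfolding A_def B_def C_def bracket3[OF a b c] bracket3[OF b c a] bracket3[OF c a b] deg
          using mem[OF a b c] mem[OF b c a] mem[OF c a b] a(1)
          by (simp add: gcls_mult deg lower_central_mult)
        also have "\<dots> = \<zero>\<^bsub>?L\<^esub>"
          using hall_witt[of a b c] a b c lower_central_closed gcls_one[of "k + l + m"] by simp
        finally have hw: "(A \<otimes>\<^bsub>?L\<^esub> B) \<otimes>\<^bsub>?L\<^esub> C \<oplus>\<^bsub>?L\<^esub>
            ((B \<otimes>\<^bsub>?L\<^esub> C) \<otimes>\<^bsub>?L\<^esub> A \<oplus>\<^bsub>?L\<^esub> (C \<otimes>\<^bsub>?L\<^esub> A) \<otimes>\<^bsub>?L\<^esub> B) = \<zero>\<^bsub>?L\<^esub>" .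
        have e1: "(B \<otimes>\<^bsub>?L\<^esub> C) \<otimes>\<^bsub>?L\<^esub> A = \<ominus>\<^bsub>?L\<^esub> (A \<otimes>\<^bsub>?L\<^esub> (B \<otimes>\<^bsub>?L\<^esub> C))"
          using antisym[of "B \<otimes>\<^bsub>?L\<^esub> C" A] A B C by (simp add: neg)
        have "(C \<otimes>\<^bsub>?L\<^esub> A) \<otimes>\<^bsub>?L\<^esub> B = (- 1) \<odot>\<^bsub>?L\<^esub> (B \<otimes>\<^bsub>?L\<^esub> (C \<otimes>\<^bsub>?L\<^esub> A))"
          using antisym[of "C \<otimes>\<^bsub>?L\<^esub> A" B] A B C by simp
        also have "\<dots> = B \<otimes>\<^bsub>?L\<^esub> (A \<otimes>\<^bsub>?L\<^esub> C)"
          using antisym[of C A] A B C by (simp add: L.mult_smult_right flip: L.smult_assoc)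
        finally have e2: "(C \<otimes>\<^bsub>?L\<^esub> A) \<otimes>\<^bsub>?L\<^esub> B = B \<otimes>\<^bsub>?L\<^esub> (A \<otimes>\<^bsub>?L\<^esub> C)" .
        define X Y Z where "X = (A \<otimes>\<^bsub>?L\<^esub> B) \<otimes>\<^bsub>?L\<^esub> C" and "Y = A \<otimes>\<^bsub>?L\<^esub> (B \<otimes>\<^bsub>?L\<^esub> C)"
          and "Z = B \<otimes>\<^bsub>?L\<^esub> (A \<otimes>\<^bsub>?L\<^esub> C)"
        have XYZ: "X \<in> carrier ?L" "Y \<in> carrier ?L" "Z \<in> carrier ?L"
          using A B C by (auto simp: X_def Y_def Z_def)
        have "X \<oplus>\<^bsub>?L\<^esub> (\<ominus>\<^bsub>?L\<^esub> Y \<oplus>\<^bsub>?L\<^esub> Z) = \<zero>\<^bsub>?L\<^esub>"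
          using hw unfolding e1 e2 X_def Y_def Z_def .
        then have "(X \<oplus>\<^bsub>?L\<^esub> Z) \<oplus>\<^bsub>?L\<^esub> \<ominus>\<^bsub>?L\<^esub> Y = \<zero>\<^bsub>?L\<^esub>"
          using XYZ by (simp add: L.a_ac)
        then have "Y = X \<oplus>\<^bsub>?L\<^esub> Z"
          using XYZ L.minus_equality[of "X \<oplus>\<^bsub>?L\<^esub> Z" "\<ominus>\<^bsub>?L\<^esub> Y"] by simp
        then show "A \<otimes>\<^bsub>?L\<^esub> (B \<otimes>\<^bsub>?L\<^esub> gcls G m c) =
            (A \<otimes>\<^bsub>?L\<^esub> B) \<otimes>\<^bsub>?L\<^esub> gcls G m c \<oplus>\<^bsub>?L\<^esub> B \<otimes>\<^bsub>?L\<^esub> (A \<otimes>\<^bsub>?L\<^esub> gcls G m c)"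
          by (simp add: X_def Y_def Z_def C_def)
      qed
      then show "A \<otimes>\<^bsub>?L\<^esub> (gcls G l b \<otimes>\<^bsub>?L\<^esub> z) =
          (A \<otimes>\<^bsub>?L\<^esub> gcls G l b) \<otimes>\<^bsub>?L\<^esub> z \<oplus>\<^bsub>?L\<^esub> gcls G l b \<otimes>\<^bsub>?L\<^esub> (A \<otimes>\<^bsub>?L\<^esub> z)"
        by (simp add: B_def)
    qed
    then show "gcls G k a \<otimes>\<^bsub>?L\<^esub> (y \<otimes>\<^bsub>?L\<^esub> z) =
        (gcls G k a \<otimes>\<^bsub>?L\<^esub> y) \<otimes>\<^bsub>?L\<^esub> z \<oplus>\<^bsub>?L\<^esub> y \<otimes>\<^bsub>?L\<^esub> (gcls G k a \<otimes>\<^bsub>?L\<^esub> z)"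
      by (simp add: A_def)
  qed (use y z in auto)
  show ?thesis
  proof unfold_locales
    show "x \<otimes>\<^bsub>?L\<^esub> y = \<ominus>\<^bsub>?L\<^esub> (y \<otimes>\<^bsub>?L\<^esub> x)" if "x \<in> carrier ?L" "y \<in> carrier ?L" for x y
      unfolding antisym[OF that] using that by (intro L.smult_minus_one) auto
  qed (rule jacobi)
qed

text \<open>The universal property of gr: additive maps in each degree that kill the next term
  assemble to a linear map, the one induced by linear extension on the pairs
  \<open>(k, g)\<close>.\<close>

lemma gr_lift:
  assumes K: "cspace K"
    and closed: "\<And>k g. 1 \<le> k \<Longrightarrow> g \<in> lower_central G k \<Longrightarrow> h k g \<in> carrier K"
    and add: "\<And>k g g'. 1 \<le> k \<Longrightarrow> g \<in> lower_central G k \<Longrightarrow> g' \<in> lower_central G k \<Longrightarrow>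
      h k (g \<otimes> g') = h k g \<oplus>\<^bsub>K\<^esub> h k g'"
    and zero: "\<And>k g. 1 \<le> k \<Longrightarrow> g \<in> lower_central G (Suc k) \<Longrightarrow> h k g = \<zero>\<^bsub>K\<^esub>"
  shows "\<exists>f. clin (gr G) K f \<and> (\<forall>k\<ge>1. \<forall>g\<in>lower_central G k. f (gcls G k g) = h k g)"
proof -
  interpret K: cspace K by (rule K)
  let ?f = "lin_ext K (\<lambda>(k, g). h k g)"
  have f: "clin (gr_pre G) K ?f"
    unfolding gr_pre_def by (rule K.clin_lin_ext) (use closed in auto)
  have basis: "?f (basis_vec (k, g)) = h k g" if "1 \<le> k" "g \<in> lower_central G k" for k g
    using K.lin_ext_basis[of "\<lambda>(k, g). h k g" "(k, g)"] closed that by simp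
  have null: "?f x = \<zero>\<^bsub>K\<^esub>" if x: "x \<in> gr_null G" for x
  proof (rule gr_lift_null[OF K f _ _ x])
    show "?f (basis_vec (k, g)) = \<zero>\<^bsub>K\<^esub>" if "1 \<le> k" "g \<in> lower_central G (Suc k)" for k g
      using that basis[of k g] zero lower_central_Suc_subset[of k] by auto
  qed (simp add: basis lower_central_mult add)
  have "clin (gr G) K (quot_lift ?f)"
    unfolding gr_def by (rule E.clin_quot_lift[OF csub_gr_null K f null])
  moreover have "quot_lift ?f (gcls G k g) = h k g" if "1 \<le> k" "g \<in> lower_central G k" for k g
    unfolding gcls_def
    using E.quot_lift_coset[OF csub_gr_null K f null gr_basis_closed[OF that]] basis[OF that] by simp
  ultimately show ?thesis by blast
qed

end

text \<open>The Lie algebra gr F is generated in degree one by the letters. The class in degree one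
  is additive in the group element, so \<open>V\<close> contains all of degree one and is stable
  under bracketing with it. Degree \<open>Suc k\<close> follows because that term is generated by
  commutators of term \<open>k\<close> with F, whose classes are brackets of classes.\<close>

lemma gr_free_group_generated:
  assumes V: "csub (gr (free_group S)) V"
    and gens: "\<And>s. s \<in> S \<Longrightarrow> gcls (free_group S) 1 (letter s) \<in> V"
    and ad: "\<And>s v. s \<in> S \<Longrightarrow> v \<in> V \<Longrightarrow>
      gcls (free_group S) 1 (letter s) \<otimes>\<^bsub>gr (free_group S)\<^esub> v \<in> V"
  shows "V = carrier (gr (free_group S))"
proof -
  let ?F = "free_group S" and ?L = "gr (free_group S)"
  interpret group ?F by (rule group_free_group)
  interpret L: clie ?L by (rule clie_gr)
  have V1: "gcls ?F 1 g \<in> V" if "g \<in> carrier ?F" for g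
    using that
  proof (induction rule: free_group_induct)
    case one
    then show ?case using gcls_one[of 1] csubD(2)[OF V] by simp
  next
    case (letter s v)
    then show ?case
      using gens gcls_mult[of 1 "letter s" v] letter_closed[OF letter(1)] csubD(3)[OF V] by simp
  next
    case (inverse s v)
    then show ?case
      using gens gcls_mult[of 1 "inv\<^bsub>?F\<^esub> letter s" v] gcls_inv[of 1 "letter s"]
        letter_closed[OF inverse(1)] csubD(3)[OF V] L.csub_minus[OF V] by simp
  qed
  have adV: "gcls ?F 1 g \<otimes>\<^bsub>?L\<^esub> v \<in> V" if "g \<in> carrier ?F" "v \<in> V" for g v
    using that(1)
  proof (induction rule: free_group_induct)
    case one
    then show ?case
      using gcls_one[of 1] csubD(2,5)[OF V] that(2) by (simp add: L.mult_zero_left)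
  next
    case (letter s g)
    then show ?case
      using ad that(2) gcls_mult[of 1 "letter s" g] letter_closed[OF letter(1)] csubD(3,5)[OF V]
        gcls_closed[of 1] by (simp add: L.mult_l_distr)
  next
    case (inverse s g)
    then show ?case
      using ad that(2) gcls_mult[of 1 "inv\<^bsub>?F\<^esub> letter s" g] gcls_inv[of 1 "letter s"]
        letter_closed[OF inverse(1)] csubD(3,5)[OF V] L.csub_minus[OF V] gcls_closed[of 1]
      by (simp add: L.mult_l_distr L.mult_minus_left)
  qed
  have "gcls ?F k g \<in> V" if "1 \<le> k" "g \<in> lower_central ?F k" for k g
    using that
  proof (induction k arbitrary: g rule: dec_induct)
    case base
    then show ?case using V1 by simp
  next
    case (step k)
    obtain j where j: "k = Suc j" using step.hyps by (cases k) auto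
    have sub: "g \<in> generate ?F {commutator ?F x y |x y. x \<in> lower_central ?F k \<and> y \<in> carrier ?F}"
      using step.prems by (simp add: j)
    define H where "H = {g \<in> lower_central ?F (Suc k). gcls ?F (Suc k) g \<in> V}"
    have "subgroup H ?F"
    proof (rule subgroupI)
      show "H \<noteq> {}"
        using lower_central_one gcls_one[of "Suc k"] csubD(2)[OF V]
        by (auto simp: H_def intro!: exI[of _ "\<one>\<^bsub>?F\<^esub>"])
    qed (auto simp: H_def gcls_mult gcls_inv lower_central_mult lower_central_inv csubD(3)[OF V]
        L.csub_minus[OF V] dest: lower_central_closed)
    moreover have "commutator ?F x y \<in> H" if "x \<in> lower_central ?F k" "y \<in> carrier ?F" for x y
    proof -
      have "gcls ?F (Suc k) (commutator ?F x y) = gcls ?F k x \<otimes>\<^bsub>?L\<^esub> gcls ?F 1 y"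
        using gcls_bracket[of k 1 x y] that step.hyps by simp
      also have "\<dots> = \<ominus>\<^bsub>?L\<^esub> (gcls ?F 1 y \<otimes>\<^bsub>?L\<^esub> gcls ?F k x)"
        using that step.hyps gcls_closed[of k x] gcls_closed[of 1 y] by (intro L.antisym) auto
      also have "\<dots> \<in> V"
        using adV[OF that(2) step.IH[OF that(1)]] by (rule L.csub_minus[OF V])
      finally show ?thesis
        using commutator_lower_central_Suc[OF step.hyps(1) that] by (simp add: H_def)
    qed
    ultimately have "generate ?F {commutator ?F x y |x y. x \<in> lower_central ?F k \<and> y \<in> carrier ?F} \<subseteq> H"
      by (intro generate_subgroup_incl) auto
    then show ?case using sub by (auto simp: H_def)
  qed
  then have "x \<in> V" if "x \<in> carrier ?L" for x
    by (rule gr_csub_induct[OF V _ that])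
  then show ?thesis
    using csubD(1)[OF V] by auto
qed

section \<open>Modules over free associative and enveloping algebras\<close>

lemma calg_free_assoc: "calg (free_assoc_algebra S)"
  unfolding free_assoc_algebra_def by (rule calg_magma) auto

lemma free_assoc_carrier: "carrier (free_assoc_algebra S) = {f. finite (supp f) \<and> supp f \<subseteq> lists S}"
  by (simp add: free_assoc_algebra_def magma_simps)

lemma free_assoc_simps:
  "\<zero>\<^bsub>free_assoc_algebra S\<^esub> = (\<lambda>_. 0)"
  "f \<oplus>\<^bsub>free_assoc_algebra S\<^esub> g = (\<lambda>c. f c + g c)"
  "z \<odot>\<^bsub>free_assoc_algebra S\<^esub> f = (\<lambda>c. z * f c)"
  "\<one>\<^bsub>free_assoc_algebra S\<^esub> = basis_vec []"
  by (simp_all add: free_assoc_algebra_def magma_simps)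

lemma free_assoc_mult_basis:
  "basis_vec v \<otimes>\<^bsub>free_assoc_algebra S\<^esub> basis_vec w = basis_vec (v @ w)"
  by (simp add: free_assoc_algebra_def magma_mult_basis)

lemma free_assoc_basis_closed: "w \<in> lists S \<Longrightarrow> basis_vec w \<in> carrier (free_assoc_algebra S)"
  unfolding free_assoc_algebra_def by (rule basis_vec_closed)

lemma free_assoc_csub_induct:
  assumes "csub (free_assoc_algebra S) V" "\<And>w. w \<in> lists S \<Longrightarrow> basis_vec w \<in> V"
    and "f \<in> carrier (free_assoc_algebra S)"
  shows "f \<in> V"
  using magma_csub_induct[OF assms(1)[unfolded free_assoc_algebra_def] assms(2)
      assms(3)[unfolded free_assoc_algebra_def]] .

lemma (in cspace) clin_free_assoc:
  "h \<in> lists S \<rightarrow> carrier M \<Longrightarrow> clin (free_assoc_algebra S) M (lin_ext M h)"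
  unfolding free_assoc_algebra_def by (rule clin_lin_ext)

lemma free_assoc_clin_eq:
  assumes "cspace M" "clin (free_assoc_algebra S) M f" "clin (free_assoc_algebra S) M g"
    and "\<And>w. w \<in> lists S \<Longrightarrow> f (basis_vec w) = g (basis_vec w)"
    and "x \<in> carrier (free_assoc_algebra S)"
  shows "f x = g x"
  using cspace.clin_eq_on_basis[OF assms(1) assms(2,3)[unfolded free_assoc_algebra_def] assms(4)
      assms(5)[unfolded free_assoc_algebra_def]] .

text \<open>A ring ideal absorbs scalar multiples of the unit, hence is also a subspace.\<close>

lemma free_assoc_ideal_csub:
  assumes "ideal I (free_assoc_algebra S)"
  shows "csub (free_assoc_algebra S) I"
proof -
  interpret A: ring "free_assoc_algebra S" by (rule ring_free_assoc_algebra)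
  interpret C: calg "free_assoc_algebra S" by (rule calg_free_assoc)
  interpret I: ideal I "free_assoc_algebra S" by (rule assms)
  show ?thesis
  proof (rule csubI)
    fix c f assume f: "f \<in> I"
    let ?A = "free_assoc_algebra S"
    have "(c \<odot>\<^bsub>?A\<^esub> \<one>\<^bsub>?A\<^esub>) \<otimes>\<^bsub>?A\<^esub> f \<in> I"
      using f by (intro I.I_l_closed) auto
    then show "c \<odot>\<^bsub>?A\<^esub> f \<in> I"
      using I.a_subset f C.mult_smult_left[of "\<one>\<^bsub>?A\<^esub>" f c] by auto
  qed (use I.a_subset in auto)
qed

lemma csub_free_assoc_ideal:
  assumes I: "csub (free_assoc_algebra S) I"
    and "\<And>a x. a \<in> I \<Longrightarrow> x \<in> carrier (free_assoc_algebra S) \<Longrightarrow> x \<otimes>\<^bsub>free_assoc_algebra S\<^esub> a \<in> I"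
    and "\<And>a x. a \<in> I \<Longrightarrow> x \<in> carrier (free_assoc_algebra S) \<Longrightarrow> a \<otimes>\<^bsub>free_assoc_algebra S\<^esub> x \<in> I"
  shows "ideal I (free_assoc_algebra S)"
proof -
  interpret C: calg "free_assoc_algebra S" by (rule calg_free_assoc)
  have "submodule I complex_ring (free_assoc_algebra S)"
    using I C.submodule_iff by simp
  then have "subgroup I (add_monoid (free_assoc_algebra S))"
    by (simp add: submodule_def)
  then show ?thesis
    using assms(2,3) by (intro idealI ring_free_assoc_algebra) auto
qed

text \<open>Arbitrary operators indexed by letters make a space a module over the free associative
  algebra; \<open>foldr\<close> lets the rightmost letter act first. Instances are the action on
  J/[J,J], iterated brackets on L, the rewriting action on T, and characters.\<close>

locale word_action = cspace M for M :: "(complex, 'm, 'x) module_scheme" (structure) +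
  fixes C :: "'c set" and \<rho> :: "'c \<Rightarrow> 'm \<Rightarrow> 'm"
  assumes clin_rho: "c \<in> C \<Longrightarrow> clin M M (\<rho> c)"
begin

definition wact :: "('c list \<Rightarrow> complex) \<Rightarrow> 'm \<Rightarrow> 'm" where
  "wact f v = lin_ext M (\<lambda>w. foldr \<rho> w v) f"

lemma clin_word: "w \<in> lists C \<Longrightarrow> clin M M (foldr \<rho> w)"
proof (induction w)
  case Nil
  then show ?case by (simp add: clin_def)
next
  case (Cons c w)
  then have "clin M M (\<lambda>v. \<rho> c (foldr \<rho> w v))"
    by (intro clin_comp[OF _ clin_rho]) auto
  then show ?case by (simp add: comp_def)
qed

lemma word_closed: "v \<in> carrier M \<Longrightarrow> (\<lambda>w. foldr \<rho> w v) \<in> lists C \<rightarrow> carrier M"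
  using clinD(1)[OF clin_word] by auto

lemma clin_wact: "v \<in> carrier M \<Longrightarrow> clin (free_assoc_algebra C) M (\<lambda>f. wact f v)"
  unfolding wact_def by (rule clin_free_assoc[OF word_closed])

lemma wact_closed [simp, intro]:
  "f \<in> carrier (free_assoc_algebra C) \<Longrightarrow> v \<in> carrier M \<Longrightarrow> wact f v \<in> carrier M"
  by (rule clinD(1)[OF clin_wact])

lemma wact_basis: "w \<in> lists C \<Longrightarrow> v \<in> carrier M \<Longrightarrow> wact (basis_vec w) v = foldr \<rho> w v"
  unfolding wact_def by (rule lin_ext_basis) (use word_closed in auto)

lemma clin_wact_right:
  assumes f: "f \<in> carrier (free_assoc_algebra C)"
  shows "clin M M (wact f)"
proof (rule clinI)
  note L = clin_wact
  have sub: "supp f \<subseteq> lists C" using f by (simp add: free_assoc_carrier)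
  show "wact f (c \<odot> v) = c \<odot> wact f v" if v: "v \<in> carrier M" for c v
    by (rule free_assoc_clin_eq[OF cspace_axioms _ _ _ f])
      (use v L[of "c \<odot> v"] clin_smult_fun[OF L[OF v]] clinD(3)[OF clin_word] in
        \<open>auto simp: wact_basis\<close>)
  show "wact f (v \<oplus> v') = wact f v \<oplus> wact f v'" if v: "v \<in> carrier M" "v' \<in> carrier M" for v v'
    by (rule free_assoc_clin_eq[OF cspace_axioms _ _ _ f])
      (use v L[of "v \<oplus> v'"] clin_add_fun[OF L[OF v(1)] L[OF v(2)]] clinD(2)[OF clin_word] in
        \<open>auto simp: wact_basis\<close>)
qed (use f in auto)

lemma wact_mult:
  assumes f: "f \<in> carrier (free_assoc_algebra C)" and g: "g \<in> carrier (free_assoc_algebra C)"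
    and v: "v \<in> carrier M"
  shows "wact (f \<otimes>\<^bsub>free_assoc_algebra C\<^esub> g) v = wact f (wact g v)"
proof -
  interpret A: calg "free_assoc_algebra C" by (rule calg_free_assoc)
  show ?thesis
  proof (rule free_assoc_clin_eq[OF cspace_axioms _ _ _ f])
    show "clin (free_assoc_algebra C) M (\<lambda>f. wact (f \<otimes>\<^bsub>free_assoc_algebra C\<^esub> g) v)"
      by (rule clin_comp[OF A.clin_mult_right[OF g] clin_wact[OF v]])
    show "clin (free_assoc_algebra C) M (\<lambda>f. wact f (wact g v))"
      using g v by (intro clin_wact) auto
    fix a assume a: "a \<in> lists C"
    note a' = free_assoc_basis_closed[OF a]
    show "wact (basis_vec a \<otimes>\<^bsub>free_assoc_algebra C\<^esub> g) v = wact (basis_vec a) (wact g v)"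
    proof (rule free_assoc_clin_eq[OF cspace_axioms _ _ _ g])
      show "clin (free_assoc_algebra C) M (\<lambda>g. wact (basis_vec a \<otimes>\<^bsub>free_assoc_algebra C\<^esub> g) v)"
        by (rule clin_comp[OF A.clin_mult_left[OF a'] clin_wact[OF v]])
      show "clin (free_assoc_algebra C) M (\<lambda>g. wact (basis_vec a) (wact g v))"
        by (rule clin_comp[OF clin_wact[OF v] clin_wact_right[OF a']])
      fix b assume b: "b \<in> lists C"
      have "foldr \<rho> b v \<in> carrier M" using clinD(1)[OF clin_word[OF b] v] .
      then show "wact (basis_vec a \<otimes>\<^bsub>free_assoc_algebra C\<^esub> basis_vec b) v =
          wact (basis_vec a) (wact (basis_vec b) v)"
        using a b v by (simp add: free_assoc_mult_basis wact_basis)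
    qed
  qed
qed

text \<open>Since the annihilator is a two-sided ideal, an ideal given by generators acts trivially
  as soon as its generators do.\<close>

lemma ideal_annihilator:
  "ideal {f \<in> carrier (free_assoc_algebra C). \<forall>v\<in>carrier M. wact f v = \<zero>} (free_assoc_algebra C)"
proof -
  interpret A: calg "free_assoc_algebra C" by (rule calg_free_assoc)
  show ?thesis
  proof (rule csub_free_assoc_ideal)
    show "csub (free_assoc_algebra C)
        {f \<in> carrier (free_assoc_algebra C). \<forall>v\<in>carrier M. wact f v = \<zero>}"
      by (rule csubI) (auto simp: clinD[OF clin_wact] clin_zero[OF A.cspace_axioms cspace_axioms clin_wact])
  qed (auto simp: wact_mult clin_zero[OF cspace_axioms cspace_axioms clin_wact_right])
qed

end

subsection \<open>Ideals of Lie algebras and the adjoint module\<close>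

context clie
begin

lemma lie_ideal_iff: "lie_ideal L I \<longleftrightarrow> csub L I \<and> (\<forall>x\<in>carrier L. \<forall>y\<in>I. x \<otimes> y \<in> I)"
  by (simp add: lie_ideal_def submodule_iff)

lemma lie_ideal_lie_ideal_gen: "X \<subseteq> carrier L \<Longrightarrow> lie_ideal L (lie_ideal_gen L X)"
  unfolding lie_ideal_gen_def lie_ideal_iff
  by (intro conjI csub_Inter) (use csub_carrier in auto)

lemma lie_ideal_gen_incl: "X \<subseteq> lie_ideal_gen L X"
  unfolding lie_ideal_gen_def by auto

lemma lie_ideal_gen_minimal: "lie_ideal L I \<Longrightarrow> X \<subseteq> I \<Longrightarrow> lie_ideal_gen L X \<subseteq> I"
  unfolding lie_ideal_gen_def by auto

end

text \<open>\<open>M0\<close> is J/[J,J] as a vector space only. The module structure is kept as an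
  action of the free algebra \<open>A\<close> on words over L/J until \<open>adjoint_smult\<close>
  passes to the quotient by \<open>Uid\<close>.\<close>

locale lie_ideal_pair = clie L for L :: "(complex, 'm, 'x) module_scheme" (structure) +
  fixes J :: "'m set"
  assumes J_ideal: "lie_ideal L J"
begin

abbreviation "D \<equiv> lie_derived L J"
abbreviation "g \<equiv> alg_quot L J"
abbreviation "LJ \<equiv> L\<lparr>carrier := J\<rparr>"
abbreviation "M0 \<equiv> alg_quot LJ D"
abbreviation "A \<equiv> free_assoc_algebra (carrier g)"
abbreviation "Uid \<equiv> Idl\<^bsub>A\<^esub> (uea_relations g)"
abbreviation "ad_coset X Y \<equiv> \<Union>x\<in>X. \<Union>y\<in>Y. D +> (x \<otimes> y)"

lemma csub_J: "csub L J"
  using J_ideal by (simp add: lie_ideal_iff)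

lemma J_closed: "y \<in> J \<Longrightarrow> y \<in> carrier L"
  by (rule csubD(5)[OF csub_J])

lemma J_left: "x \<in> carrier L \<Longrightarrow> y \<in> J \<Longrightarrow> x \<otimes> y \<in> J"
  using J_ideal by (simp add: lie_ideal_iff)

lemma J_right: "x \<in> carrier L \<Longrightarrow> y \<in> J \<Longrightarrow> y \<otimes> x \<in> J"
  using J_left antisym[of y x] csub_minus[OF csub_J] J_closed by simp

lemma D_gens: "x \<in> J \<Longrightarrow> y \<in> J \<Longrightarrow> x \<otimes> y \<in> D"
  unfolding lie_derived_def by (rule subsetD[OF lin_span_incl]) blast

lemma csub_D: "csub L D"
  unfolding lie_derived_def by (rule csub_lin_span) (auto intro: J_closed)

lemma D_minimal: "csub L V \<Longrightarrow> (\<And>x y. x \<in> J \<Longrightarrow> y \<in> J \<Longrightarrow> x \<otimes> y \<in> V) \<Longrightarrow> D \<subseteq> V"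
  unfolding lie_derived_def by (rule lin_span_minimal) auto

lemma D_subset_J: "D \<subseteq> J"
  by (rule D_minimal[OF csub_J]) (simp add: J_left J_closed)

text \<open>Bracketing with \<open>x\<close> is a derivation of L that maps J into itself, so it
  preserves the span of the brackets of J.\<close>

lemma D_left:
  assumes x: "x \<in> carrier L" and y: "y \<in> D"
  shows "x \<otimes> y \<in> D"
proof -
  have "D \<subseteq> {y \<in> carrier L. x \<otimes> y \<in> D}"
  proof (rule D_minimal[OF csub_vimage[OF cspace_axioms cspace_axioms clin_mult_left[OF x] csub_D]])
    fix u v assume uv: "u \<in> J" "v \<in> J"
    then have "(x \<otimes> u) \<otimes> v \<oplus> u \<otimes> (x \<otimes> v) \<in> D"
      using x by (intro csubD(3)[OF csub_D] D_gens J_left)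
    then show "u \<otimes> v \<in> {y \<in> carrier L. x \<otimes> y \<in> D}"
      using uv x jacobi[of x u v] J_closed by simp
  qed
  then show ?thesis using y by auto
qed

lemma cspace_LJ: "cspace LJ"
  by (rule csub_restrict[OF csub_J])

lemma csub_LJ_D: "csub LJ D"
  using csub_D D_subset_J by (auto simp: csub_def)

lemma coset_LJ: "D +>\<^bsub>LJ\<^esub> y = D +> y"
  by (simp add: a_r_coset_def')

lemma cspace_M0: "cspace M0"
  by (rule cspace.cspace_quot[OF cspace_LJ csub_LJ_D])

lemma M0_carrier: "carrier M0 = (\<lambda>y. D +> y) ` J"
  using cspace.quot_simps(1)[OF cspace_LJ csub_LJ_D] by (simp add: coset_LJ)

lemma M0_zero: "\<zero>\<^bsub>M0\<^esub> = D"
  by (rule cspace.quot_simps(2)[OF cspace_LJ csub_LJ_D])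

lemma clin_M0: "clin LJ M0 (\<lambda>y. D +> y)"
  using cspace.clin_quot[OF cspace_LJ csub_LJ_D] by (simp add: coset_LJ)

lemma calg_g: "calg g"
  by (rule calg_quot[OF csub_J J_left J_right])

lemma g_carrier: "carrier g = (\<lambda>x. J +> x) ` carrier L"
  by (rule quot_simps(1)[OF csub_J])

lemma g_bracket: "x \<in> carrier L \<Longrightarrow> y \<in> carrier L \<Longrightarrow> (J +> x) \<otimes>\<^bsub>g\<^esub> (J +> y) = J +> (x \<otimes> y)"
  by (rule quot_mult[OF csub_J J_left J_right])

lemma clin_g: "clin L g (\<lambda>x. J +> x)"
  by (rule clin_quot[OF csub_J])

text \<open>Independence of representatives: changing \<open>x\<close> by an element of J changes
  the bracket by an element of [J,J], since \<open>y\<close> is in J; changing \<open>y\<close>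
  within [J,J] is harmless because [J,J] is an ideal.\<close>

lemma ad_coset:
  assumes x: "x \<in> carrier L" and y: "y \<in> J"
  shows "ad_coset (J +> x) (D +> y) = D +> (x \<otimes> y)"
proof -
  note yc = J_closed[OF y]
  have "D +> (x' \<otimes> y') = D +> (x \<otimes> y)" if x': "x' \<in> J +> x" and y': "y' \<in> D +> y" for x' y'
  proof -
    note x' = coset_mem[OF csub_J x' x] and y' = coset_mem[OF csub_D y' yc]
    have "y' = (y' \<ominus> y) \<oplus> y" using y'(1) yc by (simp add: a_minus_def a_assoc l_neg)
    then have "y' \<in> J"
      using csubD(3)[OF csub_J subsetD[OF D_subset_J y'(2)] y] by simp
    then have "(x' \<ominus> x) \<otimes> y' \<oplus> x \<otimes> (y' \<ominus> y) \<in> D"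
      using x' y' x csubD(3)[OF csub_D] D_gens D_left by simp
    also have "(x' \<ominus> x) \<otimes> y' \<oplus> x \<otimes> (y' \<ominus> y) = x' \<otimes> y' \<ominus> x \<otimes> y"
      using x yc x'(1) y'(1) by (simp add: a_minus_def mult_l_distr mult_r_distr mult_minus_left mult_minus_right
          a_assoc r_neg1)
    finally show ?thesis using x'(1) y'(1) x yc coset_eq_iff[OF csub_D] by simp
  qed
  then have "ad_coset (J +> x) (D +> y) = (\<Union>x'\<in>J +> x. \<Union>y'\<in>D +> y. D +> (x \<otimes> y))"
    by (intro SUP_cong) auto
  then show ?thesis
    using coset_self[OF csub_J x] coset_self[OF csub_D yc] by auto
qed

sublocale W: word_action M0 "carrier g" ad_coset
proof -
  interpret M0: cspace M0 by (rule cspace_M0)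
  show "word_action M0 (carrier g) (\<lambda>X Y. ad_coset X Y)"
  proof (unfold_locales, rule clinI)
    fix X assume X: "X \<in> carrier g"
    obtain x where x: "x \<in> carrier L" "X = J +> x" using X by (auto simp: g_carrier)
    fix Y assume Y: "Y \<in> carrier M0"
    obtain y where y: "y \<in> J" "Y = D +> y" using Y by (auto simp: M0_carrier)
    have xy: "x \<otimes> y \<in> J" by (rule J_left[OF x(1) y(1)])
    show "ad_coset X Y \<in> carrier M0"
      unfolding x(2) y(2) ad_coset[OF x(1) y(1)] M0_carrier using xy by blast
    show "ad_coset X (c \<odot>\<^bsub>M0\<^esub> Y) = c \<odot>\<^bsub>M0\<^esub> ad_coset X Y" for c
    proof -
      have "c \<odot>\<^bsub>M0\<^esub> Y = D +> (c \<odot> y)" using clinD(3)[OF clin_M0, of y c] y by simp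
      moreover have "c \<odot>\<^bsub>M0\<^esub> (D +> (x \<otimes> y)) = D +> (c \<odot> (x \<otimes> y))"
        using clinD(3)[OF clin_M0, of "x \<otimes> y" c] xy by simp
      ultimately show ?thesis
        using x(2) y(2) ad_coset[OF x(1) y(1)] ad_coset[OF x(1) csubD(4)[OF csub_J y(1)], of c]
        by (simp add: mult_smult_right[OF x(1) J_closed[OF y(1)]])
    qed
    fix Z assume Z: "Z \<in> carrier M0"
    obtain z where z: "z \<in> J" "Z = D +> z" using Z by (auto simp: M0_carrier)
    have xz: "x \<otimes> z \<in> J" by (rule J_left[OF x(1) z(1)])
    have "Y \<oplus>\<^bsub>M0\<^esub> Z = D +> (y \<oplus> z)" using clinD(2)[OF clin_M0, of y z] y z by simp
    moreover have "(D +> (x \<otimes> y)) \<oplus>\<^bsub>M0\<^esub> (D +> (x \<otimes> z)) = D +> (x \<otimes> y \<oplus> x \<otimes> z)"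
      using clinD(2)[OF clin_M0, of "x \<otimes> y" "x \<otimes> z"] xy xz by simp
    ultimately show "ad_coset X (Y \<oplus>\<^bsub>M0\<^esub> Z) = ad_coset X Y \<oplus>\<^bsub>M0\<^esub> ad_coset X Z"
      using x(2) y(2) z(2) ad_coset[OF x(1) y(1)] ad_coset[OF x(1) z(1)]
        ad_coset[OF x(1) csubD(3)[OF csub_J y(1) z(1)]]
      by (simp add: mult_r_distr[OF J_closed[OF y(1)] J_closed[OF z(1)] x(1)])
  qed
qed

lemma letter_mem: "X \<in> carrier g \<Longrightarrow> basis_vec [X] \<in> carrier A"
  by (rule free_assoc_basis_closed) simp

lemma uea_relations_closed: "uea_relations g \<subseteq> carrier A"
proof -
  interpret G: calg g by (rule calg_g)
  interpret A: calg A by (rule calg_free_assoc)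
  show ?thesis
    by (auto simp: uea_relations_def Let_def intro!: letter_mem A.minus_closed A.a_closed A.mult_closed
        A.smult_closed)
qed

lemma ideal_Uid: "ideal Uid A"
  by (rule ring.genideal_ideal[OF ring_free_assoc_algebra uea_relations_closed])

lemma csub_Uid: "csub A Uid"
  by (rule free_assoc_ideal_csub[OF ideal_Uid])

lemma Uid_relations: "uea_relations g \<subseteq> Uid"
  by (rule ring.genideal_self[OF ring_free_assoc_algebra uea_relations_closed])

lemma Uid_minimal: "ideal I A \<Longrightarrow> uea_relations g \<subseteq> I \<Longrightarrow> Uid \<subseteq> I"
  by (rule ring.genideal_minimal[OF ring_free_assoc_algebra])

lemma Uid_add: "X \<in> carrier g \<Longrightarrow> Y \<in> carrier g \<Longrightarrow>
    basis_vec [X \<oplus>\<^bsub>g\<^esub> Y] \<ominus>\<^bsub>A\<^esub> (basis_vec [X] \<oplus>\<^bsub>A\<^esub> basis_vec [Y]) \<in> Uid"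
  by (rule subsetD[OF Uid_relations], unfold uea_relations_def Let_def) blast

lemma Uid_smult: "X \<in> carrier g \<Longrightarrow> basis_vec [c \<odot>\<^bsub>g\<^esub> X] \<ominus>\<^bsub>A\<^esub> (c \<odot>\<^bsub>A\<^esub> basis_vec [X]) \<in> Uid"
  by (rule subsetD[OF Uid_relations], unfold uea_relations_def Let_def) blast

lemma Uid_bracket: "X \<in> carrier g \<Longrightarrow> Y \<in> carrier g \<Longrightarrow>
    (basis_vec [X] \<otimes>\<^bsub>A\<^esub> basis_vec [Y] \<ominus>\<^bsub>A\<^esub> basis_vec [Y] \<otimes>\<^bsub>A\<^esub> basis_vec [X])
      \<ominus>\<^bsub>A\<^esub> basis_vec [X \<otimes>\<^bsub>g\<^esub> Y] \<in> Uid"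
  by (rule subsetD[OF Uid_relations], unfold uea_relations_def Let_def) blast

text \<open>The universal property of U(g) in the form used here: a representation of
  \<open>g\<close> kills the defining relations, hence the ideal they generate. It serves both for
  J/[J,J] and for one-dimensional representations.\<close>

lemma Uid_annihilates:
  assumes M: "word_action M (carrier g) \<rho>"
    and add: "\<And>X Y v. X \<in> carrier g \<Longrightarrow> Y \<in> carrier g \<Longrightarrow> v \<in> carrier M \<Longrightarrow>
      \<rho> (X \<oplus>\<^bsub>g\<^esub> Y) v = \<rho> X v \<oplus>\<^bsub>M\<^esub> \<rho> Y v"
    and smult: "\<And>c X v. X \<in> carrier g \<Longrightarrow> v \<in> carrier M \<Longrightarrow> \<rho> (c \<odot>\<^bsub>g\<^esub> X) v = c \<odot>\<^bsub>M\<^esub> \<rho> X v"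
    and bracket: "\<And>X Y v. X \<in> carrier g \<Longrightarrow> Y \<in> carrier g \<Longrightarrow> v \<in> carrier M \<Longrightarrow>
      \<rho> (X \<otimes>\<^bsub>g\<^esub> Y) v = \<rho> X (\<rho> Y v) \<ominus>\<^bsub>M\<^esub> \<rho> Y (\<rho> X v)"
    and f: "f \<in> Uid" and v: "v \<in> carrier M"
  shows "word_action.wact M \<rho> f v = \<zero>\<^bsub>M\<^esub>"
proof -
  interpret M: word_action M "carrier g" \<rho> by (rule M)
  interpret G: calg g by (rule calg_g)
  interpret A: calg A by (rule calg_free_assoc)
  have diff: "M.wact (p \<ominus>\<^bsub>A\<^esub> q) v = M.wact p v \<ominus>\<^bsub>M\<^esub> M.wact q v"
    if "p \<in> carrier A" "q \<in> carrier A" "v \<in> carrier M" for p q v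
    using that by (intro clin_diff[OF A.cspace_axioms M.cspace_axioms M.clin_wact])
  have letter: "M.wact (basis_vec [X]) v = \<rho> X v" if "X \<in> carrier g" "v \<in> carrier M" for X v
    using that by (simp add: M.wact_basis)
  have mem: "\<rho> X v \<in> carrier M" if "X \<in> carrier g" "v \<in> carrier M" for X v
    using clinD(1)[OF M.clin_rho] that by blast
  note simps = diff letter letter_mem mem M.diff_eq_zero
  have "uea_relations g \<subseteq> {f \<in> carrier A. \<forall>v\<in>carrier M. M.wact f v = \<zero>\<^bsub>M\<^esub>}"
  proof
    fix r assume r: "r \<in> uea_relations g"
    have "M.wact r v = \<zero>\<^bsub>M\<^esub>" if v: "v \<in> carrier M" for v
    proof -
      consider (add) X Y where "X \<in> carrier g" "Y \<in> carrier g"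
          "r = basis_vec [X \<oplus>\<^bsub>g\<^esub> Y] \<ominus>\<^bsub>A\<^esub> (basis_vec [X] \<oplus>\<^bsub>A\<^esub> basis_vec [Y])"
        | (smult) X c where "X \<in> carrier g" "r = basis_vec [c \<odot>\<^bsub>g\<^esub> X] \<ominus>\<^bsub>A\<^esub> (c \<odot>\<^bsub>A\<^esub> basis_vec [X])"
        | (bracket) X Y where "X \<in> carrier g" "Y \<in> carrier g"
          "r = (basis_vec [X] \<otimes>\<^bsub>A\<^esub> basis_vec [Y] \<ominus>\<^bsub>A\<^esub> basis_vec [Y] \<otimes>\<^bsub>A\<^esub> basis_vec [X])
            \<ominus>\<^bsub>A\<^esub> basis_vec [X \<otimes>\<^bsub>g\<^esub> Y]"
        using r unfolding uea_relations_def Let_def by blast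
      then show ?thesis
      proof cases
        case 1: add
        then show ?thesis using v by (simp add: simps add clinD(2)[OF M.clin_wact])
      next
        case 2: smult
        then show ?thesis using v by (simp add: simps smult clinD(3)[OF M.clin_wact])
      next
        case 3: bracket
        then show ?thesis using v by (simp add: simps bracket M.wact_mult)
      qed
    qed
    then show "r \<in> {f \<in> carrier A. \<forall>v\<in>carrier M. M.wact f v = \<zero>\<^bsub>M\<^esub>}"
      using r uea_relations_closed by auto
  qed
  then show ?thesis
    using Uid_minimal[OF M.ideal_annihilator] f v by auto
qed

lemma wact_Uid:
  assumes f: "f \<in> Uid" and v: "v \<in> carrier M0"
  shows "W.wact f v = \<zero>\<^bsub>M0\<^esub>"
proof (rule Uid_annihilates[OF W.word_action_axioms _ _ _ f v])
  fix X Y v assume X: "X \<in> carrier g" and v: "v \<in> carrier M0"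
  obtain a where a: "a \<in> carrier L" "X = J +> a" using X by (auto simp: g_carrier)
  obtain y where y: "y \<in> J" "v = D +> y" using v by (auto simp: M0_carrier)
  note yc = J_closed[OF y(1)] and ay = J_left[OF a(1) y(1)]
  define ac where "ac X Y = ad_coset X Y" for X Y
  note ac = ad_coset[folded ac_def]
  show "ad_coset (c \<odot>\<^bsub>g\<^esub> X) v = c \<odot>\<^bsub>M0\<^esub> ad_coset X v" for c
    unfolding a(2) y(2) ac_def[symmetric]
    using clinD(3)[OF clin_g a(1), of c, symmetric] clinD(3)[OF clin_M0, of "a \<otimes> y" c] a(1) y(1) yc ay
    by (simp add: ac mult_smult_left)
  assume "Y \<in> carrier g"
  then obtain b where b: "b \<in> carrier L" "Y = J +> b" by (auto simp: g_carrier)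
  note bv = J_left[OF b(1) y(1)]
  show "ad_coset (X \<oplus>\<^bsub>g\<^esub> Y) v = ad_coset X v \<oplus>\<^bsub>M0\<^esub> ad_coset Y v"
    unfolding a(2) b(2) y(2) ac_def[symmetric]
    using clinD(2)[OF clin_g a(1) b(1), symmetric] clinD(2)[OF clin_M0, of "a \<otimes> y" "b \<otimes> y"] a(1) b(1) y(1) yc ay bv
    by (simp add: ac mult_l_distr)
  have e: "(a \<otimes> b) \<otimes> y = a \<otimes> (b \<otimes> y) \<ominus> b \<otimes> (a \<otimes> y)"
    using a(1) b(1) yc jacobi[of a b y] by (simp add: a_minus_def a_assoc r_neg)
  have "(a \<otimes> (b \<otimes> y)) \<ominus>\<^bsub>LJ\<^esub> (b \<otimes> (a \<otimes> y)) = (a \<otimes> b) \<otimes> y"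
    unfolding e
    using cspace.smult_minus_one[OF cspace_LJ, of "b \<otimes> (a \<otimes> y)"] smult_minus_one[of "b \<otimes> (a \<otimes> y)"]
      J_left[OF b(1) ay] J_closed
    by (simp add: a_minus_def)
  then show "ad_coset (X \<otimes>\<^bsub>g\<^esub> Y) v = ad_coset X (ad_coset Y v) \<ominus>\<^bsub>M0\<^esub> ad_coset Y (ad_coset X v)"
    unfolding a(2) b(2) y(2) ac_def[symmetric]
    using clin_diff[OF cspace_LJ cspace_M0 clin_M0, of "a \<otimes> (b \<otimes> y)" "b \<otimes> (a \<otimes> y)"]
      J_left[OF a(1) bv] J_left[OF b(1) ay] a(1) b(1) y(1) ay bv
    by (simp add: ac g_bracket)
qed

lemma uea_carrier: "carrier (uea g) = (\<lambda>f. Uid +>\<^bsub>A\<^esub> f) ` carrier A"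
  by (auto simp: uea_def FactRing_def A_RCOSETS_def')

lemma adjoint_carrier: "carrier (adjoint_module L J) = carrier M0"
  by (simp add: adjoint_module_def Let_def)

lemma adjoint_finsum: "finsum (adjoint_module L J) f I = finsum M0 f I"
  by (simp add: adjoint_module_def Let_def finsum_def finprod_def)

text \<open>Replaces the \<open>the_elem\<close> in \<open>uea_action\<close> by evaluation at any
  representative of the coset.\<close>

lemma adjoint_smult:
  assumes f: "f \<in> carrier A" and v: "v \<in> carrier M0"
  shows "(Uid +>\<^bsub>A\<^esub> f) \<odot>\<^bsub>adjoint_module L J\<^esub> v = W.wact f v"
proof -
  interpret A: calg A by (rule calg_free_assoc)
  have "(Uid +>\<^bsub>A\<^esub> f) \<odot>\<^bsub>adjoint_module L J\<^esub> v = quot_lift (\<lambda>f. W.wact f v) (Uid +>\<^bsub>A\<^esub> f)"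
    by (simp add: adjoint_module_def Let_def uea_action_def quot_lift_def W.wact_def lin_ext_def)
  also have "\<dots> = W.wact f v"
    by (rule A.quot_lift_coset[OF csub_Uid cspace_M0 W.clin_wact[OF v] wact_Uid[OF _ v] f])
  finally show ?thesis .
qed

end

subsection \<open>The map to the enveloping algebra\<close>

context lie_ideal_pair
begin

abbreviation "U \<equiv> alg_quot A Uid"
abbreviation "cls f \<equiv> Uid +>\<^bsub>A\<^esub> f"

lemmas Uid_l = ideal.I_l_closed[OF ideal_Uid] and Uid_r = ideal.I_r_closed[OF ideal_Uid]

lemma calg_U: "calg U"
  by (rule calg.calg_quot[OF calg_free_assoc csub_Uid Uid_l Uid_r])

lemma clin_cls: "clin A U cls"
  by (rule cspace.clin_quot[OF calg.axioms(1)[OF calg_free_assoc] csub_Uid])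

lemma cls_mult: "f \<in> carrier A \<Longrightarrow> h \<in> carrier A \<Longrightarrow> cls (f \<otimes>\<^bsub>A\<^esub> h) = cls f \<otimes>\<^bsub>U\<^esub> cls h"
  by (rule calg.quot_mult[OF calg_free_assoc csub_Uid Uid_l Uid_r, symmetric])

lemma cls_eq: "f \<in> carrier A \<Longrightarrow> h \<in> carrier A \<Longrightarrow> cls f = cls h \<longleftrightarrow> f \<ominus>\<^bsub>A\<^esub> h \<in> Uid"
  by (rule cspace.coset_eq_iff[OF calg.axioms(1)[OF calg_free_assoc] csub_Uid])

lemma cls_zero: "f \<in> carrier A \<Longrightarrow> cls f = \<zero>\<^bsub>U\<^esub> \<longleftrightarrow> f \<in> Uid"
  using cspace.coset_eq_zero[OF calg.axioms(1)[OF calg_free_assoc] csub_Uid]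
    cspace.quot_simps(2)[OF calg.axioms(1)[OF calg_free_assoc] csub_Uid] by simp

text \<open>The canonical Lie algebra map from L through L/J to U(L/J).\<close>

definition \<iota> where "\<iota> z = cls (basis_vec [J +> z])"

lemma iota_letter: "z \<in> carrier L \<Longrightarrow> J +> z \<in> carrier g" "z \<in> carrier L \<Longrightarrow> basis_vec [J +> z] \<in> carrier A"
  using letter_mem[of "J +> z"] by (auto simp: g_carrier)

lemma clin_iota: "clin L U \<iota>"
proof (rule clinI)
  interpret A: calg A by (rule calg_free_assoc)
  note gm = iota_letter(1) and lm = iota_letter(2)
  show "\<iota> z \<in> carrier U" if "z \<in> carrier L" for z
    unfolding \<iota>_def by (rule clinD(1)[OF clin_cls lm[OF that]])
  show "\<iota> (y \<oplus> z) = \<iota> y \<oplus>\<^bsub>U\<^esub> \<iota> z" if y: "y \<in> carrier L" and z: "z \<in> carrier L" for y z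
    unfolding \<iota>_def clinD(2)[OF clin_cls lm[OF y] lm[OF z], symmetric]
    using lm[OF y] lm[OF z] lm[OF a_closed[OF y z]] Uid_add[OF gm[OF y] gm[OF z]] clinD(2)[OF clin_g y z]
    by (subst cls_eq) simp_all
  show "\<iota> (c \<odot> z) = c \<odot>\<^bsub>U\<^esub> \<iota> z" if z: "z \<in> carrier L" for c z
    unfolding \<iota>_def clinD(3)[OF clin_cls lm[OF z], symmetric]
    using lm[OF z] lm[OF smult_closed[OF z], of c] Uid_smult[OF gm[OF z], of c] clinD(3)[OF clin_g z, of c]
    by (subst cls_eq) simp_all
qed

lemma iota_bracket:
  assumes y: "y \<in> carrier L" and z: "z \<in> carrier L"
  shows "\<iota> (y \<otimes> z) = \<iota> y \<otimes>\<^bsub>U\<^esub> \<iota> z \<ominus>\<^bsub>U\<^esub> \<iota> z \<otimes>\<^bsub>U\<^esub> \<iota> y"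
proof -
  interpret A: calg A by (rule calg_free_assoc)
  interpret U: calg U by (rule calg_U)
  note lm = iota_letter(2)[OF y] iota_letter(2)[OF z]
  have "\<iota> y \<otimes>\<^bsub>U\<^esub> \<iota> z \<ominus>\<^bsub>U\<^esub> \<iota> z \<otimes>\<^bsub>U\<^esub> \<iota> y =
      cls (basis_vec [J +> y] \<otimes>\<^bsub>A\<^esub> basis_vec [J +> z] \<ominus>\<^bsub>A\<^esub> basis_vec [J +> z] \<otimes>\<^bsub>A\<^esub> basis_vec [J +> y])"
    unfolding \<iota>_def using lm by (simp add: clin_diff[OF A.cspace_axioms U.cspace_axioms clin_cls] cls_mult)
  also have "\<dots> = \<iota> (y \<otimes> z)"
    unfolding \<iota>_def using lm iota_letter[OF mult_closed[OF y z]]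
      Uid_bracket[OF iota_letter(1)[OF y] iota_letter(1)[OF z]]
    by (subst cls_eq) (simp_all add: g_bracket[OF y z])
  finally show ?thesis ..
qed

end

subsection \<open>Freeness of the adjoint module\<close>

text \<open>Two algebras act: T acts on all of L by iterated brackets with the elements
  \<open>x s\<close>, while U(L/J) acts only on J/[J,J]. The map \<open>push\<close> from T to
  \<open>A\<close> compares them.\<close>

locale lie_gens = lie_ideal_pair L J for L :: "(complex, 'm, 'x) module_scheme" (structure) and J +
  fixes S :: "'s set" and x :: "'s \<Rightarrow> 'm"
  assumes x_closed: "s \<in> S \<Longrightarrow> x s \<in> carrier L"
begin

abbreviation "T \<equiv> free_assoc_algebra S"

sublocale ad: word_action L S "\<lambda>s v. x s \<otimes> v"
  by unfold_locales (rule clin_mult_left[OF x_closed])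

definition push :: "('s list \<Rightarrow> complex) \<Rightarrow> 'm set list \<Rightarrow> complex" where
  "push = lin_ext A (\<lambda>w. basis_vec (map (\<lambda>s. J +> x s) w))"

lemma push_word_closed: "w \<in> lists S \<Longrightarrow> basis_vec (map (\<lambda>s. J +> x s) w) \<in> carrier A"
  by (rule free_assoc_basis_closed) (auto simp: g_carrier x_closed)

lemma clin_push: "clin T A push"
proof -
  interpret A: calg A by (rule calg_free_assoc)
  show ?thesis
    unfolding push_def by (rule A.clin_free_assoc) (use push_word_closed in auto)
qed

lemma push_closed: "t \<in> carrier T \<Longrightarrow> push t \<in> carrier A"
  by (rule clinD(1)[OF clin_push])

lemma push_basis: "w \<in> lists S \<Longrightarrow> push (basis_vec w) = basis_vec (map (\<lambda>s. J +> x s) w)"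
proof -
  interpret A: calg A by (rule calg_free_assoc)
  show "w \<in> lists S \<Longrightarrow> ?thesis"
    unfolding push_def
    by (rule A.lin_ext_basis[where h = "\<lambda>w. basis_vec (map (\<lambda>s. J +> x s) w)"])
      (rule push_word_closed)
qed

lemma push_mult:
  assumes f: "f \<in> carrier T" and h: "h \<in> carrier T"
  shows "push (f \<otimes>\<^bsub>T\<^esub> h) = push f \<otimes>\<^bsub>A\<^esub> push h"
proof -
  interpret A: calg A by (rule calg_free_assoc)
  interpret T: calg T by (rule calg_free_assoc)
  show ?thesis
  proof (rule free_assoc_clin_eq[OF A.cspace_axioms _ _ _ f])
    show "clin T A (\<lambda>f. push (f \<otimes>\<^bsub>T\<^esub> h))"
      by (rule clin_comp[OF T.clin_mult_right[OF h] clin_push])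
    show "clin T A (\<lambda>f. push f \<otimes>\<^bsub>A\<^esub> push h)"
      by (rule clin_comp[OF clin_push A.clin_mult_right[OF push_closed[OF h]]])
    fix v assume v: "v \<in> lists S"
    note vc = free_assoc_basis_closed[OF v]
    show "push (basis_vec v \<otimes>\<^bsub>T\<^esub> h) = push (basis_vec v) \<otimes>\<^bsub>A\<^esub> push h"
    proof (rule free_assoc_clin_eq[OF A.cspace_axioms _ _ _ h])
      show "clin T A (\<lambda>h. push (basis_vec v \<otimes>\<^bsub>T\<^esub> h))"
        by (rule clin_comp[OF T.clin_mult_left[OF vc] clin_push])
      show "clin T A (\<lambda>h. push (basis_vec v) \<otimes>\<^bsub>A\<^esub> push h)"
        by (rule clin_comp[OF clin_push A.clin_mult_left[OF push_closed[OF vc]]])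
      show "push (basis_vec v \<otimes>\<^bsub>T\<^esub> basis_vec w) = push (basis_vec v) \<otimes>\<^bsub>A\<^esub> push (basis_vec w)"
        if "w \<in> lists S" for w
        using v that by (simp add: free_assoc_mult_basis push_basis)
    qed
  qed
qed

lemma word_J: "w \<in> lists S \<Longrightarrow> y \<in> J \<Longrightarrow> foldr (\<lambda>s v. x s \<otimes> v) w y \<in> J"
  by (induction w) (auto simp: J_left x_closed)

lemma wact_J:
  assumes "t \<in> carrier T" "y \<in> J"
  shows "ad.wact t y \<in> J"
proof -
  interpret T: calg T by (rule calg_free_assoc)
  note yc = J_closed[OF assms(2)]
  have "t \<in> {t \<in> carrier T. ad.wact t y \<in> J}"
    by (rule free_assoc_csub_induct[OF csub_vimage[OF T.cspace_axioms cspace_axioms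
          ad.clin_wact[OF yc] csub_J] _ assms(1)])
      (simp add: free_assoc_basis_closed ad.wact_basis yc word_J assms(2))
  then show ?thesis by simp
qed

text \<open>Thus a combination in the adjoint module can be computed in L modulo [J,J], with
  coefficients in T.\<close>

lemma wact_push:
  assumes t: "t \<in> carrier T" and y: "y \<in> J"
  shows "W.wact (push t) (D +> y) = D +> ad.wact t y"
proof (rule free_assoc_clin_eq[OF cspace_M0 _ _ _ t])
  have v: "D +> y \<in> carrier M0" using y by (auto simp: M0_carrier)
  note yc = J_closed[OF y]
  show "clin T M0 (\<lambda>t. W.wact (push t) (D +> y))"
    by (rule clin_comp[OF clin_push W.clin_wact[OF v]])
  have "clin T LJ (\<lambda>t. ad.wact t y)"
    by (rule clinI) (simp_all add: wact_J y clinD[OF ad.clin_wact[OF yc]])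
  then show "clin T M0 (\<lambda>t. D +> ad.wact t y)"
    by (rule clin_comp[OF _ clin_M0])
  fix w assume w: "w \<in> lists S"
  have "foldr ad_coset (map (\<lambda>s. J +> x s) w) (D +> y) = D +> foldr (\<lambda>s v. x s \<otimes> v) w y"
    using w by (induction w) (simp_all add: ad_coset x_closed word_J y)
  moreover have "map (\<lambda>s. J +> x s) w \<in> lists (carrier g)"
    using w by (auto simp: g_carrier x_closed)
  ultimately show "W.wact (push (basis_vec w)) (D +> y) = D +> ad.wact (basis_vec w) y"
    using w v yc by (simp add: push_basis W.wact_basis ad.wact_basis)
qed

context
  fixes cs :: "'m list"
  assumes cs: "set cs \<subseteq> J"
begin

abbreviation "comb t \<equiv> finsum L (\<lambda>i. ad.wact (t i) (cs ! i)) {..<length cs}"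

lemma cs_nth: "i < length cs \<Longrightarrow> cs ! i \<in> J"
  using cs nth_mem by blast

lemma comb_J: "t \<in> {..<length cs} \<rightarrow> carrier T \<Longrightarrow> comb t \<in> J"
  by (rule csub_finsum[OF csub_J]) (auto intro: wact_J cs_nth)

lemma module_comb:
  assumes t: "t \<in> {..<length cs} \<rightarrow> carrier T"
    and u: "\<And>i. i < length cs \<Longrightarrow> u i = Uid +>\<^bsub>A\<^esub> push (t i)"
  shows "finsum (adjoint_module L J) (\<lambda>i. u i \<odot>\<^bsub>adjoint_module L J\<^esub> map (\<lambda>c. D +> c) cs ! i)
    {..<length cs} = D +> comb t"
proof -
  have wJ: "(\<lambda>i. ad.wact (t i) (cs ! i)) \<in> {..<length cs} \<rightarrow> J"
    using t cs_nth wact_J by auto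
  have "D +> comb t = D +> finsum LJ (\<lambda>i. ad.wact (t i) (cs ! i)) {..<length cs}"
    by (simp add: finsum_restrict[OF csub_J wJ])
  also have "\<dots> = finsum M0 (\<lambda>i. D +> ad.wact (t i) (cs ! i)) {..<length cs}"
    using wJ by (intro clin_finsum[OF cspace_LJ cspace_M0 clin_M0]) auto
  also have "\<dots> = finsum M0 (\<lambda>i. u i \<odot>\<^bsub>adjoint_module L J\<^esub> map (\<lambda>c. D +> c) cs ! i) {..<length cs}"
  proof (rule W.finsum_cong'[OF refl])
    fix i assume i: "i \<in> {..<length cs}"
    have ti: "t i \<in> carrier T" using t i by auto
    have ci: "cs ! i \<in> J" using cs_nth i by simp
    then have v: "D +> cs ! i \<in> carrier M0" by (auto simp: M0_carrier)
    have e: "u i \<odot>\<^bsub>adjoint_module L J\<^esub> map (\<lambda>c. D +> c) cs ! i = D +> ad.wact (t i) (cs ! i)"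
      using i u adjoint_smult[OF push_closed[OF ti] v] wact_push[OF ti ci] by simp
    then show "D +> ad.wact (t i) (cs ! i) = u i \<odot>\<^bsub>adjoint_module L J\<^esub> map (\<lambda>c. D +> c) cs ! i" ..
  next
    show "(\<lambda>i. u i \<odot>\<^bsub>adjoint_module L J\<^esub> map (\<lambda>c. D +> c) cs ! i) \<in> {..<length cs} \<rightarrow> carrier M0"
    proof
      fix i assume i: "i \<in> {..<length cs}"
      have ti: "t i \<in> carrier T" using t i by auto
      have ci: "cs ! i \<in> J" using cs_nth i by simp
      then have v: "D +> cs ! i \<in> carrier M0" by (auto simp: M0_carrier)
      have "u i \<odot>\<^bsub>adjoint_module L J\<^esub> map (\<lambda>c. D +> c) cs ! i = D +> ad.wact (t i) (cs ! i)"
        using i u adjoint_smult[OF push_closed[OF ti] v] wact_push[OF ti ci] by simp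
      then show "u i \<odot>\<^bsub>adjoint_module L J\<^esub> map (\<lambda>c. D +> c) cs ! i \<in> carrier M0"
        using wact_J[OF ti ci] by (auto simp: M0_carrier)
    qed
  qed
  finally show ?thesis by (simp add: adjoint_finsum)
qed

text \<open>The coefficients \<open>t\<close> and the zero coefficients both represent the zero
  class, so uniqueness of coordinates makes each \<open>t i\<close> vanish in U(L/J).\<close>

lemma free_module_imp:
  assumes free: "free_module_on (uea g) (adjoint_module L J) (map (\<lambda>c. D +> c) cs)"
    and t: "t \<in> {..<length cs} \<rightarrow> carrier T" and comb: "comb t \<in> D" and i: "i < length cs"
  shows "push (t i) \<in> Uid"
proof -
  interpret A: calg A by (rule calg_free_assoc)
  interpret T: calg T by (rule calg_free_assoc)
  let ?bs = "map (\<lambda>c. D +> c) cs"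
  define u where "u = (\<lambda>i\<in>{..<length cs}. Uid +>\<^bsub>A\<^esub> push (t i))"
  \<comment> \<open>The zero coordinates, restricted to the index range because
    \<open>free_module_on\<close> speaks of extensional functions.\<close>
  define u0 where "u0 = (\<lambda>i\<in>{..<length cs}. Uid +>\<^bsub>A\<^esub> push \<zero>\<^bsub>T\<^esub>)"
  have 1: "u \<in> {..<length ?bs} \<rightarrow>\<^sub>E carrier (uea g)"
    using t push_closed by (auto simp: u_def uea_carrier)
  have 2: "u0 \<in> {..<length ?bs} \<rightarrow>\<^sub>E carrier (uea g)"
    using push_closed[OF T.zero_closed] by (auto simp: u0_def uea_carrier)
  have s1: "D = finsum (adjoint_module L J) (\<lambda>i. u i \<odot>\<^bsub>adjoint_module L J\<^esub> ?bs ! i) {..<length ?bs}"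
    using module_comb[OF t, of u] coset_eq_zero[OF csub_D csubD(5)[OF csub_D comb]] comb
    by (simp add: u_def)
  have z: "ad.wact \<zero>\<^bsub>T\<^esub> y = \<zero>" if "y \<in> carrier L" for y
    by (rule clin_zero[OF T.cspace_axioms cspace_axioms ad.clin_wact[OF that]])
  have "comb (\<lambda>_. \<zero>\<^bsub>T\<^esub>) = finsum L (\<lambda>i. \<zero>) {..<length cs}"
    by (rule finsum_cong') (use z J_closed[OF cs_nth] in auto)
  then have "comb (\<lambda>_. \<zero>\<^bsub>T\<^esub>) = \<zero>" by simp
  then have s2: "D = finsum (adjoint_module L J) (\<lambda>i. u0 i \<odot>\<^bsub>adjoint_module L J\<^esub> ?bs ! i) {..<length ?bs}"
    using module_comb[of "\<lambda>_. \<zero>\<^bsub>T\<^esub>" u0] coset_eq_zero[OF csub_D zero_closed] csubD(2)[OF csub_D]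
    by (simp add: u0_def)
  have DM: "D \<in> carrier (adjoint_module L J)"
    using W.zero_closed by (simp add: adjoint_carrier M0_zero)
  let ?P = "\<lambda>u. u \<in> {..<length ?bs} \<rightarrow>\<^sub>E carrier (uea g) \<and>
      D = finsum (adjoint_module L J) (\<lambda>i. u i \<odot>\<^bsub>adjoint_module L J\<^esub> ?bs ! i) {..<length ?bs}"
  have ex1: "\<exists>!u. ?P u"
    using bspec[OF conjunct2[OF free[unfolded free_module_on_def]] DM] .
  have P1: "?P u" by (intro conjI 1 s1)
  have P2: "?P u0" by (intro conjI 2 s2)
  from ex1 obtain z where z: "\<And>v. ?P v \<Longrightarrow> v = z" by (elim ex1E) (rule that, drule spec, erule mp)
  have "u = u0" using z[of u, OF P1] z[of u0, OF P2] by simp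
  then have "u i = u0 i" by simp
  then have "Uid +>\<^bsub>A\<^esub> push (t i) = Uid +>\<^bsub>A\<^esub> push \<zero>\<^bsub>T\<^esub>"
    using i by (simp add: u_def u0_def)
  also have "push \<zero>\<^bsub>T\<^esub> = \<zero>\<^bsub>A\<^esub>"
    by (rule clin_zero[OF T.cspace_axioms A.cspace_axioms clin_push])
  also have "Uid +>\<^bsub>A\<^esub> \<zero>\<^bsub>A\<^esub> = Uid"
    using A.coset_eq_zero[OF csub_Uid A.zero_closed] csubD(2)[OF csub_Uid] by simp
  finally show ?thesis
    using A.coset_eq_zero[OF csub_Uid push_closed] t i by auto
qed

end

end

text \<open>Generation is phrased for subspaces stable under the operators [x s, -]; for free groups
  this is \<open>gr_free_group_generated\<close>.\<close>

locale lie_generated = lie_gens L J S x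
  for L :: "(complex, 'm, 'x) module_scheme" (structure) and J and S :: "'s set" and x +
  assumes generated: "csub L V \<Longrightarrow> (\<And>s. s \<in> S \<Longrightarrow> x s \<in> V) \<Longrightarrow>
      (\<And>s v. s \<in> S \<Longrightarrow> v \<in> V \<Longrightarrow> x s \<otimes> v \<in> V) \<Longrightarrow> V = carrier L"
begin

text \<open>The elements \<open>z\<close> with [z, V] contained in \<open>V\<close> form a subspace,
  and by the Jacobi identity it is stable under bracketing with the generators.\<close>

lemma lie_ideal_of_generators:
  assumes V: "csub L V" and ad: "\<And>s v. s \<in> S \<Longrightarrow> v \<in> V \<Longrightarrow> x s \<otimes> v \<in> V"
  shows "lie_ideal L V"
proof -
  let ?Z = "{z \<in> carrier L. \<forall>y\<in>V. z \<otimes> y \<in> V}"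
  have Vc: "y \<in> carrier L" if "y \<in> V" for y using csubD(5)[OF V that] .
  have "?Z = carrier L"
  proof (rule generated)
    show "csub L ?Z"
      by (rule csubI)
        (use csubD[OF V] Vc in \<open>auto simp: mult_zero_left mult_l_distr mult_smult_left\<close>)
    show "x s \<otimes> z \<in> ?Z" if s: "s \<in> S" and z: "z \<in> ?Z" for s z
    proof -
      have "(x s \<otimes> z) \<otimes> y \<in> V" if y: "y \<in> V" for y
      proof -
        have c: "x s \<in> carrier L" "z \<in> carrier L" "y \<in> carrier L"
          using x_closed s z Vc y by auto
        have "(x s \<otimes> z) \<otimes> y = x s \<otimes> (z \<otimes> y) \<ominus> z \<otimes> (x s \<otimes> y)"
          using jacobi[OF c] c by (simp add: a_minus_def a_assoc r_neg)
        then show ?thesis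
          using csub_diff[OF V] ad[OF s] y z by simp
      qed
      then show ?thesis using s z x_closed by simp
    qed
  qed (use x_closed ad in auto)
  then show ?thesis using V by (auto simp: lie_ideal_iff)
qed

text \<open>The image \<open>W\<close> of T in U(L/J) is a subalgebra. The elements of L whose image
  under \<open>\<iota>\<close> lies in \<open>W\<close> form a subspace that contains the generators
  and is stable under bracketing with them, so all letters of \<open>A\<close>, and hence all words,
  land in \<open>W\<close>.\<close>

lemma uea_generated:
  assumes f: "f \<in> carrier A"
  shows "\<exists>t\<in>carrier T. f \<ominus>\<^bsub>A\<^esub> push t \<in> Uid"
proof -
  interpret A: calg A by (rule calg_free_assoc)
  interpret T: calg T by (rule calg_free_assoc)
  interpret U: calg U by (rule calg_U)
  note p = clin_comp[OF clin_push clin_cls]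
  define W where "W = (\<lambda>t. cls (push t)) ` carrier T"
  have mem: "cls (push t) \<in> W" if "t \<in> carrier T" for t using that by (auto simp: W_def)
  have W: "csub U W"
    unfolding W_def by (rule csub_image[OF T.cspace_axioms U.cspace_axioms p T.csub_carrier])
  have mult: "f \<otimes>\<^bsub>U\<^esub> h \<in> W" if f: "f \<in> W" and h: "h \<in> W" for f h
  proof -
    obtain t t' where t: "t \<in> carrier T" "t' \<in> carrier T" "f = cls (push t)" "h = cls (push t')"
      using f h by (auto simp: W_def)
    then show ?thesis
      using mem[of "t \<otimes>\<^bsub>T\<^esub> t'"] by (simp add: push_mult cls_mult push_closed)
  qed
  have "{z \<in> carrier L. \<iota> z \<in> W} = carrier L"
  proof (rule generated)
    show "csub L {z \<in> carrier L. \<iota> z \<in> W}"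
      by (rule csub_vimage[OF cspace_axioms U.cspace_axioms clin_iota W])
    have xW: "\<iota> (x s) \<in> W" if "s \<in> S" for s
      using mem[OF free_assoc_basis_closed[of "[s]"]] push_basis[of "[s]"] that by (simp add: \<iota>_def)
    then show "x s \<in> {z \<in> carrier L. \<iota> z \<in> W}" if "s \<in> S" for s using that x_closed by simp
    show "x s \<otimes> z \<in> {z \<in> carrier L. \<iota> z \<in> W}" if "s \<in> S" "z \<in> {z \<in> carrier L. \<iota> z \<in> W}" for s z
      using that xW x_closed mult by (auto simp: iota_bracket intro!: U.csub_diff[OF W])
  qed
  then have iW: "\<iota> z \<in> W" if "z \<in> carrier L" for z using that by blast
  have "f \<in> {f \<in> carrier A. cls f \<in> W}"
  proof (rule free_assoc_csub_induct[OF csub_vimage[OF A.cspace_axioms U.cspace_axioms clin_cls W] _ f])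
    fix w assume w: "w \<in> lists (carrier g)"
    then have "cls (basis_vec w) \<in> W"
    proof (induction w)
      case Nil
      then show ?case
        using mem[OF free_assoc_basis_closed[of "[]"]] push_basis[of "[]"] by simp
    next
      case (Cons X w)
      then obtain z where z: "z \<in> carrier L" "X = J +> z" by (auto simp: g_carrier)
      have "cls (basis_vec [X] \<otimes>\<^bsub>A\<^esub> basis_vec w) = \<iota> z \<otimes>\<^bsub>U\<^esub> cls (basis_vec w)"
        using Cons z by (subst cls_mult) (auto simp: \<iota>_def intro: letter_mem free_assoc_basis_closed)
      then show ?case using mult[OF iW[OF z(1)] Cons.IH] by (simp add: free_assoc_mult_basis)
    qed
    then show "basis_vec w \<in> {f \<in> carrier A. cls f \<in> W}" using w by (simp add: free_assoc_basis_closed)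
  qed
  then obtain t where t: "t \<in> carrier T" "cls f = cls (push t)" by (auto simp: W_def)
  then show ?thesis using cls_eq[OF f push_closed[OF t(1)]] by auto
qed

context
  fixes cs :: "'m list"
  assumes cs: "set cs \<subseteq> carrier L" and J_gen: "J = lie_ideal_gen L (set cs)"
begin

lemma cs_J: "set cs \<subseteq> J"
  unfolding J_gen by (rule lie_ideal_gen_incl)

text \<open>Bracketing a combination with \<open>x s\<close> prepends the letter \<open>s\<close> to
  its coefficients, so the combinations form an ideal. The equality holds in L itself, not merely
  modulo [J,J], and is used in this form in \<open>determinant_zero\<close>.\<close>

lemma J_combinations:
  assumes "y \<in> J"
  shows "\<exists>t\<in>{..<length cs} \<rightarrow> carrier T. y = comb cs t"
proof -
  interpret T: calg T by (rule calg_free_assoc)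
  interpret TR: ring T by (rule ring_free_assoc_algebra)
  note nth = cs_nth[OF cs_J]
  have nthc: "cs ! i \<in> carrier L" if "i < length cs" for i using J_closed[OF nth[OF that]] .
  define V where "V = {comb cs t | t. t \<in> {..<length cs} \<rightarrow> carrier T}"
  have wc: "(\<lambda>i. ad.wact (t i) (cs ! i)) \<in> {..<length cs} \<rightarrow> carrier L"
    if "t \<in> {..<length cs} \<rightarrow> carrier T" for t
    using that nthc by auto
  have V: "csub L V"
  proof (rule csubI)
    show "V \<subseteq> carrier L" using comb_J[OF cs_J] J_closed by (auto simp: V_def)
    have "comb cs (\<lambda>_. \<zero>\<^bsub>T\<^esub>) = finsum L (\<lambda>i. \<zero>) {..<length cs}"
      by (rule finsum_cong') (use nthc clin_zero[OF T.cspace_axioms cspace_axioms ad.clin_wact] in auto)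
    then show "\<zero> \<in> V"
      by (auto simp: V_def intro!: exI[of _ "\<lambda>_. \<zero>\<^bsub>T\<^esub>"])
    show "y \<oplus> z \<in> V" if y: "y \<in> V" and z: "z \<in> V" for y z
    proof -
      obtain t where t: "t \<in> {..<length cs} \<rightarrow> carrier T" "y = comb cs t" using y by (auto simp: V_def)
      obtain t' where t': "t' \<in> {..<length cs} \<rightarrow> carrier T" "z = comb cs t'" using z by (auto simp: V_def)
      have "y \<oplus> z = finsum L (\<lambda>i. ad.wact (t i) (cs ! i) \<oplus> ad.wact (t' i) (cs ! i)) {..<length cs}"
        unfolding t(2) t'(2) by (rule finsum_addf[symmetric, OF wc[OF t(1)] wc[OF t'(1)]])
      also have "\<dots> = comb cs (\<lambda>i. t i \<oplus>\<^bsub>T\<^esub> t' i)"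
      proof (rule finsum_cong'[OF refl])
        fix i assume i: "i \<in> {..<length cs}"
        show "ad.wact (t i) (cs ! i) \<oplus> ad.wact (t' i) (cs ! i) = ad.wact (t i \<oplus>\<^bsub>T\<^esub> t' i) (cs ! i)"
          using i t(1) t'(1) nthc by (intro clinD(2)[OF ad.clin_wact, symmetric]) auto
      qed (use t(1) t'(1) nthc in auto)
      finally show ?thesis
        using t(1) t'(1) by (auto simp: V_def intro!: exI[of _ "\<lambda>i. t i \<oplus>\<^bsub>T\<^esub> t' i"])
    qed
    show "c \<odot> y \<in> V" if y: "y \<in> V" for c y
    proof -
      obtain t where t: "t \<in> {..<length cs} \<rightarrow> carrier T" "y = comb cs t" using y by (auto simp: V_def)
      have "c \<odot> y = finsum L (\<lambda>i. c \<odot> ad.wact (t i) (cs ! i)) {..<length cs}"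
        unfolding t(2) by (rule finsum_smult[OF wc[OF t(1)]])
      also have "\<dots> = comb cs (\<lambda>i. c \<odot>\<^bsub>T\<^esub> t i)"
      proof (rule finsum_cong'[OF refl])
        fix i assume i: "i \<in> {..<length cs}"
        show "c \<odot> ad.wact (t i) (cs ! i) = ad.wact (c \<odot>\<^bsub>T\<^esub> t i) (cs ! i)"
          using i t(1) nthc by (intro clinD(3)[OF ad.clin_wact, symmetric]) auto
      qed (use t(1) nthc in auto)
      finally show ?thesis
        using t(1) by (auto simp: V_def intro!: exI[of _ "\<lambda>i. c \<odot>\<^bsub>T\<^esub> t i"])
    qed
  qed
  have "lie_ideal L V"
  proof (rule lie_ideal_of_generators[OF V])
    fix s y assume s: "s \<in> S" and "y \<in> V"
    then obtain t where t: "t \<in> {..<length cs} \<rightarrow> carrier T" "y = comb cs t" by (auto simp: V_def)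
    have sT: "basis_vec [s] \<in> carrier T" using s by (intro free_assoc_basis_closed) simp
    have "x s \<otimes> y = finsum L (\<lambda>i. x s \<otimes> ad.wact (t i) (cs ! i)) {..<length cs}"
      unfolding t(2) by (rule mult_finsum_right[OF x_closed[OF s] wc[OF t(1)]])
    also have "\<dots> = comb cs (\<lambda>i. basis_vec [s] \<otimes>\<^bsub>T\<^esub> t i)"
    proof (rule finsum_cong'[OF refl])
      fix i assume i: "i \<in> {..<length cs}"
      then have c: "t i \<in> carrier T" "cs ! i \<in> carrier L" using t(1) nthc by auto
      then show "x s \<otimes> ad.wact (t i) (cs ! i) = ad.wact (basis_vec [s] \<otimes>\<^bsub>T\<^esub> t i) (cs ! i)"
        using s ad.wact_mult[OF sT c] ad.wact_basis[of "[s]"] by simp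
    qed (use t(1) nthc sT in auto)
    finally show "x s \<otimes> y \<in> V"
      using t(1) sT by (auto simp: V_def intro!: exI[of _ "\<lambda>i. basis_vec [s] \<otimes>\<^bsub>T\<^esub> t i"])
  qed
  moreover have "set cs \<subseteq> V"
  proof
    fix c assume "c \<in> set cs"
    then obtain j where j: "j < length cs" "cs ! j = c" by (auto simp: in_set_conv_nth)
    have one: "ad.wact \<one>\<^bsub>T\<^esub> c = c"
      using ad.wact_basis[of "[]" c] nthc[OF j(1)] j(2) by (simp add: free_assoc_simps)
    have "comb cs (\<lambda>i. if i = j then \<one>\<^bsub>T\<^esub> else \<zero>\<^bsub>T\<^esub>) = finsum L (\<lambda>i. if i = j then c else \<zero>) {..<length cs}"
      by (rule finsum_cong') (use j one nthc clin_zero[OF T.cspace_axioms cspace_axioms ad.clin_wact] in auto)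
    also have "\<dots> = c"
      using add.finprod_singleton_swap[of j "{..<length cs}" "\<lambda>_. c"] j nthc[OF j(1)] by simp
    finally show "c \<in> V"
      by (auto simp: V_def intro!: exI[of _ "\<lambda>i. if i = j then \<one>\<^bsub>T\<^esub> else \<zero>\<^bsub>T\<^esub>"])
  qed
  ultimately have "J \<subseteq> V" unfolding J_gen by (rule lie_ideal_gen_minimal)
  then show ?thesis using assms by (auto simp: V_def)
qed

text \<open>Existence of coordinates is \<open>J_combinations\<close>. For uniqueness,
  \<open>uea_generated\<close> lifts coordinates from U(L/J) to T, and \<open>indep\<close> is
  applied to the difference of two lifts.\<close>

lemma free_moduleI:
  assumes indep: "\<And>t i. t \<in> {..<length cs} \<rightarrow> carrier T \<Longrightarrow> comb cs t \<in> D \<Longrightarrow> i < length cs \<Longrightarrow>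
      push (t i) \<in> Uid"
  shows "free_module_on (uea g) (adjoint_module L J) (map (\<lambda>c. D +> c) cs)"
proof -
  interpret A: calg A by (rule calg_free_assoc)
  interpret T: calg T by (rule calg_free_assoc)
  note nthc = J_closed[OF cs_nth[OF cs_J]]
  let ?bs = "map (\<lambda>c. D +> c) cs"
  let ?P = "\<lambda>v u. u \<in> {..<length ?bs} \<rightarrow>\<^sub>E carrier (uea g) \<and>
      v = finsum (adjoint_module L J) (\<lambda>i. u i \<odot>\<^bsub>adjoint_module L J\<^esub> ?bs ! i) {..<length ?bs}"
  have lift: "\<exists>t\<in>{..<length cs} \<rightarrow> carrier T. \<forall>i<length cs. u i = Uid +>\<^bsub>A\<^esub> push (t i)"
    if u: "u \<in> {..<length ?bs} \<rightarrow>\<^sub>E carrier (uea g)" for u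
  proof -
    have "\<exists>t\<in>carrier T. u i = Uid +>\<^bsub>A\<^esub> push t" if i: "i < length cs" for i
    proof -
      obtain f where f: "f \<in> carrier A" "u i = Uid +>\<^bsub>A\<^esub> f"
        using u i by (auto simp: uea_carrier PiE_iff)
      obtain t where t: "t \<in> carrier T" "f \<ominus>\<^bsub>A\<^esub> push t \<in> Uid" using uea_generated[OF f(1)] by blast
      then show ?thesis
        using f A.coset_eq_iff[OF csub_Uid f(1) push_closed[OF t(1)]] by auto
    qed
    then obtain t where "\<And>i. i < length cs \<Longrightarrow> t i \<in> carrier T \<and> u i = Uid +>\<^bsub>A\<^esub> push (t i)"
      by metis
    then show ?thesis by (intro bexI[of _ t]) auto
  qed
  have "\<exists>!u. ?P v u" if v: "v \<in> carrier (adjoint_module L J)" for v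
  proof -
    obtain y where y: "y \<in> J" "v = D +> y" using v by (auto simp: adjoint_carrier M0_carrier)
    obtain t where t: "t \<in> {..<length cs} \<rightarrow> carrier T" "y = comb cs t"
      using J_combinations[OF y(1)] by blast
    define u where "u = (\<lambda>i\<in>{..<length cs}. Uid +>\<^bsub>A\<^esub> push (t i))"
    have ex: "?P v u"
      using t module_comb[OF cs_J t(1), of u] y(2) push_closed
      by (auto simp: u_def uea_carrier)
    have "u' = u" if u': "?P v u'" for u'
    proof -
      obtain t' where t': "t' \<in> {..<length cs} \<rightarrow> carrier T"
        "\<And>i. i < length cs \<Longrightarrow> u' i = Uid +>\<^bsub>A\<^esub> push (t' i)"
        using lift[OF conjunct1[OF u']] by blast
      have wc: "(\<lambda>i. ad.wact (t i) (cs ! i)) \<in> {..<length cs} \<rightarrow> carrier L"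
        if "t \<in> {..<length cs} \<rightarrow> carrier T" for t
        using that nthc by auto
      have "D +> comb cs t' = D +> comb cs t"
        using module_comb[OF cs_J t'] u' y(2) t(2) by simp
      then have d: "comb cs t' \<ominus> comb cs t \<in> D"
        using coset_eq_iff[OF csub_D] comb_J[OF cs_J] J_closed t(1) t'(1) by blast
      have "comb cs (\<lambda>i. t' i \<ominus>\<^bsub>T\<^esub> t i) =
          finsum L (\<lambda>i. ad.wact (t' i) (cs ! i) \<oplus> (- 1) \<odot> ad.wact (t i) (cs ! i)) {..<length cs}"
      proof (rule finsum_cong'[OF refl])
        fix i assume "i \<in> {..<length cs}"
        then have c: "t i \<in> carrier T" "t' i \<in> carrier T" "cs ! i \<in> carrier L" using t t' nthc by auto
        show "ad.wact (t' i \<ominus>\<^bsub>T\<^esub> t i) (cs ! i) =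
            ad.wact (t' i) (cs ! i) \<oplus> (- 1) \<odot> ad.wact (t i) (cs ! i)"
          using c clin_diff[OF T.cspace_axioms cspace_axioms ad.clin_wact[OF c(3)] c(2,1)]
          by (simp add: a_minus_def smult_minus_one)
      qed (use wc[OF t(1)] wc[OF t'(1)] in auto)
      also have "\<dots> = comb cs t' \<oplus> finsum L (\<lambda>i. (- 1) \<odot> ad.wact (t i) (cs ! i)) {..<length cs}"
        using wc[OF t(1)] wc[OF t'(1)] by (intro finsum_addf) auto
      also have "finsum L (\<lambda>i. (- 1) \<odot> ad.wact (t i) (cs ! i)) {..<length cs} = (- 1) \<odot> comb cs t"
        by (rule finsum_smult[symmetric, OF wc[OF t(1)]])
      also have "comb cs t' \<oplus> (- 1) \<odot> comb cs t = comb cs t' \<ominus> comb cs t"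
        using smult_minus_one J_closed[OF comb_J[OF cs_J t(1)]] by (simp add: a_minus_def)
      finally have D: "comb cs (\<lambda>i. t' i \<ominus>\<^bsub>T\<^esub> t i) \<in> D" using d by simp
      have "u' i = u i" if i: "i < length cs" for i
      proof -
        have c: "t i \<in> carrier T" "t' i \<in> carrier T" using i t t' by auto
        have "push (t' i \<ominus>\<^bsub>T\<^esub> t i) \<in> Uid"
          by (rule indep[OF _ D i]) (use t(1) t'(1) in auto)
        then have "push (t' i) \<ominus>\<^bsub>A\<^esub> push (t i) \<in> Uid"
          using clin_diff[OF T.cspace_axioms A.cspace_axioms clin_push c(2,1)] by simp
        then show ?thesis
          using i t'(2) A.coset_eq_iff[OF csub_Uid push_closed[OF c(2)] push_closed[OF c(1)]]
          by (simp add: u_def)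
      qed
      \<comment> \<open>Outside the index range both functions are extensional and hence
        agree.\<close>
      moreover have "u' i = undefined" "u i = undefined" if "\<not> i < length cs" for i
        using that u' by (auto simp: u_def PiE_iff extensional_def)
      ultimately show ?thesis by (metis ext)
    qed
    then show ?thesis by (intro ex1I[of _ u] ex)
  qed
  moreover have "set ?bs \<subseteq> carrier (adjoint_module L J)"
    using cs_J by (auto simp: adjoint_carrier M0_carrier)
  ultimately show ?thesis by (simp add: free_module_on_def)
qed

end

end

section \<open>The Magnus expansion\<close>

text \<open>The Cauchy product of noncommutative series. Recursion on the first letter replaces the
  sum over prefixes, which \<open>conv_eq_sum\<close> recovers.\<close>

fun conv :: "('a list \<Rightarrow> complex) \<Rightarrow> ('a list \<Rightarrow> complex) \<Rightarrow> 'a list \<Rightarrow> complex" where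
  "conv f g [] = f [] * g []"
| "conv f g (x # w) = f [] * g (x # w) + conv (\<lambda>u. f (x # u)) g w"

lemma conv_eq_sum: "conv f g w = (\<Sum>i\<le>length w. f (take i w) * g (drop i w))"
  by (induction w arbitrary: f) (simp_all add: sum.atMost_Suc_shift del: sum.atMost_Suc)

lemma conv_assoc: "conv (conv f g) h w = conv f (conv g h) w"
proof (induction w arbitrary: f)
  case (Cons x w)
  have lin: "conv (\<lambda>u. c * p u + q u) h w = c * conv p h w + conv q h w" for c p q
    by (simp add: conv_eq_sum distrib_right sum.distrib sum_distrib_left mult.assoc)
  show ?case
    using Cons[of "\<lambda>u. f (x # u)"] by (simp add: lin algebra_simps)
qed simp

lemma conv_zero_left: "conv (\<lambda>_. 0) g w = 0"
  by (simp add: conv_eq_sum)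

lemma conv_one_left: "conv (basis_vec []) g = g"
proof
  show "conv (basis_vec []) g w = g w" for w
    by (cases w) (simp_all add: basis_vec_def conv_zero_left)
qed

lemma conv_one_right: "conv f (basis_vec []) w = f w"
  by (induction w arbitrary: f) (simp_all add: basis_vec_def)

declare conv.simps(2) [simp del]

definition power_series :: "('a list \<Rightarrow> complex) monoid" where
  "power_series = \<lparr>carrier = UNIV, monoid.mult = conv, one = basis_vec []\<rparr>"

lemma monoid_power_series: "monoid power_series"
  by (rule monoidI) (auto simp: power_series_def conv_one_left conv_one_right conv_assoc fun_eq_iff)

definition PS :: "('a list \<Rightarrow> complex) monoid" where
  "PS = units_of power_series"

lemma group_PS: "group PS"
  unfolding PS_def by (rule monoid.units_group[OF monoid_power_series])

interpretation PS: group PS by (rule group_PS)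

lemma PS_mult: "f \<otimes>\<^bsub>PS\<^esub> g = conv f g"
  and PS_one: "\<one>\<^bsub>PS\<^esub> = basis_vec []"
  by (simp_all add: PS_def units_of_def power_series_def)

lemma PS_carrierI: "(\<And>w. conv f g w = basis_vec [] w) \<Longrightarrow> (\<And>w. conv g f w = basis_vec [] w) \<Longrightarrow>
    f \<in> carrier PS"
  by (auto simp: PS_def units_of_def Units_def power_series_def fun_eq_iff intro!: exI[of _ g])

lemma PS_inv: "f \<in> carrier PS \<Longrightarrow> conv f (inv\<^bsub>PS\<^esub> f) = basis_vec []"
  using PS.r_inv[of f] by (simp add: PS_mult PS_one)

text \<open>The series 1 + s; the definition after it is the inverse 1 - s + s^2 - s^3 + ...
  .\<close>

definition letter_series :: "'a \<Rightarrow> 'a list \<Rightarrow> complex" where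
  "letter_series s w = (if w = [] \<or> w = [s] then 1 else 0)"

definition letter_inverse :: "'a \<Rightarrow> 'a list \<Rightarrow> complex" where
  "letter_inverse s w = (if set w \<subseteq> {s} then (- 1) ^ length w else 0)"

lemma letter_series_Nil [simp]: "letter_series s [] = 1"
  and letter_inverse_Nil [simp]: "letter_inverse s [] = 1"
  by (simp_all add: letter_series_def letter_inverse_def)

lemma conv_letter_series:
  "conv (letter_series s) g [] = g []"
  "conv (letter_series s) g (x # w) = g (x # w) + (if x = s then g w else 0)"
proof -
  have "(\<lambda>u. letter_series s (x # u)) = (if x = s then basis_vec [] else (\<lambda>_. 0))"
    by (auto simp: letter_series_def basis_vec_def)
  then show "conv (letter_series s) g (x # w) = g (x # w) + (if x = s then g w else 0)"
    by (simp add: conv.simps(2) conv_one_left conv_zero_left)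
qed simp

lemma conv_letter_inverse:
  "conv (letter_inverse s) g [] = g []"
  "conv (letter_inverse s) g (x # w) = g (x # w) - (if x = s then conv (letter_inverse s) g w else 0)"
proof -
  have "conv (\<lambda>u. letter_inverse s (x # u)) g w = - (if x = s then conv (letter_inverse s) g w else 0)"
    by (auto simp: letter_inverse_def conv_eq_sum sum_negf intro!: sum.cong)
      (auto simp flip: sum_negf intro!: sum.cong)
  then show "conv (letter_inverse s) g (x # w) = g (x # w) - (if x = s then conv (letter_inverse s) g w else 0)"
    by (simp add: conv.simps(2))
qed simp

lemma conv_letter_series_inverse:
  "conv (letter_series s) (letter_inverse s) w = basis_vec [] w"
  "conv (letter_inverse s) (letter_series s) w = basis_vec [] w"
proof -
  show "conv (letter_series s) (letter_inverse s) w = basis_vec [] w"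
    by (cases w) (auto simp: conv_letter_series letter_inverse_def basis_vec_def)
  show "conv (letter_inverse s) (letter_series s) w = basis_vec [] w"
    by (induction w) (auto simp: conv_letter_inverse letter_series_def basis_vec_def)
qed

lemma letter_series_closed: "letter_series s \<in> carrier PS"
  by (rule PS_carrierI[OF conv_letter_series_inverse])

lemma inv_letter_series: "inv\<^bsub>PS\<^esub> letter_series s = letter_inverse s"
proof (rule PS.inv_equality)
  show "letter_inverse s \<otimes>\<^bsub>PS\<^esub> letter_series s = \<one>\<^bsub>PS\<^esub>"
    by (simp add: PS_mult PS_one fun_eq_iff conv_letter_series_inverse)
  show "letter_inverse s \<in> carrier PS"
    by (rule PS_carrierI[OF conv_letter_series_inverse(2,1)])
qed (rule letter_series_closed)

definition magnus :: "'a gword \<Rightarrow> 'a list \<Rightarrow> complex" where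
  "magnus w = word_eval PS letter_series w"

lemma magnus_hom: "magnus \<in> hom (free_group S) PS"
  unfolding magnus_def[abs_def] by (rule PS.word_eval_hom) (auto intro: letter_series_closed)

lemma group_hom_magnus: "group_hom (free_group S) PS magnus"
  using magnus_hom[of S] group_free_group[of S] group_PS by (simp add: group_hom_def group_hom_axioms_def)

lemma magnus_Nil: "magnus [] = basis_vec []"
  by (simp add: magnus_def PS_one)

lemma magnus_Cons_Nil: "magnus (x # w) [] = magnus w []"
  by (cases x) (simp add: magnus_def word_eval_Cons PS_mult inv_letter_series conv_letter_series
      conv_letter_inverse)

lemma magnus_Cons_pos:
  "magnus ((s, True) # w) (y # v) = magnus w (y # v) + (if y = s then magnus w v else 0)"
  by (simp add: magnus_def word_eval_Cons PS_mult conv_letter_series)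

text \<open>If g = (1 + s)^(-1) f, then g = f - s g, so the shorter monomial is again evaluated in
  the full word.\<close>

lemma magnus_Cons_neg:
  "magnus ((s, False) # w) (y # v) =
    magnus w (y # v) - (if y = s then magnus ((s, False) # w) v else 0)"
  by (simp add: magnus_def word_eval_Cons PS_mult inv_letter_series conv_letter_inverse)

lemma magnus_letter: "magnus (letter s) = letter_series s"
  unfolding magnus_def by (rule PS.word_eval_letter[OF letter_series_closed])

lemma magnus_empty: "magnus w [] = 1"
  by (induction w) (simp_all add: magnus_Nil magnus_Cons_Nil basis_vec_def)

lemma magnus_support:
  assumes "fst ` set w \<subseteq> S" "v \<notin> lists S"
  shows "magnus w v = 0"
  using assms
proof (induction w arbitrary: v)
  case Nil
  then show ?case by (auto simp: magnus_Nil basis_vec_def)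
next
  case (Cons x w)
  obtain s e where x: "x = (s, e)" by (cases x)
  have s: "s \<in> S" using Cons.prems(1) x by simp
  have IH: "\<And>v. v \<notin> lists S \<Longrightarrow> magnus w v = 0" using Cons by auto
  show ?case
  proof (cases e)
    case True
    show ?thesis
    proof (cases v)
      case (Cons y u)
      then show ?thesis using x True IH[of v] IH[of u] Cons.prems(2) s
        by (auto simp: magnus_Cons_pos)
    qed (use Cons.prems(2) in simp)
  next
    case False
    show ?thesis
      using Cons.prems(2)
    proof (induction v)
      case (Cons y u)
      then show ?case using x False IH[of "y # u"] s by (auto simp: magnus_Cons_neg)
    qed simp
  qed
qed

subsection \<open>The filtration by degree\<close>

definition order_ge :: "nat \<Rightarrow> ('a list \<Rightarrow> complex) set" where
  "order_ge k = {f \<in> carrier PS. f [] = 1 \<and> (\<forall>w. w \<noteq> [] \<longrightarrow> length w < k \<longrightarrow> f w = 0)}"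

lemma conv_split:
  assumes "w \<noteq> []"
  shows "conv f g w = f [] * g w + f w * g [] + (\<Sum>i\<in>{1..<length w}. f (take i w) * g (drop i w))"
proof -
  obtain n where n: "length w = Suc n" using assms by (cases w) auto
  have "conv f g w = (\<Sum>i\<in>{0..<Suc (Suc n)}. f (take i w) * g (drop i w))"
    by (simp add: conv_eq_sum n atLeast0LessThan lessThan_Suc_atMost del: sum.atMost_Suc)
  also have "\<dots> = f (take 0 w) * g (drop 0 w) + (\<Sum>i\<in>{1..<Suc (Suc n)}. f (take i w) * g (drop i w))"
    by (simp add: sum.atLeast_Suc_lessThan)
  also have "(\<Sum>i\<in>{1..<Suc (Suc n)}. f (take i w) * g (drop i w)) =
      (\<Sum>i\<in>{1..<Suc n}. f (take i w) * g (drop i w)) + f (take (Suc n) w) * g (drop (Suc n) w)"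
    by (rule sum.atLeastLessThan_Suc) simp
  finally show ?thesis by (simp add: n)
qed

lemma conv_order:
  assumes f: "f \<in> order_ge k" and g: "g \<in> order_ge l" and w: "w \<noteq> []" "length w < k + l"
  shows "conv f g w = f w + g w"
proof -
  have "f (take i w) * g (drop i w) = 0" if "i \<in> {1..<length w}" for i
  proof (cases "i < k")
    case True
    then show ?thesis using f that w by (auto simp: order_ge_def)
  next
    case False
    then have "length (drop i w) < l" using w(2) that by auto
    then show ?thesis using g that by (auto simp: order_ge_def)
  qed
  then have "(\<Sum>i\<in>{1..<length w}. f (take i w) * g (drop i w)) = 0"
    by (intro sum.neutral) auto
  then show ?thesis using conv_split[OF w(1), of f g] f g by (simp add: order_ge_def)
qed

lemma conv_order_top:
  assumes f: "f \<in> order_ge k" and g: "g \<in> order_ge l" and kl: "1 \<le> k" "1 \<le> l"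
    and w: "length w = k + l"
  shows "conv f g w = f w + g w + f (take k w) * g (drop k w)"
proof -
  have "f (take i w) * g (drop i w) = 0" if "i \<in> {1..<length w} - {k}" for i
  proof (cases "i < k")
    case True
    have "take i w \<noteq> []" "length (take i w) < k" using that True by auto
    then show ?thesis using f by (auto simp: order_ge_def)
  next
    case False
    then have "length (drop i w) < l" using w that by auto
    then show ?thesis using g that by (auto simp: order_ge_def)
  qed
  then have "(\<Sum>i\<in>{1..<length w} - {k}. f (take i w) * g (drop i w)) = 0"
    by (rule sum.neutral[OF ballI])
  then have "(\<Sum>i\<in>{1..<length w}. f (take i w) * g (drop i w)) = f (take k w) * g (drop k w)"
    using kl w by (subst sum.remove[of _ k]) simp_all
  moreover have "w \<noteq> []" using kl w by auto
  ultimately show ?thesis using conv_split[of w f g] f g by (simp add: order_ge_def)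
qed

lemma order_ge_closed: "f \<in> order_ge k \<Longrightarrow> f \<in> carrier PS"
  by (simp add: order_ge_def)

lemma order_ge_one: "f \<in> carrier PS \<Longrightarrow> f [] = 1 \<Longrightarrow> f \<in> order_ge 1"
  by (auto simp: order_ge_def)

lemma subgroup_order_ge: "subgroup (order_ge k) PS"
proof (rule PS.subgroupI)
  show "order_ge k \<noteq> {}"
    using PS.one_closed by (auto simp: order_ge_def PS_one basis_vec_def split: if_splits
        intro!: exI[of _ "basis_vec []"])
  show "f \<otimes>\<^bsub>PS\<^esub> g \<in> order_ge k" if fg: "f \<in> order_ge k" "g \<in> order_ge k" for f g
  proof -
    have "conv f g w = 0" if "w \<noteq> []" "length w < k" for w
      using conv_order[OF fg, of w] that fg by (simp add: order_ge_def)
    then show ?thesis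
      using fg PS.m_closed[of f g] by (simp add: order_ge_def PS_mult)
  qed
  show "inv\<^bsub>PS\<^esub> f \<in> order_ge k" if f: "f \<in> order_ge k" for f
  proof -
    have fc: "f \<in> carrier PS" and f1: "f [] = 1" using f by (auto simp: order_ge_def)
    note inv = PS_inv[OF fc]
    have 1: "(inv\<^bsub>PS\<^esub> f) [] = 1"
      using fun_cong[OF inv, of "[]"] f1 by (simp add: basis_vec_def)
    have "(inv\<^bsub>PS\<^esub> f) w = 0" if w: "w \<noteq> []" "length w < k" for w
    proof -
      have "f (take i w) * (inv\<^bsub>PS\<^esub> f) (drop i w) = 0" if "i \<in> {1..<length w}" for i
        using f w that by (auto simp: order_ge_def)
      then have "(\<Sum>i\<in>{1..<length w}. f (take i w) * (inv\<^bsub>PS\<^esub> f) (drop i w)) = 0"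
        by (intro sum.neutral) auto
      then show ?thesis
        using conv_split[OF w(1), of f "inv\<^bsub>PS\<^esub> f"] fun_cong[OF inv, of w] f w 1
        by (simp add: order_ge_def basis_vec_def)
    qed
    then show ?thesis using fc 1 by (simp add: order_ge_def)
  qed
qed (auto simp: order_ge_def)

text \<open>With c the commutator of f and g, compare coefficients in c (g f) = f g. Below degree k
  + l the products f g and g f agree, so c has no terms of positive degree there, by induction on
  the length. In degree k + l the two products differ by the ring commutator of the leading
  forms.\<close>

lemma commutator_order:
  assumes f: "f \<in> order_ge k" and g: "g \<in> order_ge l" and kl: "1 \<le> k" "1 \<le> l"
  shows "commutator PS f g \<in> order_ge (k + l)"
    and "length w = k + l \<Longrightarrow>
      commutator PS f g w = f (take k w) * g (drop k w) - g (take l w) * f (drop l w)"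
proof -
  note fc = order_ge_closed[OF f] and gc = order_ge_closed[OF g]
  define c where "c = commutator PS f g"
  have cc: "c \<in> carrier PS" unfolding c_def using fc gc by (rule PS.commutator_closed)
  have "c \<otimes>\<^bsub>PS\<^esub> (g \<otimes>\<^bsub>PS\<^esub> f) = f \<otimes>\<^bsub>PS\<^esub> g"
    using fc gc by (simp add: c_def commutator_def PS.m_assoc)
  then have eq: "conv c (conv g f) = conv f g" by (simp add: PS_mult)
  have f1: "f [] = 1" and g1: "g [] = 1" using f g by (auto simp: order_ge_def)
  have c1: "c [] = 1" using fun_cong[OF eq, of "[]"] f1 g1 by simp
  have low: "c w = 0" if "w \<noteq> []" "length w < k + l" for w
    using that
  proof (induction w rule: length_induct)
    case (1 w)
    have "c (take i w) * conv g f (drop i w) = 0" if i: "i \<in> {1..<length w}" for i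
    proof -
      have "length (take i w) < length w" "take i w \<noteq> []" "length (take i w) < k + l"
        using i 1 by auto
      then show ?thesis using 1 by auto
    qed
    then have "(\<Sum>i\<in>{1..<length w}. c (take i w) * conv g f (drop i w)) = 0"
      by (intro sum.neutral) auto
    then have "conv c (conv g f) w = conv g f w + c w"
      using conv_split[of w c "conv g f"] 1 c1 f1 g1 by simp
    moreover have "conv f g w = f w + g w" by (rule conv_order[OF f g]) (use 1 in auto)
    moreover have "conv g f w = g w + f w" by (rule conv_order[OF g f]) (use 1 in auto)
    ultimately show ?case using fun_cong[OF eq, of w] by simp
  qed
  then show "commutator PS f g \<in> order_ge (k + l)"
    using cc c1 by (simp add: order_ge_def flip: c_def)
  show "commutator PS f g w = f (take k w) * g (drop k w) - g (take l w) * f (drop l w)"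
    if w: "length w = k + l"
  proof -
    have ne: "w \<noteq> []" using w kl by auto
    have "c (take i w) * conv g f (drop i w) = 0" if i: "i \<in> {1..<length w}" for i
      using low[of "take i w"] i w ne by auto
    then have "(\<Sum>i\<in>{1..<length w}. c (take i w) * conv g f (drop i w)) = 0"
      by (intro sum.neutral) auto
    then have "conv c (conv g f) w = conv g f w + c w"
      using conv_split[OF ne, of c "conv g f"] c1 f1 g1 by simp
    moreover have "conv f g w = f w + g w + f (take k w) * g (drop k w)"
      by (rule conv_order_top[OF f g kl w])
    moreover have "conv g f w = g w + f w + g (take l w) * f (drop l w)"
      by (rule conv_order_top[OF g f kl(2,1)]) (use w in simp)
    ultimately show ?thesis using fun_cong[OF eq, of w] by (simp add: c_def algebra_simps)
  qed
qed

text \<open>Each commutator with an element of the group raises the order by at least one.\<close>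

lemma magnus_lower_central:
  assumes "1 \<le> k" "g \<in> lower_central (free_group S) k"
  shows "magnus g \<in> order_ge k"
proof -
  interpret F: group "free_group S" by (rule group_free_group)
  interpret h: group_hom "free_group S" PS magnus by (rule group_hom_magnus)
  show ?thesis
    using assms
  proof (induction k arbitrary: g rule: dec_induct)
    case base
    then show ?case using order_ge_one[OF h.hom_closed magnus_empty] by simp
  next
    case (step k)
    obtain j where j: "k = Suc j" using step.hyps by (cases k) auto
    define H where "H = {g \<in> carrier (free_group S). magnus g \<in> order_ge (Suc k)}"
    interpret O: subgroup "order_ge (Suc k)" PS by (rule subgroup_order_ge)
    have "subgroup H (free_group S)"
    proof (rule F.subgroupI)
      show "H \<noteq> {}" using O.one_closed h.hom_one F.one_closed
        by (auto simp: H_def intro!: exI[of _ "\<one>\<^bsub>free_group S\<^esub>"])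
      show "inv\<^bsub>free_group S\<^esub> x \<in> H" if "x \<in> H" for x
        using that O.m_inv_closed[of "magnus x"] by (simp add: H_def)
      show "x \<otimes>\<^bsub>free_group S\<^esub> y \<in> H" if "x \<in> H" "y \<in> H" for x y
        using that O.m_closed[of "magnus x" "magnus y"] by (simp add: H_def)
    qed (simp add: H_def)
    moreover have "commutator (free_group S) x y \<in> H"
      if "x \<in> lower_central (free_group S) k" "y \<in> carrier (free_group S)" for x y
    proof -
      have "magnus y \<in> order_ge 1"
        by (rule order_ge_one[OF h.hom_closed[OF that(2)] magnus_empty])
      then have "commutator PS (magnus x) (magnus y) \<in> order_ge (k + 1)"
        by (rule commutator_order(1)[OF step.IH[OF that(1)] _ step.hyps(1) order.refl])
      then show ?thesis
        using that(2) F.lower_central_closed[OF that(1)] hom_commutator[OF group_hom_magnus, of x S y]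
        by (simp add: H_def)
    qed
    ultimately have "generate (free_group S) {commutator (free_group S) x y |x y.
        x \<in> lower_central (free_group S) k \<and> y \<in> carrier (free_group S)} \<subseteq> H"
      by (intro F.generate_subgroup_incl) auto
    then show ?case using step.prems by (auto simp: j H_def)
  qed
qed

subsection \<open>Residual nilpotence of free groups\<close>

text \<open>Such monomials use one letter from each syllable of a reduced word, so they detect its
  syllable structure.\<close>

definition alternating :: "'a list \<Rightarrow> bool" where
  "alternating v \<longleftrightarrow> successively (\<noteq>) v"

lemma alternating_Cons: "alternating (y # v) \<longleftrightarrow> (v = [] \<or> hd v \<noteq> y) \<and> alternating v"
  by (cases v) (auto simp: alternating_def)

text \<open>Along an alternating monomial the coefficient of a reduced word is the product of the exponents
  of its syllables. The invariant describes the first syllable, a power of \<open>s\<close> with \<open>m\<close> letters;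
  \<open>a\<close> is the monomial and \<open>p\<close> the coefficient of the remaining syllables.\<close>

lemma magnus_alternating:
  assumes "reduced ((s, e) # w)"
  shows "\<exists>a p m. alternating (s # a) \<and> p \<noteq> 0 \<and> (1::nat) \<le> m \<and>
    magnus ((s, e) # w) a = p \<and>
    magnus ((s, e) # w) (s # a) = (if e then of_nat m * p else - of_nat m * p) \<and>
    (\<forall>v. alternating v \<and> (v = [] \<or> hd v \<noteq> s) \<and> length a \<le> length v \<and> v \<noteq> a \<longrightarrow>
      magnus ((s, e) # w) v = 0) \<and>
    (\<forall>v. alternating (s # v) \<and> length a \<le> length v \<and> v \<noteq> a \<longrightarrow>
      magnus ((s, e) # w) (s # v) = 0)"
  using assms
proof (induction w arbitrary: s e)
  case Nil
  have pos: "magnus ((s, e) # []) v = 0" if "v \<noteq> []" "hd v \<noteq> s" for v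
    using that by (cases v; cases e) (auto simp: magnus_Cons_pos magnus_Cons_neg magnus_Nil basis_vec_def)
  have s1: "magnus ((s, e) # []) [s] = (if e then 1 else - 1)"
    by (simp add: magnus_Cons_pos magnus_Cons_neg magnus_Cons_Nil magnus_Nil basis_vec_def)
  have s2: "magnus ((s, e) # []) (s # v) = 0" if "alternating (s # v)" "v \<noteq> []" for v
    using that pos[of v]
    by (cases e) (auto simp: alternating_Cons magnus_Cons_pos magnus_Cons_neg magnus_Nil basis_vec_def)
  show ?case
    by (rule exI[of _ "[]"], rule exI[of _ 1], rule exI[of _ 1])
      (use pos s1 s2 in \<open>auto simp: alternating_def magnus_empty\<close>)
next
  case (Cons y w)
  obtain s' e' where y: "y = (s', e')" by (cases y)
  have red: "reduced ((s', e') # w)" and flip: "y \<noteq> flip (s, e)" using Cons.prems y by auto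
  let ?w = "(s', e') # w" and ?x = "(s, e) # (s', e') # w"
  obtain a p m where alt: "alternating (s' # a)" and p: "p \<noteq> 0" and m: "(1::nat) \<le> m"
    and ca: "magnus ?w a = p"
    and csa: "magnus ?w (s' # a) = (if e' then of_nat m * p else - of_nat m * p)"
    and z1: "\<And>v. alternating v \<Longrightarrow> v = [] \<or> hd v \<noteq> s' \<Longrightarrow> length a \<le> length v \<Longrightarrow> v \<noteq> a \<Longrightarrow>
      magnus ?w v = 0"
    and z2: "\<And>v. alternating (s' # v) \<Longrightarrow> length a \<le> length v \<Longrightarrow> v \<noteq> a \<Longrightarrow> magnus ?w (s' # v) = 0"
    using Cons.IH[OF red] by blast
  have other: "magnus ?x v = magnus ?w v" if "v = [] \<or> hd v \<noteq> s" for v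
    using that by (cases v; cases e) (auto simp: magnus_empty magnus_Cons_pos magnus_Cons_neg)
  have same: "magnus ?x (s # v) = magnus ?w (s # v) + (if e then magnus ?w v else - magnus ?w v)"
    if "alternating (s # v)" for v
    using that other[of v] by (auto simp: alternating_Cons magnus_Cons_pos magnus_Cons_neg)
  show ?case
  proof (cases "s' = s")
    case True
    \<comment> \<open>The new letter belongs to the first syllable. Since the word is reduced it
      does not cancel, so the exponents have the same sign and add up.\<close>
    then have e: "e' = e" using flip y by (auto simp: flip_def)
    have alt': "alternating (s # a)" using alt True by simp
    then have a: "a = [] \<or> hd a \<noteq> s" by (simp add: alternating_Cons)
    show ?thesis
      unfolding y
    proof (rule exI[of _ a], rule exI[of _ p], rule exI[of _ "Suc m"], intro conjI allI impI)
      show "magnus ?x a = p" using other[OF a] ca by simp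
      show "magnus ?x (s # a) = (if e then of_nat (Suc m) * p else - of_nat (Suc m) * p)"
        using same[OF alt'] csa ca True e by (cases e) (simp_all add: ring_distribs)
      show "magnus ?x v = 0"
        if "alternating v \<and> (v = [] \<or> hd v \<noteq> s) \<and> length a \<le> length v \<and> v \<noteq> a" for v
        using that other[of v] z1[of v] True by auto
      show "magnus ?x (s # v) = 0" if "alternating (s # v) \<and> length a \<le> length v \<and> v \<noteq> a" for v
        using that same[of v] z1[of v] z2[of v] True by (auto simp: alternating_Cons)
    qed (use alt' p in auto)
  next
    case False
    \<comment> \<open>A new syllable begins: the old leading monomial \<open>s' # a\<close> takes
      the role of \<open>a\<close>, and the new exponent is one letter long.\<close>
    have alt': "alternating (s # s' # a)" using alt False by (simp add: alternating_Cons[of s])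
    have long: "magnus ?w v = 0" if "alternating v" "length a < length v" "v \<noteq> s' # a" for v
    proof (cases "v = [] \<or> hd v \<noteq> s'")
      case True
      then show ?thesis using z1[of v] that by auto
    next
      case False
      then obtain u where "v = s' # u" by (cases v) auto
      then show ?thesis using z2[of u] that by auto
    qed
    show ?thesis
      unfolding y
    proof (rule exI[of _ "s' # a"], rule exI[of _ "magnus ?w (s' # a)"], rule exI[of _ 1],
        intro conjI allI impI)
      show "magnus ?w (s' # a) \<noteq> 0" using csa p m by simp
      show "magnus ?x (s' # a) = magnus ?w (s' # a)" using other[of "s' # a"] False by simp
      show "magnus ?x (s # s' # a) =
          (if e then of_nat 1 * magnus ?w (s' # a) else - of_nat 1 * magnus ?w (s' # a))"
        using same[OF alt'] long[of "s # s' # a"] alt' False by simp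
      show "magnus ?x v = 0"
        if "alternating v \<and> (v = [] \<or> hd v \<noteq> s) \<and> length (s' # a) \<le> length v \<and> v \<noteq> s' # a" for v
        using that other[of v] long[of v] by auto
      show "magnus ?x (s # v) = 0"
        if "alternating (s # v) \<and> length (s' # a) \<le> length v \<and> v \<noteq> s' # a" for v
        using that same[of v] long[of v] long[of "s # v"] False by (auto simp: alternating_Cons)
    qed (use alt' in auto)
  qed
qed

text \<open>A monomial of positive length with nonzero coefficient bounds the indices
  \<open>k\<close> for which \<open>r\<close> lies in term \<open>k\<close>, so the supremum in
  \<open>weight\<close> is attained.\<close>

lemma weight_free_group:
  assumes r: "r \<in> carrier (free_group S)" "r \<noteq> \<one>\<^bsub>free_group S\<^esub>"
  shows "1 \<le> weight (free_group S) r" "r \<in> lower_central (free_group S) (weight (free_group S) r)"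
proof -
  let ?K = "{k. 1 \<le> k \<and> r \<in> lower_central (free_group S) k}"
  obtain x w where w: "r = x # w" using r(2) by (cases r) (auto simp: free_group_one)
  obtain s e where x: "x = (s, e)" by (cases x)
  have "reduced ((s, e) # w)" using r(1) w x by (simp add: free_group_carrier)
  from magnus_alternating[OF this] obtain a p m where
    "p \<noteq> 0" "(1::nat) \<le> m" "magnus r (s # a) = (if e then of_nat m * p else - of_nat m * p)"
    unfolding w x by blast
  then have nz: "magnus r (s # a) \<noteq> 0" by auto
  have "k \<le> length (s # a)" if "k \<in> ?K" for k
    using magnus_lower_central[of k r S] that nz by (force simp: order_ge_def)
  then have fin: "finite ?K" by (intro finite_subset[of ?K "{..length (s # a)}"]) auto
  have "1 \<in> ?K" using r(1) by simp
  then have "?K \<noteq> {}" by blast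
  have "weight (free_group S) r \<in> ?K"
    unfolding weight_def using Max_in[OF fin \<open>?K \<noteq> {}\<close>] cSup_eq_Max[OF fin \<open>?K \<noteq> {}\<close>] by simp
  then show "1 \<le> weight (free_group S) r"
    "r \<in> lower_central (free_group S) (weight (free_group S) r)" by auto
qed

subsection \<open>The induced map of graded Lie algebras\<close>

lemma free_assoc_mult:
  assumes f: "f \<in> carrier (free_assoc_algebra S)" and g: "g \<in> carrier (free_assoc_algebra S)"
  shows "f \<otimes>\<^bsub>free_assoc_algebra S\<^esub> g = conv f g"
proof
  fix c
  have fin: "finite (supp f)" "finite (supp g)" using f g by (auto simp: free_assoc_carrier)
  let ?P = "{(a, b). a \<in> supp f \<and> b \<in> supp g \<and> a @ b = c}"
  let ?I = "{i \<in> {..length c}. f (take i c) * g (drop i c) \<noteq> 0}"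
  have "(f \<otimes>\<^bsub>free_assoc_algebra S\<^esub> g) c = (\<Sum>(a, b)\<in>supp f \<times> supp g. if a @ b = c then f a * g b else 0)"
    by (simp add: free_assoc_algebra_def magma_algebra_def sum.cartesian_product)
  also have "\<dots> = (\<Sum>(a, b)\<in>?P. f a * g b)"
    by (rule sum.mono_neutral_cong_right) (use fin in \<open>auto split: if_splits\<close>)
  also have "\<dots> = (\<Sum>i\<in>?I. f (take i c) * g (drop i c))"
    by (rule sum.reindex_bij_witness[of _ "\<lambda>i. (take i c, drop i c)" "\<lambda>(a, b). length a"])
      (auto simp: supp_def)
  also have "\<dots> = (\<Sum>i\<le>length c. f (take i c) * g (drop i c))"
    by (rule sum.mono_neutral_left) auto
  finally show "(f \<otimes>\<^bsub>free_assoc_algebra S\<^esub> g) c = conv f g c" by (simp add: conv_eq_sum)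
qed

definition homog :: "nat \<Rightarrow> ('a list \<Rightarrow> complex) \<Rightarrow> 'a list \<Rightarrow> complex" where
  "homog k f w = (if length w = k then f w else 0)"

text \<open>Finiteness of \<open>S\<close> leaves finitely many words of each length, so a
  homogeneous part of a series is a polynomial.\<close>

lemma homog_closed:
  assumes "finite S" "g \<in> carrier (free_group S)"
  shows "homog k (magnus g) \<in> carrier (free_assoc_algebra S)"
proof -
  have "supp (homog k (magnus g)) \<subseteq> {w. set w \<subseteq> S \<and> length w = k}"
  proof
    fix w assume "w \<in> supp (homog k (magnus g))"
    then have "length w = k" "magnus g w \<noteq> 0" by (auto simp: supp_def homog_def split: if_splits)
    then show "w \<in> {w. set w \<subseteq> S \<and> length w = k}"
      using magnus_support[of g S w] assms(2) by (auto simp: free_group_carrier lists_eq_set)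
  qed
  then show ?thesis
    using finite_subset[OF _ finite_lists_length_eq[OF assms(1), of k]]
    by (auto simp: free_assoc_carrier lists_eq_set)
qed

lemma conv_homog:
  "conv (homog k f) (homog l g) w = (if length w = k + l then f (take k w) * g (drop k w) else 0)"
proof -
  have "conv (homog k f) (homog l g) w =
      (\<Sum>i\<le>length w. if i = k then homog k f (take k w) * homog l g (drop k w) else 0)"
    unfolding conv_eq_sum by (rule sum.cong) (auto simp: homog_def)
  then show ?thesis by (auto simp: homog_def)
qed

text \<open>The map that takes a class in degree k to the degree k part of the Magnus expansion; it
  is chosen because \<open>gr_lift\<close> asserts existence.\<close>

definition gr_magnus :: "'a set \<Rightarrow> (nat \<times> 'a gword \<Rightarrow> complex) set \<Rightarrow> 'a list \<Rightarrow> complex" where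
  "gr_magnus S = (SOME f. clin (gr (free_group S)) (free_assoc_algebra S) f \<and>
     (\<forall>k\<ge>1. \<forall>g\<in>lower_central (free_group S) k. f (gcls (free_group S) k g) = homog k (magnus g)))"

lemma gr_magnus:
  assumes S: "finite S"
  shows clin_gr_magnus: "clin (gr (free_group S)) (free_assoc_algebra S) (gr_magnus S)"
    and gr_magnus_gcls: "\<And>k g. 1 \<le> k \<Longrightarrow> g \<in> lower_central (free_group S) k \<Longrightarrow>
      gr_magnus S (gcls (free_group S) k g) = homog k (magnus g)"
proof -
  interpret F: group "free_group S" by (rule group_free_group)
  interpret h: group_hom "free_group S" PS magnus by (rule group_hom_magnus)
  interpret T: calg "free_assoc_algebra S" by (rule calg_free_assoc)
  have "\<exists>f. clin (gr (free_group S)) (free_assoc_algebra S) f \<and>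
     (\<forall>k\<ge>1. \<forall>g\<in>lower_central (free_group S) k. f (gcls (free_group S) k g) = homog k (magnus g))"
  proof (rule F.gr_lift[OF T.cspace_axioms])
    fix k g g' assume k: "1 \<le> k" and g: "g \<in> lower_central (free_group S) k"
      and g': "g' \<in> lower_central (free_group S) k"
    note c = F.lower_central_closed[OF g] F.lower_central_closed[OF g']
    have "magnus (g \<otimes>\<^bsub>free_group S\<^esub> g') w = magnus g w + magnus g' w" if w: "length w = k" for w
    proof -
      have "w \<noteq> []" using w k by auto
      then show ?thesis
        using conv_order[OF magnus_lower_central[OF k g] magnus_lower_central[OF k g'], of w] w k
          h.hom_mult[OF c] by (simp add: PS_mult)
    qed
    then show "homog k (magnus (g \<otimes>\<^bsub>free_group S\<^esub> g')) =
        homog k (magnus g) \<oplus>\<^bsub>free_assoc_algebra S\<^esub> homog k (magnus g')"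
      by (auto simp: homog_def free_assoc_simps fun_eq_iff)
  next
    fix k g assume k: "1 \<le> k" and g: "g \<in> lower_central (free_group S) (Suc k)"
    have "magnus g w = 0" if w: "length w = k" for w
    proof -
      have "w \<noteq> []" using w k by auto
      then show ?thesis using magnus_lower_central[OF _ g] k w by (auto simp: order_ge_def)
    qed
    then show "homog k (magnus g) = \<zero>\<^bsub>free_assoc_algebra S\<^esub>"
      by (auto simp: homog_def free_assoc_simps fun_eq_iff)
  qed (use homog_closed[OF S] F.lower_central_closed in auto)
  from someI_ex[OF this] show "clin (gr (free_group S)) (free_assoc_algebra S) (gr_magnus S)"
    "\<And>k g. 1 \<le> k \<Longrightarrow> g \<in> lower_central (free_group S) k \<Longrightarrow>
      gr_magnus S (gcls (free_group S) k g) = homog k (magnus g)"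
    unfolding gr_magnus_def by blast+
qed

lemma gr_magnus_letter:
  assumes "finite S" "s \<in> S"
  shows "gr_magnus S (gcls (free_group S) 1 (letter s)) = basis_vec [s]"
  using gr_magnus_gcls[OF assms(1), of 1 "letter s"] letter_closed[OF assms(2)]
  by (auto simp: magnus_letter homog_def letter_series_def basis_vec_def fun_eq_iff)

text \<open>Both sides are bilinear; on classes of group elements this is the leading form in
  \<open>commutator_order\<close>.\<close>

lemma gr_magnus_bracket:
  assumes S: "finite S" and x: "x \<in> carrier (gr (free_group S))" and y: "y \<in> carrier (gr (free_group S))"
  shows "gr_magnus S (x \<otimes>\<^bsub>gr (free_group S)\<^esub> y) =
    gr_magnus S x \<otimes>\<^bsub>free_assoc_algebra S\<^esub> gr_magnus S y \<ominus>\<^bsub>free_assoc_algebra S\<^esub>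
    gr_magnus S y \<otimes>\<^bsub>free_assoc_algebra S\<^esub> gr_magnus S x"
proof -
  interpret F: group "free_group S" by (rule group_free_group)
  interpret L: clie "gr (free_group S)" by (rule F.clie_gr)
  interpret T: calg "free_assoc_algebra S" by (rule calg_free_assoc)
  let ?L = "gr (free_group S)" and ?T = "free_assoc_algebra S" and ?m = "gr_magnus S"
  note m = clin_gr_magnus[OF S]
  have dif: "a \<ominus>\<^bsub>?T\<^esub> b = a \<oplus>\<^bsub>?T\<^esub> (- 1) \<odot>\<^bsub>?T\<^esub> b" if "b \<in> carrier ?T" for a b
    using T.smult_minus_one[OF that] by (simp add: a_minus_def)
  have r: "clin ?L ?T (\<lambda>y. ?m x \<otimes>\<^bsub>?T\<^esub> ?m y \<oplus>\<^bsub>?T\<^esub> (- 1) \<odot>\<^bsub>?T\<^esub> (?m y \<otimes>\<^bsub>?T\<^esub> ?m x))"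
    if "x \<in> carrier ?L" for x
    using clinD(1)[OF m that]
    by (intro T.clin_add_fun T.clin_smult_fun clin_comp[OF m T.clin_mult_left]
        clin_comp[OF m T.clin_mult_right])
  have l: "clin ?L ?T (\<lambda>x. ?m x \<otimes>\<^bsub>?T\<^esub> ?m y \<oplus>\<^bsub>?T\<^esub> (- 1) \<odot>\<^bsub>?T\<^esub> (?m y \<otimes>\<^bsub>?T\<^esub> ?m x))"
    if "y \<in> carrier ?L" for y
    using clinD(1)[OF m that]
    by (intro T.clin_add_fun T.clin_smult_fun clin_comp[OF m T.clin_mult_left]
        clin_comp[OF m T.clin_mult_right])
  have "?m (x \<otimes>\<^bsub>?L\<^esub> y) = ?m x \<otimes>\<^bsub>?T\<^esub> ?m y \<oplus>\<^bsub>?T\<^esub> (- 1) \<odot>\<^bsub>?T\<^esub> (?m y \<otimes>\<^bsub>?T\<^esub> ?m x)"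
  proof (rule F.gr_clin_eq[OF T.cspace_axioms clin_comp[OF L.clin_mult_right[OF y] m] l[OF y] _ x])
    fix k g assume g: "1 \<le> k" "g \<in> lower_central (free_group S) k"
    note gc = F.gcls_closed[OF g]
    show "?m (gcls (free_group S) k g \<otimes>\<^bsub>?L\<^esub> y) = ?m (gcls (free_group S) k g) \<otimes>\<^bsub>?T\<^esub> ?m y \<oplus>\<^bsub>?T\<^esub>
        (- 1) \<odot>\<^bsub>?T\<^esub> (?m y \<otimes>\<^bsub>?T\<^esub> ?m (gcls (free_group S) k g))"
    proof (rule F.gr_clin_eq[OF T.cspace_axioms clin_comp[OF L.clin_mult_left[OF gc] m] r[OF gc] _ y])
      fix l h assume h: "1 \<le> l" "h \<in> lower_central (free_group S) l"
      note hom = homog_closed[OF S F.lower_central_closed[OF g(2)], of k]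
        homog_closed[OF S F.lower_central_closed[OF h(2)], of l]
      have "homog (k + l) (magnus (commutator (free_group S) g h)) =
          (\<lambda>w. conv (homog k (magnus g)) (homog l (magnus h)) w
            - conv (homog l (magnus h)) (homog k (magnus g)) w)"
        using hom_commutator[OF group_hom_magnus F.lower_central_closed[OF g(2)] F.lower_central_closed[OF h(2)]]
          commutator_order(2)[OF magnus_lower_central[OF g] magnus_lower_central[OF h] g(1) h(1)]
        by (auto simp: fun_eq_iff homog_def[of "k + l"] conv_homog)
      then show "?m (gcls (free_group S) k g \<otimes>\<^bsub>?L\<^esub> gcls (free_group S) l h) =
          ?m (gcls (free_group S) k g) \<otimes>\<^bsub>?T\<^esub> ?m (gcls (free_group S) l h) \<oplus>\<^bsub>?T\<^esub>
          (- 1) \<odot>\<^bsub>?T\<^esub> (?m (gcls (free_group S) l h) \<otimes>\<^bsub>?T\<^esub> ?m (gcls (free_group S) k g))"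
        using g h F.commutator_lower_central[OF g(1) h(1) g(2) h(2)] hom
        by (simp add: F.gcls_bracket gr_magnus_gcls[OF S] free_assoc_mult free_assoc_simps)
    qed
  qed
  then show ?thesis
    using clinD(1)[OF m x] clinD(1)[OF m y] by (simp add: dif)
qed

section \<open>A criterion for mildness\<close>

lemma free_assoc_diff:
  "g \<in> carrier (free_assoc_algebra S) \<Longrightarrow> f \<ominus>\<^bsub>free_assoc_algebra S\<^esub> g = (\<lambda>w. f w - g w)"
  unfolding free_assoc_algebra_def by (rule magma_diff)

lemma free_assoc_finsum:
  "f \<in> A \<rightarrow> carrier (free_assoc_algebra S) \<Longrightarrow>
    finsum (free_assoc_algebra S) f A w = (\<Sum>a\<in>A. f a w)"
  unfolding free_assoc_algebra_def by (rule magma_finsum)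

lemma free_assoc_lincomb:
  assumes "\<And>a. a \<in> A \<Longrightarrow> f a \<in> carrier (free_assoc_algebra S)"
  shows "finsum (free_assoc_algebra S) (\<lambda>a. c a \<odot>\<^bsub>free_assoc_algebra S\<^esub> f a) A w = (\<Sum>a\<in>A. c a * f a w)"
proof -
  interpret T: calg "free_assoc_algebra S" by (rule calg_free_assoc)
  have "(\<lambda>a. c a \<odot>\<^bsub>free_assoc_algebra S\<^esub> f a) \<in> A \<rightarrow> carrier (free_assoc_algebra S)"
    using assms by auto
  then show ?thesis by (subst free_assoc_finsum) (simp_all add: free_assoc_simps)
qed

lemma conv_snoc: "conv f g (w @ [s]) = conv f (\<lambda>u. g (u @ [s])) w + f (w @ [s]) * g []"
proof -
  have "(\<Sum>i\<le>length w. f (take i (w @ [s])) * g (drop i (w @ [s]))) =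
      (\<Sum>i\<le>length w. f (take i w) * g (drop i w @ [s]))"
    by (rule sum.cong) auto
  then show ?thesis by (simp add: conv_eq_sum)
qed

lemma free_assoc_mult_letter:
  assumes "f \<in> carrier (free_assoc_algebra S)" "c \<in> S"
  shows "(f \<otimes>\<^bsub>free_assoc_algebra S\<^esub> basis_vec [c]) [] = 0"
    and "(f \<otimes>\<^bsub>free_assoc_algebra S\<^esub> basis_vec [c]) (w @ [s]) = (if s = c then f w else 0)"
proof -
  have m: "f \<otimes>\<^bsub>free_assoc_algebra S\<^esub> basis_vec [c] = conv f (basis_vec [c])"
    using assms by (intro free_assoc_mult free_assoc_basis_closed) auto
  show "(f \<otimes>\<^bsub>free_assoc_algebra S\<^esub> basis_vec [c]) [] = 0"
    unfolding m by (simp add: basis_vec_def)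
  have "(\<lambda>u. basis_vec [c] (u @ [s])) = (if s = c then basis_vec [] else (\<lambda>_. 0))"
    by (auto simp: basis_vec_def fun_eq_iff)
  then show "(f \<otimes>\<^bsub>free_assoc_algebra S\<^esub> basis_vec [c]) (w @ [s]) = (if s = c then f w else 0)"
    unfolding m conv_snoc by (simp add: basis_vec_def[of "[c]"] conv_one_right) (simp add: conv_eq_sum)
qed

text \<open>A Fox derivative: every y is its constant term plus the sum over s of
  \<open>right_quot s y\<close> times s.\<close>

definition right_quot :: "'a \<Rightarrow> ('a list \<Rightarrow> complex) \<Rightarrow> 'a list \<Rightarrow> complex" where
  "right_quot s f = (\<lambda>w. f (w @ [s]))"

lemma right_quot_closed:
  assumes "f \<in> carrier (free_assoc_algebra S)"
  shows "right_quot s f \<in> carrier (free_assoc_algebra S)"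
proof -
  have "(\<lambda>w. w @ [s]) ` supp (right_quot s f) \<subseteq> supp f"
    by (auto simp: right_quot_def supp_def)
  moreover have "inj_on (\<lambda>w. w @ [s]) (supp (right_quot s f))" by (simp add: inj_on_def)
  moreover have "finite (supp f)" using assms by (simp add: free_assoc_carrier)
  ultimately have "finite (supp (right_quot s f))"
    using finite_imageD[of "\<lambda>w. w @ [s]" "supp (right_quot s f)"] finite_subset[of _ "supp f"] by simp
  moreover have "supp (right_quot s f) \<subseteq> lists S"
    using assms by (auto simp: right_quot_def supp_def free_assoc_carrier)
  ultimately show ?thesis by (simp add: free_assoc_carrier)
qed

lemma clin_right_quot: "clin (free_assoc_algebra S) (free_assoc_algebra S) (right_quot s)"
  by (rule clinI) (simp_all add: right_quot_closed, simp_all add: right_quot_def free_assoc_simps)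

lemma right_quot_mult:
  assumes f: "f \<in> carrier (free_assoc_algebra S)" and g: "g \<in> carrier (free_assoc_algebra S)"
    and g0: "g [] = 0"
  shows "right_quot s (f \<otimes>\<^bsub>free_assoc_algebra S\<^esub> g) = f \<otimes>\<^bsub>free_assoc_algebra S\<^esub> right_quot s g"
  using free_assoc_mult[OF f g] free_assoc_mult[OF f right_quot_closed[OF g]] g0
  by (simp add: right_quot_def fun_eq_iff conv_snoc)

text \<open>The anti-automorphism reversing words. It turns an action of letters from the right into
  a left action, to which \<open>word_action\<close> applies.\<close>

definition rev_series :: "'a set \<Rightarrow> ('a list \<Rightarrow> complex) \<Rightarrow> 'a list \<Rightarrow> complex" where
  "rev_series S = lin_ext (free_assoc_algebra S) (\<lambda>w. basis_vec (rev w))"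

lemma clin_rev_series: "clin (free_assoc_algebra S) (free_assoc_algebra S) (rev_series S)"
proof -
  interpret T: calg "free_assoc_algebra S" by (rule calg_free_assoc)
  show ?thesis
    unfolding rev_series_def
    by (rule T.clin_free_assoc) (auto intro!: free_assoc_basis_closed simp: lists_eq_set)
qed

lemma rev_series_basis: "w \<in> lists S \<Longrightarrow> rev_series S (basis_vec w) = basis_vec (rev w)"
proof -
  interpret T: calg "free_assoc_algebra S" by (rule calg_free_assoc)
  show "w \<in> lists S \<Longrightarrow> ?thesis"
    unfolding rev_series_def
    by (rule T.lin_ext_basis[where h = "\<lambda>w. basis_vec (rev w)"])
      (auto intro!: free_assoc_basis_closed simp: lists_eq_set)
qed

lemma rev_series_mult:
  assumes f: "f \<in> carrier (free_assoc_algebra S)" and g: "g \<in> carrier (free_assoc_algebra S)"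
  shows "rev_series S (f \<otimes>\<^bsub>free_assoc_algebra S\<^esub> g) =
    rev_series S g \<otimes>\<^bsub>free_assoc_algebra S\<^esub> rev_series S f"
proof -
  interpret T: calg "free_assoc_algebra S" by (rule calg_free_assoc)
  let ?T = "free_assoc_algebra S"
  note r = clin_rev_series[of S]
  show ?thesis
  proof (rule free_assoc_clin_eq[OF T.cspace_axioms clin_comp[OF T.clin_mult_right[OF g] r]
        clin_comp[OF r T.clin_mult_left[OF clinD(1)[OF r g]]] _ f])
    fix v assume v: "v \<in> lists S"
    note vc = free_assoc_basis_closed[OF v]
    show "rev_series S (basis_vec v \<otimes>\<^bsub>?T\<^esub> g) = rev_series S g \<otimes>\<^bsub>?T\<^esub> rev_series S (basis_vec v)"
      by (rule free_assoc_clin_eq[OF T.cspace_axioms clin_comp[OF T.clin_mult_left[OF vc] r]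
            clin_comp[OF r T.clin_mult_right[OF clinD(1)[OF r vc]]] _ g])
        (use v in \<open>simp add: free_assoc_mult_basis rev_series_basis\<close>)
  qed
qed

text \<open>The relators below are commutators of a letter of \<open>S - C\<close> with a linear form that contains
  exactly one letter of \<open>C\<close>. Ordering the words so that a product of a letter of \<open>S - C\<close> and
  a letter of \<open>C\<close> is leading, the leading words have no overlaps, hence the relators are strongly
  free in the sense of Anick. The normal form is computed by letting the letters act from the right.\<close>

locale inert_relators =
  fixes S C :: "'a set" and m :: nat and b a :: "nat \<Rightarrow> 'a" and e :: "nat \<Rightarrow> 'a \<Rightarrow> complex"
  assumes S: "finite S" and C: "C \<subseteq> S"
    and b: "i < m \<Longrightarrow> b i \<in> S - C" and a: "i < m \<Longrightarrow> a i \<in> C"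
    and e: "i < m \<Longrightarrow> s \<in> C \<Longrightarrow> e i s = (if s = a i then 1 else 0)"
    and inj: "i < m \<Longrightarrow> j < m \<Longrightarrow> b i = b j \<Longrightarrow> a i = a j \<Longrightarrow> i = j"
begin

abbreviation "T \<equiv> free_assoc_algebra S"

abbreviation mul_T (infixl "\<cdot>" 70) where "f \<cdot> g \<equiv> f \<otimes>\<^bsub>T\<^esub> g"
abbreviation smul_T (infixl "\<star>" 71) where "c \<star> f \<equiv> c \<odot>\<^bsub>T\<^esub> f"

sublocale T: calg T by (rule calg_free_assoc)

definition lform :: "nat \<Rightarrow> 'a list \<Rightarrow> complex" where
  "lform i = finsum T (\<lambda>s. e i s \<star> basis_vec [s]) S"

text \<open>The element [b_i, l_i]; it will be the image under \<open>gr_magnus\<close> of the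
  initial form of the relator with index \<open>i\<close>.\<close>

definition rel :: "nat \<Rightarrow> 'a list \<Rightarrow> complex" where
  "rel i = basis_vec [b i] \<cdot> lform i \<ominus>\<^bsub>T\<^esub> lform i \<cdot> basis_vec [b i]"

abbreviation "I \<equiv> Idl\<^bsub>T\<^esub> (rel ` {..<m})"

lemma letter_T: "s \<in> S \<Longrightarrow> basis_vec [s] \<in> carrier T"
  by (rule free_assoc_basis_closed) simp

lemma lform_terms: "(\<lambda>s. e i s \<star> basis_vec [s]) \<in> S \<rightarrow> carrier T"
  using letter_T by auto

lemma lform_closed: "lform i \<in> carrier T"
  unfolding lform_def by (rule T.finsum_closed[OF lform_terms])

lemma b_S: "i < m \<Longrightarrow> b i \<in> S" and b_C: "i < m \<Longrightarrow> b i \<notin> C" and a_S: "i < m \<Longrightarrow> a i \<in> S"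
  using b a C by auto

lemma rel_closed: "i < m \<Longrightarrow> rel i \<in> carrier T"
  unfolding rel_def by (intro T.minus_closed T.mult_closed letter_T lform_closed b_S)

lemma lform_mult:
  assumes f: "f \<in> carrier T"
  shows "f \<cdot> lform i = finsum T (\<lambda>s. e i s \<star> (f \<cdot> basis_vec [s])) S"
    and "lform i \<cdot> f = finsum T (\<lambda>s. e i s \<star> (basis_vec [s] \<cdot> f)) S"
proof -
  show "f \<cdot> lform i = finsum T (\<lambda>s. e i s \<star> (f \<cdot> basis_vec [s])) S"
    unfolding lform_def T.mult_finsum_right[OF f lform_terms]
    by (rule T.finsum_cong') (use f letter_T in \<open>auto simp: T.mult_smult_right\<close>)
  show "lform i \<cdot> f = finsum T (\<lambda>s. e i s \<star> (basis_vec [s] \<cdot> f)) S"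
    unfolding lform_def T.mult_finsum_left[OF f lform_terms]
    by (rule T.finsum_cong') (use f letter_T in \<open>auto simp: T.mult_smult_left\<close>)
qed

lemma rel_set_closed: "rel ` {..<m} \<subseteq> carrier T"
  using rel_closed by auto

lemma ideal_I: "ideal I T"
  by (rule ring.genideal_ideal[OF ring_free_assoc_algebra rel_set_closed])

lemmas I_l = ideal.I_l_closed[OF ideal_I]
lemmas I_r = ideal.I_r_closed[OF ideal_I]
lemmas T_assoc = monoid.m_assoc[OF ring.is_monoid[OF ring_free_assoc_algebra[of S]]]

lemma csub_I: "csub T I"
  by (rule free_assoc_ideal_csub[OF ideal_I])

lemma rel_I: "i < m \<Longrightarrow> rel i \<in> I"
  using ring.genideal_self[OF ring_free_assoc_algebra rel_set_closed] by auto

lemma I_closed: "f \<in> I \<Longrightarrow> f \<in> carrier T"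
  by (rule csubD(5)[OF csub_I])

lemma I_minimal: "ideal K T \<Longrightarrow> (\<And>i. i < m \<Longrightarrow> rel i \<in> K) \<Longrightarrow> I \<subseteq> K"
  by (rule ring.genideal_minimal[OF ring_free_assoc_algebra]) auto

lemma I_empty: "f \<in> I \<Longrightarrow> f [] = 0"
proof -
  have "ideal {f \<in> carrier T. f [] = 0} T"
  proof (rule csub_free_assoc_ideal)
    show "csub T {f \<in> carrier T. f [] = 0}"
      by (rule csubI) (auto, auto simp: free_assoc_simps)
  qed (auto, auto simp: free_assoc_mult)
  then have "I \<subseteq> {f \<in> carrier T. f [] = 0}"
  proof (rule I_minimal)
    fix i assume i: "i < m"
    note bc = letter_T[OF b_S[OF i]]
    have "rel i [] = 0"
      unfolding rel_def free_assoc_diff[OF T.mult_closed[OF lform_closed bc]]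
      unfolding free_assoc_mult[OF lform_closed bc] free_assoc_mult[OF bc lform_closed]
      by (simp add: basis_vec_def)
    then show "rel i \<in> {f \<in> carrier T. f [] = 0}" using rel_closed[OF i] by simp
  qed
  then show "f \<in> I \<Longrightarrow> f [] = 0" by auto
qed

text \<open>The leading words b_i a_i of length two. Overlaps are impossible because the first
  letter is outside \<open>C\<close> and the second inside.\<close>

definition redex :: "'a \<Rightarrow> 'a \<Rightarrow> bool" where
  "redex c s \<longleftrightarrow> (\<exists>i<m. c = b i \<and> s = a i)"

definition idx :: "'a \<Rightarrow> 'a \<Rightarrow> nat" where
  "idx c s = (SOME i. i < m \<and> c = b i \<and> s = a i)"

lemma redex_rel: "i < m \<Longrightarrow> redex (b i) (a i)" "i < m \<Longrightarrow> idx (b i) (a i) = i"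
proof -
  show "i < m \<Longrightarrow> redex (b i) (a i)" by (auto simp: redex_def)
  assume "i < m"
  then have "idx (b i) (a i) < m \<and> b i = b (idx (b i) (a i)) \<and> a i = a (idx (b i) (a i))"
    using someI[of "\<lambda>i'. i' < m \<and> b i = b i' \<and> a i = a i'" i] unfolding idx_def by blast
  then show "idx (b i) (a i) = i" using inj[OF _ \<open>i < m\<close>] by auto
qed

text \<open>The word is given in reverse order.\<close>

fun act_letter :: "'a list \<Rightarrow> 'a \<Rightarrow> 'a list \<Rightarrow> complex" where
  "act_letter [] s = basis_vec [s]"
| "act_letter (c # v) s =
    (if redex c s then
       finsum T (\<lambda>s'. e (idx c s) s' \<star> (act_letter v s' \<cdot> basis_vec [c])) S \<ominus>\<^bsub>T\<^esub>
       finsum T (\<lambda>s'. e (idx c s) s' \<star> basis_vec (rev v @ [c, s'])) (S - C)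
     else basis_vec (rev v @ [c, s]))"

lemma word_T: "w \<in> lists S \<Longrightarrow> basis_vec w \<in> carrier T"
  by (rule free_assoc_basis_closed)

lemma act_letter_closed: "v \<in> lists S \<Longrightarrow> s \<in> S \<Longrightarrow> act_letter v s \<in> carrier T"
proof (induction v arbitrary: s)
  case (Cons c v)
  then have "(\<lambda>s'. e (idx c s) s' \<star> (act_letter v s' \<cdot> basis_vec [c])) \<in> S \<rightarrow> carrier T"
    by (auto intro!: letter_T)
  moreover have "(\<lambda>s'. e (idx c s) s' \<star> basis_vec (rev v @ [c, s'])) \<in> S - C \<rightarrow> carrier T"
    using Cons by (auto intro!: T.smult_closed word_T simp: lists_eq_set)
  moreover have "basis_vec (rev v @ [c, s]) \<in> carrier T"
    using Cons by (intro word_T) (auto simp: lists_eq_set)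
  ultimately show ?case by (auto intro!: T.minus_closed T.finsum_closed)
qed (auto intro: letter_T)

text \<open>A letter outside \<open>C\<close> never completes a leading word.\<close>

lemma act_letter_append: "s \<notin> C \<Longrightarrow> act_letter v s = basis_vec (rev v @ [s])"
  using a by (cases v) (auto simp: redex_def)

lemma lform_split:
  assumes i: "i < m"
  shows "(\<Sum>s\<in>S. e i s * F s) = (\<Sum>s\<in>S - C. e i s * F s) + F (a i)"
proof -
  have "(\<Sum>s\<in>S. e i s * F s) = (\<Sum>s\<in>S - C. e i s * F s) + (\<Sum>s\<in>C. e i s * F s)"
    by (rule sum.subset_diff[OF C S])
  also have "(\<Sum>s\<in>C. e i s * F s) = (\<Sum>s\<in>C. if s = a i then F s else 0)"
    by (rule sum.cong) (auto simp: e[OF i])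
  finally show ?thesis using a[OF i] finite_subset[OF C S] by simp
qed

text \<open>For a prefix u, the relator replaces u b_i a_i by u l_i b_i minus the part of u b_i l_i
  with letters outside \<open>C\<close>. The products of u with the letters of l_i are normalised
  recursively; appending b_i afterwards creates no leading word because b_i is not in
  \<open>C\<close>.\<close>

lemma act_letter_cong:
  "v \<in> lists S \<Longrightarrow> s \<in> S \<Longrightarrow> act_letter v s \<ominus>\<^bsub>T\<^esub> basis_vec (rev v @ [s]) \<in> I"
proof (induction v arbitrary: s)
  case Nil
  then show ?case
    using letter_T[of s] T.diff_eq_zero[of "basis_vec [s]" "basis_vec [s]"] csubD(2)[OF csub_I] by simp
next
  case (Cons c v)
  have c: "c \<in> S" and v: "v \<in> lists S" and s: "s \<in> S" using Cons.prems by auto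
  have wT: "basis_vec (rev v @ [c, s']) \<in> carrier T" "basis_vec (rev v @ [s', c]) \<in> carrier T"
    "basis_vec (rev v @ [s']) \<in> carrier T" if "s' \<in> S" for s'
    using that v c by (auto intro!: word_T simp: lists_eq_set)
  show ?case
  proof (cases "redex c s")
    case False
    then show ?thesis
      using wT(1)[OF s] T.diff_eq_zero[of "basis_vec (rev v @ [c, s])" "basis_vec (rev v @ [c, s])"]
        csubD(2)[OF csub_I] by simp
  next
    case True
    then obtain i where i: "i < m" "c = b i" "s = a i" by (auto simp: redex_def)
    have idx: "idx c s = i" using redex_rel i by simp
    have vT: "basis_vec (rev v) \<in> carrier T" using v by (intro word_T) (auto simp: lists_eq_set)
    note cT = letter_T[OF c]
    let ?d = "\<lambda>s'. (act_letter v s' \<ominus>\<^bsub>T\<^esub> basis_vec (rev v @ [s'])) \<cdot> basis_vec [c]"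
    have dI: "?d s' \<in> I" if "s' \<in> S" for s'
      using I_r[OF Cons.IH[OF v that] cT] .
    have "finsum T (\<lambda>s'. e i s' \<star> ?d s') S \<in> I"
      using dI csubD(4)[OF csub_I] by (intro T.csub_finsum[OF csub_I S]) auto
    moreover have "basis_vec (rev v) \<cdot> rel i \<in> I"
      using I_l[OF rel_I[OF i(1)] vT] .
    ultimately have "finsum T (\<lambda>s'. e i s' \<star> ?d s') S \<ominus>\<^bsub>T\<^esub> basis_vec (rev v) \<cdot> rel i \<in> I"
      by (rule T.csub_diff[OF csub_I])
    also have "finsum T (\<lambda>s'. e i s' \<star> ?d s') S \<ominus>\<^bsub>T\<^esub> basis_vec (rev v) \<cdot> rel i =
        act_letter (c # v) s \<ominus>\<^bsub>T\<^esub> basis_vec (rev (c # v) @ [s])"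
    proof
      fix w
      note al = act_letter_closed[OF v]
      \<comment> \<open>Coefficients of \<open>w\<close> in the normalised product followed by
        \<open>c\<close>, in the word with \<open>c\<close> before \<open>s'\<close>, and in the
        word with \<open>c\<close> after \<open>s'\<close>.\<close>
      define P Q G where "P s' = (act_letter v s' \<cdot> basis_vec [c]) w"
        and "Q s' = basis_vec (rev v @ [c, s']) w" and "G s' = basis_vec (rev v @ [s', c]) w" for s'
      have d: "?d s' w = P s' - G s'" if "s' \<in> S" for s'
      proof -
        have "?d s' = act_letter v s' \<cdot> basis_vec [c] \<ominus>\<^bsub>T\<^esub> basis_vec (rev v @ [s', c])"
          unfolding T.mult_diff_left[OF cT al[OF that] wT(3)[OF that]] by (simp add: free_assoc_mult_basis)
        then show ?thesis by (simp add: free_assoc_diff wT(2)[OF that] P_def G_def)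
      qed
      have 1: "finsum T (\<lambda>s'. e i s' \<star> ?d s') S w = (\<Sum>s'\<in>S. e i s' * (P s' - G s'))"
        using dI I_closed d by (subst free_assoc_lincomb) auto
      have r1: "basis_vec (rev v) \<cdot> (basis_vec [c] \<cdot> lform i) =
          basis_vec (rev v @ [c]) \<cdot> lform i"
        using T_assoc[OF vT cT lform_closed[of i]]
        by (simp add: free_assoc_mult_basis)
      have r2: "basis_vec (rev v) \<cdot> (lform i \<cdot> basis_vec [c]) =
          (basis_vec (rev v) \<cdot> lform i) \<cdot> basis_vec [c]"
        using T_assoc[OF vT lform_closed[of i] cT] by simp
      have vcT: "basis_vec (rev v @ [c]) \<in> carrier T" by (rule wT(3)[OF c])
      have r3: "(basis_vec (rev v @ [c]) \<cdot> lform i) w = (\<Sum>s'\<in>S. e i s' * Q s')"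
        unfolding lform_mult(1)[OF vcT] using wT
        by (subst free_assoc_lincomb) (auto simp: free_assoc_mult_basis Q_def)
      have vl: "(\<lambda>s. e i s \<star> (basis_vec (rev v) \<cdot> basis_vec [s])) \<in> S \<rightarrow> carrier T"
        using vT letter_T by auto
      have r4: "((basis_vec (rev v) \<cdot> lform i) \<cdot> basis_vec [c]) w = (\<Sum>s'\<in>S. e i s' * G s')"
      proof -
        have "((basis_vec (rev v) \<cdot> lform i) \<cdot> basis_vec [c]) w =
            finsum T (\<lambda>s. (e i s \<star> (basis_vec (rev v) \<cdot> basis_vec [s])) \<cdot> basis_vec [c]) S w"
          unfolding lform_mult(1)[OF vT] by (rule fun_cong[OF T.mult_finsum_left[OF cT vl]])
        also have "\<dots> = (\<Sum>s\<in>S. ((e i s \<star> (basis_vec (rev v) \<cdot> basis_vec [s])) \<cdot> basis_vec [c]) w)"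
          by (rule free_assoc_finsum) (use vT letter_T cT in auto)
        also have "\<dots> = (\<Sum>s'\<in>S. e i s' * G s')"
        proof (rule sum.cong[OF refl])
          fix s' assume s': "s' \<in> S"
          have "(e i s' \<star> (basis_vec (rev v) \<cdot> basis_vec [s'])) \<cdot> basis_vec [c] =
              e i s' \<star> basis_vec (rev v @ [s', c])"
            unfolding free_assoc_mult_basis T.mult_smult_left[OF wT(3)[OF s'] cT] append_assoc by simp
          then show "((e i s' \<star> (basis_vec (rev v) \<cdot> basis_vec [s'])) \<cdot> basis_vec [c]) w =
              e i s' * G s'"
            by (simp add: free_assoc_simps G_def)
        qed
        finally show ?thesis .
      qed
      have 2: "(basis_vec (rev v) \<cdot> rel i) w = (\<Sum>s'\<in>S. e i s' * Q s') - (\<Sum>s'\<in>S. e i s' * G s')"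
      proof -
        have "basis_vec (rev v) \<cdot> rel i = basis_vec (rev v @ [c]) \<cdot> lform i \<ominus>\<^bsub>T\<^esub>
            (basis_vec (rev v) \<cdot> lform i) \<cdot> basis_vec [c]"
          unfolding rel_def i(2)[symmetric] r1[symmetric] r2[symmetric]
          by (rule T.mult_diff_right) (use vT cT lform_closed in auto)
        then show ?thesis
          using vT cT lform_closed[of i] r3 r4 by (simp add: free_assoc_diff)
      qed
      have 3: "finsum T (\<lambda>s'. e i s' \<star> (act_letter v s' \<cdot> basis_vec [c])) S w = (\<Sum>s'\<in>S. e i s' * P s')"
        using al cT by (subst free_assoc_lincomb) (auto simp: P_def)
      have 4: "finsum T (\<lambda>s'. e i s' \<star> basis_vec (rev v @ [c, s'])) (S - C) w =
          (\<Sum>s'\<in>S - C. e i s' * Q s')"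
        using wT by (subst free_assoc_lincomb) (auto simp: Q_def)
      have fc: "finsum T (\<lambda>s'. e i s' \<star> basis_vec (rev v @ [c, s'])) (S - C) \<in> carrier T"
        using wT by (intro T.finsum_closed) auto
      have "(finsum T (\<lambda>s'. e i s' \<star> ?d s') S \<ominus>\<^bsub>T\<^esub> basis_vec (rev v) \<cdot> rel i) w =
          (\<Sum>s'\<in>S. e i s' * (P s' - G s')) - ((\<Sum>s'\<in>S. e i s' * Q s') - (\<Sum>s'\<in>S. e i s' * G s'))"
        using T.mult_closed[OF vT rel_closed[OF i(1)]] 1 2 by (simp add: free_assoc_diff)
      also have "\<dots> = (\<Sum>s'\<in>S. e i s' * P s') - (\<Sum>s'\<in>S - C. e i s' * Q s') - Q (a i)"
        by (simp add: right_diff_distrib sum_subtractf lform_split[OF i(1), of Q])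
      also have "\<dots> = (act_letter (c # v) s \<ominus>\<^bsub>T\<^esub> basis_vec (rev (c # v) @ [s])) w"
        using True wT(1)[OF s] fc
        by (simp add: idx free_assoc_diff 3 4 Q_def flip: i(3))
      finally show "(finsum T (\<lambda>s'. e i s' \<star> ?d s') S \<ominus>\<^bsub>T\<^esub> basis_vec (rev v) \<cdot> rel i) w =
          (act_letter (c # v) s \<ominus>\<^bsub>T\<^esub> basis_vec (rev (c # v) @ [s])) w" .
    qed
    finally show ?thesis .
  qed
qed

definition ract :: "'a \<Rightarrow> ('a list \<Rightarrow> complex) \<Rightarrow> 'a list \<Rightarrow> complex" where
  "ract s = lin_ext T (\<lambda>w. act_letter (rev w) s)"

lemma ract_words: "s \<in> S \<Longrightarrow> (\<lambda>w. act_letter (rev w) s) \<in> lists S \<rightarrow> carrier T"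
  by (auto intro!: act_letter_closed simp: lists_eq_set)

lemma clin_ract: "s \<in> S \<Longrightarrow> clin T T (ract s)"
  unfolding ract_def by (rule T.clin_free_assoc[OF ract_words])

lemma ract_basis: "s \<in> S \<Longrightarrow> w \<in> lists S \<Longrightarrow> ract s (basis_vec w) = act_letter (rev w) s"
  unfolding ract_def
  by (rule T.lin_ext_basis[where h = "\<lambda>w. act_letter (rev w) s"]) (use ract_words in auto)

sublocale R: word_action T S ract
  by unfold_locales (rule clin_ract)

lemma ract_append:
  assumes s: "s \<in> S" "s \<notin> C" and f: "f \<in> carrier T"
  shows "ract s f = f \<cdot> basis_vec [s]"
  by (rule free_assoc_clin_eq[OF T.cspace_axioms clin_ract[OF s(1)] T.clin_mult_right[OF letter_T[OF s(1)]] _ f])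
    (simp add: ract_basis s act_letter_append free_assoc_mult_basis)

lemma ract_cong:
  assumes s: "s \<in> S" and f: "f \<in> carrier T"
  shows "ract s f \<ominus>\<^bsub>T\<^esub> f \<cdot> basis_vec [s] \<in> I"
proof -
  note sT = letter_T[OF s]
  have l: "clin T T (\<lambda>f. ract s f \<ominus>\<^bsub>T\<^esub> f \<cdot> basis_vec [s])"
    by (intro T.clin_diff_fun clin_ract[OF s] T.clin_mult_right[OF sT])
  have "f \<in> {f \<in> carrier T. ract s f \<ominus>\<^bsub>T\<^esub> f \<cdot> basis_vec [s] \<in> I}"
  proof (rule free_assoc_csub_induct[OF csub_vimage[OF T.cspace_axioms T.cspace_axioms l csub_I] _ f])
    fix w assume w: "w \<in> lists S"
    have "rev w \<in> lists S" using w by (auto simp: lists_eq_set)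
    then show "basis_vec w \<in> {f \<in> carrier T. ract s f \<ominus>\<^bsub>T\<^esub> f \<cdot> basis_vec [s] \<in> I}"
      using act_letter_cong[of "rev w" s] w s by (simp add: word_T ract_basis free_assoc_mult_basis)
  qed
  then show ?thesis by simp
qed

text \<open>Confluence: letting b_i and then l_i act agrees with letting l_i and then b_i act. The
  letter b_i is simply appended; when l_i acts next, its letter a_i triggers the rewriting rule, and
  the correction terms of the rule cancel the letters of l_i outside \<open>C\<close>.\<close>

lemma ract_rel:
  assumes i: "i < m" and f: "f \<in> carrier T"
  shows "R.wact (rev_series S (rel i)) f = \<zero>\<^bsub>T\<^esub>"
proof -
  note bT = letter_T[OF b_S[OF i]]
  have rl: "rev_series S (lform i) = lform i"
  proof -
    have "rev_series S (lform i) = finsum T (\<lambda>s. rev_series S (e i s \<star> basis_vec [s])) S"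
      unfolding lform_def by (rule clin_finsum[OF T.cspace_axioms T.cspace_axioms clin_rev_series lform_terms])
    also have "\<dots> = lform i"
      unfolding lform_def
      by (rule T.finsum_cong') (use letter_T in \<open>auto simp: clinD(3)[OF clin_rev_series] rev_series_basis\<close>)
    finally show ?thesis .
  qed
  have rb: "rev_series S (basis_vec [b i]) = basis_vec [b i]"
    using b_S[OF i] by (simp add: rev_series_basis)
  have rr: "rev_series S (rel i) = lform i \<cdot> basis_vec [b i] \<ominus>\<^bsub>T\<^esub> basis_vec [b i] \<cdot> lform i"
    unfolding rel_def using bT lform_closed[of i]
    by (simp add: clin_diff[OF T.cspace_axioms T.cspace_axioms clin_rev_series] rev_series_mult rl rb)
  have wl: "R.wact (lform i) f = finsum T (\<lambda>s. e i s \<star> ract s f) S" if f: "f \<in> carrier T" for f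
  proof -
    have "R.wact (lform i) f = finsum T (\<lambda>s. R.wact (e i s \<star> basis_vec [s]) f) S"
      unfolding lform_def by (rule clin_finsum[OF T.cspace_axioms T.cspace_axioms R.clin_wact[OF f] lform_terms])
    also have "\<dots> = finsum T (\<lambda>s. e i s \<star> ract s f) S"
      by (rule T.finsum_cong')
        (use letter_T f clinD(1)[OF clin_ract] in \<open>auto simp: clinD(3)[OF R.clin_wact[OF f]] R.wact_basis\<close>)
    finally show ?thesis .
  qed
  have wb: "R.wact (basis_vec [b i]) f = f \<cdot> basis_vec [b i]" if f: "f \<in> carrier T" for f
    using f b_S[OF i] b_C[OF i] by (simp add: R.wact_basis ract_append)
  have main: "finsum T (\<lambda>s. e i s \<star> ract s (f \<cdot> basis_vec [b i])) S =
      finsum T (\<lambda>s. e i s \<star> ract s f) S \<cdot> basis_vec [b i]"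
  proof (rule free_assoc_clin_eq[OF T.cspace_axioms _ _ _ f])
    show "clin T T (\<lambda>f. finsum T (\<lambda>s. e i s \<star> ract s (f \<cdot> basis_vec [b i])) S)"
      by (intro T.clin_finsum_fun T.clin_smult_fun clin_comp[OF T.clin_mult_right[OF bT] clin_ract])
    show "clin T T (\<lambda>f. finsum T (\<lambda>s. e i s \<star> ract s f) S \<cdot> basis_vec [b i])"
      by (intro clin_comp[OF _ T.clin_mult_right[OF bT]] T.clin_finsum_fun T.clin_smult_fun clin_ract)
    fix w assume w: "w \<in> lists S"
    then have rw: "rev w \<in> lists S" by (auto simp: lists_eq_set)
    let ?c = "b i"
    have wb: "w @ [?c] \<in> lists S" using w b_S[OF i] by simp
    have wT': "basis_vec (w @ [?c, s]) \<in> carrier T" if "s \<in> S" for s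
      using that w b_S[OF i] by (intro word_T) simp
    note al = act_letter_closed[OF rw]
    have alc: "act_letter (?c # rev w) s \<in> carrier T" if "s \<in> S" for s
      by (rule act_letter_closed[OF _ that]) (use rw b_S[OF i] in simp)
    have right: "finsum T (\<lambda>s. e i s \<star> act_letter (rev w) s) S \<cdot> basis_vec [?c] =
        finsum T (\<lambda>s. e i s \<star> (act_letter (rev w) s \<cdot> basis_vec [?c])) S"
    proof -
      have "(\<lambda>s. e i s \<star> act_letter (rev w) s) \<in> S \<rightarrow> carrier T" using al by auto
      then have "finsum T (\<lambda>s. e i s \<star> act_letter (rev w) s) S \<cdot> basis_vec [?c] =
          finsum T (\<lambda>s. (e i s \<star> act_letter (rev w) s) \<cdot> basis_vec [?c]) S"
        by (rule T.mult_finsum_left[OF bT])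
      also have "\<dots> = finsum T (\<lambda>s. e i s \<star> (act_letter (rev w) s \<cdot> basis_vec [?c])) S"
        by (rule T.finsum_cong') (use al bT in \<open>auto simp: T.mult_smult_left\<close>)
      finally show ?thesis .
    qed
    have "finsum T (\<lambda>s. e i s \<star> act_letter (?c # rev w) s) S =
        finsum T (\<lambda>s. e i s \<star> (act_letter (rev w) s \<cdot> basis_vec [?c])) S"
    proof
      fix v
      have fc: "finsum T (\<lambda>s. e i s \<star> basis_vec (w @ [?c, s])) (S - C) \<in> carrier T"
        using wT' by (intro T.finsum_closed) auto
      have "finsum T (\<lambda>s. e i s \<star> act_letter (?c # rev w) s) S v =
          (\<Sum>s\<in>S. e i s * act_letter (?c # rev w) s v)"
        by (rule free_assoc_lincomb[OF alc])
      also have "\<dots> = (\<Sum>s\<in>S - C. e i s * act_letter (?c # rev w) s v) + act_letter (?c # rev w) (a i) v"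
        by (rule lform_split[OF i])
      also have "(\<Sum>s\<in>S - C. e i s * act_letter (?c # rev w) s v) =
          (\<Sum>s\<in>S - C. e i s * basis_vec (w @ [?c, s]) v)"
        by (rule sum.cong) (simp_all add: act_letter_append del: act_letter.simps)
      also have "\<dots> = finsum T (\<lambda>s. e i s \<star> basis_vec (w @ [?c, s])) (S - C) v"
        using wT' by (subst free_assoc_lincomb) auto
      also have "act_letter (?c # rev w) (a i) v =
          finsum T (\<lambda>s. e i s \<star> (act_letter (rev w) s \<cdot> basis_vec [?c])) S v -
          finsum T (\<lambda>s. e i s \<star> basis_vec (w @ [?c, s])) (S - C) v"
        using fc redex_rel[OF i] by (simp add: free_assoc_diff)
      finally show "finsum T (\<lambda>s. e i s \<star> act_letter (?c # rev w) s) S v =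
          finsum T (\<lambda>s. e i s \<star> (act_letter (rev w) s \<cdot> basis_vec [?c])) S v" by simp
    qed
    moreover have "finsum T (\<lambda>s. e i s \<star> ract s (basis_vec w \<cdot> basis_vec [?c])) S =
        finsum T (\<lambda>s. e i s \<star> act_letter (?c # rev w) s) S"
      by (rule T.finsum_cong')
        (use alc wb in \<open>auto simp: free_assoc_mult_basis ract_basis simp del: act_letter.simps\<close>)
    moreover have "finsum T (\<lambda>s. e i s \<star> ract s (basis_vec w)) S =
        finsum T (\<lambda>s. e i s \<star> act_letter (rev w) s) S"
      by (rule T.finsum_cong') (use al w in \<open>auto simp: ract_basis simp del: act_letter.simps\<close>)
    ultimately show "finsum T (\<lambda>s. e i s \<star> ract s (basis_vec w \<cdot> basis_vec [?c])) S =
        finsum T (\<lambda>s. e i s \<star> ract s (basis_vec w)) S \<cdot> basis_vec [?c]"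
      using right by simp
  qed
  have fb: "f \<cdot> basis_vec [b i] \<in> carrier T" using f bT by simp
  have "R.wact (rev_series S (rel i)) f =
      R.wact (lform i) (R.wact (basis_vec [b i]) f) \<ominus>\<^bsub>T\<^esub> R.wact (basis_vec [b i]) (R.wact (lform i) f)"
    unfolding rr using f bT lform_closed[of i]
    by (simp add: clin_diff[OF T.cspace_axioms T.cspace_axioms R.clin_wact] R.wact_mult)
  also have "R.wact (basis_vec [b i]) (R.wact (lform i) f) =
      R.wact (lform i) (R.wact (basis_vec [b i]) f)"
    using main wb[OF R.wact_closed[OF lform_closed[of i] f]] by (simp only: wb[OF f] wl[OF f] wl[OF fb])
  also have "R.wact (lform i) (R.wact (basis_vec [b i]) f) \<ominus>\<^bsub>T\<^esub>
      R.wact (lform i) (R.wact (basis_vec [b i]) f) = \<zero>\<^bsub>T\<^esub>"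
    using f bT lform_closed[of i] by (simp add: T.diff_eq_zero)
  finally show ?thesis .
qed

text \<open>The letters act on the empty word in reading order; the reversal is there because
  \<open>R.wact\<close> lets the rightmost letter act first.\<close>

definition nf :: "('a list \<Rightarrow> complex) \<Rightarrow> 'a list \<Rightarrow> complex" where
  "nf t = R.wact (rev_series S t) (basis_vec [])"

lemma one_T: "basis_vec [] \<in> carrier T"
  by (rule word_T) simp

lemma clin_nf: "clin T T nf"
  unfolding nf_def[abs_def] by (rule clin_comp[OF clin_rev_series R.clin_wact[OF one_T]])

text \<open>Elements whose reversal annihilates T form a two-sided ideal, which contains the
  relators by \<open>ract_rel\<close>.\<close>

lemma nf_I:
  assumes t: "t \<in> I"
  shows "nf t = \<zero>\<^bsub>T\<^esub>"
proof -
  let ?K = "{f \<in> carrier T. \<forall>v\<in>carrier T. R.wact f v = \<zero>\<^bsub>T\<^esub>}"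
  note K_l = ideal.I_l_closed[OF R.ideal_annihilator]
    and K_r = ideal.I_r_closed[OF R.ideal_annihilator]
  have "ideal {t \<in> carrier T. rev_series S t \<in> ?K} T"
  proof (rule csub_free_assoc_ideal)
    show "csub T {t \<in> carrier T. rev_series S t \<in> ?K}"
      by (rule csub_vimage[OF T.cspace_axioms T.cspace_axioms clin_rev_series
          free_assoc_ideal_csub[OF R.ideal_annihilator]])
    fix f x assume f: "f \<in> {t \<in> carrier T. rev_series S t \<in> ?K}" and x: "x \<in> carrier T"
    have fT: "f \<in> carrier T" and fK: "rev_series S f \<in> ?K" using f by auto
    note xr = clinD(1)[OF clin_rev_series x]
    show "x \<cdot> f \<in> {t \<in> carrier T. rev_series S t \<in> ?K}"
      using rev_series_mult[OF x fT] K_r[OF fK xr] T.mult_closed[OF x fT] by simp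
    show "f \<cdot> x \<in> {t \<in> carrier T. rev_series S t \<in> ?K}"
      using rev_series_mult[OF fT x] K_l[OF fK xr] T.mult_closed[OF fT x] by simp
  qed
  then have "I \<subseteq> {t \<in> carrier T. rev_series S t \<in> ?K}"
    by (rule I_minimal) (auto simp: rel_closed ract_rel clinD(1)[OF clin_rev_series])
  then show ?thesis using t one_T by (auto simp: nf_def)
qed

lemma nf_letter:
  assumes s: "s \<in> S" and t: "t \<in> carrier T"
  shows "nf (t \<cdot> basis_vec [s]) = ract s (nf t)"
  using rev_series_mult[OF t letter_T[OF s]] clinD(1)[OF clin_rev_series t] one_T s
    R.wact_mult[OF letter_T[OF s] clinD(1)[OF clin_rev_series t] one_T]
    R.wact_closed[OF clinD(1)[OF clin_rev_series t] one_T]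
  by (simp add: nf_def rev_series_basis R.wact_basis)

lemma nf_cong:
  assumes t: "t \<in> carrier T"
  shows "t \<ominus>\<^bsub>T\<^esub> nf t \<in> I"
proof -
  have l: "clin T T (\<lambda>t. t \<ominus>\<^bsub>T\<^esub> nf t)"
    by (intro T.clin_diff_fun clin_nf) (simp add: clin_def)
  have "t \<in> {t \<in> carrier T. t \<ominus>\<^bsub>T\<^esub> nf t \<in> I}"
  proof (rule free_assoc_csub_induct[OF csub_vimage[OF T.cspace_axioms T.cspace_axioms l csub_I] _ t])
    fix w assume "w \<in> lists S"
    then have "basis_vec w \<ominus>\<^bsub>T\<^esub> nf (basis_vec w) \<in> I"
    proof (induction w rule: rev_induct)
      case Nil
      have "nf (basis_vec []) = basis_vec []"
        using one_T by (simp add: nf_def rev_series_basis R.wact_basis)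
      then show ?case
        using T.diff_eq_zero[OF one_T one_T] csubD(2)[OF csub_I] by simp
    next
      case (snoc s w)
      have s: "s \<in> S" and w: "w \<in> lists S" using snoc.prems by auto
      note wT = word_T[OF w] and nT = clinD(1)[OF clin_nf word_T[OF w]] and sT = letter_T[OF s]
      have ws: "basis_vec (w @ [s]) = basis_vec w \<cdot> basis_vec [s]"
        by (simp add: free_assoc_mult_basis)
      have "(basis_vec w \<ominus>\<^bsub>T\<^esub> nf (basis_vec w)) \<cdot> basis_vec [s] \<ominus>\<^bsub>T\<^esub>
          (ract s (nf (basis_vec w)) \<ominus>\<^bsub>T\<^esub> nf (basis_vec w) \<cdot> basis_vec [s]) \<in> I"
        using I_r[OF snoc.IH[OF w] sT] ract_cong[OF s nT] by (rule T.csub_diff[OF csub_I])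
      also have "(basis_vec w \<ominus>\<^bsub>T\<^esub> nf (basis_vec w)) \<cdot> basis_vec [s] \<ominus>\<^bsub>T\<^esub>
          (ract s (nf (basis_vec w)) \<ominus>\<^bsub>T\<^esub> nf (basis_vec w) \<cdot> basis_vec [s]) =
          basis_vec (w @ [s]) \<ominus>\<^bsub>T\<^esub> ract s (nf (basis_vec w))"
        unfolding ws T.mult_diff_left[OF sT wT nT]
        using wT nT sT clinD(1)[OF clin_ract[OF s] nT] T.mult_closed[OF nT sT]
          T.mult_closed[OF wT sT]
        by (simp add: a_minus_def T.minus_add T.a_ac T.r_neg1 T.r_neg2)
      also have "ract s (nf (basis_vec w)) = nf (basis_vec (w @ [s]))"
        unfolding ws by (rule nf_letter[OF s wT, symmetric])
      finally show ?case .
    qed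
    then show "basis_vec w \<in> {t \<in> carrier T. t \<ominus>\<^bsub>T\<^esub> nf t \<in> I}"
      using word_T \<open>w \<in> lists S\<close> by simp
  qed
  then show ?thesis by simp
qed

text \<open>In t (b_i l_i - l_i b_i) the second product ends in b_i, which is not in
  \<open>C\<close>; in the first, the only final letter from \<open>C\<close> is a_i, with
  coefficient one.\<close>

lemma right_quot_rel:
  assumes i: "i < m" and t: "t \<in> carrier T" and s: "s \<in> C"
  shows "right_quot s (t \<cdot> rel i) = (if s = a i then t \<cdot> basis_vec [b i] else (\<lambda>_. 0))"
proof
  fix w
  note bT = letter_T[OF b_S[OF i]] and lT = lform_closed[of i]
  have "t \<cdot> rel i = (t \<cdot> basis_vec [b i]) \<cdot> lform i \<ominus>\<^bsub>T\<^esub>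
      (t \<cdot> lform i) \<cdot> basis_vec [b i]"
    using t bT lT T_assoc[OF t bT lT]
      T_assoc[OF t lT bT] by (simp add: rel_def T.mult_diff_right)
  then have "right_quot s (t \<cdot> rel i) w =
      ((t \<cdot> basis_vec [b i]) \<cdot> lform i) (w @ [s]) -
      ((t \<cdot> lform i) \<cdot> basis_vec [b i]) (w @ [s])"
    using t bT lT by (simp add: right_quot_def free_assoc_diff)
  also have "((t \<cdot> lform i) \<cdot> basis_vec [b i]) (w @ [s]) = 0"
    using t lT b_S[OF i] b_C[OF i] s by (auto simp: free_assoc_mult_letter)
  also have "((t \<cdot> basis_vec [b i]) \<cdot> lform i) (w @ [s]) =
      (\<Sum>c\<in>S. e i c * ((t \<cdot> basis_vec [b i]) \<cdot> basis_vec [c]) (w @ [s]))"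
    using t bT letter_T
    by (subst lform_mult(1), simp, subst free_assoc_lincomb) auto
  also have "\<dots> = (\<Sum>c\<in>S. if c = s then e i c * (t \<cdot> basis_vec [b i]) w else 0)"
    using t bT by (intro sum.cong) (auto simp: free_assoc_mult_letter)
  also have "\<dots> = e i s * (t \<cdot> basis_vec [b i]) w"
    using S C s by auto
  finally show "right_quot s (t \<cdot> rel i) w =
      (if s = a i then t \<cdot> basis_vec [b i] else (\<lambda>_. 0)) w"
    using e[OF i s] by simp
qed

text \<open>The derivative at a_j leaves the sum of t_i b_i over those i with a_i = a_j, and this
  lies in I. Its normal form is the sum of the \<open>nf (t i)\<close> with b_i appended. Since
  these b_i are distinct, each summand vanishes, so \<open>nf (t j)\<close> is zero and
  \<open>t j\<close> is in I.\<close>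

theorem relators_independent:
  assumes t: "t \<in> {..<m} \<rightarrow> carrier T"
    and comb: "\<And>s. s \<in> S \<Longrightarrow> right_quot s (finsum T (\<lambda>i. t i \<cdot> rel i) {..<m}) \<in> I"
    and j: "j < m"
  shows "t j \<in> I"
proof -
  have tT: "t i \<in> carrier T" if "i < m" for i using t that by auto
  have nT: "nf (t i) \<in> carrier T" if "i < m" for i by (rule clinD(1)[OF clin_nf tT[OF that]])
  let ?P = "\<lambda>i. if a j = a i then t i \<cdot> basis_vec [b i] else \<zero>\<^bsub>T\<^esub>"
  have PT: "?P \<in> {..<m} \<rightarrow> carrier T" using tT letter_T b_S by auto
  have "right_quot (a j) (finsum T (\<lambda>i. t i \<cdot> rel i) {..<m}) =
      finsum T (\<lambda>i. right_quot (a j) (t i \<cdot> rel i)) {..<m}"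
    using tT rel_closed by (intro clin_finsum[OF T.cspace_axioms T.cspace_axioms clin_right_quot]) auto
  also have "\<dots> = finsum T ?P {..<m}"
    by (rule T.finsum_cong'[OF refl PT]) (use tT a[OF j] in \<open>auto simp: right_quot_rel free_assoc_simps\<close>)
  finally have "finsum T ?P {..<m} \<in> I" using comb[OF a_S[OF j]] by simp
  then have "\<zero>\<^bsub>T\<^esub> = nf (finsum T ?P {..<m})" by (simp add: nf_I)
  also have "\<dots> = finsum T (\<lambda>i. nf (?P i)) {..<m}"
    by (rule clin_finsum[OF T.cspace_axioms T.cspace_axioms clin_nf PT])
  finally have zero: "finsum T (\<lambda>i. nf (?P i)) {..<m} = \<zero>\<^bsub>T\<^esub>" by simp
  have nfP: "nf (?P i) = (if a j = a i then nf (t i) \<cdot> basis_vec [b i] else \<zero>\<^bsub>T\<^esub>)" if i: "i < m" for i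
    using nf_letter[OF b_S[OF i] tT[OF i]] ract_append[OF b_S[OF i] b_C[OF i] nT[OF i]]
      clin_zero[OF T.cspace_axioms T.cspace_axioms clin_nf] by simp
  have "nf (t j) w = 0" for w
  proof -
    have "0 = (\<Sum>i<m. nf (?P i) (w @ [b j]))"
      using zero fun_cong[OF zero, of "w @ [b j]"] clinD(1)[OF clin_nf] PT
      by (subst (asm) free_assoc_finsum) (auto simp: free_assoc_simps)
    also have "\<dots> = (\<Sum>i<m. if i = j then nf (t j) w else 0)"
      by (rule sum.cong)
        (use nT b_S inj[OF _ j] in \<open>auto simp: nfP free_assoc_mult_letter free_assoc_simps\<close>)
    finally show ?thesis using j by simp
  qed
  then have "nf (t j) = \<zero>\<^bsub>T\<^esub>" by (simp add: free_assoc_simps fun_eq_iff)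
  then show ?thesis
    using nf_cong[OF tT[OF j]] tT[OF j] T.minus_equality[of "\<zero>\<^bsub>T\<^esub>" "\<zero>\<^bsub>T\<^esub>"]
    by (simp add: a_minus_def)
qed

end

lemma magnus_degree_one:
  assumes "g \<in> carrier (free_group S)" "h \<in> carrier (free_group S)"
  shows "magnus (g \<otimes>\<^bsub>free_group S\<^esub> h) [s] = magnus g [s] + magnus h [s]"
  using hom_mult[OF magnus_hom assms] by (simp add: PS_mult magnus_empty conv.simps(2))

lemma magnus_degree_one_one: "magnus \<one>\<^bsub>free_group S\<^esub> [s] = 0"
  by (simp add: free_group_one magnus_Nil basis_vec_def)

lemma magnus_degree_one_inv:
  assumes "g \<in> carrier (free_group S)"
  shows "magnus (inv\<^bsub>free_group S\<^esub> g) [s] = - magnus g [s]"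
proof -
  interpret F: group "free_group S" by (rule group_free_group)
  have "magnus (inv\<^bsub>free_group S\<^esub> g \<otimes>\<^bsub>free_group S\<^esub> g) [s] =
      magnus (inv\<^bsub>free_group S\<^esub> g) [s] + magnus g [s]"
    using assms by (intro magnus_degree_one) auto
  then show ?thesis
    using assms magnus_degree_one_one[of S s] by (simp add: eq_neg_iff_add_eq_0)
qed

lemma magnus_degree_one_letter: "magnus (letter t) [s] = (if s = t then 1 else 0)"
  by (auto simp: magnus_letter letter_series_def)

text \<open>The coefficient \<open>magnus g [s]\<close> is the exponent sum of \<open>s\<close> in
  \<open>g\<close>. Both sides are additive in \<open>g\<close> and agree on letters.\<close>

lemma gcls_one_expand:
  assumes S: "finite S" and g: "g \<in> carrier (free_group S)"
  shows "gcls (free_group S) 1 g = finsum (gr (free_group S))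
    (\<lambda>s. magnus g [s] \<odot>\<^bsub>gr (free_group S)\<^esub> gcls (free_group S) 1 (letter s)) S"
proof -
  let ?F = "free_group S" and ?L = "gr (free_group S)"
  interpret F: group ?F by (rule group_free_group)
  interpret L: clie ?L by (rule F.clie_gr)
  let ?x = "\<lambda>s. gcls ?F 1 (letter s)" and ?e = "\<lambda>g. finsum ?L (\<lambda>s. magnus g [s] \<odot>\<^bsub>?L\<^esub> gcls ?F 1 (letter s)) S"
  have x: "?x s \<in> carrier ?L" if "s \<in> S" for s
    using that by (intro F.gcls_closed) (auto intro: letter_closed)
  have ec: "?e g \<in> carrier ?L" for g using x by (intro L.finsum_closed) auto
  have add: "?e (g \<otimes>\<^bsub>?F\<^esub> h) = ?e g \<oplus>\<^bsub>?L\<^esub> ?e h" if "g \<in> carrier ?F" "h \<in> carrier ?F" for g h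
  proof -
    have "?e (g \<otimes>\<^bsub>?F\<^esub> h) = finsum ?L (\<lambda>s. magnus g [s] \<odot>\<^bsub>?L\<^esub> ?x s \<oplus>\<^bsub>?L\<^esub> magnus h [s] \<odot>\<^bsub>?L\<^esub> ?x s) S"
      by (rule L.finsum_cong') (use x that in \<open>auto simp: magnus_degree_one L.smult_l_distr\<close>)
    also have "\<dots> = ?e g \<oplus>\<^bsub>?L\<^esub> ?e h" using x by (intro L.finsum_addf) auto
    finally show ?thesis .
  qed
  have let1: "?e (letter t) = ?x t" if t: "t \<in> S" for t
  proof -
    have "?e (letter t) = finsum ?L (\<lambda>s. if t = s then ?x s else \<zero>\<^bsub>?L\<^esub>) S"
      by (rule L.finsum_cong') (use x in \<open>auto simp: magnus_degree_one_letter\<close>)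
    also have "\<dots> = ?x t"
      using L.add.finprod_singleton[of t S ?x] S t x by auto
    finally show ?thesis .
  qed
  have zero: "?e \<one>\<^bsub>?F\<^esub> = \<zero>\<^bsub>?L\<^esub>"
  proof -
    have "?e \<one>\<^bsub>?F\<^esub> = finsum ?L (\<lambda>s. \<zero>\<^bsub>?L\<^esub>) S"
      by (rule L.finsum_cong') (use x in \<open>auto simp: magnus_degree_one_one\<close>)
    then show ?thesis by simp
  qed
  show ?thesis
    using g
  proof (induction rule: free_group_induct)
    case one
    then show ?case using zero F.gcls_one[of 1] by simp
  next
    case (letter s v)
    then show ?case
      using add[of "letter s" v] F.gcls_mult[of 1 "letter s" v] let1[OF letter(1)]
        letter_closed[OF letter(1)] by simp
  next
    case (inverse s v)
    have s: "letter s \<in> carrier ?F" by (rule letter_closed[OF inverse(1)])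
    have "?e (inv\<^bsub>?F\<^esub> letter s) \<oplus>\<^bsub>?L\<^esub> ?e (letter s) = \<zero>\<^bsub>?L\<^esub>"
      using add[of "inv\<^bsub>?F\<^esub> letter s" "letter s"] s zero by simp
    then have "?e (inv\<^bsub>?F\<^esub> letter s) = gcls ?F 1 (inv\<^bsub>?F\<^esub> letter s)"
      using ec L.minus_equality[of "?e (inv\<^bsub>?F\<^esub> letter s)" "?e (letter s)"] let1[OF inverse(1)]
        F.gcls_inv[of 1 "letter s"] s by simp
    then show ?case
      using add[of "inv\<^bsub>?F\<^esub> letter s" v] F.gcls_mult[of 1 "inv\<^bsub>?F\<^esub> letter s" v] inverse s by simp
  qed
qed

text \<open>The coefficients of l_i are the exponent sums of \<open>w i\<close>, so the initial form
  of the relator, in degree two, is [b_i, l_i].\<close>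

locale commutator_relators = inert_relators S C m b a "\<lambda>i s. magnus (w i) [s]" + clie L
  for S C :: "'a set" and m and b a :: "nat \<Rightarrow> 'a" and w :: "nat \<Rightarrow> 'a gword"
    and L :: "(complex, (nat \<times> 'a gword \<Rightarrow> complex) set) module" (structure) +
  fixes F :: "'a gword monoid" and rs :: "'a gword list"
  assumes F_eq: "F = free_group S" and L_eq: "L = gr F"
    and w: "i < m \<Longrightarrow> w i \<in> carrier F"
    and rs: "rs = map (\<lambda>i. commutator F (letter (b i)) (w i)) [0..<m]"
begin

text \<open>Freeness is tested in T through the Magnus map. It sends J into I and [J,J] into I T_+,
  and a coefficient \<open>t\<close> acting on J becomes left multiplication by \<open>t\<close>
  modulo I T_+. A combination of initial forms in [J,J] thus yields a sum of t_i [b_i, l_i] in I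
  T_+, and \<open>relators_independent\<close> puts the t_i into I, which maps to zero in
  U(L/J).\<close>

lemma relators_free:
  shows "set rs \<subseteq> carrier F - {\<one>\<^bsub>F\<^esub>}"
    and "J = lie_ideal_gen L (initial_form F ` set rs) \<Longrightarrow>
      free_module_on (uea (alg_quot L J)) (adjoint_module L J)
        (map (\<lambda>r. lie_derived L J +> initial_form F r) rs)"
proof -
  interpret F: group F unfolding F_eq by (rule group_free_group)
  let ?mg = "gr_magnus S"
  note F_closed = F.gcls_closed[folded L_eq] and F_bracket = F.gcls_bracket[folded L_eq]
    and F_zero = F.gcls_zero[folded L_eq]
  define x where "x s = gcls F 1 (letter s)" for s
  have letF: "letter s \<in> carrier F" if "s \<in> S" for s
    using letter_closed[OF that] by (simp add: F_eq)
  have x: "x s \<in> carrier L" if "s \<in> S" for s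
    unfolding x_def using letF[OF that] by (intro F_closed) auto
  note mg = clin_gr_magnus[OF S, folded F_eq L_eq]
  have mgx: "?mg (x s) = basis_vec [s]" if "s \<in> S" for s
    unfolding x_def F_eq by (rule gr_magnus_letter[OF S that])
  have mgb: "?mg (y \<otimes> z) = ?mg y \<cdot> ?mg z \<ominus>\<^bsub>T\<^esub> ?mg z \<cdot> ?mg y"
    if "y \<in> carrier L" "z \<in> carrier L" for y z
    using gr_magnus_bracket[OF S, folded F_eq L_eq, of y z] that by simp
  define r where "r i = commutator F (letter (b i)) (w i)" for i
  define cw where "cw i = gcls F 1 (w i)" for i
  have cw: "cw i \<in> carrier L" if "i < m" for i
    unfolding cw_def using w[OF that] by (intro F_closed) auto
  have cw_expand: "cw i = finsum L (\<lambda>s. magnus (w i) [s] \<odot> x s) S" if "i < m" for i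
    using gcls_one_expand[OF S, folded F_eq L_eq, of "w i"] w[OF that] by (simp add: cw_def x_def)
  have xterms: "(\<lambda>s. magnus (w i) [s] \<odot> x s) \<in> S \<rightarrow> carrier L" for i
    using x by auto
  have mgw: "?mg (cw i) = lform i" if i: "i < m" for i
  proof -
    have "?mg (cw i) = finsum T (\<lambda>s. ?mg (magnus (w i) [s] \<odot> x s)) S"
      unfolding cw_expand[OF i] by (rule clin_finsum[OF cspace_axioms T.cspace_axioms mg xterms])
    also have "\<dots> = lform i"
      unfolding lform_def
      by (rule T.finsum_cong') (use x letter_T in \<open>auto simp: clinD(3)[OF mg] mgx\<close>)
    finally show ?thesis .
  qed
  have r2: "r i \<in> lower_central F 2" if i: "i < m" for i
    using F.commutator_lower_central[of 1 1 "letter (b i)" "w i"] letF[OF b_S[OF i]] w[OF i]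
    by (simp add: r_def numeral_2_eq_2)
  have r_cls: "gcls F 2 (r i) = x (b i) \<otimes> cw i" if i: "i < m" for i
    using F_bracket[of 1 1 "letter (b i)" "w i"] letF[OF b_S[OF i]] w[OF i]
    by (simp add: r_def x_def cw_def numeral_2_eq_2)
  have mgr: "?mg (gcls F 2 (r i)) = rel i" if i: "i < m" for i
    using mgb[OF x[OF b_S[OF i]] cw[OF i]] mgx[OF b_S[OF i]] mgw[OF i]
    by (simp add: r_cls[OF i] rel_def)
  \<comment> \<open>A nonzero derivative shows that the image in degree two is nonzero, so the
    relator has weight exactly two.\<close>
  have rel_nz: "rel i \<noteq> \<zero>\<^bsub>T\<^esub>" if i: "i < m" for i
  proof
    assume z: "rel i = \<zero>\<^bsub>T\<^esub>"
    have "right_quot (a i) (basis_vec [] \<cdot> rel i) = basis_vec [] \<cdot> basis_vec [b i]"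
      using right_quot_rel[OF i one_T a[OF i]] by simp
    moreover have "basis_vec [] \<cdot> rel i = \<zero>\<^bsub>T\<^esub>"
      unfolding z by (rule T.mult_zero_right[OF one_T])
    ultimately have "(\<lambda>w. 0) = basis_vec [b i]"
      by (simp add: right_quot_def free_assoc_simps free_assoc_mult_basis)
    from fun_cong[OF this, of "[b i]"] show False by (simp add: basis_vec_def)
  qed
  have r3: "r i \<notin> lower_central F (Suc 2)" if i: "i < m" for i
  proof
    assume "r i \<in> lower_central F (Suc 2)"
    then have "gcls F 2 (r i) = \<zero>" by (intro F_zero) auto
    then show False
      using mgr[OF i] rel_nz[OF i] clin_zero[OF cspace_axioms T.cspace_axioms mg] by simp
  qed
  have weight: "weight F (r i) = 2" if i: "i < m" for i
  proof -
    have "{k. 1 \<le> k \<and> r i \<in> lower_central F k} = {1, 2}"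
    proof (intro equalityI subsetI)
      fix k assume k: "k \<in> {k. 1 \<le> k \<and> r i \<in> lower_central F k}"
      have "\<not> 3 \<le> k"
        using F.lower_central_antimono[of 3 k] k r3[OF i] by (auto simp: numeral_3_eq_3 numeral_2_eq_2)
      then show "k \<in> {1, 2}" using k by auto
    qed (use r2[OF i] F.lower_central_closed[OF r2[OF i]] in auto)
    then show ?thesis by (simp add: weight_def cSup_eq_Max)
  qed
  have rs_r: "rs = map r [0..<m]" by (simp add: rs r_def)
  show "set rs \<subseteq> carrier F - {\<one>\<^bsub>F\<^esub>}"
    using F.lower_central_closed[OF r2] r3 F.lower_central_one by (force simp: rs_r)
  define cs where "cs = map (initial_form F) rs"
  have len: "length cs = m" by (simp add: cs_def rs_r)
  have cs_nth: "cs ! i = gcls F 2 (r i)" if "i < m" for i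
    using that weight by (simp add: cs_def rs_r initial_form_eq)
  have cs_L: "set cs \<subseteq> carrier L"
    using F_closed[OF _ r2] weight by (auto simp: cs_def rs_r initial_form_eq)
  assume "J = lie_ideal_gen L (initial_form F ` set rs)"
  then have J_def: "J = lie_ideal_gen L (set cs)" by (simp add: cs_def)
  interpret G: lie_generated L J S x
  proof (unfold_locales)
    show "lie_ideal L J" unfolding J_def by (rule lie_ideal_lie_ideal_gen[OF cs_L])
    show "V = carrier L" if "csub L V" "\<And>s. s \<in> S \<Longrightarrow> x s \<in> V"
      "\<And>s v. s \<in> S \<Longrightarrow> v \<in> V \<Longrightarrow> x s \<otimes> v \<in> V" for V
      using gr_free_group_generated[of S V, folded F_eq L_eq] that by (simp add: x_def)
  qed (rule x)
  note csJ = G.cs_J[OF cs_L J_def]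
  have mgJ: "?mg y \<in> I" if "y \<in> J" for y
  proof -
    let ?V = "{y \<in> carrier L. ?mg y \<in> I}"
    have "lie_ideal L ?V"
      unfolding lie_ideal_iff
    proof (intro conjI ballI)
      show "csub L ?V" by (rule csub_vimage[OF cspace_axioms T.cspace_axioms mg csub_I])
      fix z y assume z: "z \<in> carrier L" and y: "y \<in> ?V"
      have yL: "y \<in> carrier L" and yI: "?mg y \<in> I" using y by auto
      have "?mg (z \<otimes> y) \<in> I"
        unfolding mgb[OF z yL]
        by (intro T.csub_diff[OF csub_I] I_l I_r yI clinD(1)[OF mg z])
      then show "z \<otimes> y \<in> ?V" using z yL by simp
    qed
    moreover have "set cs \<subseteq> ?V"
    proof
      fix c assume "c \<in> set cs"
      then obtain i where "i < m" "c = cs ! i" using len by (auto simp: in_set_conv_nth)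
      then show "c \<in> ?V" using cs_nth mgr rel_I F_closed[OF _ r2] by simp
    qed
    ultimately have "J \<subseteq> ?V" unfolding J_def by (rule lie_ideal_gen_minimal)
    then show ?thesis using that by auto
  qed
  \<comment> \<open>This is I T_+ described by right quotients.\<close>
  define Q where "Q = {y \<in> carrier T. y [] = 0 \<and> (\<forall>s. right_quot s y \<in> I)}"
  have csub_Q: "csub T Q"
  proof (rule csubI)
    show "\<zero>\<^bsub>T\<^esub> \<in> Q"
      using clin_zero[OF T.cspace_axioms T.cspace_axioms clin_right_quot] csubD(2)[OF csub_I]
      by (simp add: Q_def) (simp add: free_assoc_simps)
    show "f \<oplus>\<^bsub>T\<^esub> h \<in> Q" if "f \<in> Q" "h \<in> Q" for f h
    proof -
      have fh: "f \<in> carrier T" "h \<in> carrier T" "f [] = 0" "h [] = 0"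
        and rf: "right_quot s f \<in> I" and rh: "right_quot s h \<in> I" for s
        using that by (auto simp: Q_def)
      have "right_quot s (f \<oplus>\<^bsub>T\<^esub> h) \<in> I" for s
        unfolding clinD(2)[OF clin_right_quot fh(1,2)] by (rule csubD(3)[OF csub_I rf rh])
      moreover have "(f \<oplus>\<^bsub>T\<^esub> h) [] = 0" using fh by (simp add: free_assoc_simps)
      ultimately show ?thesis using fh by (simp add: Q_def)
    qed
    show "c \<star> f \<in> Q" if "f \<in> Q" for c f
    proof -
      have f: "f \<in> carrier T" "f [] = 0" and rf: "right_quot s f \<in> I" for s
        using that by (auto simp: Q_def)
      have "right_quot s (c \<star> f) \<in> I" for s
        unfolding clinD(3)[OF clin_right_quot f(1)] by (rule csubD(4)[OF csub_I rf])
      moreover have "(c \<star> f) [] = 0" using f by (simp add: free_assoc_simps)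
      ultimately show ?thesis using f by (simp add: Q_def)
    qed
  qed (auto simp: Q_def)
  have Q_mult: "f \<cdot> h \<in> Q" if "f \<in> carrier T" "h \<in> Q" for f h
  proof -
    have h: "h \<in> carrier T" "h [] = 0" and rh: "right_quot s h \<in> I" for s
      using that by (auto simp: Q_def)
    have "right_quot s (f \<cdot> h) \<in> I" for s
      unfolding right_quot_mult[OF that(1) h] by (rule I_l[OF rh that(1)])
    moreover have "(f \<cdot> h) [] = 0" using free_assoc_mult[OF that(1) h(1)] h(2) by simp
    ultimately show ?thesis using that(1) h(1) by (simp add: Q_def)
  qed
  have Q_I: "f \<cdot> h \<in> Q" if f: "f \<in> I" and h: "h \<in> carrier T" "h [] = 0" for f h
  proof -
    note fT = I_closed[OF f]
    have "right_quot s (f \<cdot> h) \<in> I" for s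
      unfolding right_quot_mult[OF fT h] by (rule I_r[OF f right_quot_closed[OF h(1)]])
    moreover have "(f \<cdot> h) [] = 0" using free_assoc_mult[OF fT h(1)] h(2) by simp
    ultimately show ?thesis using fT h(1) by (simp add: Q_def)
  qed
  have mgD: "?mg y \<in> Q" if "y \<in> G.D" for y
  proof -
    have "G.D \<subseteq> {y \<in> carrier L. ?mg y \<in> Q}"
    proof (rule G.D_minimal[OF csub_vimage[OF cspace_axioms T.cspace_axioms mg csub_Q]])
      fix u v assume u: "u \<in> J" and v: "v \<in> J"
      note uv = G.J_closed[OF u] G.J_closed[OF v]
      have "?mg (u \<otimes> v) \<in> Q"
        unfolding mgb[OF uv]
        by (intro T.csub_diff[OF csub_Q] Q_I mgJ u v clinD(1)[OF mg] uv I_empty)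
      then show "u \<otimes> v \<in> {y \<in> carrier L. ?mg y \<in> Q}" using uv by simp
    qed
    then show ?thesis using that by auto
  qed
  \<comment> \<open>The bracket with \<open>x s\<close> becomes left minus right multiplication by
    s. On elements of I the right multiplication lands in I T_+, so only the left one
    survives.\<close>
  have mg_word: "?mg (foldr (\<lambda>s v. x s \<otimes> v) u y) \<ominus>\<^bsub>T\<^esub> basis_vec u \<cdot> ?mg y \<in> Q"
    if y: "y \<in> J" and u: "u \<in> lists S" for u y
    using u
  proof (induction u rule: list.induct)
    case Nil
    have mT: "?mg y \<in> carrier T" using clinD(1)[OF mg G.J_closed[OF y]] .
    have "basis_vec [] \<cdot> ?mg y = ?mg y"
      using free_assoc_mult[OF one_T mT] by (simp add: conv_one_left)
    then show ?case
      using T.diff_eq_zero[OF mT mT] csubD(2)[OF csub_Q] by simp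
  next
    case (Cons s u)
    let ?z = "foldr (\<lambda>s v. x s \<otimes> v) u y"
    have s: "s \<in> S" and u: "u \<in> lists S" using Cons.prems by auto
    have zJ: "?z \<in> J" by (rule G.word_J[OF u y])
    note zL = G.J_closed[OF zJ] and sT = letter_T[OF s]
    have mz: "?mg ?z \<in> carrier T" and my: "?mg y \<in> carrier T"
      using clinD(1)[OF mg] zL G.J_closed[OF y] by auto
    have uT: "basis_vec u \<in> carrier T" by (rule word_T[OF u])
    have uy: "basis_vec u \<cdot> ?mg y \<in> carrier T" using uT my by simp
    have "basis_vec [s] \<cdot> (?mg ?z \<ominus>\<^bsub>T\<^esub> basis_vec u \<cdot> ?mg y) \<ominus>\<^bsub>T\<^esub>
        ?mg ?z \<cdot> basis_vec [s] \<in> Q"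
      by (intro T.csub_diff[OF csub_Q] Q_mult[OF sT Cons.IH[OF u]] Q_I[OF mgJ[OF zJ] sT])
        (simp add: basis_vec_def)
    also have "basis_vec [s] \<cdot> (?mg ?z \<ominus>\<^bsub>T\<^esub> basis_vec u \<cdot> ?mg y) =
        basis_vec [s] \<cdot> ?mg ?z \<ominus>\<^bsub>T\<^esub> basis_vec [s] \<cdot> (basis_vec u \<cdot> ?mg y)"
      by (rule T.mult_diff_right[OF sT mz uy])
    also have "basis_vec [s] \<cdot> (basis_vec u \<cdot> ?mg y) =
        basis_vec (s # u) \<cdot> ?mg y"
      using T_assoc[OF sT uT my] by (simp add: free_assoc_mult_basis)
    also have "(basis_vec [s] \<cdot> ?mg ?z \<ominus>\<^bsub>T\<^esub> basis_vec (s # u) \<cdot> ?mg y) \<ominus>\<^bsub>T\<^esub>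
        ?mg ?z \<cdot> basis_vec [s] =
        (basis_vec [s] \<cdot> ?mg ?z \<ominus>\<^bsub>T\<^esub> ?mg ?z \<cdot> basis_vec [s]) \<ominus>\<^bsub>T\<^esub>
        basis_vec (s # u) \<cdot> ?mg y"
    proof -
      have "basis_vec (s # u) \<in> carrier T" by (rule word_T) (use s u in simp)
      then show ?thesis
        using T.mult_closed[OF sT mz] T.mult_closed[OF mz sT] T.mult_closed[OF _ my]
        by (simp add: a_minus_def T.a_ac)
    qed
    finally show ?case
      using mgb[OF x[OF s] zL] mgx[OF s] by simp
  qed
  have mg_act: "?mg (G.ad.wact t y) \<ominus>\<^bsub>T\<^esub> t \<cdot> ?mg y \<in> Q"
    if t: "t \<in> carrier T" and y: "y \<in> J" for t y
  proof -
    note yL = G.J_closed[OF y]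
    have my: "?mg y \<in> carrier T" using clinD(1)[OF mg yL] .
    have l: "clin T T (\<lambda>t. ?mg (G.ad.wact t y) \<ominus>\<^bsub>T\<^esub> t \<cdot> ?mg y)"
      by (intro T.clin_diff_fun clin_comp[OF G.ad.clin_wact[OF yL] mg] T.clin_mult_right[OF my])
    have "t \<in> {t \<in> carrier T. ?mg (G.ad.wact t y) \<ominus>\<^bsub>T\<^esub> t \<cdot> ?mg y \<in> Q}"
    proof (rule free_assoc_csub_induct[OF csub_vimage[OF T.cspace_axioms T.cspace_axioms l csub_Q] _ t])
      fix u assume u: "u \<in> lists S"
      show "basis_vec u \<in> {t \<in> carrier T. ?mg (G.ad.wact t y) \<ominus>\<^bsub>T\<^esub> t \<cdot> ?mg y \<in> Q}"
        unfolding mem_Collect_eq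
        using mg_word[OF y u] word_T[OF u] by (simp only: G.ad.wact_basis[OF u yL] simp_thms)
    qed
    then show ?thesis by simp
  qed
  \<comment> \<open>Modulo \<open>Q\<close> the image of the combination is the sum of the products
    \<open>t i \<cdot> rel i\<close>.\<close>
  have indep: "t j \<in> I"
    if t: "t \<in> {..<length cs} \<rightarrow> carrier T" and comb: "G.comb cs t \<in> G.D" and j: "j < length cs" for t j
  proof -
    have t': "t \<in> {..<m} \<rightarrow> carrier T" using t len by simp
    have tT: "t i \<in> carrier T" if "i < m" for i using t' that by auto
    have nthJ: "cs ! i \<in> J" if "i < m" for i using csJ len that nth_mem[of i cs] by auto
    have wc: "(\<lambda>i. G.ad.wact (t i) (cs ! i)) \<in> {..<m} \<rightarrow> carrier L"
      using tT nthJ G.J_closed by auto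
    define d where "d i = ?mg (G.ad.wact (t i) (cs ! i)) \<ominus>\<^bsub>T\<^esub> t i \<cdot> rel i" for i
    have dQ: "d i \<in> Q" if "i < m" for i
      using mg_act[OF tT[OF that] nthJ[OF that]] mgr[OF that] cs_nth[OF that] by (simp add: d_def)
    have rT: "t i \<cdot> rel i \<in> carrier T" if "i < m" for i
      using tT[OF that] rel_closed[OF that] by simp
    have "?mg (G.comb cs t) = finsum T (\<lambda>i. ?mg (G.ad.wact (t i) (cs ! i))) {..<m}"
      unfolding len by (rule clin_finsum[OF cspace_axioms T.cspace_axioms mg wc])
    also have "\<dots> = finsum T (\<lambda>i. t i \<cdot> rel i \<oplus>\<^bsub>T\<^esub> d i) {..<m}"
    proof (rule T.finsum_cong'[OF refl])
      fix i assume "i \<in> {..<m}"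
      then have i: "i < m" by simp
      have "?mg (G.ad.wact (t i) (cs ! i)) \<in> carrier T"
        using clinD(1)[OF mg] wc i by auto
      then show "?mg (G.ad.wact (t i) (cs ! i)) = t i \<cdot> rel i \<oplus>\<^bsub>T\<^esub> d i"
        using rT[OF i] by (simp add: d_def a_minus_def T.a_ac T.r_neg2)
          (simp add: T.a_lcomm T.r_neg)
    qed (use rT csubD(5)[OF csub_Q dQ] in auto)
    also have "\<dots> = finsum T (\<lambda>i. t i \<cdot> rel i) {..<m} \<oplus>\<^bsub>T\<^esub> finsum T d {..<m}"
      using rT csubD(5)[OF csub_Q dQ] by (intro T.finsum_addf) auto
    finally have eq: "?mg (G.comb cs t) =
        finsum T (\<lambda>i. t i \<cdot> rel i) {..<m} \<oplus>\<^bsub>T\<^esub> finsum T d {..<m}" .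
    have sT: "finsum T (\<lambda>i. t i \<cdot> rel i) {..<m} \<in> carrier T"
      using rT by (intro T.finsum_closed) auto
    have dsQ: "finsum T d {..<m} \<in> Q" using dQ by (intro T.csub_finsum[OF csub_Q]) auto
    have "?mg (G.comb cs t) \<ominus>\<^bsub>T\<^esub> finsum T d {..<m} \<in> Q"
      by (rule T.csub_diff[OF csub_Q mgD[OF comb] dsQ])
    also have "?mg (G.comb cs t) \<ominus>\<^bsub>T\<^esub> finsum T d {..<m} =
        finsum T (\<lambda>i. t i \<cdot> rel i) {..<m}"
      unfolding eq using sT csubD(5)[OF csub_Q dsQ] by (simp add: a_minus_def T.a_assoc T.r_neg)
    finally show ?thesis
      using relators_independent[OF t' _ j[unfolded len]] by (simp add: Q_def)
  qed
  \<comment> \<open>T/I maps to U(L/J): under \<open>\<iota>\<close> the element [b_i, l_i]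
    corresponds to an initial form, which is zero in L/J.\<close>
  have pushI: "G.push f \<in> G.Uid" if f: "f \<in> I" for f
  proof -
    interpret A: calg G.A by (rule calg_free_assoc)
    interpret U: calg G.U by (rule G.calg_U)
    note q = G.clin_cls and i = G.clin_iota
    define p where "p f = G.cls (G.push f)" for f
    have p: "clin T G.U p" unfolding p_def[abs_def] by (rule clin_comp[OF G.clin_push q])
    have p_mult: "p (f \<cdot> h) = p f \<otimes>\<^bsub>G.U\<^esub> p h" if "f \<in> carrier T" "h \<in> carrier T" for f h
      unfolding p_def G.push_mult[OF that] by (rule G.cls_mult[OF G.push_closed[OF that(1)] G.push_closed[OF that(2)]])
    have p_letter: "p (basis_vec [s]) = G.\<iota> (x s)" if "s \<in> S" for s
      using that by (simp add: p_def G.\<iota>_def G.push_basis)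
    have p_lform: "p (lform n) = G.\<iota> (cw n)" if n: "n < m" for n
    proof -
      have "p (lform n) = finsum G.U (\<lambda>s. p (magnus (w n) [s] \<star> basis_vec [s])) S"
        unfolding lform_def by (rule clin_finsum[OF T.cspace_axioms U.cspace_axioms p lform_terms])
      also have "\<dots> = finsum G.U (\<lambda>s. G.\<iota> (magnus (w n) [s] \<odot> x s)) S"
        by (rule U.finsum_cong')
          (use letter_T x clinD(1)[OF i] in \<open>auto simp: clinD(3)[OF p] clinD(3)[OF i] p_letter\<close>)
      also have "\<dots> = G.\<iota> (cw n)"
        unfolding cw_expand[OF n] by (rule clin_finsum[OF cspace_axioms U.cspace_axioms i xterms, symmetric])
      finally show ?thesis .
    qed
    have rel0: "rel n \<in> {f \<in> carrier T. G.push f \<in> G.Uid}" if n: "n < m" for n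
    proof -
      note bL = x[OF b_S[OF n]] and bT = letter_T[OF b_S[OF n]] and lT = lform_closed[of n]
      have "p (rel n) = G.\<iota> (x (b n)) \<otimes>\<^bsub>G.U\<^esub> G.\<iota> (cw n) \<ominus>\<^bsub>G.U\<^esub> G.\<iota> (cw n) \<otimes>\<^bsub>G.U\<^esub> G.\<iota> (x (b n))"
        unfolding rel_def using bT lT
        by (simp add: clin_diff[OF T.cspace_axioms U.cspace_axioms p] p_mult p_letter[OF b_S[OF n]]
            p_lform[OF n])
      also have "\<dots> = G.\<iota> (x (b n) \<otimes> cw n)" by (rule G.iota_bracket[OF bL cw[OF n], symmetric])
      also have "x (b n) \<otimes> cw n = cs ! n" using r_cls[OF n] cs_nth[OF n] by simp
      also have "G.\<iota> (cs ! n) = G.\<iota> \<zero>"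
      proof -
        have c: "cs ! n \<in> J" using csJ len n nth_mem[of n cs] by auto
        then have "J +> (cs ! n) = J +> \<zero>"
          using coset_eq_zero[OF G.csub_J G.J_closed[OF c]] coset_eq_zero[OF G.csub_J zero_closed]
            csubD(2)[OF G.csub_J] by simp
        then show ?thesis by (simp add: G.\<iota>_def)
      qed
      also have "G.\<iota> \<zero> = \<zero>\<^bsub>G.U\<^esub>" by (rule clin_zero[OF cspace_axioms U.cspace_axioms i])
      finally show ?thesis
        using G.cls_zero[OF G.push_closed[OF rel_closed[OF n]]] rel_closed[OF n] by (simp add: p_def)
    qed
    have "ideal {f \<in> carrier T. G.push f \<in> G.Uid} T"
    proof (rule csub_free_assoc_ideal)
      show "csub T {f \<in> carrier T. G.push f \<in> G.Uid}"
        by (rule csub_vimage[OF T.cspace_axioms A.cspace_axioms G.clin_push G.csub_Uid])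
    qed (auto simp: G.push_mult intro: G.Uid_l G.Uid_r G.push_closed)
    then have "I \<subseteq> {f \<in> carrier T. G.push f \<in> G.Uid}"
      by (rule I_minimal[OF _ rel0])
    then show ?thesis using f by auto
  qed
  have "free_module_on (uea G.g) (adjoint_module L J) (map (\<lambda>c. G.D +> c) cs)"
    by (rule G.free_moduleI[OF cs_L J_def]) (rule pushI, rule indep)
  moreover have "map (\<lambda>c. G.D +> c) cs = map (\<lambda>r. G.D +> initial_form F r) rs"
    by (simp add: cs_def)
  ultimately show "free_module_on (uea (alg_quot L J)) (adjoint_module L J)
      (map (\<lambda>r. lie_derived L J +> initial_form F r) rs)"
    by simp
qed

end

theorem mild_commutator_relators:
  fixes q m :: nat and a b :: "nat \<Rightarrow> nat" and w :: "nat \<Rightarrow> nat gword"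
  defines "F \<equiv> free_group {1..q}"
  assumes C: "C \<subseteq> {1..q}"
    and b: "\<And>i. i < m \<Longrightarrow> b i \<in> {1..q} - C" and a: "\<And>i. i < m \<Longrightarrow> a i \<in> C"
    and w: "\<And>i. i < m \<Longrightarrow> w i \<in> carrier F"
    and exponents: "\<And>i s. i < m \<Longrightarrow> s \<in> C \<Longrightarrow> magnus (w i) [s] = (if s = a i then 1 else 0)"
    and inj: "\<And>i j. i < m \<Longrightarrow> j < m \<Longrightarrow> b i = b j \<Longrightarrow> a i = a j \<Longrightarrow> i = j"
    and rs: "rs = map (\<lambda>i. commutator F (letter (b i)) (w i)) [0..<m]"
  shows "set rs \<subseteq> carrier F - {\<one>\<^bsub>F\<^esub>}" and "mild q rs"
proof -
  define S where "S = {1..q}"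
  have FS: "F = free_group S" by (simp add: F_def S_def)
  interpret clie "gr F" unfolding F_def by (rule group.clie_gr[OF group_free_group])
  interpret commutator_relators S C m b a w "gr F" F rs
    by unfold_locales (use C b a exponents inj w rs FS in \<open>auto simp: S_def\<close>)
  show "set rs \<subseteq> carrier F - {\<one>\<^bsub>F\<^esub>}" by (rule relators_free(1))
  show "mild q rs"
    using relators_free(2)[OF refl] unfolding mild_def Let_def F_def .
qed

section \<open>An obstruction to mildness\<close>

text \<open>The one-dimensional space as a record of vector-space type, so that functionals are
  instances of \<open>clin\<close>.\<close>

definition cline :: "(complex, complex) module" where
  "cline = \<lparr>carrier = UNIV, monoid.mult = (*), monoid.one = 1, ring.zero = 0, ring.add = (+), smult = (*)\<rparr>"

lemma cline_simps [simp]: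
  "carrier cline = UNIV" "\<zero>\<^bsub>cline\<^esub> = 0" "x \<oplus>\<^bsub>cline\<^esub> y = x + y" "c \<odot>\<^bsub>cline\<^esub> x = c * x"
  by (simp_all add: cline_def)

lemma cspace_cline: "cspace cline"
proof -
  have "abelian_group cline"
    by (rule abelian_groupI) (auto intro: exI[of _ "- _"])
  then show ?thesis
    by (simp add: cspace_def cspace_axioms_def algebra_simps)
qed

interpretation cline: cspace cline by (rule cspace_cline)

lemma cline_finsum: "finsum cline f A = sum f A"
  by (induction A rule: infinite_finite_induct) auto

lemma cline_diff: "x \<ominus>\<^bsub>cline\<^esub> y = x - y"
  using cline.smult_minus_one[of y] by (simp add: a_minus_def)

context lie_gens
begin

text \<open>The algebra character of T with value \<open>l (x s)\<close> on the letter
  \<open>s\<close>.\<close>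

definition char :: "('m \<Rightarrow> complex) \<Rightarrow> ('s list \<Rightarrow> complex) \<Rightarrow> complex" where
  "char l t = (\<Sum>w\<in>supp t. t w * prod_list (map (\<lambda>s. l (x s)) w))"

text \<open>A linear functional on \<open>L\<close> that vanishes on \<open>J\<close> and on all brackets is a Lie algebra map
  from \<open>L / J\<close> to the abelian Lie algebra \<open>\<complex>\<close>, hence extends to the enveloping algebra.\<close>

lemma char_Uid:
  assumes l: "clin L cline l" and lJ: "\<And>y. y \<in> J \<Longrightarrow> l y = 0"
    and lb: "\<And>y z. y \<in> carrier L \<Longrightarrow> z \<in> carrier L \<Longrightarrow> l (y \<otimes> z) = 0"
    and t: "t \<in> carrier T" and push: "push t \<in> Uid"
  shows "char l t = 0"
proof -
  define k where "k = quot_lift l"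
  have k: "clin g cline k"
    unfolding k_def by (rule clin_quot_lift[OF csub_J cspace_cline l]) (simp add: lJ)
  have kl: "k (J +> y) = l y" if "y \<in> carrier L" for y
    unfolding k_def by (rule quot_lift_coset[OF csub_J cspace_cline l _ that]) (simp add: lJ)
  interpret K: word_action cline "carrier g" "\<lambda>X v. k X * v"
    by unfold_locales (simp add: clin_def algebra_simps)
  have "K.wact (push t) 1 = \<zero>\<^bsub>cline\<^esub>"
  proof (rule Uid_annihilates[OF K.word_action_axioms _ _ _ push])
    show "k (X \<otimes>\<^bsub>g\<^esub> Y) * v = k X * (k Y * v) \<ominus>\<^bsub>cline\<^esub> k Y * (k X * v)"
      if "X \<in> carrier g" "Y \<in> carrier g" for X Y v
      using that by (auto simp: g_carrier g_bracket kl lb cline_diff)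
  qed (simp_all add: clinD(2,3)[OF k] distrib_right)
  then have "K.wact (push t) 1 = 0" by simp
  moreover have "K.wact (push t) 1 = lin_ext cline (\<lambda>w. prod_list (map (\<lambda>s. l (x s)) w)) t"
  proof (rule free_assoc_clin_eq[OF cspace_cline _ _ _ t])
    show "clin T cline (\<lambda>t. K.wact (push t) 1)"
      by (rule clin_comp[OF clin_push K.clin_wact]) simp
    show "clin T cline (lin_ext cline (\<lambda>w. prod_list (map (\<lambda>s. l (x s)) w)))"
      by (rule cline.clin_free_assoc) simp
    fix w assume w: "w \<in> lists S"
    then have "foldr (\<lambda>X v. k X * v) (map (\<lambda>s. J +> x s) w) 1 = prod_list (map (\<lambda>s. l (x s)) w)"
      by (induction w) (simp_all add: kl x_closed)
    moreover have "map (\<lambda>s. J +> x s) w \<in> lists (carrier g)" using w by (auto simp: g_carrier x_closed)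
    ultimately show "K.wact (push (basis_vec w)) 1 =
        lin_ext cline (\<lambda>w. prod_list (map (\<lambda>s. l (x s)) w)) (basis_vec w)"
      using w by (simp add: push_basis K.wact_basis cline.lin_ext_basis)
  qed
  ultimately show ?thesis by (simp add: char_def lin_ext_def cline_finsum)
qed

lemma clin_char: "clin T cline (char l)"
proof -
  have "char l = lin_ext cline (\<lambda>w. prod_list (map (\<lambda>s. l (x s)) w))"
    by (simp add: char_def[abs_def] lin_ext_def[abs_def] cline_finsum)
  then show ?thesis using cline.clin_free_assoc by simp
qed

lemma char_basis: "char l (basis_vec w) = prod_list (map (\<lambda>s. l (x s)) w)"
  by (simp add: char_def) (simp add: basis_vec_def)

lemma char_letter_mult:
  assumes s: "s \<in> S" and t: "t \<in> carrier T"
  shows "char l (basis_vec [s] \<otimes>\<^bsub>T\<^esub> t) = l (x s) * char l t"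
proof (rule free_assoc_clin_eq[OF cspace_cline _ _ _ t])
  interpret T: calg T by (rule calg_free_assoc)
  have sT: "basis_vec [s] \<in> carrier T" using s by (intro free_assoc_basis_closed) simp
  show "clin T cline (\<lambda>t. char l (basis_vec [s] \<otimes>\<^bsub>T\<^esub> t))"
    by (rule clin_comp[OF T.clin_mult_left[OF sT] clin_char])
  show "clin T cline (\<lambda>t. l (x s) * char l t)"
    using cline.clin_smult_fun[OF clin_char] by simp
qed (simp add: free_assoc_mult_basis char_basis)

text \<open>The multiples of a functional give a line of characters through the augmentation;
  continuity at 0 is what permits division by \<open>z\<close> in
  \<open>determinant_zero\<close>.\<close>

lemma char_scale_cont: "isCont (\<lambda>z. char (\<lambda>y. z * l y) t) 0"
proof -
  have "isCont (\<lambda>z. prod_list (map (\<lambda>s. z * l (x s)) w)) 0" for w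
    by (induction w) (auto intro: continuous_intros)
  then show ?thesis unfolding char_def by (intro continuous_intros)
qed

end

subsection \<open>Functionals on the graded Lie algebra of a free group\<close>

locale free_group_functionals =
  fixes S :: "'a set"
  assumes S: "finite S"
begin

abbreviation "F \<equiv> free_group S"
abbreviation "T \<equiv> free_assoc_algebra S"
abbreviation "mg \<equiv> gr_magnus S"

sublocale F: group F by (rule group_free_group)
sublocale L: clie "gr F" by (rule F.clie_gr)

definition lin1 :: "('a gword \<Rightarrow> complex) \<Rightarrow> (nat \<times> 'a gword \<Rightarrow> complex) set \<Rightarrow> complex" where
  "lin1 f y = (\<Sum>s\<in>S. f (letter s) * mg y [s])"

text \<open>The tensor product of two linear forms on degree one, evaluated on the degree two part
  in T. On brackets it becomes a two by two determinant (\<open>lin2_bracket\<close>).\<close>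

definition lin2 :: "('a gword \<Rightarrow> complex) \<Rightarrow> ('a gword \<Rightarrow> complex) \<Rightarrow>
    (nat \<times> 'a gword \<Rightarrow> complex) set \<Rightarrow> complex" where
  "lin2 f h y = (\<Sum>s\<in>S. \<Sum>u\<in>S. f (letter s) * h (letter u) * mg y [s, u])"

lemma mg_add: "y \<in> carrier (gr F) \<Longrightarrow> z \<in> carrier (gr F) \<Longrightarrow> mg (y \<oplus>\<^bsub>gr F\<^esub> z) w = mg y w + mg z w"
  and mg_smult: "y \<in> carrier (gr F) \<Longrightarrow> mg (c \<odot>\<^bsub>gr F\<^esub> y) w = c * mg y w"
  using clinD(2,3)[OF clin_gr_magnus[OF S]] by (simp_all add: free_assoc_simps)

lemma clin_lin1: "clin (gr F) cline (lin1 f)"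
  by (rule clinI) (simp_all add: lin1_def mg_add mg_smult distrib_left sum.distrib sum_distrib_left
      mult.left_commute)

lemma clin_lin2: "clin (gr F) cline (lin2 f h)"
  by (rule clinI) (simp_all add: lin2_def mg_add mg_smult distrib_left sum.distrib sum_distrib_left
      mult.left_commute)

lemma mg_empty: "y \<in> carrier (gr F) \<Longrightarrow> mg y [] = 0"
proof -
  assume y: "y \<in> carrier (gr F)"
  have "y \<in> {y \<in> carrier (gr F). mg y [] = 0}"
  proof (rule F.gr_csub_induct[OF _ _ y])
    show "csub (gr F) {y \<in> carrier (gr F). mg y [] = 0}"
      using clin_zero[OF L.cspace_axioms calg.axioms(1)[OF calg_free_assoc] clin_gr_magnus[OF S]]
      by (intro csubI) (auto simp: mg_add mg_smult free_assoc_simps)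
  qed (auto simp: gr_magnus_gcls[OF S] homog_def F.gcls_closed)
  then show ?thesis by simp
qed

lemma mg_bracket:
  assumes y: "y \<in> carrier (gr F)" and z: "z \<in> carrier (gr F)"
  shows "mg (y \<otimes>\<^bsub>gr F\<^esub> z) [s] = 0"
    and "mg (y \<otimes>\<^bsub>gr F\<^esub> z) [s, u] = mg y [s] * mg z [u] - mg z [s] * mg y [u]"
proof -
  interpret T: calg T by (rule calg_free_assoc)
  note c = clinD(1)[OF clin_gr_magnus[OF S]]
  have e: "mg (y \<otimes>\<^bsub>gr F\<^esub> z) w = conv (mg y) (mg z) w - conv (mg z) (mg y) w" for w
    using c[OF y] c[OF z] free_assoc_diff[OF T.mult_closed[OF c[OF z] c[OF y]]]
    by (simp add: gr_magnus_bracket[OF S y z] free_assoc_mult)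
  show "mg (y \<otimes>\<^bsub>gr F\<^esub> z) [s] = 0"
    and "mg (y \<otimes>\<^bsub>gr F\<^esub> z) [s, u] = mg y [s] * mg z [u] - mg z [s] * mg y [u]"
    using mg_empty[OF y] mg_empty[OF z] by (simp_all add: e conv.simps(2))
qed

lemma lin1_bracket: "y \<in> carrier (gr F) \<Longrightarrow> z \<in> carrier (gr F) \<Longrightarrow> lin1 f (y \<otimes>\<^bsub>gr F\<^esub> z) = 0"
  by (simp add: lin1_def mg_bracket)

lemma lin2_bracket:
  assumes "y \<in> carrier (gr F)" "z \<in> carrier (gr F)"
  shows "lin2 f h (y \<otimes>\<^bsub>gr F\<^esub> z) = lin1 f y * lin1 h z - lin1 f z * lin1 h y"
  unfolding lin1_def lin2_def sum_product sum_subtractf[symmetric] mg_bracket[OF assms]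
  by (intro sum.cong refl) (simp add: algebra_simps)

lemma lin1_gcls:
  assumes f: "\<And>g h. g \<in> carrier F \<Longrightarrow> h \<in> carrier F \<Longrightarrow> f (g \<otimes>\<^bsub>F\<^esub> h) = f g + f h"
    and g: "g \<in> carrier F"
  shows "lin1 f (gcls F 1 g) = f g"
proof -
  have f1: "f \<one>\<^bsub>F\<^esub> = 0" using f[of "\<one>\<^bsub>F\<^esub>" "\<one>\<^bsub>F\<^esub>"] by simp
  have finv: "f (inv\<^bsub>F\<^esub> h) = - f h" if "h \<in> carrier F" for h
    using f[of "inv\<^bsub>F\<^esub> h" h] that f1 by (simp add: eq_neg_iff_add_eq_0)
  have e: "lin1 f (gcls F 1 g) = (\<Sum>s\<in>S. f (letter s) * magnus g [s])" if "g \<in> carrier F" for g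
    using that gr_magnus_gcls[OF S, of 1 g] by (simp add: lin1_def homog_def)
  have let1: "(\<Sum>s\<in>S. f (letter s) * magnus (letter t) [s]) = f (letter t)" if "t \<in> S" for t
    using that S by (simp add: magnus_degree_one_letter if_distrib cong: if_cong)
  have "(\<Sum>s\<in>S. f (letter s) * magnus g [s]) = f g"
    using g
  proof (induction rule: free_group_induct)
    case one
    then show ?case by (simp add: magnus_degree_one_one f1)
  next
    case (letter t v)
    then show ?case
      using letter_closed[OF letter(1)] let1[OF letter(1)]
      by (simp add: magnus_degree_one distrib_left sum.distrib f)
  next
    case (inverse t v)
    then show ?case
      using letter_closed[OF inverse(1)] let1[OF inverse(1)]
      by (simp add: magnus_degree_one magnus_degree_one_inv right_diff_distrib sum_subtractf f finv)
  qed
  then show ?thesis using e[OF g] by simp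
qed

lemma lin1_gcls_high: "2 \<le> k \<Longrightarrow> g \<in> lower_central F k \<Longrightarrow> lin1 f (gcls F k g) = 0"
  by (simp add: lin1_def gr_magnus_gcls[OF S] homog_def)

end

subsection \<open>Products of central elements\<close>

text \<open>The exponents are kept as a function because they reappear as the coefficients of the
  class in degree one (\<open>gcls_pow_prod\<close>).\<close>

primrec (in monoid) pow_prod :: "(nat \<Rightarrow> 'a) \<Rightarrow> (nat \<Rightarrow> int) \<Rightarrow> nat \<Rightarrow> 'a" where
  "pow_prod c n 0 = \<one>"
| "pow_prod c n (Suc k) = pow_prod c n k \<otimes> c k [^] n k"

context group
begin

lemma pow_prod_closed: "(\<And>i. i < k \<Longrightarrow> c i \<in> carrier G) \<Longrightarrow> pow_prod c n k \<in> carrier G"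
  by (induction k) auto

lemma subgroup_center: "subgroup {x \<in> carrier G. \<forall>y\<in>carrier G. x \<otimes> y = y \<otimes> x} G"
proof (rule subgroupI)
  show "inv x \<in> {x \<in> carrier G. \<forall>y\<in>carrier G. x \<otimes> y = y \<otimes> x}"
    if "x \<in> {x \<in> carrier G. \<forall>y\<in>carrier G. x \<otimes> y = y \<otimes> x}" for x
  proof -
    have x: "x \<in> carrier G" "\<And>y. y \<in> carrier G \<Longrightarrow> x \<otimes> y = y \<otimes> x" using that by auto
    have "inv x \<otimes> y = y \<otimes> inv x" if y: "y \<in> carrier G" for y
    proof -
      have "inv x \<otimes> y = inv x \<otimes> (y \<otimes> x) \<otimes> inv x" using x(1) y by (simp add: m_assoc)
      also have "\<dots> = y \<otimes> inv x" unfolding x(2)[OF y, symmetric] using x(1) y by simp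
      finally show ?thesis .
    qed
    then show ?thesis using x(1) by simp
  qed
  show "x \<otimes> z \<in> {x \<in> carrier G. \<forall>y\<in>carrier G. x \<otimes> y = y \<otimes> x}"
    if "x \<in> {x \<in> carrier G. \<forall>y\<in>carrier G. x \<otimes> y = y \<otimes> x}"
      "z \<in> {x \<in> carrier G. \<forall>y\<in>carrier G. x \<otimes> y = y \<otimes> x}" for x z
  proof -
    have x: "x \<in> carrier G" "\<And>y. y \<in> carrier G \<Longrightarrow> x \<otimes> y = y \<otimes> x"
      and z: "z \<in> carrier G" "\<And>y. y \<in> carrier G \<Longrightarrow> z \<otimes> y = y \<otimes> z" using that by auto
    have "x \<otimes> z \<otimes> y = y \<otimes> (x \<otimes> z)" if y: "y \<in> carrier G" for y
    proof -
      have "x \<otimes> z \<otimes> y = x \<otimes> (y \<otimes> z)" using x(1) z y by (simp add: m_assoc)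
      also have "\<dots> = x \<otimes> y \<otimes> z" using x(1) z(1) y by (simp add: m_assoc)
      also have "\<dots> = y \<otimes> (x \<otimes> z)" unfolding x(2)[OF y] using x(1) z(1) y by (simp add: m_assoc)
      finally show ?thesis .
    qed
    then show ?thesis using x(1) z(1) by simp
  qed
qed auto

lemma pow_prod_add:
  assumes c: "\<And>i. i < k \<Longrightarrow> c i \<in> carrier G"
    and central: "\<And>i y. i < k \<Longrightarrow> y \<in> carrier G \<Longrightarrow> c i \<otimes> y = y \<otimes> c i"
  shows "pow_prod c (\<lambda>i. n i + n' i) k = pow_prod c n k \<otimes> pow_prod c n' k"
  using assms
proof (induction k)
  case (Suc k)
  have ck: "c k \<in> {x \<in> carrier G. \<forall>y\<in>carrier G. x \<otimes> y = y \<otimes> x}" using Suc.prems by auto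
  have pc: "c k [^] j \<otimes> y = y \<otimes> c k [^] j" if "y \<in> carrier G" for j :: int and y
    using subgroup_int_pow_closed[OF subgroup_center ck, of j] that by auto
  have cl: "pow_prod c n k \<in> carrier G" "pow_prod c n' k \<in> carrier G" "c k \<in> carrier G"
    using Suc.prems by (auto intro: pow_prod_closed)
  have "pow_prod c (\<lambda>i. n i + n' i) (Suc k) =
      pow_prod c n k \<otimes> (pow_prod c n' k \<otimes> (c k [^] n k \<otimes> c k [^] n' k))"
    using Suc.IH Suc.prems cl by (simp add: int_pow_mult m_assoc)
  also have "pow_prod c n' k \<otimes> (c k [^] n k \<otimes> c k [^] n' k) =
      c k [^] n k \<otimes> (pow_prod c n' k \<otimes> c k [^] n' k)"
    using pc[OF cl(2), of "n k"] cl by (simp flip: m_assoc)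
  finally show ?case using cl by (simp add: m_assoc)
qed simp

lemma pow_prod_zero: "(\<And>i. i < k \<Longrightarrow> n i = 0) \<Longrightarrow> pow_prod c n k = \<one>"
  by (induction k) auto

lemma pow_prod_mem:
  "subgroup H G \<Longrightarrow> (\<And>i. i < k \<Longrightarrow> c i [^] n i \<in> H) \<Longrightarrow> pow_prod c n k \<in> H"
  by (induction k) (auto simp: subgroup.one_closed subgroup.m_closed)

lemma gcls_int_pow:
  assumes "g \<in> carrier G"
  shows "gcls G 1 (g [^] (n :: int)) = of_int n \<odot>\<^bsub>gr G\<^esub> gcls G 1 g"
proof -
  interpret L: clie "gr G" by (rule clie_gr)
  have gc: "gcls G 1 g \<in> carrier (gr G)" using assms by (intro gcls_closed) auto
  have nat: "gcls G 1 (g [^] (k :: nat)) = of_nat k \<odot>\<^bsub>gr G\<^esub> gcls G 1 g" for k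
  proof (induction k)
    case 0
    then show ?case using gc gcls_one[of 1] by simp
  next
    case (Suc k)
    then show ?case using assms gc gcls_mult[of 1 "g [^] k" g] by (simp add: L.smult_l_distr L.a_comm)
  qed
  show ?thesis
  proof (cases n)
    case (nonneg k)
    then show ?thesis using nat by (simp add: int_pow_int)
  next
    case (neg k)
    have "g [^] n = inv (g [^] Suc k)" unfolding neg by (rule int_pow_neg_int[OF assms])
    moreover have "gcls G 1 (inv (g [^] Suc k)) = \<ominus>\<^bsub>gr G\<^esub> (of_nat (Suc k) \<odot>\<^bsub>gr G\<^esub> gcls G 1 g)"
      unfolding nat[symmetric] using assms by (intro gcls_inv) auto
    ultimately show ?thesis
      unfolding neg using gc by (simp add: L.smult_minus_left del: of_nat_Suc nat_pow_Suc)
  qed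
qed

lemma gcls_pow_prod:
  assumes "\<And>i. i < k \<Longrightarrow> c i \<in> carrier G"
  shows "gcls G 1 (pow_prod c n k) = finsum (gr G) (\<lambda>i. of_int (n i) \<odot>\<^bsub>gr G\<^esub> gcls G 1 (c i)) {..<k}"
proof -
  interpret L: clie "gr G" by (rule clie_gr)
  show ?thesis
    using assms
  proof (induction k)
    case 0
    then show ?case using gcls_one[of 1] by simp
  next
    case (Suc k)
    have "gcls G 1 (c i) \<in> carrier (gr G)" if "i < Suc k" for i
      using Suc.prems[OF that] by (intro gcls_closed) auto
    moreover have "lower_central G 1 = carrier G" by simp
    ultimately show ?case
      using Suc gcls_mult[of 1 "pow_prod c n k" "c k [^] n k"] pow_prod_closed[of k c n]
      by (simp add: lessThan_Suc gcls_int_pow L.a_comm Pi_iff del: One_nat_def)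
  qed
qed

end

lemma (in group_hom) hom_pow_prod:
  "(\<And>i. i < k \<Longrightarrow> c i \<in> carrier G) \<Longrightarrow> h (G.pow_prod c n k) = H.pow_prod (\<lambda>i. h (c i)) n k"
  by (induction k) (simp_all add: G.pow_prod_closed hom_int_pow)

lemma (in group) pow_prod_single:
  "(\<And>i. i < k \<Longrightarrow> c i \<in> carrier G) \<Longrightarrow> pow_prod c (\<lambda>i. if i = j then 1 else 0) k = (if j < k then c j else \<one>)"
  by (induction k) (auto simp: less_Suc_eq)

lemma (in clie) jacobi_cyclic:
  assumes c: "x \<in> carrier L" "y \<in> carrier L" "z \<in> carrier L"
  shows "x \<otimes> (y \<otimes> z) \<oplus> y \<otimes> (z \<otimes> x) \<oplus> z \<otimes> (x \<otimes> y) = \<zero>"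
proof -
  have "y \<otimes> (z \<otimes> x) = \<ominus> (y \<otimes> (x \<otimes> z))" "z \<otimes> (x \<otimes> y) = \<ominus> ((x \<otimes> y) \<otimes> z)"
    using antisym[of z x] antisym[of z "x \<otimes> y"] c by (simp_all add: mult_minus_right)
  then show ?thesis
    using jacobi[OF c] c by (simp add: a_assoc r_neg r_neg1 r_neg2)
qed

section \<open>Consequences of mildness for commuting triples\<close>

text \<open>Relators of weight one are allowed, so the abelianization of F may be larger than that
  of the presented group.\<close>

locale mild_presentation = free_group_functionals S for S :: "'a set" +
  fixes rs :: "'a gword list"
  assumes rs: "set rs \<subseteq> carrier F - {\<one>\<^bsub>F\<^esub>}"
    and mild: "J = lie_ideal_gen (gr F) (initial_form F ` set rs) \<Longrightarrow>
      free_module_on (uea (alg_quot (gr F) J)) (adjoint_module (gr F) J)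
        (map (\<lambda>r. lie_derived (gr F) J +>\<^bsub>gr F\<^esub> initial_form F r) rs)"
begin

abbreviation "L \<equiv> gr F"
abbreviation "cs \<equiv> map (initial_form F) rs"

definition "J = lie_ideal_gen L (set cs)"

sublocale P: presentation S "set rs"
  by unfold_locales (use rs in auto)

lemma rs_nth:
  assumes "i < length rs"
  shows "rs ! i \<in> carrier F" "1 \<le> weight F (rs ! i)" "rs ! i \<in> lower_central F (weight F (rs ! i))"
proof -
  have r: "rs ! i \<in> carrier F" "rs ! i \<noteq> \<one>\<^bsub>F\<^esub>" using rs nth_mem[OF assms] by auto
  show "rs ! i \<in> carrier F" "1 \<le> weight F (rs ! i)" "rs ! i \<in> lower_central F (weight F (rs ! i))"
    using r weight_free_group[OF r] by auto
qed

lemma cs_nth_eq: "i < length rs \<Longrightarrow> cs ! i = gcls F (weight F (rs ! i)) (rs ! i)"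
  by (simp add: initial_form_eq)

lemma cs_closed: "i < length rs \<Longrightarrow> cs ! i \<in> carrier L"
  unfolding cs_nth_eq by (rule F.gcls_closed) (use rs_nth in auto)

lemma cs_L: "set cs \<subseteq> carrier L"
  using cs_closed by (auto simp: set_conv_nth)

text \<open>Every element of L is taken as a generator, so a bracket with an arbitrary element is
  the action of a single letter of \<open>K.T\<close>.\<close>

sublocale K: lie_generated L J "carrier L" "\<lambda>y. y"
proof unfold_locales
  show "lie_ideal L J" unfolding J_def by (rule L.lie_ideal_lie_ideal_gen[OF cs_L])
  show "V = carrier L" if "csub L V" "\<And>s. s \<in> carrier L \<Longrightarrow> s \<in> V" for V
    using that csubD(5)[OF that(1)] by auto
qed

lemma csJ: "set cs \<subseteq> J"
  by (rule K.cs_J[OF cs_L J_def])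

lemma cs_nth_J: "i < length rs \<Longrightarrow> cs ! i \<in> J"
  using csJ nth_mem[of i cs] by auto

lemma free: "free_module_on (uea K.g) (adjoint_module L J) (map (\<lambda>c. K.D +>\<^bsub>L\<^esub> c) cs)"
  using mild by (simp add: J_def comp_def)

abbreviation "Tm \<equiv> {..<length cs} \<rightarrow> carrier K.T"

text \<open>These are the first cohomology classes of the presented group with complex
  coefficients.\<close>

definition additive :: "('a gword \<Rightarrow> complex) \<Rightarrow> bool" where
  "additive f \<longleftrightarrow> (\<forall>g\<in>carrier F. \<forall>h\<in>carrier F. f (g \<otimes>\<^bsub>F\<^esub> h) = f g + f h) \<and> (\<forall>r\<in>set rs. f r = 0)"

text \<open>The form vanishes on brackets and on initial forms of weight at least two; on an initial
  form of weight one it is the value of \<open>f\<close> at the relator.\<close>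

lemma lin1_J:
  assumes f: "additive f" and y: "y \<in> J"
  shows "lin1 f y = 0"
proof -
  let ?V = "{y \<in> carrier L. lin1 f y = 0}"
  have "lie_ideal L ?V"
    unfolding L.lie_ideal_iff
  proof (intro conjI ballI)
    show "csub L ?V"
      using clin_zero[OF L.cspace_axioms cspace_cline clin_lin1, of f] clinD[OF clin_lin1, where f1 = f]
      by (intro csubI) auto
  qed (auto simp: lin1_bracket)
  moreover have "set cs \<subseteq> ?V"
  proof
    fix c assume "c \<in> set cs"
    then obtain i where i: "i < length rs" "c = cs ! i" by (auto simp: in_set_conv_nth)
    have "lin1 f (gcls F (weight F (rs ! i)) (rs ! i)) = 0"
    proof (cases "weight F (rs ! i) = 1")
      case True
      have "lin1 f (gcls F 1 (rs ! i)) = f (rs ! i)"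
        by (rule lin1_gcls) (use f rs_nth(1)[OF i(1)] in \<open>auto simp: additive_def\<close>)
      then show ?thesis using True f i(1) by (simp add: additive_def)
    next
      case False
      then show ?thesis using rs_nth[OF i(1)] by (intro lin1_gcls_high) auto
    qed
    then show "c \<in> ?V" using i cs_closed[OF i(1)] unfolding cs_nth_eq[OF i(1), symmetric] by simp
  qed
  ultimately have "J \<subseteq> ?V" unfolding J_def by (rule L.lie_ideal_gen_minimal)
  then show ?thesis using y by auto
qed

text \<open>By freeness the coefficients of a relation vanish in U(L/J), hence under every
  character; each multiple \<open>z\<close> of \<open>lin1 f\<close> defines one because it vanishes
  on J and on brackets.\<close>

lemma char_zero:
  assumes f: "additive f" and t: "t \<in> Tm" and comb: "K.comb cs t \<in> K.D" and i: "i < length rs"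
  shows "K.char (\<lambda>y. z * lin1 f y) (t i) = 0"
proof (rule K.char_Uid)
  show "clin L cline (\<lambda>y. z * lin1 f y)"
    using cline.clin_smult_fun[OF clin_lin1] by simp
  show "t i \<in> carrier K.T" using t i by auto
  show "K.push (t i) \<in> K.Uid"
    by (rule K.free_module_imp[OF csJ free t comb]) (simp add: i)
qed (simp_all add: lin1_J[OF f] lin1_bracket)

lemma comb_scalars:
  "K.comb cs (\<lambda>i. n i \<odot>\<^bsub>K.T\<^esub> basis_vec []) = finsum L (\<lambda>i. n i \<odot>\<^bsub>L\<^esub> (cs ! i)) {..<length cs}"
proof (rule L.finsum_cong'[OF refl])
  fix i assume "i \<in> {..<length cs}"
  then have c: "cs ! i \<in> carrier L" using cs_closed[of i] by simp
  have b: "basis_vec [] \<in> carrier K.T" by (rule free_assoc_basis_closed) simp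
  have "K.ad.wact (n i \<odot>\<^bsub>K.T\<^esub> basis_vec []) (cs ! i) = n i \<odot>\<^bsub>L\<^esub> K.ad.wact (basis_vec []) (cs ! i)"
    by (rule clinD(3)[OF K.ad.clin_wact[OF c] b])
  then show "K.ad.wact (n i \<odot>\<^bsub>K.T\<^esub> basis_vec []) (cs ! i) = n i \<odot>\<^bsub>L\<^esub> (cs ! i)"
    using K.ad.wact_basis[of "[]" "cs ! i"] c by simp
qed (simp add: Pi_iff cs_closed del: nth_map)

text \<open>Scalars are coefficients of degree zero, detected by the augmentation, which is the
  character of the zero functional.\<close>

lemma independent:
  assumes "finsum L (\<lambda>i. n i \<odot>\<^bsub>L\<^esub> (cs ! i)) {..<length cs} = \<zero>\<^bsub>L\<^esub>" and i: "i < length rs"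
  shows "n i = 0"
proof -
  interpret T: calg K.T by (rule calg_free_assoc)
  have b: "basis_vec [] \<in> carrier K.T" by (rule free_assoc_basis_closed) simp
  have "K.char (\<lambda>y. 0 * lin1 (\<lambda>_. 0) y) (n i \<odot>\<^bsub>K.T\<^esub> basis_vec []) = 0"
  proof (rule char_zero[where t = "\<lambda>i. n i \<odot>\<^bsub>K.T\<^esub> basis_vec []", OF _ _ _ i])
    show "additive (\<lambda>_. 0)" by (simp add: additive_def)
    show "K.comb cs (\<lambda>i. n i \<odot>\<^bsub>K.T\<^esub> basis_vec []) \<in> K.D"
      unfolding comb_scalars assms(1) by (rule csubD(2)[OF K.csub_D])
  qed (simp add: Pi_iff b)
  moreover have "K.char l (n i \<odot>\<^bsub>K.T\<^esub> basis_vec []) = n i * K.char l (basis_vec [])" for l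
    using clinD(3)[OF K.clin_char b] by simp
  ultimately show ?thesis by (simp add: K.char_basis)
qed

text \<open>Modulo \<open>quadratic\<close>, the relators become central, so an element of the normal closure becomes
  a product of powers of relators.\<close>

definition quadratic :: "'a gword set" where
  "quadratic = {g \<in> lower_central F 2. gcls F 2 g \<in> J}"

lemma quadratic_normal: "quadratic \<lhd> F"
proof -
  have "subgroup quadratic F"
  proof (rule F.subgroupI)
    show "quadratic \<subseteq> carrier F" using F.lower_central_closed by (auto simp: quadratic_def)
    show "quadratic \<noteq> {}"
      using F.lower_central_one[of 2] F.gcls_one[of 2] csubD(2)[OF K.csub_J]
      by (auto simp: quadratic_def)
    show "inv\<^bsub>F\<^esub> g \<in> quadratic" if "g \<in> quadratic" for g
      using that F.lower_central_inv F.gcls_inv[of 2 g] L.csub_minus[OF K.csub_J]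
      by (auto simp: quadratic_def)
    show "g \<otimes>\<^bsub>F\<^esub> h \<in> quadratic" if "g \<in> quadratic" "h \<in> quadratic" for g h
      using that F.lower_central_mult F.gcls_mult[of 2 g h] csubD(3)[OF K.csub_J]
      by (auto simp: quadratic_def)
  qed
  then show ?thesis
    unfolding F.normal_inv_iff
    using F.lower_central_conj F.gcls_conj[of 2] by (auto simp: quadratic_def)
qed

text \<open>For a relator of weight one the class is a bracket with an element of J; for larger
  weight the commutator lies in the third term and its class in degree two is zero.\<close>

lemma quadratic_commutator:
  assumes i: "i < length rs" and g: "g \<in> carrier F"
  shows "commutator F (rs ! i) g \<in> quadratic"
proof (cases "weight F (rs ! i) = 1")
  case True
  then have "gcls F 1 (rs ! i) \<in> J" using cs_nth_J[OF i] cs_nth_eq[OF i] by simp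
  then have "gcls F 1 (rs ! i) \<otimes>\<^bsub>L\<^esub> gcls F 1 g \<in> J"
    using g by (intro K.J_right F.gcls_closed) auto
  moreover have "commutator F (rs ! i) g \<in> lower_central F (1 + 1)"
    using rs_nth(1)[OF i] g by (intro F.commutator_lower_central) auto
  ultimately show ?thesis
    using F.gcls_bracket[of 1 1 "rs ! i" g] rs_nth(1)[OF i] g by (simp add: quadratic_def numeral_2_eq_2)
next
  case False
  then have w2: "2 \<le> weight F (rs ! i)" using rs_nth(2)[OF i] by simp
  have "commutator F (rs ! i) g \<in> lower_central F (weight F (rs ! i) + 1)"
    using rs_nth[OF i] g by (intro F.commutator_lower_central) auto
  then have "commutator F (rs ! i) g \<in> lower_central F 3"
    using F.lower_central_antimono[of 3 "weight F (rs ! i) + 1"] w2 by auto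
  then show ?thesis
    using F.gcls_zero[of 2 "commutator F (rs ! i) g"] F.lower_central_Suc_subset[of 2]
      csubD(2)[OF K.csub_J] by (auto simp: quadratic_def)
qed

lemma quadratic_power:
  assumes i: "i < length rs" and n: "weight F (rs ! i) = 1 \<Longrightarrow> n = 0"
  shows "rs ! i [^]\<^bsub>F\<^esub> (n :: int) \<in> quadratic"
proof (cases "weight F (rs ! i) = 1")
  case True
  then show ?thesis using n normal_imp_subgroup[OF quadratic_normal] by (simp add: subgroup.one_closed)
next
  case False
  have "rs ! i \<in> quadratic"
  proof (cases "weight F (rs ! i) = 2")
    case True
    then show ?thesis using rs_nth[OF i] cs_nth_J[OF i] cs_nth_eq[OF i] by (simp add: quadratic_def)
  next
    case w: False
    then have "rs ! i \<in> lower_central F 3"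
      using F.lower_central_antimono[of 3 "weight F (rs ! i)"] False rs_nth[OF i] by auto
    then show ?thesis
      using F.gcls_zero[of 2 "rs ! i"] F.lower_central_Suc_subset[of 2] csubD(2)[OF K.csub_J]
      by (auto simp: quadratic_def)
  qed
  then show ?thesis
    by (rule F.subgroup_int_pow_closed[OF normal_imp_subgroup[OF quadratic_normal]])
qed

text \<open>Modulo \<open>quadratic\<close> the element \<open>g\<close> agrees with a product of
  powers of relators. Since \<open>g\<close> lies in the second term, so does the product, and its
  class in degree one is a combination of the initial forms of weight one with the exponents as
  coefficients. By \<open>independent\<close> these exponents are zero, and the remaining relator
  powers lie in \<open>quadratic\<close>.\<close>

lemma normal_closure_quadratic:
  assumes gN: "g \<in> P.N" and g2: "g \<in> lower_central F 2"
  shows "gcls F 2 g \<in> J"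
proof -
  interpret Q: normal quadratic F by (rule quadratic_normal)
  define M where "M = F Mod quadratic"
  define p where "p = (\<lambda>w. quadratic #>\<^bsub>F\<^esub> w)"
  interpret M: group M unfolding M_def by (rule Q.factorgroup_is_group)
  have "p \<in> hom F M" unfolding p_def M_def by (rule Q.r_coset_hom_Mod)
  then interpret p: group_hom F M p by unfold_locales
  have p_one: "w \<in> quadratic" if "w \<in> carrier F" "p w = \<one>\<^bsub>M\<^esub>" for w
    using that F.rcos_self[OF that(1) Q.subgroup_axioms] by (simp add: p_def M_def FactGroup_def)
  have p_quad: "p w = \<one>\<^bsub>M\<^esub>" if "w \<in> quadratic" for w
    using Q.rcos_const[OF F.is_group that] by (simp add: p_def M_def FactGroup_def)
  define c where "c = (\<lambda>i. p (rs ! i))"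
  have c: "c i \<in> carrier M" if "i < length rs" for i
    using rs_nth(1)[OF that] by (simp add: c_def)
  have Msurj: "\<exists>w\<in>carrier F. y = p w" if "y \<in> carrier M" for y
    using that by (auto simp: M_def p_def FactGroup_def RCOSETS_def)
  have central: "c i \<otimes>\<^bsub>M\<^esub> y = y \<otimes>\<^bsub>M\<^esub> c i" if i: "i < length rs" and y: "y \<in> carrier M" for i y
  proof -
    obtain w where w: "w \<in> carrier F" "y = p w" using Msurj[OF y] by blast
    have "commutator M (c i) y = p (commutator F (rs ! i) w)"
      using w rs_nth(1)[OF i] by (simp add: c_def commutator_def p.hom_mult)
    also have "\<dots> = \<one>\<^bsub>M\<^esub>" by (rule p_quad[OF quadratic_commutator[OF i w(1)]])
    finally show ?thesis using M.commutator_eq_one[OF c[OF i] y] by simp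
  qed
  let ?Z = "{x \<in> carrier M. \<forall>y\<in>carrier M. x \<otimes>\<^bsub>M\<^esub> y = y \<otimes>\<^bsub>M\<^esub> x}"
  have pp: "M.pow_prod c n (length rs) \<in> ?Z" for n
    by (rule M.pow_prod_mem[OF M.subgroup_center], rule M.subgroup_int_pow_closed[OF M.subgroup_center])
      (use c central in auto)
  have ppc: "M.pow_prod c n (length rs) \<in> carrier M" for n
    using pp by (rule CollectE) (rule conjunct1)
  define X where "X = {w \<in> carrier F. \<exists>n. p w = M.pow_prod c n (length rs)}"
  have add: "M.pow_prod c (\<lambda>i. n i + n' i) (length rs) =
      M.pow_prod c n (length rs) \<otimes>\<^bsub>M\<^esub> M.pow_prod c n' (length rs)" for n n'
    by (rule M.pow_prod_add) (use c central in auto)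
  have zero: "M.pow_prod c (\<lambda>_. 0) (length rs) = \<one>\<^bsub>M\<^esub>"
    by (rule M.pow_prod_zero) simp
  have "subgroup X F"
  proof (rule F.subgroupI)
    have "p \<one>\<^bsub>F\<^esub> = M.pow_prod c (\<lambda>_. 0) (length rs)" unfolding zero by simp
    then have "\<one>\<^bsub>F\<^esub> \<in> X" unfolding X_def by blast
    then show "X \<noteq> {}" by blast
    show "w \<otimes>\<^bsub>F\<^esub> v \<in> X" if w: "w \<in> X" and v: "v \<in> X" for w v
    proof -
      obtain n where n: "p w = M.pow_prod c n (length rs)" using w by (auto simp: X_def)
      obtain n' where n': "p v = M.pow_prod c n' (length rs)" using v by (auto simp: X_def)
      have wv: "w \<in> carrier F" "v \<in> carrier F" using w v by (auto simp: X_def)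
      then have "p (w \<otimes>\<^bsub>F\<^esub> v) = M.pow_prod c (\<lambda>i. n i + n' i) (length rs)"
        by (simp add: add n n')
      then show ?thesis using wv by (auto simp: X_def)
    qed
    show "inv\<^bsub>F\<^esub> w \<in> X" if w: "w \<in> X" for w
    proof -
      obtain n where n: "p w = M.pow_prod c n (length rs)" using w by (auto simp: X_def)
      have wc: "w \<in> carrier F" using w by (simp add: X_def)
      have "M.pow_prod c (\<lambda>i. - n i) (length rs) \<otimes>\<^bsub>M\<^esub> M.pow_prod c n (length rs) = \<one>\<^bsub>M\<^esub>"
        using add[of "\<lambda>i. - n i" n] zero by simp
      then have "inv\<^bsub>M\<^esub> (p w) = M.pow_prod c (\<lambda>i. - n i) (length rs)"
        unfolding n by (rule M.inv_equality[OF _ ppc ppc])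
      then show ?thesis using wc by (auto simp: X_def)
    qed
  qed (auto simp: X_def)
  moreover have "v \<otimes>\<^bsub>F\<^esub> w \<otimes>\<^bsub>F\<^esub> inv\<^bsub>F\<^esub> v \<in> X" if w: "w \<in> X" and v: "v \<in> carrier F" for v w
  proof -
    obtain n where n: "p w = M.pow_prod c n (length rs)" using w by (auto simp: X_def)
    have wc: "w \<in> carrier F" using w by (simp add: X_def)
    have "\<forall>y\<in>carrier M. p w \<otimes>\<^bsub>M\<^esub> y = y \<otimes>\<^bsub>M\<^esub> p w"
      unfolding n using pp by (rule CollectE) (rule conjunct2)
    from bspec[OF this p.hom_closed[OF v]]
    have z: "p v \<otimes>\<^bsub>M\<^esub> p w = p w \<otimes>\<^bsub>M\<^esub> p v" ..
    have "p (v \<otimes>\<^bsub>F\<^esub> w \<otimes>\<^bsub>F\<^esub> inv\<^bsub>F\<^esub> v) = p v \<otimes>\<^bsub>M\<^esub> p w \<otimes>\<^bsub>M\<^esub> inv\<^bsub>M\<^esub> (p v)"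
      using v wc by simp
    also have "\<dots> = p w \<otimes>\<^bsub>M\<^esub> p v \<otimes>\<^bsub>M\<^esub> inv\<^bsub>M\<^esub> (p v)" unfolding z ..
    also have "\<dots> = p w" using v wc by (simp add: M.m_assoc)
    finally show ?thesis using v wc n by (auto simp: X_def)
  qed
  ultimately have "X \<lhd> F" by (simp add: F.normal_inv_iff)
  moreover have "set rs \<subseteq> X"
  proof
    fix r assume "r \<in> set rs"
    then obtain j where j: "j < length rs" "r = rs ! j" by (auto simp: in_set_conv_nth)
    have "M.pow_prod c (\<lambda>i. if i = j then 1 else 0) (length rs) = c j"
      using M.pow_prod_single[of "length rs" c j] c j by simp
    then show "r \<in> X" using rs_nth(1)[OF j(1)] j by (auto simp: X_def c_def)
  qed
  ultimately have "g \<in> X" using F.normal_closure_minimal gN by blast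
  then obtain n where n: "p g = M.pow_prod c n (length rs)" and gc: "g \<in> carrier F"
    by (auto simp: X_def)
  \<comment> \<open>The product of powers lifted to F; it differs from \<open>g\<close> by an
    element of \<open>quadratic\<close>.\<close>
  define h where "h = F.pow_prod (\<lambda>i. rs ! i) n (length rs)"
  have h: "h \<in> carrier F" unfolding h_def using rs_nth(1) by (rule F.pow_prod_closed)
  have "p h = p g"
    unfolding h_def n c_def by (rule p.hom_pow_prod) (rule rs_nth(1))
  then have gh: "g \<otimes>\<^bsub>F\<^esub> inv\<^bsub>F\<^esub> h \<in> quadratic"
    using gc h by (intro p_one) auto
  have h2: "h \<in> lower_central F 2"
  proof -
    have "inv\<^bsub>F\<^esub> (g \<otimes>\<^bsub>F\<^esub> inv\<^bsub>F\<^esub> h) \<otimes>\<^bsub>F\<^esub> g \<in> lower_central F 2"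
      by (rule F.lower_central_mult[OF F.lower_central_inv g2]) (use gh in \<open>simp add: quadratic_def\<close>)
    then show ?thesis using gc h by (simp add: F.inv_mult_group F.m_assoc)
  qed
  have "gcls F 1 h = \<zero>\<^bsub>L\<^esub>"
    using h2 by (intro F.gcls_zero) (simp_all add: numeral_2_eq_2)
  then have s: "finsum L (\<lambda>i. of_int (n i) \<odot>\<^bsub>L\<^esub> gcls F 1 (rs ! i)) {..<length rs} = \<zero>\<^bsub>L\<^esub>"
    using F.gcls_pow_prod[of "length rs" "\<lambda>i. rs ! i" n] rs_nth(1) by (simp add: h_def)
  \<comment> \<open>Relators of larger weight have zero class in degree one, so their exponents are
    masked before linear independence is applied.\<close>
  let ?m = "\<lambda>i. if weight F (rs ! i) = 1 then complex_of_int (n i) else 0"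
  have "finsum L (\<lambda>i. ?m i \<odot>\<^bsub>L\<^esub> (cs ! i)) {..<length rs} =
      finsum L (\<lambda>i. of_int (n i) \<odot>\<^bsub>L\<^esub> gcls F 1 (rs ! i)) {..<length rs}"
  proof (rule L.finsum_cong'[OF refl])
    show "(\<lambda>i. of_int (n i) \<odot>\<^bsub>L\<^esub> gcls F 1 (rs ! i)) \<in> {..<length rs} \<rightarrow> carrier L"
      using rs_nth(1) F.gcls_closed[of 1] by auto
    fix i assume "i \<in> {..<length rs}"
    then have i: "i < length rs" by simp
    show "?m i \<odot>\<^bsub>L\<^esub> (cs ! i) = of_int (n i) \<odot>\<^bsub>L\<^esub> gcls F 1 (rs ! i)"
    proof (cases "weight F (rs ! i) = 1")
      case True
      then show ?thesis using cs_nth_eq[OF i] by simp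
    next
      case False
      then have "rs ! i \<in> lower_central F (Suc 1)"
        using F.lower_central_antimono[of "Suc 1" "weight F (rs ! i)"] rs_nth[OF i] by auto
      then have "gcls F 1 (rs ! i) = \<zero>\<^bsub>L\<^esub>" by (intro F.gcls_zero) simp_all
      then show ?thesis using False cs_closed[OF i] by simp
    qed
  qed
  then have "?m i = 0" if "i < length rs" for i
    using independent[of ?m i] that s by simp
  then have "n i = 0" if "weight F (rs ! i) = 1" "i < length rs" for i
    using that by (metis of_int_eq_0_iff)
  then have "h \<in> quadratic"
    unfolding h_def
    by (intro F.pow_prod_mem[OF normal_imp_subgroup[OF quadratic_normal]] quadratic_power) auto
  then have "g \<otimes>\<^bsub>F\<^esub> inv\<^bsub>F\<^esub> h \<otimes>\<^bsub>F\<^esub> h \<in> quadratic"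
    by (rule Q.m_closed[OF gh])
  then show ?thesis using gc h by (simp add: F.m_assoc quadratic_def)
qed

text \<open>On a bracket [x, v] with \<open>v\<close> in J the form \<open>lin2\<close> vanishes,
  because \<open>lin1\<close> vanishes on J. Only the augmentation of \<open>t\<close> is
  seen.\<close>

lemma lin2_wact:
  assumes f: "additive f" "additive f'" and t: "t \<in> carrier K.T" and y: "y \<in> J"
  shows "lin2 f f' (K.ad.wact t y) = K.char (\<lambda>_. 0) t * lin2 f f' y"
proof (rule free_assoc_clin_eq[OF cspace_cline _ _ _ t])
  note yc = K.J_closed[OF y]
  show "clin K.T cline (\<lambda>t. lin2 f f' (K.ad.wact t y))"
    by (rule clin_comp[OF K.ad.clin_wact[OF yc] clin_lin2])
  show "clin K.T cline (\<lambda>t. K.char (\<lambda>_. 0) t * lin2 f f' y)"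
    using cline.clin_smult_fun[OF K.clin_char, of "lin2 f f' y"] by (simp add: mult.commute)
  fix w assume w: "w \<in> lists (carrier L)"
  show "lin2 f f' (K.ad.wact (basis_vec w) y) = K.char (\<lambda>_. 0) (basis_vec w) * lin2 f f' y"
  proof (cases w)
    case Nil
    then show ?thesis using K.ad.wact_basis[of "[]" y] yc by (simp add: K.char_basis)
  next
    case (Cons x v)
    then have x: "x \<in> carrier L" "v \<in> lists (carrier L)" using w by auto
    have J: "foldr (\<lambda>s v. s \<otimes>\<^bsub>L\<^esub> v) v y \<in> J" by (rule K.word_J[OF x(2) y])
    have "lin2 f f' (x \<otimes>\<^bsub>L\<^esub> foldr (\<lambda>s v. s \<otimes>\<^bsub>L\<^esub> v) v y) = 0"
      by (simp add: lin2_bracket[OF x(1) K.J_closed[OF J]] lin1_J[OF f(1) J] lin1_J[OF f(2) J])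
    then show ?thesis using K.ad.wact_basis[OF w yc] Cons by (simp add: K.char_basis)
  qed
qed

text \<open>The brackets [B, C], [C, A], [A, B] lie in J; let t1, t2, t3 be their coefficients. By
  the Jacobi identity, A t1 + B t2 + C t3 are the coefficients of a relation. To first order at the
  augmentation this says that the constant terms of t1, t2, t3, weighted by the values of
  \<open>f1\<close> at A, B, C, sum to zero. The form \<open>lin2 f2 f3\<close> sees only these
  constant terms and takes the two by two minors as values on the brackets, so the determinant
  expanded along \<open>f1\<close> is zero.\<close>

lemma determinant_zero:
  assumes A: "A \<in> carrier F" and B: "B \<in> carrier F" and C: "C \<in> carrier F"
    and BC: "commutator F B C \<in> P.N" and CA: "commutator F C A \<in> P.N" and AB: "commutator F A B \<in> P.N"
    and f1: "additive f1" and f2: "additive f2" and f3: "additive f3"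
  shows "f1 A * (f2 B * f3 C - f2 C * f3 B) + f1 B * (f2 C * f3 A - f2 A * f3 C)
    + f1 C * (f2 A * f3 B - f2 B * f3 A) = 0"
proof -
  interpret T: calg K.T by (rule calg_free_assoc)
  let ?c = "gcls F 1"
  have cl: "?c g \<in> carrier L" if "g \<in> carrier F" for g
    using that by (intro F.gcls_closed) auto
  have lin1: "lin1 f (?c g) = f g" if "additive f" "g \<in> carrier F" for f g
    using that by (intro lin1_gcls) (auto simp: additive_def)
  have lin2: "lin2 f f' (?c g \<otimes>\<^bsub>L\<^esub> ?c h) = f g * f' h - f h * f' g"
    if "additive f" "additive f'" "g \<in> carrier F" "h \<in> carrier F" for f f' g h
    unfolding lin2_bracket[OF cl[OF that(3)] cl[OF that(4)]] lin1[OF that(1) that(3)]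
      lin1[OF that(1) that(4)] lin1[OF that(2) that(3)] lin1[OF that(2) that(4)] ..
  have inJ: "?c g \<otimes>\<^bsub>L\<^esub> ?c h \<in> J" if "g \<in> carrier F" "h \<in> carrier F" "commutator F g h \<in> P.N" for g h
  proof -
    have "commutator F g h \<in> lower_central F (1 + 1)"
      using that(1,2) by (intro F.commutator_lower_central) auto
    then have "gcls F 2 (commutator F g h) \<in> J"
      using that(3) by (intro normal_closure_quadratic) (simp_all add: numeral_2_eq_2)
    then show ?thesis using F.gcls_bracket[of 1 1 g h] that by (simp add: numeral_2_eq_2)
  qed
  obtain t1 where t1: "t1 \<in> Tm" "?c B \<otimes>\<^bsub>L\<^esub> ?c C = K.comb cs t1"
    using K.J_combinations[OF cs_L J_def inJ[OF B C BC]] by blast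
  obtain t2 where t2: "t2 \<in> Tm" "?c C \<otimes>\<^bsub>L\<^esub> ?c A = K.comb cs t2"
    using K.J_combinations[OF cs_L J_def inJ[OF C A CA]] by blast
  obtain t3 where t3: "t3 \<in> Tm" "?c A \<otimes>\<^bsub>L\<^esub> ?c B = K.comb cs t3"
    using K.J_combinations[OF cs_L J_def inJ[OF A B AB]] by blast
  have lc: "basis_vec [?c g] \<in> carrier K.T" if "g \<in> carrier F" for g
    using cl[OF that] by (intro free_assoc_basis_closed) simp
  let ?m = "\<lambda>g t i. basis_vec [?c g] \<otimes>\<^bsub>K.T\<^esub> t i"
  \<comment> \<open>The Jacobi sum, read as coefficients of a relation among the initial
    forms.\<close>
  define t where "t = (\<lambda>i. ?m A t1 i \<oplus>\<^bsub>K.T\<^esub> ?m B t2 i \<oplus>\<^bsub>K.T\<^esub> ?m C t3 i)"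
  have m: "?m g t \<in> Tm" if "g \<in> carrier F" "t \<in> Tm" for g t
    using lc[OF that(1)] that(2) by auto
  have t: "t \<in> Tm" unfolding t_def using m[OF A t1(1)] m[OF B t2(1)] m[OF C t3(1)] by (auto simp: Pi_iff)
  have wc: "(\<lambda>i. K.ad.wact (t i) (cs ! i)) \<in> {..<length cs} \<rightarrow> carrier L" if "t \<in> Tm" for t
    using that cs_closed by (auto simp: Pi_iff)
  have combm: "K.comb cs (?m g t) = ?c g \<otimes>\<^bsub>L\<^esub> K.comb cs t" if g: "g \<in> carrier F" and t: "t \<in> Tm" for g t
    unfolding L.mult_finsum_right[OF cl[OF g] wc[OF t]]
  proof (rule L.finsum_cong'[OF refl])
    show "(\<lambda>i. ?c g \<otimes>\<^bsub>L\<^esub> K.ad.wact (t i) (cs ! i)) \<in> {..<length cs} \<rightarrow> carrier L"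
      using wc[OF t] cl[OF g] by auto
    fix i assume "i \<in> {..<length cs}"
    then have c: "t i \<in> carrier K.T" "cs ! i \<in> carrier L" using t cs_closed[of i] by auto
    show "K.ad.wact (?m g t i) (cs ! i) = ?c g \<otimes>\<^bsub>L\<^esub> K.ad.wact (t i) (cs ! i)"
      using K.ad.wact_mult[OF lc[OF g] c] K.ad.wact_basis[of "[?c g]"] cl[OF g] c by simp
  qed
  have combadd: "K.comb cs (\<lambda>i. u i \<oplus>\<^bsub>K.T\<^esub> v i) = K.comb cs u \<oplus>\<^bsub>L\<^esub> K.comb cs v"
    if u: "u \<in> Tm" and v: "v \<in> Tm" for u v
    unfolding L.finsum_addf[OF wc[OF u] wc[OF v], symmetric]
  proof (rule L.finsum_cong'[OF refl])
    show "(\<lambda>i. K.ad.wact (u i) (cs ! i) \<oplus>\<^bsub>L\<^esub> K.ad.wact (v i) (cs ! i)) \<in> {..<length cs} \<rightarrow> carrier L"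
      using wc[OF u] wc[OF v] by (simp add: Pi_iff)
    fix i assume "i \<in> {..<length cs}"
    then have c: "u i \<in> carrier K.T" "v i \<in> carrier K.T" "cs ! i \<in> carrier L"
      using u v cs_closed[of i] by auto
    show "K.ad.wact (u i \<oplus>\<^bsub>K.T\<^esub> v i) (cs ! i) = K.ad.wact (u i) (cs ! i) \<oplus>\<^bsub>L\<^esub> K.ad.wact (v i) (cs ! i)"
      by (rule clinD(2)[OF K.ad.clin_wact[OF c(3)] c(1,2)])
  qed
  note mABC = m[OF A t1(1)] m[OF B t2(1)] m[OF C t3(1)]
  have mAB: "(\<lambda>i. ?m A t1 i \<oplus>\<^bsub>K.T\<^esub> ?m B t2 i) \<in> Tm" using mABC(1,2) by (simp add: Pi_iff)
  have "K.comb cs t = ?c A \<otimes>\<^bsub>L\<^esub> (?c B \<otimes>\<^bsub>L\<^esub> ?c C) \<oplus>\<^bsub>L\<^esub> ?c B \<otimes>\<^bsub>L\<^esub> (?c C \<otimes>\<^bsub>L\<^esub> ?c A)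
      \<oplus>\<^bsub>L\<^esub> ?c C \<otimes>\<^bsub>L\<^esub> (?c A \<otimes>\<^bsub>L\<^esub> ?c B)"
    unfolding t_def combadd[OF mAB mABC(3)] combadd[OF mABC(1,2)] combm[OF A t1(1)]
      combm[OF B t2(1)] combm[OF C t3(1)] t1(2) t2(2) t3(2) ..
  also have "\<dots> = \<zero>\<^bsub>L\<^esub>"
    by (rule L.jacobi_cyclic[OF cl[OF A] cl[OF B] cl[OF C]])
  finally have combt: "K.comb cs t \<in> K.D" using csubD(2)[OF K.csub_D] by simp
  let ?e = "K.char (\<lambda>_. 0)"
  have e0: "f1 A * ?e (t1 i) + f1 B * ?e (t2 i) + f1 C * ?e (t3 i) = 0" if i: "i < length rs" for i
  proof -
    have ti: "t1 i \<in> carrier K.T" "t2 i \<in> carrier K.T" "t3 i \<in> carrier K.T"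
      using t1(1) t2(1) t3(1) i by auto
    let ?l = "\<lambda>z y. z * lin1 f1 y"
    \<comment> \<open>The character at \<open>z\<close> takes the value z \<phi>(z) on
      \<open>t i\<close>. Thus \<phi> vanishes away from 0, and by continuity at 0, where the
      characters become the augmentation.\<close>
    define \<phi> where "\<phi> = (\<lambda>z. f1 A * K.char (?l z) (t1 i) + f1 B * K.char (?l z) (t2 i)
      + f1 C * K.char (?l z) (t3 i))"
    have cm: "K.char (?l z) (basis_vec [?c g] \<otimes>\<^bsub>K.T\<^esub> u) = z * f1 g * K.char (?l z) u"
      if "g \<in> carrier F" "u \<in> carrier K.T" for g u z
      unfolding K.char_letter_mult[OF cl[OF that(1)] that(2)] lin1[OF f1 that(1)] ..
    have "K.char (?l z) (t i) = K.char (?l z) (?m A t1 i) + K.char (?l z) (?m B t2 i) + K.char (?l z) (?m C t3 i)" for z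
      using ti lc A B C by (simp add: t_def clinD(2)[OF K.clin_char])
    then have "K.char (?l z) (t i) = z * \<phi> z" for z
      unfolding cm[OF A ti(1)] cm[OF B ti(2)] cm[OF C ti(3)] \<phi>_def by (simp add: algebra_simps)
    then have "z * \<phi> z = 0" for z
      using char_zero[OF f1 t combt i, of z] by simp
    then have "\<forall>\<^sub>F z in at 0. \<phi> z = 0"
      by (auto simp: eventually_at_filter intro!: always_eventually)
    then have "(\<phi> \<longlongrightarrow> 0) (at 0)"
      by (rule tendsto_eventually)
    moreover have "isCont \<phi> 0"
      unfolding \<phi>_def using K.char_scale_cont by (intro continuous_intros)
    then have "(\<phi> \<longlongrightarrow> \<phi> 0) (at 0)" by (simp add: isCont_def)
    ultimately have "\<phi> 0 = 0"
      using LIM_unique by blast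
    then show ?thesis by (simp add: \<phi>_def)
  qed
  have l2: "lin2 f2 f3 (K.comb cs u) = (\<Sum>i<length rs. ?e (u i) * lin2 f2 f3 (cs ! i))" if u: "u \<in> Tm" for u
  proof -
    have "lin2 f2 f3 (K.comb cs u) = (\<Sum>i<length cs. lin2 f2 f3 (K.ad.wact (u i) (cs ! i)))"
      using clin_finsum[OF L.cspace_axioms cspace_cline clin_lin2 wc[OF u]] by (simp add: cline_finsum)
    also have "\<dots> = (\<Sum>i<length rs. ?e (u i) * lin2 f2 f3 (cs ! i))"
    proof (rule sum.cong)
      fix i assume "i \<in> {..<length rs}"
      then have "u i \<in> carrier K.T" "cs ! i \<in> J" using u cs_nth_J[of i] by auto
      then show "lin2 f2 f3 (K.ad.wact (u i) (cs ! i)) = ?e (u i) * lin2 f2 f3 (cs ! i)"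
        by (rule lin2_wact[OF f2 f3])
    qed simp
    finally show ?thesis .
  qed
  have "f1 A * lin2 f2 f3 (K.comb cs t1) + f1 B * lin2 f2 f3 (K.comb cs t2)
      + f1 C * lin2 f2 f3 (K.comb cs t3) =
      (\<Sum>i<length rs. (f1 A * ?e (t1 i) + f1 B * ?e (t2 i) + f1 C * ?e (t3 i)) * lin2 f2 f3 (cs ! i))"
    unfolding l2[OF t1(1)] l2[OF t2(1)] l2[OF t3(1)]
    by (simp add: sum_distrib_left distrib_right sum.distrib mult.assoc)
  also have "\<dots> = 0" by (simp add: e0)
  finally show ?thesis
    unfolding t1(2)[symmetric] t2(2)[symmetric] t3(2)[symmetric]
      lin2[OF f2 f3 B C] lin2[OF f2 f3 C A] lin2[OF f2 f3 A B] by simp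
qed

end

text \<open>In a group with a mild presentation the triple products of classes in \<open>H^1\<close> vanish on every
  torus \<open>\<int>^3\<close>, because \<open>H^3\<close> would otherwise be nonzero.\<close>

theorem not_mild:
  fixes f :: "nat \<Rightarrow> 'g \<Rightarrow> complex" and G :: "('g, 'x) monoid_scheme"
  assumes G: "group G" and abc: "a \<in> carrier G" "b \<in> carrier G" "c \<in> carrier G"
    and comm: "b \<otimes>\<^bsub>G\<^esub> c = c \<otimes>\<^bsub>G\<^esub> b" "c \<otimes>\<^bsub>G\<^esub> a = a \<otimes>\<^bsub>G\<^esub> c" "a \<otimes>\<^bsub>G\<^esub> b = b \<otimes>\<^bsub>G\<^esub> a"
    and f: "\<And>i x y. i < 3 \<Longrightarrow> x \<in> carrier G \<Longrightarrow> y \<in> carrier G \<Longrightarrow> f i (x \<otimes>\<^bsub>G\<^esub> y) = f i x + f i y"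
    and det: "f 0 a * (f 1 b * f 2 c - f 1 c * f 2 b) + f 0 b * (f 1 c * f 2 a - f 1 a * f 2 c)
      + f 0 c * (f 1 a * f 2 b - f 1 b * f 2 a) \<noteq> 0"
  shows "\<not> admits_mild_presentation G"
proof
  assume "admits_mild_presentation G"
  then obtain q rs where rs: "set rs \<subseteq> carrier (free_group {1..q}) - {\<one>\<^bsub>free_group {1..q}\<^esub>}"
    and iso: "G \<cong> presented_group {1..q} (set rs)" and mild: "mild q rs"
    by (auto simp: admits_mild_presentation_def)
  define S where "S = {1..q}"
  interpret M: mild_presentation S rs
    by unfold_locales (use rs mild in \<open>auto simp: mild_def Let_def S_def\<close>)
  interpret G: group G by (rule G)
  note rs = rs[folded S_def] and iso = iso[folded S_def]
  obtain \<theta> where \<theta>: "\<theta> \<in> iso M.P.P G"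
    using G.iso_sym[OF iso] by (auto simp: is_iso_def)
  define p where "p = \<theta> \<circ> (\<lambda>w. M.P.N #>\<^bsub>M.F\<^esub> w)"
  have "p \<in> hom M.F G"
    unfolding p_def using \<theta> by (intro hom_compose[OF M.P.proj_hom]) (simp add: iso_def)
  then interpret p: group_hom M.F G p by unfold_locales
  have surj: "\<exists>w\<in>carrier M.F. p w = x" if "x \<in> carrier G" for x
  proof -
    have "x \<in> \<theta> ` carrier M.P.P" using \<theta> that by (simp add: iso_def bij_betw_def)
    then show ?thesis by (auto simp: M.P.carrier_P p_def)
  qed
  have ker: "w \<in> M.P.N" if "w \<in> carrier M.F" "p w = \<one>\<^bsub>G\<^esub>" for w
  proof -
    interpret \<theta>: group_hom M.P.P G \<theta> using \<theta> by unfold_locales (simp add: iso_def)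
    have "\<theta> (M.P.N #>\<^bsub>M.F\<^esub> w) = \<theta> \<one>\<^bsub>M.P.P\<^esub>" using that(2) by (simp add: p_def)
    moreover have "inj_on \<theta> (carrier M.P.P)" using \<theta> by (simp add: iso_def bij_betw_def)
    ultimately have "M.P.N #>\<^bsub>M.F\<^esub> w = \<one>\<^bsub>M.P.P\<^esub>"
      using that(1) by (auto simp: inj_on_def)
    then show ?thesis using M.P.proj_eq_one_iff[OF that(1)] by simp
  qed
  have rel: "p r = \<one>\<^bsub>G\<^esub>" if "r \<in> set rs" for r
  proof -
    interpret \<theta>: group_hom M.P.P G \<theta> using \<theta> by unfold_locales (simp add: iso_def)
    have "r \<in> carrier M.F" using that rs by auto
    then have "M.P.N #>\<^bsub>M.F\<^esub> r = \<one>\<^bsub>M.P.P\<^esub>"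
      using M.P.proj_eq_one_iff M.F.normal_closure_incl[OF M.P.relators that] by blast
    then show ?thesis by (simp add: p_def)
  qed
  have f1: "f i \<one>\<^bsub>G\<^esub> = 0" if "i < 3" for i
    using f[OF that G.one_closed G.one_closed] by simp
  have additive: "M.additive (\<lambda>w. f i (p w))" if "i < 3" for i
    using f[OF that] f1[OF that] rel by (simp add: M.additive_def)
  obtain A where A: "A \<in> carrier M.F" "p A = a" using surj[OF abc(1)] by blast
  obtain B where B: "B \<in> carrier M.F" "p B = b" using surj[OF abc(2)] by blast
  obtain C where C: "C \<in> carrier M.F" "p C = c" using surj[OF abc(3)] by blast
  have N: "commutator M.F u v \<in> M.P.N" if "u \<in> carrier M.F" "v \<in> carrier M.F"
    "p u \<otimes>\<^bsub>G\<^esub> p v = p v \<otimes>\<^bsub>G\<^esub> p u" for u v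
  proof (rule ker)
    have "p (commutator M.F u v) = commutator G (p u) (p v)"
      using that(1,2) by (simp add: commutator_def)
    then show "p (commutator M.F u v) = \<one>\<^bsub>G\<^esub>"
      using that G.commutator_eq_one[of "p u" "p v"] by simp
  qed (use that in simp)
  have "f 0 (p A) * (f 1 (p B) * f 2 (p C) - f 1 (p C) * f 2 (p B)) +
      f 0 (p B) * (f 1 (p C) * f 2 (p A) - f 1 (p A) * f 2 (p C)) +
      f 0 (p C) * (f 1 (p A) * f 2 (p B) - f 1 (p B) * f 2 (p A)) = 0"
    by (rule M.determinant_zero[OF A(1) B(1) C(1)]) (use A B C comm additive N in auto)
  then show False using det by (simp add: A B C)
qed

section \<open>Pure virtual braid groups\<close>

definition commutes :: "('a, 'x) monoid_scheme \<Rightarrow> 'a \<Rightarrow> 'a \<Rightarrow> bool" where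
  "commutes G x y \<longleftrightarrow> x \<otimes>\<^bsub>G\<^esub> y = y \<otimes>\<^bsub>G\<^esub> x"

definition yang_baxter :: "('a, 'x) monoid_scheme \<Rightarrow> 'a \<Rightarrow> 'a \<Rightarrow> 'a \<Rightarrow> bool" where
  "yang_baxter G x y z \<longleftrightarrow> x \<otimes>\<^bsub>G\<^esub> (y \<otimes>\<^bsub>G\<^esub> z) = z \<otimes>\<^bsub>G\<^esub> (y \<otimes>\<^bsub>G\<^esub> x)"

context group
begin

lemma commutes_sym: "commutes G x y \<longleftrightarrow> commutes G y x"
  by (auto simp: commutes_def)

lemma commutes_mult:
  assumes "x \<in> carrier G" "y \<in> carrier G" "z \<in> carrier G" "commutes G x y" "commutes G x z"
  shows "commutes G x (y \<otimes> z)"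
proof -
  have "x \<otimes> (y \<otimes> z) = y \<otimes> (x \<otimes> z)"
    using assms(1-4) by (simp add: commutes_def flip: m_assoc)
  then show ?thesis using assms by (simp add: commutes_def m_assoc)
qed

lemma commutes_inv_iff:
  assumes "x \<in> carrier G" "y \<in> carrier G"
  shows "commutes G x (inv y) \<longleftrightarrow> commutes G x y"
proof -
  have "commutes G x (inv y) \<longleftrightarrow> y \<otimes> (x \<otimes> inv y) \<otimes> y = y \<otimes> (inv y \<otimes> x) \<otimes> y"
    using assms by (simp add: commutes_def del: inv_cancel)
  also have "\<dots> \<longleftrightarrow> commutes G x y"
    using assms by (auto simp: commutes_def m_assoc)
  finally show ?thesis .
qed

lemma commutes_mult_iff:
  assumes "x \<in> carrier G" "y \<in> carrier G" "z \<in> carrier G"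
  shows "commutes G x y \<Longrightarrow> commutes G x (y \<otimes> z) \<longleftrightarrow> commutes G x z"
    and "commutes G x z \<Longrightarrow> commutes G x (y \<otimes> z) \<longleftrightarrow> commutes G x y"
proof -
  show "commutes G x (y \<otimes> z) \<longleftrightarrow> commutes G x z" if "commutes G x y"
    using commutes_mult[of x y z] commutes_mult[of x "inv y" "y \<otimes> z"] assms that
    by (auto simp: commutes_inv_iff)
  show "commutes G x (y \<otimes> z) \<longleftrightarrow> commutes G x y" if "commutes G x z"
    using commutes_mult[of x y z] commutes_mult[of x "y \<otimes> z" "inv z"] assms that
    by (auto simp: commutes_inv_iff m_assoc)
qed

text \<open>The first two forms turn the cubic relation into a commutation of products, the shape
  required of the relators. The third rotates the arguments while inverting one of them; it relates
  the different orders of the three strands.\<close>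

lemma yang_baxter_commutes:
  assumes "x \<in> carrier G" "y \<in> carrier G" "z \<in> carrier G"
  shows "yang_baxter G x y z \<longleftrightarrow> commutes G (y \<otimes> z) (inv z \<otimes> x)"
    and "yang_baxter G x y z \<longleftrightarrow> commutes G (x \<otimes> y) (x \<otimes> inv z)"
    and "yang_baxter G x y z \<longleftrightarrow> yang_baxter G (inv z) x y"
proof -
  have c: "commutes G (y \<otimes> z) (inv z \<otimes> x) \<longleftrightarrow> z \<otimes> (y \<otimes> z \<otimes> (inv z \<otimes> x)) = z \<otimes> (inv z \<otimes> x \<otimes> (y \<otimes> z))"
    using assms by (simp add: commutes_def)
  show 1: "yang_baxter G x y z \<longleftrightarrow> commutes G (y \<otimes> z) (inv z \<otimes> x)"
    unfolding c using assms by (auto simp: yang_baxter_def m_assoc)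
  have c: "commutes G (x \<otimes> y) (x \<otimes> inv z) \<longleftrightarrow>
      inv x \<otimes> (x \<otimes> y \<otimes> (x \<otimes> inv z)) \<otimes> z = inv x \<otimes> (x \<otimes> inv z \<otimes> (x \<otimes> y)) \<otimes> z"
    using assms by (simp add: commutes_def)
  have c': "yang_baxter G x y z \<longleftrightarrow> inv z \<otimes> (x \<otimes> (y \<otimes> z)) = inv z \<otimes> (z \<otimes> (y \<otimes> x))"
    using assms by (simp add: yang_baxter_def del: inv_cancel)
  show "yang_baxter G x y z \<longleftrightarrow> commutes G (x \<otimes> y) (x \<otimes> inv z)"
    unfolding c c' using assms by (auto simp: m_assoc)
  have c: "yang_baxter G (inv z) x y \<longleftrightarrow> inv z \<otimes> (x \<otimes> y) \<otimes> z = y \<otimes> (x \<otimes> inv z) \<otimes> z"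
    using assms by (simp add: yang_baxter_def)
  show "yang_baxter G x y z \<longleftrightarrow> yang_baxter G (inv z) x y"
    unfolding c c' using assms by (auto simp: m_assoc)
qed

end

lemma (in presentation) subgroup_eq_carrier:
  assumes H: "subgroup H P" and gens: "\<And>s. s \<in> S \<Longrightarrow> gen s \<in> H"
  shows "H = carrier P"
proof
  show "H \<subseteq> carrier P" by (rule subgroup.subset[OF H])
  show "carrier P \<subseteq> H"
  proof
    fix C assume "C \<in> carrier P"
    then obtain w where w: "w \<in> carrier F" "C = word_eval P gen w" by (rule P_cases)
    have hg: "gen s \<in> carrier P" if "s \<in> S" for s using gen_closed that by auto
    have "N #>\<^bsub>F\<^esub> w \<in> H"
      using w(1)
    proof (induction rule: free_group_induct)
      case one
      then show ?case using subgroup.one_closed[OF H] by simp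
    next
      case (letter s v)
      then show ?case
        using gens[OF letter(1)] subgroup.m_closed[OF H] letter_closed[OF letter(1)]
        by (simp add: presented_gen_def)
    next
      case (inverse s v)
      then show ?case
        using gens[OF inverse(1)] subgroup.m_closed[OF H] subgroup.m_inv_closed[OF H]
          letter_closed[OF inverse(1)]
        by (simp add: presented_gen_def)
    qed
    then show "C \<in> H" using w word_eval_gen by simp
  qed
qed

text \<open>The presentations for which @@mild_commutator_relators@@ applies\<close>

locale commutator_presentation =
  fixes q m :: nat and S :: "nat set" and C :: "nat set" and a b :: "nat \<Rightarrow> nat" and w :: "nat \<Rightarrow> nat gword"
  assumes S: "S = {1..q}" and C: "C \<subseteq> S"
    and b: "\<And>i. i < m \<Longrightarrow> b i \<in> S - C" and a: "\<And>i. i < m \<Longrightarrow> a i \<in> C"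
    and w: "\<And>i. i < m \<Longrightarrow> w i \<in> carrier (free_group S)"
    and exponents: "\<And>i s. i < m \<Longrightarrow> s \<in> C \<Longrightarrow> magnus (w i) [s] = (if s = a i then 1 else 0)"
    and inj: "\<And>i j. i < m \<Longrightarrow> j < m \<Longrightarrow> b i = b j \<Longrightarrow> a i = a j \<Longrightarrow> i = j"
begin

definition "rels = map (\<lambda>i. commutator (free_group S) (letter (b i)) (w i)) [0..<m]"

lemma rels: "set rels \<subseteq> carrier (free_group S) - {\<one>\<^bsub>free_group S\<^esub>}" "mild q rels"
  by (rule mild_commutator_relators[OF C[unfolded S] b[unfolded S] a w[unfolded S] exponents inj
      rels_def[unfolded S], folded S]; assumption)+

sublocale presentation "S" "set rels"
  using rels by unfold_locales auto

lemma admits_mild: "G \<cong> P \<Longrightarrow> admits_mild_presentation G"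
  using rels unfolding admits_mild_presentation_def S by blast

lemma rels_eval:
  assumes G: "group G" and f: "f \<in> S \<rightarrow> carrier G"
    and comm: "\<And>i. i < m \<Longrightarrow> commutes G (f (b i)) (word_eval G f (w i))" and r: "r \<in> set rels"
  shows "word_eval G f r = \<one>\<^bsub>G\<^esub>"
proof -
  interpret G: group G by (rule G)
  interpret h: group_hom F G "word_eval G f" using G.word_eval_hom[OF f] by unfold_locales
  obtain i where i: "i < m" "r = commutator F (letter (b i)) (w i)" using r by (auto simp: rels_def)
  have l: "letter (b i) \<in> carrier F" "f (b i) \<in> carrier G"
    using b[OF i(1)] letter_closed[of "b i" "S"] f by auto
  then have "word_eval G f r = commutator G (f (b i)) (word_eval G f (w i))"
    using i w[OF i(1)] by (simp add: commutator_def G.word_eval_letter)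
  then show ?thesis
    using G.commutator_eq_one[OF l(2) h.hom_closed[OF w[OF i(1)]]] comm[OF i(1)]
    by (simp add: commutes_def)
qed

lemma gen_commutes:
  assumes i: "i < m"
  shows "commutes P (gen (b i)) (word_eval P gen (w i))"
proof -
  have "commutator F (letter (b i)) (w i) \<in> set rels" using i by (auto simp: rels_def)
  then have "word_eval P gen (commutator F (letter (b i)) (w i)) = \<one>\<^bsub>P\<^esub>"
    by (rule relator_eq_one)
  moreover interpret h: group_hom F P "word_eval P gen"
    using P.word_eval_hom[OF gen_closed] by unfold_locales
  have l: "letter (b i) \<in> carrier F" "gen (b i) \<in> carrier P"
    using b[OF i(1)] letter_closed[of "b i" "S"] gen_closed by auto
  then have "word_eval P gen (commutator F (letter (b i)) (w i)) =
      commutator P (gen (b i)) (word_eval P gen (w i))"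
    using w[OF i(1)] by (simp add: commutator_def P.word_eval_letter)
  ultimately show ?thesis
    using P.commutator_eq_one[OF l(2) h.hom_closed[OF w[OF i(1)]]] by (simp add: commutes_def)
qed

end

section \<open>The groups vP_n and vP_n^+, and commuting triples on four strands\<close>

locale virtual_braids =
  fixes n :: nat
begin

lemma virt_gens_iff: "(i, j) \<in> virt_gens n \<longleftrightarrow> i \<in> {1..n} \<and> j \<in> {1..n} \<and> i \<noteq> j"
  by (auto simp: virt_gens_def)

lemma virt_relators_closed: "virt_relators n \<subseteq> carrier (free_group (virt_gens n))"
  unfolding virt_relators_def
  by (auto intro!: relator_closed simp: letter_def virt_gens_iff)

sublocale presentation "virt_gens n" "virt_relators n"
  by unfold_locales (rule virt_relators_closed)

abbreviation "x i j \<equiv> gen (i, j)"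
abbreviation mul_P (infixl "\<cdot>" 70) where "y \<cdot> z \<equiv> y \<otimes>\<^bsub>P\<^esub> z"

lemma x_closed [simp]: "i \<in> {1..n} \<Longrightarrow> j \<in> {1..n} \<Longrightarrow> i \<noteq> j \<Longrightarrow> x i j \<in> carrier P"
  using gen_closed by (auto simp: virt_gens_iff)

lemma triple:
  assumes "{i, j, k} \<subseteq> {1..n}" "distinct [i, j, k]"
  shows "yang_baxter P (x i j) (x i k) (x j k)"
proof -
  have "relator (virt_gens n) (letter (i, j) @ letter (i, k) @ letter (j, k))
      (letter (j, k) @ letter (i, k) @ letter (i, j)) \<in> virt_relators n"
    using assms unfolding virt_relators_def by blast
  from relation[OF this] show ?thesis
    using assms by (simp add: letter_def virt_gens_iff word_eval_Cons yang_baxter_def)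
qed

lemma disjoint_commute:
  assumes "{i, j, k, l} \<subseteq> {1..n}" "distinct [i, j, k, l]"
  shows "commutes P (x i j) (x k l)"
proof -
  have "relator (virt_gens n) (letter (i, j) @ letter (k, l)) (letter (k, l) @ letter (i, j)) \<in> virt_relators n"
    using assms unfolding virt_relators_def by blast
  from relation[OF this] show ?thesis
    using assms by (simp add: letter_def virt_gens_iff word_eval_Cons commutes_def)
qed

lemma relators_eval:
  assumes G: "group G" and h: "\<And>i j. i \<in> {1..n} \<Longrightarrow> j \<in> {1..n} \<Longrightarrow> i \<noteq> j \<Longrightarrow> h (i, j) \<in> carrier G"
    and triple: "\<And>i j k. {i, j, k} \<subseteq> {1..n} \<Longrightarrow> distinct [i, j, k] \<Longrightarrow>
      yang_baxter G (h (i, j)) (h (i, k)) (h (j, k))"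
    and comm: "\<And>i j k l. {i, j, k, l} \<subseteq> {1..n} \<Longrightarrow> distinct [i, j, k, l] \<Longrightarrow>
      commutes G (h (i, j)) (h (k, l))"
    and r: "r \<in> virt_relators n"
  shows "word_eval G h r = \<one>\<^bsub>G\<^esub>"
proof -
  interpret G: group G by (rule G)
  have hc: "h \<in> virt_gens n \<rightarrow> carrier G" using h by (auto simp: virt_gens_iff)
  show ?thesis
    using r unfolding virt_relators_def
  proof (elim UnE CollectE exE conjE)
    fix i j k
    assume e: "r = relator (virt_gens n) (letter (i, j) @ letter (i, k) @ letter (j, k))
        (letter (j, k) @ letter (i, k) @ letter (i, j))"
      and three: "{i, j, k} \<subseteq> {1..n}" "distinct [i, j, k]"
    have "word_eval G h (letter (i, j) @ letter (i, k) @ letter (j, k)) =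
        word_eval G h (letter (j, k) @ letter (i, k) @ letter (i, j))"
      using triple[OF three] three h by (simp add: letter_def word_eval_Cons yang_baxter_def)
    then show ?thesis
      unfolding e using three
      by (subst G.word_eval_relator_iff[OF hc]) (auto simp: letter_def virt_gens_iff)
  next
    fix i j k l
    assume e: "r = relator (virt_gens n) (letter (i, j) @ letter (k, l)) (letter (k, l) @ letter (i, j))"
      and four: "{i, j, k, l} \<subseteq> {1..n}" "distinct [i, j, k, l]"
    have "word_eval G h (letter (i, j) @ letter (k, l)) = word_eval G h (letter (k, l) @ letter (i, j))"
      using comm[OF four] four h by (simp add: letter_def word_eval_Cons commutes_def)
    then show ?thesis
      unfolding e using four
      by (subst G.word_eval_relator_iff[OF hc]) (auto simp: letter_def virt_gens_iff)
  qed
qed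

text \<open>The exponent sum of one generator, well defined because both sides of every relation
  contain the same letters.\<close>

definition exponent :: "nat \<times> nat \<Rightarrow> (nat \<times> nat) gword set \<Rightarrow> int" where
  "exponent p = pres_hom integer_group (\<lambda>p'. if p' = p then 1 else 0)"

lemma exponent:
  shows exponent_hom: "group_hom P integer_group (exponent p)"
    and exponent_x: "i \<in> {1..n} \<Longrightarrow> j \<in> {1..n} \<Longrightarrow> i \<noteq> j \<Longrightarrow> exponent p (x i j) = (if (i, j) = p then 1 else 0)"
proof -
  have r: "word_eval integer_group (\<lambda>p'. if p' = p then 1 else 0) r = \<one>\<^bsub>integer_group\<^esub>"
    if "r \<in> virt_relators n" for r
    by (rule relators_eval[OF group_integer_group _ _ _ that])
      (auto simp: integer_group_def yang_baxter_def commutes_def)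
  have f: "(\<lambda>p'. if p' = p then 1 else 0) \<in> virt_gens n \<rightarrow> carrier integer_group"
    by (simp add: integer_group_def)
  show "group_hom P integer_group (exponent p)"
    unfolding exponent_def group_hom_def group_hom_axioms_def
    using pres_hom_in_hom[OF group_integer_group f r] P.is_group group_integer_group by simp
  show "exponent p (x i j) = (if (i, j) = p then 1 else 0)" if "i \<in> {1..n}" "j \<in> {1..n}" "i \<noteq> j"
    unfolding exponent_def
    by (rule pres_hom_gen[OF group_integer_group f r]) (use that in \<open>auto simp: virt_gens_iff\<close>)
qed

abbreviation "upper \<equiv> {gen (i, j) | i j. 1 \<le> i \<and> i < j \<and> j \<le> n}"
abbreviation "U \<equiv> subgroup_generated P upper"

end

text \<open>Computations on four strands, where \<open>xij\<close> stands for the generator \<open>x i j\<close>.\<close>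

lemma (in group) four_strands:
  assumes x: "x12 \<in> carrier G" "x13 \<in> carrier G" "x14 \<in> carrier G" "x23 \<in> carrier G" "x24 \<in> carrier G"
      "x34 \<in> carrier G"
    and yb: "yang_baxter G x12 x13 x23" "yang_baxter G x12 x14 x24" "yang_baxter G x13 x14 x34"
      "yang_baxter G x23 x24 x34"
    and c: "commutes G x12 x34" "commutes G x13 x24" "commutes G x23 x14"
  defines "A \<equiv> inv x23 \<otimes> inv x24 \<otimes> x12" and "B \<equiv> inv x34 \<otimes> x13 \<otimes> x23" and "C \<equiv> x14 \<otimes> x24 \<otimes> x34"
  shows "B \<otimes> C = C \<otimes> B" "C \<otimes> A = A \<otimes> C" "A \<otimes> B = B \<otimes> A"
proof -
  have inv34: "x12 \<otimes> inv x34 = inv x34 \<otimes> x12"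
    using c(1) commutes_inv_iff[of x12 x34] x by (simp add: commutes_def)
  have inv23: "inv x23 \<otimes> x14 = x14 \<otimes> inv x23"
    using c(3) commutes_inv_iff[of x14 x23] commutes_sym x by (simp add: commutes_def)
  have y: "inv x23 \<otimes> inv x24 \<otimes> inv x34 = inv x34 \<otimes> inv x24 \<otimes> inv x23"
    using arg_cong[OF yb(4)[unfolded yang_baxter_def], of "m_inv G"] x
    by (simp add: inv_mult_group)
  have y': "x24 \<otimes> x34 \<otimes> inv x23 \<otimes> inv x24 = inv x23 \<otimes> x34"
  proof -
    have "x24 \<otimes> x34 \<otimes> inv x23 \<otimes> inv x24 = inv x23 \<otimes> (x23 \<otimes> (x24 \<otimes> x34)) \<otimes> inv x23 \<otimes> inv x24"
      using x by (simp add: m_assoc)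
    also have "\<dots> = inv x23 \<otimes> x34"
      unfolding yb(4)[unfolded yang_baxter_def] using x by (simp add: m_assoc)
    finally show ?thesis .
  qed
  have "B \<otimes> C = inv x34 \<otimes> x13 \<otimes> (x23 \<otimes> x14) \<otimes> x24 \<otimes> x34" using x by (simp add: B_def C_def m_assoc)
  also have "\<dots> = inv x34 \<otimes> x13 \<otimes> x14 \<otimes> (x23 \<otimes> (x24 \<otimes> x34))"
    unfolding c(3)[unfolded commutes_def] using x by (simp add: m_assoc)
  also have "\<dots> = inv x34 \<otimes> (x13 \<otimes> (x14 \<otimes> x34)) \<otimes> x24 \<otimes> x23"
    unfolding yb(4)[unfolded yang_baxter_def] using x by (simp add: m_assoc)
  also have "\<dots> = x14 \<otimes> (x13 \<otimes> x24) \<otimes> x23"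
    unfolding yb(3)[unfolded yang_baxter_def] using x by (simp add: m_assoc)
  also have "\<dots> = C \<otimes> B"
    unfolding c(2)[unfolded commutes_def] using x by (simp add: B_def C_def m_assoc)
  finally show "B \<otimes> C = C \<otimes> B" .
  have "A \<otimes> C = inv x23 \<otimes> inv x24 \<otimes> (x12 \<otimes> (x14 \<otimes> x24)) \<otimes> x34" using x by (simp add: A_def C_def m_assoc)
  also have "\<dots> = inv x23 \<otimes> x14 \<otimes> (x12 \<otimes> x34)"
    unfolding yb(2)[unfolded yang_baxter_def] using x by (simp add: m_assoc)
  also have "\<dots> = x14 \<otimes> (inv x23 \<otimes> x34) \<otimes> x12"
    unfolding c(1)[unfolded commutes_def] inv23 using x by (simp add: m_assoc)
  also have "\<dots> = C \<otimes> A" unfolding y'[symmetric] using x by (simp add: A_def C_def m_assoc)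
  finally show "C \<otimes> A = A \<otimes> C" ..
  have "A \<otimes> B = inv x23 \<otimes> inv x24 \<otimes> (x12 \<otimes> inv x34) \<otimes> x13 \<otimes> x23" using x by (simp add: A_def B_def m_assoc)
  also have "\<dots> = inv x23 \<otimes> inv x24 \<otimes> inv x34 \<otimes> (x12 \<otimes> (x13 \<otimes> x23))"
    unfolding inv34 using x by (simp add: m_assoc)
  also have "\<dots> = inv x34 \<otimes> inv x24 \<otimes> x13 \<otimes> x12"
    unfolding y yb(1)[unfolded yang_baxter_def] using x by (simp add: m_assoc)
  also have "\<dots> = inv x34 \<otimes> (x13 \<otimes> inv x24) \<otimes> x12"
    using c(2) commutes_inv_iff[of x13 x24] x by (simp add: commutes_def m_assoc)
  also have "\<dots> = B \<otimes> A" using x by (simp add: A_def B_def m_assoc)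
  finally show "A \<otimes> B = B \<otimes> A" .
qed

context virtual_braids
begin

lemma four_not_mild:
  assumes n: "4 \<le> n"
  shows "\<not> admits_mild_presentation P" and "\<not> admits_mild_presentation U"
proof -
  \<comment> \<open>A commuting triple of products of upper generators. Exactly one generator with
    first index 1 occurs in each, so the exponents of \<open>x 1 2\<close>, \<open>x 1 3\<close>,
    \<open>x 1 4\<close> on \<open>a\<close>, \<open>b\<close>, \<open>c\<close> form the identity
    matrix.\<close>
  define a where "a = inv\<^bsub>P\<^esub> (x 2 3) \<cdot> inv\<^bsub>P\<^esub> (x 2 4) \<cdot> x 1 2"
  define b where "b = inv\<^bsub>P\<^esub> (x 3 4) \<cdot> x 1 3 \<cdot> x 2 3"
  define c where "c = x 1 4 \<cdot> x 2 4 \<cdot> x 3 4"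
  have xs: "x 1 2 \<in> carrier P" "x 1 3 \<in> carrier P" "x 1 4 \<in> carrier P" "x 2 3 \<in> carrier P"
      "x 2 4 \<in> carrier P" "x 3 4 \<in> carrier P"
    using n by (auto intro!: x_closed)
  have ys: "yang_baxter P (x 1 2) (x 1 3) (x 2 3)" "yang_baxter P (x 1 2) (x 1 4) (x 2 4)"
      "yang_baxter P (x 1 3) (x 1 4) (x 3 4)" "yang_baxter P (x 2 3) (x 2 4) (x 3 4)"
    using n by (auto intro!: triple)
  have cs: "commutes P (x 1 2) (x 3 4)" "commutes P (x 1 3) (x 2 4)" "commutes P (x 2 3) (x 1 4)"
    using n by (auto intro!: disjoint_commute)
  note comm = P.four_strands[OF xs ys cs, folded a_def b_def c_def]
  have cl: "a \<in> carrier P" "b \<in> carrier P" "c \<in> carrier P"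
    using n by (simp_all add: a_def b_def c_def)
  define f where "f i y = complex_of_int (exponent (1, i + 2) y)" for i y
  have f: "f i (y \<cdot> z) = f i y + f i z" if "y \<in> carrier P" "z \<in> carrier P" for i y z
    using group_hom.hom_mult[OF exponent_hom that] by (simp add: f_def integer_group_def)
  have finv: "f i (inv\<^bsub>P\<^esub> y) = - f i y" if "y \<in> carrier P" for i y
    using group_hom.hom_inv[OF exponent_hom that] by (simp add: f_def)
  have fx: "f i (x j k) = (if j = 1 \<and> k = i + 2 then 1 else 0)" if "j \<in> {1..n}" "k \<in> {1..n}" "j \<noteq> k" for i j k
    using exponent_x[OF that, of "(1, i + 2)"] by (simp add: f_def)
  have fabc: "f i a = (if i = 0 then 1 else 0)" "f i b = (if i = 1 then 1 else 0)"
    "f i c = (if i = 2 then 1 else 0)" for i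
    using n by (simp_all add: a_def b_def c_def f finv fx)
  show "\<not> admits_mild_presentation P"
    by (rule not_mild[OF P.is_group cl comm, of f]) (simp_all add: f fabc)
  \<comment> \<open>The triple already lies in the upper group, and the functionals restrict to
    it.\<close>
  interpret U: group U by (rule P.group_subgroup_generated)
  have Ux: "x i j \<in> carrier U" if "1 \<le> i" "i < j" "j \<le> n" for i j
    unfolding carrier_subgroup_generated using that by (intro generate.incl) auto
  have inv: "inv\<^bsub>P\<^esub> y \<in> carrier U" if "y \<in> carrier U" for y
    using U.inv_closed[OF that] that by (simp add: P.inv_subgroup_generated)
  have mult: "y \<cdot> z \<in> carrier U" if "y \<in> carrier U" "z \<in> carrier U" for y z
    using U.m_closed[OF that] by simp
  have clU: "a \<in> carrier U" "b \<in> carrier U" "c \<in> carrier U"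
    unfolding a_def b_def c_def using n by (intro mult inv Ux; simp)+
  show "\<not> admits_mild_presentation U"
  proof (rule not_mild[OF U.is_group clU, of f])
    show "f i (y \<otimes>\<^bsub>U\<^esub> z) = f i y + f i z" if "y \<in> carrier U" "z \<in> carrier U" for i y z
      using f that P.carrier_subgroup_generated_subset[of upper] by auto
  qed (use comm in \<open>simp_all add: fabc\<close>)
qed

end

subsection \<open>At most three strands\<close>

lemma (in group) word_eval_subgroup_generated:
  assumes "f \<in> S \<rightarrow> carrier (subgroup_generated G X)" "fst ` set w \<subseteq> S"
  shows "word_eval (subgroup_generated G X) f w = word_eval G f w"
  using assms(2)
proof (induction w)
  case (Cons y w)
  then show ?case
    using assms(1) by (cases y) (auto simp: word_eval_Cons inv_subgroup_generated Pi_iff)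
qed simp

lemma yang_baxter_sym: "yang_baxter G x y z \<longleftrightarrow> yang_baxter G z y x"
  by (auto simp: yang_baxter_def)

context presentation
begin

lemma word_eval_image_subgroup:
  assumes G: "group G" and f: "f \<in> S \<rightarrow> carrier G"
  shows "subgroup (word_eval G f ` carrier F) G" and "s \<in> S \<Longrightarrow> f s \<in> word_eval G f ` carrier F"
proof -
  interpret G: group G by (rule G)
  interpret h: group_hom F G "word_eval G f" using G.word_eval_hom[OF f] by unfold_locales
  show "subgroup (word_eval G f ` carrier F) G" by (rule h.img_is_subgroup)
  show "f s \<in> word_eval G f ` carrier F" if "s \<in> S"
    using letter_closed[OF that] G.word_eval_letter[of f s] f that by (metis PiE image_eqI)
qed

end

context virtual_braids
begin

context
  fixes S :: "'a set" and R :: "'a gword set" and f :: "'a \<Rightarrow> (nat \<times> nat) gword set"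
    and h :: "nat \<times> nat \<Rightarrow> 'a gword set" and Q
  assumes S: "presentation S R" and Q: "Q = presented_group S R"
    and f: "f \<in> S \<rightarrow> carrier P"
    and rel: "\<And>r. r \<in> R \<Longrightarrow> word_eval P f r = \<one>\<^bsub>P\<^esub>"
    and h: "\<And>i j. i \<in> {1..n} \<Longrightarrow> j \<in> {1..n} \<Longrightarrow> i \<noteq> j \<Longrightarrow> h (i, j) \<in> carrier Q"
    and h_triple: "\<And>i j k. {i, j, k} \<subseteq> {1..n} \<Longrightarrow> distinct [i, j, k] \<Longrightarrow>
      yang_baxter Q (h (i, j)) (h (i, k)) (h (j, k))"
    and h_disjoint: "\<And>i j k l. {i, j, k, l} \<subseteq> {1..n} \<Longrightarrow> distinct [i, j, k, l] \<Longrightarrow>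
      commutes Q (h (i, j)) (h (k, l))"
    and hf: "\<And>k s. group_hom P Q k \<Longrightarrow> (\<And>i j. i \<in> {1..n} \<Longrightarrow> j \<in> {1..n} \<Longrightarrow> i \<noteq> j \<Longrightarrow> k (x i j) = h (i, j)) \<Longrightarrow>
      s \<in> S \<Longrightarrow> k (f s) = presented_gen S R s"
begin

text \<open>The assignment \<open>h\<close> on generators defines a homomorphism by von Dyck's
  theorem, and \<open>hf\<close> says that it undoes \<open>f\<close> on the generators of
  \<open>Q\<close>.\<close>

lemma retraction: "\<exists>k. group_hom P Q k \<and> (\<forall>s\<in>S. k (f s) = presented_gen S R s)"
proof -
  interpret Q: presentation S R by (rule S)
  have QG: "group Q" unfolding Q by (rule Q.P.is_group)
  have hc: "h \<in> virt_gens n \<rightarrow> carrier Q" using h by (auto simp: virt_gens_iff)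
  have r: "word_eval Q h r = \<one>\<^bsub>Q\<^esub>" if "r \<in> virt_relators n" for r
    by (rule relators_eval[OF QG _ _ _ that]) (rule h h_triple h_disjoint; assumption)+
  have hom: "group_hom P Q (pres_hom Q h)"
    using pres_hom_in_hom[OF QG hc r] QG P.is_group by (simp add: group_hom_def group_hom_axioms_def)
  have "pres_hom Q h (x i j) = h (i, j)" if "i \<in> {1..n}" "j \<in> {1..n}" "i \<noteq> j" for i j
    by (rule pres_hom_gen[OF QG hc r]) (use that in \<open>simp_all add: virt_gens_iff\<close>)
  then show ?thesis using hf[OF hom] hom by blast
qed

lemma iso_P:
  assumes "\<And>H i j. subgroup H P \<Longrightarrow> (\<And>s. s \<in> S \<Longrightarrow> f s \<in> H) \<Longrightarrow> i \<in> {1..n} \<Longrightarrow> j \<in> {1..n} \<Longrightarrow> i \<noteq> j \<Longrightarrow>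
      x i j \<in> H"
  shows "P \<cong> Q"
proof -
  interpret Q: presentation S R by (rule S)
  obtain k where k: "group_hom P Q k" "\<forall>s\<in>S. k (f s) = presented_gen S R s" using retraction by blast
  note im = Q.word_eval_image_subgroup[OF P.is_group f]
  have "word_eval P f ` carrier Q.F = carrier P"
    by (rule subgroup_eq_carrier[OF im(1)]) (use assms[OF im] in \<open>auto simp: virt_gens_def\<close>)
  then show ?thesis
    unfolding Q using k
    by (intro Q.iso_presented[OF P.is_group f rel, of k])
      (auto simp: Q group_hom_def group_hom_axioms_def)
qed

text \<open>The upper group is given only as a subgroup, so the homomorphism to \<open>Q\<close> is
  defined on all of vP_n and then restricted.\<close>

lemma iso_U:
  assumes fU: "f \<in> S \<rightarrow> carrier U"
    and gens: "\<And>H i j. subgroup H P \<Longrightarrow> (\<And>s. s \<in> S \<Longrightarrow> f s \<in> H) \<Longrightarrow> i \<in> {1..n} \<Longrightarrow> j \<in> {1..n} \<Longrightarrow> i < j \<Longrightarrow>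
      x i j \<in> H"
  shows "U \<cong> Q"
proof -
  interpret Q: presentation S R by (rule S)
  interpret U: group U by (rule P.group_subgroup_generated)
  obtain k where k: "group_hom P Q k" "\<forall>s\<in>S. k (f s) = presented_gen S R s" using retraction by blast
  have w: "word_eval U f w = word_eval P f w" if "w \<in> carrier Q.F" for w
    using that by (intro P.word_eval_subgroup_generated[OF fU]) (simp add: free_group_carrier)
  note im = Q.word_eval_image_subgroup[OF P.is_group f]
  have "carrier U = generate P (carrier P \<inter> upper)" by (rule carrier_subgroup_generated)
  also have "\<dots> \<subseteq> word_eval P f ` carrier Q.F"
    by (rule P.generate_subgroup_incl[OF _ im(1)]) (use gens[OF im] in auto)
  finally have surj: "carrier U \<subseteq> word_eval U f ` carrier Q.F" using w by (simp cong: image_cong)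
  have relU: "word_eval U f r = \<one>\<^bsub>U\<^esub>" if "r \<in> R" for r
    using w rel[OF that] Q.relators that by auto
  have "k \<in> hom U Q"
  proof (rule homI)
    have sub: "y \<in> carrier P" if "y \<in> carrier U" for y
      using P.carrier_subgroup_generated_subset[of upper] that by blast
    show "k y \<in> carrier Q" if "y \<in> carrier U" for y
      by (rule group_hom.hom_closed[OF k(1) sub[OF that]])
    show "k (y \<otimes>\<^bsub>U\<^esub> y') = k y \<otimes>\<^bsub>Q\<^esub> k y'" if "y \<in> carrier U" "y' \<in> carrier U" for y y'
      using group_hom.hom_mult[OF k(1) sub[OF that(1)] sub[OF that(2)]] by simp
  qed
  then show ?thesis
    unfolding Q using k(2)
    by (intro Q.iso_presented[OF U.is_group fU relU _ _ surj, of k]) (auto simp: Q)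
qed

end

end

text \<open>The substitution z = x12, p1 = x23^(-1) x12, p2 = x31^(-1) x23, u1 = x13 x12, u2 = x21
  x23, u3 = x32 x31, read backwards. Each of the six relations becomes the commutation of some u_i
  with an element whose exponent sums at p1 and p2 are those of exactly one of them, as the mildness
  criterion requires. Several equivalences presuppose a commutation obtained earlier in the
  list.\<close>

lemma (in group) three_strands:
  assumes c: "z \<in> carrier G" "p1 \<in> carrier G" "p2 \<in> carrier G" "u1 \<in> carrier G" "u2 \<in> carrier G"
      "u3 \<in> carrier G"
    and x: "x12 = z" "x23 = z \<otimes> inv p1" "x31 = z \<otimes> inv p1 \<otimes> inv p2" "x13 = u1 \<otimes> inv z"
      "x21 = u2 \<otimes> p1 \<otimes> inv z" "x32 = u3 \<otimes> p2 \<otimes> p1 \<otimes> inv z"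
  shows "yang_baxter G x12 x13 x23 \<longleftrightarrow> commutes G u1 p1"
    and "commutes G u1 p1 \<Longrightarrow> yang_baxter G x13 x12 x32 \<longleftrightarrow> commutes G u1 (u3 \<otimes> p2)"
    and "commutes G u1 p1 \<Longrightarrow> yang_baxter G x21 x23 x13 \<longleftrightarrow> commutes G u2 (inv u1 \<otimes> p1)"
    and "yang_baxter G x23 x21 x31 \<longleftrightarrow> commutes G u2 p2"
    and "commutes G u2 p2 \<Longrightarrow> yang_baxter G x32 x31 x21 \<longleftrightarrow> commutes G u3 (inv u2 \<otimes> p2)"
    and "commutes G u2 p2 \<Longrightarrow> commutes G u3 (inv u2 \<otimes> p2) \<Longrightarrow>
      yang_baxter G x31 x32 x12 \<longleftrightarrow> commutes G u3 (u2 \<otimes> p1)"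
proof -
  have cx: "x12 \<in> carrier G" "x23 \<in> carrier G" "x31 \<in> carrier G" "x13 \<in> carrier G"
    "x21 \<in> carrier G" "x32 \<in> carrier G" unfolding x using c by simp_all
  have self: "commutes G y (y \<otimes> y') \<longleftrightarrow> commutes G y y'" if "y \<in> carrier G" "y' \<in> carrier G" for y y'
    using that by (intro commutes_mult_iff) (simp_all add: commutes_def)
  have inv_left: "inv y \<otimes> y' = y' \<otimes> inv y" if "y \<in> carrier G" "y' \<in> carrier G" "commutes G y y'" for y y'
    using commutes_inv_iff[of y' y] that commutes_sym[of y y'] by (simp add: commutes_def)
  show "yang_baxter G x12 x13 x23 \<longleftrightarrow> commutes G u1 p1"
    unfolding yang_baxter_def x using commutes_inv_iff[of u1 p1] c by (simp add: m_assoc commutes_def)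
  show "yang_baxter G x13 x12 x32 \<longleftrightarrow> commutes G u1 (u3 \<otimes> p2)" if "commutes G u1 p1"
  proof -
    have "x13 \<otimes> x12 = u1" "x13 \<otimes> inv x32 = u1 \<otimes> inv (u3 \<otimes> p2 \<otimes> p1)"
      unfolding x using c by (simp_all add: m_assoc inv_mult_group)
    then show ?thesis
      using yang_baxter_commutes(2)[OF cx(4,1,6)] self[of u1] commutes_inv_iff[of u1]
        commutes_mult_iff(2)[of u1 "u3 \<otimes> p2" p1] that c by simp
  qed
  show "yang_baxter G x21 x23 x13 \<longleftrightarrow> commutes G u2 (inv u1 \<otimes> p1)" if "commutes G u1 p1"
  proof -
    have "x21 \<otimes> x23 = u2" "x21 \<otimes> inv x13 = u2 \<otimes> (p1 \<otimes> inv u1)"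
      unfolding x using c by (simp_all add: m_assoc inv_mult_group)
    then show ?thesis
      using yang_baxter_commutes(2)[OF cx(5,2,4)] self[of u2] inv_left[of u1 p1] that c by simp
  qed
  show "yang_baxter G x23 x21 x31 \<longleftrightarrow> commutes G u2 p2"
  proof -
    have "x21 \<otimes> x31 = u2 \<otimes> inv p2" "inv x31 \<otimes> x23 = p2"
      unfolding x using c by (simp_all add: m_assoc inv_mult_group)
    moreover have "commutes G p2 (inv p2)" using c by (simp add: commutes_def)
    ultimately show ?thesis
      using yang_baxter_commutes(1)[OF cx(2,5,3)] commutes_mult_iff(2)[of p2 u2 "inv p2"]
        commutes_sym[of p2] c by simp
  qed
  show "yang_baxter G x32 x31 x21 \<longleftrightarrow> commutes G u3 (inv u2 \<otimes> p2)" if "commutes G u2 p2"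
  proof -
    have "x32 \<otimes> x31 = u3" "x32 \<otimes> inv x21 = u3 \<otimes> (p2 \<otimes> inv u2)"
      unfolding x using c by (simp_all add: m_assoc inv_mult_group)
    then show ?thesis
      using yang_baxter_commutes(2)[OF cx(6,3,5)] self[of u3] inv_left[of u2 p2] that c by simp
  qed
  show "yang_baxter G x31 x32 x12 \<longleftrightarrow> commutes G u3 (u2 \<otimes> p1)"
    if "commutes G u2 p2" "commutes G u3 (inv u2 \<otimes> p2)"
  proof -
    let ?p = "p2 \<otimes> p1"
    have "x32 \<otimes> x12 = u3 \<otimes> ?p" "inv x12 \<otimes> x31 = inv ?p"
      unfolding x using c by (simp_all add: m_assoc inv_mult_group)
    then have "yang_baxter G x31 x32 x12 \<longleftrightarrow> commutes G (u3 \<otimes> ?p) ?p"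
      using yang_baxter_commutes(1)[OF cx(3,6,1)] commutes_inv_iff[of "u3 \<otimes> ?p" ?p] c by simp
    also have "\<dots> \<longleftrightarrow> commutes G u3 ?p"
      using commutes_mult_iff(2)[of ?p u3 ?p] commutes_sym[of ?p] c by (simp add: commutes_def)
    also have "?p = (inv u2 \<otimes> p2) \<otimes> (u2 \<otimes> p1)"
      using inv_left[of u2 p2] that(1) c by (simp add: m_assoc)
    also have "commutes G u3 ((inv u2 \<otimes> p2) \<otimes> (u2 \<otimes> p1)) \<longleftrightarrow> commutes G u3 (u2 \<otimes> p1)"
      using that(2) c by (intro commutes_mult_iff) simp_all
    finally show ?thesis .
  qed
qed

lemma three_cases:
  assumes "{i, j, k} \<subseteq> {1..3::nat}" "distinct [i, j, k]"
  shows "(i, j, k) = (1, 2, 3) \<or> (i, j, k) = (1, 3, 2) \<or> (i, j, k) = (2, 1, 3) \<or> (i, j, k) = (2, 3, 1)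
    \<or> (i, j, k) = (3, 1, 2) \<or> (i, j, k) = (3, 2, 1)"
proof -
  have "i = 1 \<or> i = 2 \<or> i = 3" "j = 1 \<or> j = 2 \<or> j = 3" "k = 1 \<or> k = 2 \<or> k = 3"
    using assms(1) by auto
  then show ?thesis using assms(2) by auto
qed

lemma no_four_distinct: "{i, j, k, l} \<subseteq> {1..m::nat} \<Longrightarrow> distinct [i, j, k, l] \<Longrightarrow> m \<le> 3 \<Longrightarrow> A"
  using card_mono[of "{1..m}" "{i, j, k, l}"] by simp

lemma no_three_distinct: "{i, j, k} \<subseteq> {1..m::nat} \<Longrightarrow> distinct [i, j, k] \<Longrightarrow> m \<le> 2 \<Longrightarrow> A"
  using card_mono[of "{1..m}" "{i, j, k}"] by simp

context virtual_braids
begin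

lemma upper_closed: "1 \<le> i \<Longrightarrow> i < j \<Longrightarrow> j \<le> n \<Longrightarrow> x i j \<in> carrier U"
  unfolding carrier_subgroup_generated by (intro generate.incl) auto

text \<open>Letters 1 and 2 stand for p1 and p2 and form the set C; 3, 4, 5 stand for u1, u2, u3;
  letter 6 stands for z and occurs in no relator.\<close>

lemma three_mild:
  assumes n: "n = 3"
  shows "admits_mild_presentation P"
proof -
  have n': "3 \<le> n" using n by simp
  define S where "S = {1..6::nat}"
  let ?F = "free_group S" and ?l = letter
  define a where "a i = [1::nat, 2, 2, 1, 2, 1] ! i" for i
  define b where "b i = [3::nat, 3, 4, 4, 5, 5] ! i" for i
  define w where "w i = [?l 1, ?l 5 \<otimes>\<^bsub>?F\<^esub> ?l 2, ?l 2, inv\<^bsub>?F\<^esub> ?l 3 \<otimes>\<^bsub>?F\<^esub> ?l 1,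
    inv\<^bsub>?F\<^esub> ?l 4 \<otimes>\<^bsub>?F\<^esub> ?l 2, ?l 4 \<otimes>\<^bsub>?F\<^esub> ?l 1] ! i" for i
  interpret FS: group ?F by (rule group_free_group)
  have S_iff: "s \<in> S \<longleftrightarrow> s = 1 \<or> s = 2 \<or> s = 3 \<or> s = 4 \<or> s = 5 \<or> s = 6" for s
    by (auto simp: S_def)
  have l: "?l s \<in> carrier ?F" if "s \<in> S" for s using that by (rule letter_closed)
  have ls: "?l 1 \<in> carrier ?F" "?l 2 \<in> carrier ?F" "?l 3 \<in> carrier ?F" "?l 4 \<in> carrier ?F"
      "?l 5 \<in> carrier ?F" "?l 6 \<in> carrier ?F"
    by (simp_all add: l S_iff)
  have six: "i = 0 \<or> i = 1 \<or> i = 2 \<or> i = 3 \<or> i = 4 \<or> i = 5" if "i < 6" for i :: nat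
    using that by auto
  interpret Q: commutator_presentation 6 6 S "{1, 2}" a b w
  proof
    show "S = {1..6}" by (rule S_def)
    show "{1, 2} \<subseteq> S" by (auto simp: S_iff)
    show "b i \<in> S - {1, 2}" "a i \<in> {1, 2}" "w i \<in> carrier ?F" if "i < 6" for i
      using six[OF that] ls by (auto simp: a_def b_def w_def S_iff)
    show "magnus (w i) [s] = (if s = a i then 1 else 0)" if "i < 6" "s \<in> {1, 2}" for i s
      using six[OF that(1)] that(2) ls
      by (auto simp: a_def w_def magnus_degree_one[of _ S] magnus_degree_one_inv[of _ S]
          magnus_degree_one_letter)
    show "i = j" if "i < 6" "j < 6" "b i = b j" "a i = a j" for i j
      using six[OF that(1)] six[OF that(2)] that(3,4) by (auto simp: a_def b_def)
  qed
  define z where "z = x 1 2"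
  define p1 where "p1 = inv\<^bsub>P\<^esub> (x 2 3) \<cdot> x 1 2"
  define p2 where "p2 = inv\<^bsub>P\<^esub> (x 3 1) \<cdot> x 2 3"
  define u1 where "u1 = x 1 3 \<cdot> x 1 2"
  define u2 where "u2 = x 2 1 \<cdot> x 2 3"
  define u3 where "u3 = x 3 2 \<cdot> x 3 1"
  define f where "f s = [\<one>\<^bsub>P\<^esub>, p1, p2, u1, u2, u3, z] ! s" for s
  have cx: "x 1 2 \<in> carrier P" "x 2 3 \<in> carrier P" "x 3 1 \<in> carrier P" "x 1 3 \<in> carrier P"
      "x 2 1 \<in> carrier P" "x 3 2 \<in> carrier P"
    using n' by (auto intro!: x_closed)
  have c: "z \<in> carrier P" "p1 \<in> carrier P" "p2 \<in> carrier P" "u1 \<in> carrier P" "u2 \<in> carrier P"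
      "u3 \<in> carrier P"
    using cx by (simp_all add: z_def p1_def p2_def u1_def u2_def u3_def)
  have ex: "x 1 2 = z" "x 2 3 = z \<cdot> inv\<^bsub>P\<^esub> p1" "x 3 1 = z \<cdot> inv\<^bsub>P\<^esub> p1 \<cdot> inv\<^bsub>P\<^esub> p2"
      "x 1 3 = u1 \<cdot> inv\<^bsub>P\<^esub> z" "x 2 1 = u2 \<cdot> p1 \<cdot> inv\<^bsub>P\<^esub> z"
      "x 3 2 = u3 \<cdot> p2 \<cdot> p1 \<cdot> inv\<^bsub>P\<^esub> z"
    using cx by (simp_all add: z_def p1_def p2_def u1_def u2_def u3_def P.m_assoc P.inv_mult_group)
  have yb: "yang_baxter P (x 1 2) (x 1 3) (x 2 3)" "yang_baxter P (x 1 3) (x 1 2) (x 3 2)"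
      "yang_baxter P (x 2 1) (x 2 3) (x 1 3)" "yang_baxter P (x 2 3) (x 2 1) (x 3 1)"
      "yang_baxter P (x 3 2) (x 3 1) (x 2 1)" "yang_baxter P (x 3 1) (x 3 2) (x 1 2)"
    using n' by (auto intro!: triple)
  note t = P.three_strands[OF c ex]
  have c1: "commutes P u1 p1" and c4: "commutes P u2 p2" using t(1,4) yb by simp_all
  have c2: "commutes P u1 (u3 \<cdot> p2)" and c3: "commutes P u2 (inv\<^bsub>P\<^esub> u1 \<cdot> p1)"
    and c5: "commutes P u3 (inv\<^bsub>P\<^esub> u2 \<cdot> p2)"
    using t(2)[OF c1] t(3)[OF c1] t(5)[OF c4] yb by simp_all
  have c6: "commutes P u3 (u2 \<cdot> p1)" using t(6)[OF c4 c5] yb by simp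
  have f: "f \<in> S \<rightarrow> carrier P" using c by (auto simp: S_iff f_def)
  have rel: "word_eval P f r = \<one>\<^bsub>P\<^esub>" if "r \<in> set Q.rels" for r
  proof (rule Q.rels_eval[OF P.is_group f _ that])
    interpret e: group_hom ?F P "word_eval P f" using P.word_eval_hom[OF f] by unfold_locales
    have el: "word_eval P f (?l s) = f s" if "s \<in> S" for s
      using f that by (intro P.word_eval_letter) auto
    show "commutes P (f (b i)) (word_eval P f (w i))" if "i < 6" for i
      using six[OF that] c1 c2 c3 c4 c5 c6
      by (auto simp: b_def w_def ls el S_iff f_def simp del: One_nat_def)
  qed
  let ?g = "Q.gen"
  \<comment> \<open>The inverse substitution of \<open>three_strands\<close>; the last branch serves
    the pair (3, 2).\<close>
  define h where "h p = (if p = (1, 2) then ?g 6 else if p = (2, 3) then ?g 6 \<otimes>\<^bsub>Q.P\<^esub> inv\<^bsub>Q.P\<^esub> ?g 1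
    else if p = (3, 1) then ?g 6 \<otimes>\<^bsub>Q.P\<^esub> inv\<^bsub>Q.P\<^esub> ?g 1 \<otimes>\<^bsub>Q.P\<^esub> inv\<^bsub>Q.P\<^esub> ?g 2
    else if p = (1, 3) then ?g 3 \<otimes>\<^bsub>Q.P\<^esub> inv\<^bsub>Q.P\<^esub> ?g 6
    else if p = (2, 1) then ?g 4 \<otimes>\<^bsub>Q.P\<^esub> ?g 1 \<otimes>\<^bsub>Q.P\<^esub> inv\<^bsub>Q.P\<^esub> ?g 6
    else ?g 5 \<otimes>\<^bsub>Q.P\<^esub> ?g 2 \<otimes>\<^bsub>Q.P\<^esub> ?g 1 \<otimes>\<^bsub>Q.P\<^esub> inv\<^bsub>Q.P\<^esub> ?g 6)" for p :: "nat \<times> nat"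
  have gc: "?g s \<in> carrier Q.P" if "s \<in> S" for s using Q.gen_closed that by auto
  have gs: "?g 6 \<in> carrier Q.P" "?g 1 \<in> carrier Q.P" "?g 2 \<in> carrier Q.P" "?g 3 \<in> carrier Q.P"
      "?g 4 \<in> carrier Q.P" "?g 5 \<in> carrier Q.P"
    by (simp_all add: gc S_iff)
  have hx: "h (1, 2) = ?g 6" "h (2, 3) = ?g 6 \<otimes>\<^bsub>Q.P\<^esub> inv\<^bsub>Q.P\<^esub> ?g 1"
    "h (3, 1) = ?g 6 \<otimes>\<^bsub>Q.P\<^esub> inv\<^bsub>Q.P\<^esub> ?g 1 \<otimes>\<^bsub>Q.P\<^esub> inv\<^bsub>Q.P\<^esub> ?g 2"
    "h (1, 3) = ?g 3 \<otimes>\<^bsub>Q.P\<^esub> inv\<^bsub>Q.P\<^esub> ?g 6"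
    "h (2, 1) = ?g 4 \<otimes>\<^bsub>Q.P\<^esub> ?g 1 \<otimes>\<^bsub>Q.P\<^esub> inv\<^bsub>Q.P\<^esub> ?g 6"
    "h (3, 2) = ?g 5 \<otimes>\<^bsub>Q.P\<^esub> ?g 2 \<otimes>\<^bsub>Q.P\<^esub> ?g 1 \<otimes>\<^bsub>Q.P\<^esub> inv\<^bsub>Q.P\<^esub> ?g 6"
    by (simp_all add: h_def)
  have hc: "h p \<in> carrier Q.P" for p using gs by (simp add: h_def)
  interpret eg: group_hom ?F Q.P "word_eval Q.P ?g"
    using Q.P.word_eval_hom[OF Q.gen_closed] by unfold_locales
  have el: "word_eval Q.P ?g (?l s) = ?g s" if "s \<in> S" for s
    using gc that by (intro Q.P.word_eval_letter) auto
  have d: "commutes Q.P (?g 3) (?g 1)" "commutes Q.P (?g 3) (?g 5 \<otimes>\<^bsub>Q.P\<^esub> ?g 2)"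
      "commutes Q.P (?g 4) (?g 2)" "commutes Q.P (?g 4) (inv\<^bsub>Q.P\<^esub> ?g 3 \<otimes>\<^bsub>Q.P\<^esub> ?g 1)"
      "commutes Q.P (?g 5) (inv\<^bsub>Q.P\<^esub> ?g 4 \<otimes>\<^bsub>Q.P\<^esub> ?g 2)" "commutes Q.P (?g 5) (?g 4 \<otimes>\<^bsub>Q.P\<^esub> ?g 1)"
    using Q.gen_commutes[of 0] Q.gen_commutes[of 1] Q.gen_commutes[of 2] Q.gen_commutes[of 3]
      Q.gen_commutes[of 4] Q.gen_commutes[of 5]
    by (simp_all add: b_def w_def ls el S_iff del: One_nat_def)
  note tq = Q.P.three_strands[OF gs hx]
  have yq: "yang_baxter Q.P (h (1, 2)) (h (1, 3)) (h (2, 3))" "yang_baxter Q.P (h (1, 3)) (h (1, 2)) (h (3, 2))"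
      "yang_baxter Q.P (h (2, 1)) (h (2, 3)) (h (1, 3))" "yang_baxter Q.P (h (2, 3)) (h (2, 1)) (h (3, 1))"
      "yang_baxter Q.P (h (3, 2)) (h (3, 1)) (h (2, 1))" "yang_baxter Q.P (h (3, 1)) (h (3, 2)) (h (1, 2))"
    using tq(1) tq(2)[OF d(1)] tq(3)[OF d(1)] tq(4) tq(5)[OF d(3)] tq(6)[OF d(3,5)] d by simp_all
  have "P \<cong> Q.P"
  proof (rule iso_P[where S = S and R = "set Q.rels" and f = f and h = h])
    show "presentation S (set Q.rels)" by (rule Q.presentation_axioms)
    show "yang_baxter Q.P (h (i, j)) (h (i, k)) (h (j, k))" if "{i, j, k} \<subseteq> {1..n}" "distinct [i, j, k]" for i j k
      using three_cases[OF that(1)[unfolded n] that(2)] yq by (elim disjE) simp_all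
    show "commutes Q.P (h (i, j)) (h (k, l))" if "{i, j, k, l} \<subseteq> {1..n}" "distinct [i, j, k, l]" for i j k l
      by (rule no_four_distinct[OF that]) (simp add: n)
    show "k (f s) = Q.gen s"
      if k: "group_hom P Q.P k" and kx: "\<And>i j. i \<in> {1..n} \<Longrightarrow> j \<in> {1..n} \<Longrightarrow> i \<noteq> j \<Longrightarrow> k (x i j) = h (i, j)"
        and s: "s \<in> S" for k s
    proof -
      interpret k: group_hom P Q.P k by (rule k)
      have kx': "k (x 1 2) = h (1, 2)" "k (x 2 3) = h (2, 3)" "k (x 3 1) = h (3, 1)" "k (x 1 3) = h (1, 3)"
        "k (x 2 1) = h (2, 1)" "k (x 3 2) = h (3, 2)" using n' by (simp_all add: kx)
      show ?thesis
        using s[unfolded S_iff] cx gs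
        by (elim disjE)
          (simp_all add: f_def z_def p1_def p2_def u1_def u2_def u3_def kx' hx Q.P.m_assoc Q.P.inv_mult_group
            del: One_nat_def)
    qed
    show "x i j \<in> H" if H: "subgroup H P" and fH: "\<And>s. s \<in> S \<Longrightarrow> f s \<in> H"
      and ij: "i \<in> {1..n}" "j \<in> {1..n}" "i \<noteq> j" for H i j
    proof -
      have "z \<in> H" "p1 \<in> H" "p2 \<in> H" "u1 \<in> H" "u2 \<in> H" "u3 \<in> H"
        using fH[of 6] fH[of 1] fH[of 2] fH[of 3] fH[of 4] fH[of 5] by (simp_all add: f_def S_iff)
      then have "x 1 2 \<in> H" "x 2 3 \<in> H" "x 3 1 \<in> H" "x 1 3 \<in> H" "x 2 1 \<in> H" "x 3 2 \<in> H"
        unfolding ex by (simp_all add: subgroup.m_closed[OF H] subgroup.m_inv_closed[OF H])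
      moreover have "i = 1 \<or> i = 2 \<or> i = 3" "j = 1 \<or> j = 2 \<or> j = 3" using ij(1,2) n by auto
      ultimately show ?thesis using ij(3) by (elim disjE) simp_all
    qed
  qed (use f rel hc in auto)
  then show ?thesis by (rule Q.admits_mild)
qed

text \<open>With letters x12 x23^(-1), x12 x13 and x12 the single relation is the commutation of the
  first two, so the group is the free product of Z^2 and Z. The homomorphism from vP_3 sends
  \<open>x j i\<close> to the inverse of the image of \<open>x i j\<close> for i < j.\<close>

lemma three_upper_mild:
  assumes n: "n = 3"
  shows "admits_mild_presentation U"
proof -
  have n': "3 \<le> n" using n by simp
  define S where "S = {1..3::nat}"
  have S_iff: "s \<in> S \<longleftrightarrow> s = 1 \<or> s = 2 \<or> s = 3" for s
    by (auto simp: S_def)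
  define m where "m = (1 :: nat)"
  define w where "w = (\<lambda>_ :: nat. letter (1 :: nat))"
  interpret Q: commutator_presentation 3 m S "{1}" "\<lambda>_. 1" "\<lambda>_. 2" w
    by unfold_locales
      (simp_all add: S_iff letter_closed magnus_degree_one_letter m_def w_def, simp add: S_def)
  have cx: "x 1 2 \<in> carrier P" "x 1 3 \<in> carrier P" "x 2 3 \<in> carrier P"
    using n' by (auto intro!: x_closed)
  define f where "f s = [\<one>\<^bsub>P\<^esub>, x 1 2 \<cdot> inv\<^bsub>P\<^esub> (x 2 3), x 1 2 \<cdot> x 1 3, x 1 2] ! s" for s
  have f: "f \<in> S \<rightarrow> carrier P" using cx by (auto simp: S_iff f_def)
  have "yang_baxter P (x 1 2) (x 1 3) (x 2 3)" using n' by (auto intro!: triple)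
  then have "commutes P (f 2) (f 1)"
    using P.yang_baxter_commutes(2)[OF cx] by (simp add: f_def)
  then have rel: "word_eval P f r = \<one>\<^bsub>P\<^esub>" if "r \<in> set Q.rels" for r
    using cx by (intro Q.rels_eval[OF P.is_group f _ that]) (simp add: P.word_eval_letter f_def w_def)
  let ?g = "Q.gen"
  have gs: "?g 1 \<in> carrier Q.P" "?g 2 \<in> carrier Q.P" "?g 3 \<in> carrier Q.P"
    using Q.gen_closed by (auto simp: S_iff simp del: One_nat_def)
  define X where "X = ?g 3"
  define Y where "Y = inv\<^bsub>Q.P\<^esub> ?g 3 \<otimes>\<^bsub>Q.P\<^esub> ?g 2"
  define Z where "Z = inv\<^bsub>Q.P\<^esub> ?g 1 \<otimes>\<^bsub>Q.P\<^esub> ?g 3"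
  have XYZ: "X \<in> carrier Q.P" "Y \<in> carrier Q.P" "Z \<in> carrier Q.P"
    using gs by (simp_all add: X_def Y_def Z_def)
  have w0: "w i = letter 1" "0 < m" for i by (simp_all add: w_def m_def)
  have "commutes Q.P (?g 2) (?g 1)"
    using Q.gen_commutes[OF w0(2)] gs by (simp add: Q.P.word_eval_letter w0 del: One_nat_def)
  then have yb: "yang_baxter Q.P X Y Z"
    using Q.P.yang_baxter_commutes(2)[OF XYZ] gs
    by (simp add: X_def Y_def Z_def Q.P.inv_mult_group)
  \<comment> \<open>Rotating the one relation five times, and reading some of the results in reverse
    order, gives the relations for all six orders of the strands under this inversion rule.\<close>
  note rot = Q.P.yang_baxter_commutes(3)[THEN iffD1]
  let ?i = "m_inv Q.P"
  have i: "?i X \<in> carrier Q.P" "?i Y \<in> carrier Q.P" "?i Z \<in> carrier Q.P" using XYZ by simp_all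
  have r1: "yang_baxter Q.P (?i Z) X Y" by (rule rot[OF XYZ yb])
  have r2: "yang_baxter Q.P (?i Y) (?i Z) X" by (rule rot[OF i(3) XYZ(1,2) r1])
  have r3: "yang_baxter Q.P (?i X) (?i Y) (?i Z)" by (rule rot[OF i(2,3) XYZ(1) r2])
  have r4: "yang_baxter Q.P Z (?i X) (?i Y)" using rot[OF i r3] XYZ by simp
  have r5: "yang_baxter Q.P Y Z (?i X)" using rot[OF XYZ(3) i(1,2) r4] XYZ by simp
  define h where "h p = (if p = (1, 2) then X else if p = (1, 3) then Y else if p = (2, 3) then Z
    else if p = (2, 1) then ?i X else if p = (3, 1) then ?i Y else ?i Z)" for p :: "nat \<times> nat"
  have hc: "h p \<in> carrier Q.P" for p using XYZ by (simp add: h_def)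
  have "U \<cong> Q.P"
  proof (rule iso_U[where S = S and R = "set Q.rels" and f = f and h = h])
    show "presentation S (set Q.rels)" by (rule Q.presentation_axioms)
    show "yang_baxter Q.P (h (i, j)) (h (i, k)) (h (j, k))" if "{i, j, k} \<subseteq> {1..n}" "distinct [i, j, k]" for i j k
      using three_cases[OF that(1)[unfolded n] that(2)] yb r1 r2 r3 r4 r5
        r1[THEN yang_baxter_sym[THEN iffD1]] r3[THEN yang_baxter_sym[THEN iffD1]]
        r5[THEN yang_baxter_sym[THEN iffD1]]
      by (elim disjE) (simp_all add: h_def)
    show "commutes Q.P (h (i, j)) (h (k, l))" if "{i, j, k, l} \<subseteq> {1..n}" "distinct [i, j, k, l]" for i j k l
      by (rule no_four_distinct[OF that]) (simp add: n)
    show "k (f s) = Q.gen s"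
      if k: "group_hom P Q.P k" and kx: "\<And>i j. i \<in> {1..n} \<Longrightarrow> j \<in> {1..n} \<Longrightarrow> i \<noteq> j \<Longrightarrow> k (x i j) = h (i, j)"
        and s: "s \<in> S" for k s
    proof -
      interpret k: group_hom P Q.P k by (rule k)
      have kx': "k (x 1 2) = X" "k (x 1 3) = Y" "k (x 2 3) = Z" using n' by (simp_all add: kx h_def)
      show ?thesis
        using s[unfolded S_iff] cx gs
        by (elim disjE)
          (simp_all add: f_def kx' X_def Y_def Z_def Q.P.m_assoc Q.P.inv_mult_group del: One_nat_def)
    qed
    interpret U: group U by (rule P.group_subgroup_generated)
    have "x 1 2 \<in> carrier U" "x 1 3 \<in> carrier U" "x 2 3 \<in> carrier U"
      by (rule upper_closed; use n' in simp)+
    then show "f \<in> S \<rightarrow> carrier U"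
      using U.inv_closed U.m_closed by (auto simp: f_def S_iff P.inv_subgroup_generated simp del: One_nat_def)
    show "x i j \<in> H" if H: "subgroup H P" and fH: "\<And>s. s \<in> S \<Longrightarrow> f s \<in> H"
      and ij: "i \<in> {1..n}" "j \<in> {1..n}" "i < j" for H i j
    proof -
      have fs: "f 1 \<in> H" "f 2 \<in> H" "f 3 \<in> H" by (auto intro!: fH simp: S_iff)
      have "x 1 2 = f 3" "x 1 3 = inv\<^bsub>P\<^esub> (f 3) \<cdot> f 2" "x 2 3 = inv\<^bsub>P\<^esub> (f 1) \<cdot> f 3"
        using cx by (simp_all add: f_def P.inv_mult_group P.m_assoc)
      then have "x 1 2 \<in> H" "x 1 3 \<in> H" "x 2 3 \<in> H"
        using fs by (simp_all add: subgroup.m_closed[OF H] subgroup.m_inv_closed[OF H])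
      moreover have "i = 1 \<or> i = 2 \<or> i = 3" "j = 1 \<or> j = 2 \<or> j = 3" using ij(1,2) n by auto
      ultimately show ?thesis using ij(3) by (elim disjE) simp_all
    qed
  qed (use f rel hc in auto)
  then show ?thesis by (rule Q.admits_mild)
qed

lemma two_mild:
  assumes n: "n = 2"
  shows "admits_mild_presentation P" and "admits_mild_presentation U"
proof -
  have n': "2 \<le> n" using n by simp
  have two: "i = 1 \<and> j = 2 \<or> i = 2 \<and> j = 1" if "i \<in> {1..n}" "j \<in> {1..n}" "i \<noteq> j" for i j
    using that n by auto
  have cx: "x 1 2 \<in> carrier P" "x 2 1 \<in> carrier P"
    using n' by (auto intro!: x_closed)
  define S where "S = {1..2::nat}"
  have S_iff: "s \<in> S \<longleftrightarrow> s = 1 \<or> s = 2" for s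
    by (auto simp: S_def)
  \<comment> \<open>With no relators the group is free, and the functions for the relators are
    arbitrary default values.\<close>
  interpret Q: commutator_presentation 2 0 S "{}" "\<lambda>_. 0" "\<lambda>_. 0" "\<lambda>_. []"
    by unfold_locales (simp_all add: S_def)
  have gs: "Q.gen 1 \<in> carrier Q.P" "Q.gen 2 \<in> carrier Q.P"
    using Q.gen_closed by (auto simp: S_iff simp del: One_nat_def)
  \<comment> \<open>The letters 1 and 2 go to \<open>x 1 2\<close> and \<open>x 2 1\<close>, both
    written as \<open>x s (3 - s)\<close>.\<close>
  have "P \<cong> Q.P"
  proof (rule iso_P[where S = S and R = "set Q.rels" and f = "\<lambda>s. x s (3 - s)" and h = "\<lambda>p. Q.gen (fst p)"])
    show "presentation S (set Q.rels)" by (rule Q.presentation_axioms)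
    show "x i j \<in> H" if "subgroup H P" and fH: "\<And>s. s \<in> S \<Longrightarrow> x s (3 - s) \<in> H"
      and ij: "i \<in> {1..n}" "j \<in> {1..n}" "i \<noteq> j" for H i j
      using fH[of 1] fH[of 2] two[OF ij] by (auto simp: S_iff)
    show "k (x s (3 - s)) = Q.gen s"
      if "group_hom P Q.P k" and kx: "\<And>i j. i \<in> {1..n} \<Longrightarrow> j \<in> {1..n} \<Longrightarrow> i \<noteq> j \<Longrightarrow>
          k (x i j) = Q.gen (fst (i, j))" and s: "s \<in> S" for k s
      using s[unfolded S_iff] n' by (elim disjE) (simp_all add: kx)
    show "word_eval P (\<lambda>s. x s (3 - s)) r = \<one>\<^bsub>P\<^esub>" if "r \<in> set Q.rels" for r
      using that by (simp add: Q.rels_def)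
    show "Q.gen (fst (i, j)) \<in> carrier Q.P" if "i \<in> {1..n}" "j \<in> {1..n}" "i \<noteq> j" for i j
      using two[OF that] gs by auto
    show "yang_baxter Q.P (Q.gen (fst (i, j))) (Q.gen (fst (i, k))) (Q.gen (fst (j, k)))"
      if "{i, j, k} \<subseteq> {1..n}" "distinct [i, j, k]" for i j k
      by (rule no_three_distinct[OF that]) (simp add: n)
    show "commutes Q.P (Q.gen (fst (i, j))) (Q.gen (fst (k, l)))"
      if "{i, j, k, l} \<subseteq> {1..n}" "distinct [i, j, k, l]" for i j k l
      by (rule no_four_distinct[OF that]) (simp add: n)
    show "(\<lambda>s. x s (3 - s)) \<in> S \<rightarrow> carrier P" using cx by (auto simp: S_iff)
  qed (rule refl)
  then show "admits_mild_presentation P" by (rule Q.admits_mild)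
  define S1 where "S1 = {1 :: nat}"
  interpret Q1: commutator_presentation 1 0 S1 "{}" "\<lambda>_. 0" "\<lambda>_. 0" "\<lambda>_. []"
    by unfold_locales (simp_all add: S1_def)
  have S1: "s \<in> S1 \<longleftrightarrow> s = 1" for s by (simp add: S1_def)
  have g: "Q1.gen 1 \<in> carrier Q1.P" using Q1.gen_closed by (auto simp: S1)
  have "U \<cong> Q1.P"
  proof (rule iso_U[where S = S1 and R = "set Q1.rels" and f = "\<lambda>s. x 1 2" and h = "\<lambda>p. Q1.gen 1"])
    show "presentation S1 (set Q1.rels)" by (rule Q1.presentation_axioms)
    show "word_eval P (\<lambda>s. x 1 2) r = \<one>\<^bsub>P\<^esub>" if "r \<in> set Q1.rels" for r
      using that by (simp add: Q1.rels_def)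
    have "x 1 2 \<in> carrier U" by (rule upper_closed) (use n' in simp_all)
    then show "(\<lambda>s. x 1 2) \<in> S1 \<rightarrow> carrier U" by simp
    show "x i j \<in> H" if "subgroup H P" and "\<And>s. s \<in> S1 \<Longrightarrow> x 1 2 \<in> H"
      and ij: "i \<in> {1..n}" "j \<in> {1..n}" "i < j" for H i j
      using that(2)[of 1] two[of i j] ij by (auto simp: S1)
    show "k (x 1 2) = Q1.gen s"
      if "group_hom P Q1.P k" and "\<And>i j. i \<in> {1..n} \<Longrightarrow> j \<in> {1..n} \<Longrightarrow> i \<noteq> j \<Longrightarrow> k (x i j) = Q1.gen 1"
        and "s \<in> S1" for k s
      using that(2)[of 1 2] that(3) n' by (simp add: S1)
  qed (use cx g in \<open>auto simp: yang_baxter_def commutes_def\<close>)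
  then show "admits_mild_presentation U" by (rule Q1.admits_mild)
qed

lemma one_mild:
  assumes n: "n = 1"
  shows "admits_mild_presentation P" and "admits_mild_presentation U"
proof -
  interpret Q: commutator_presentation 0 0 "{}" "{}" "\<lambda>_. 0" "\<lambda>_. 0" "\<lambda>_. []"
    by unfold_locales simp_all
  have rels: "set Q.rels = {}" by (simp add: Q.rels_def)
  have "P \<cong> Q.P"
    by (rule iso_P[where S = "{}" and R = "set Q.rels" and f = "\<lambda>s. \<one>\<^bsub>P\<^esub>" and h = "\<lambda>p. \<one>\<^bsub>Q.P\<^esub>"])
      (use Q.presentation_axioms n in \<open>auto simp: rels yang_baxter_def commutes_def\<close>)
  then show "admits_mild_presentation P" by (rule Q.admits_mild)
  have "U \<cong> Q.P"
    by (rule iso_U[where S = "{}" and R = "set Q.rels" and f = "\<lambda>s. \<one>\<^bsub>P\<^esub>" and h = "\<lambda>p. \<one>\<^bsub>Q.P\<^esub>"])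
      (use Q.presentation_axioms n in \<open>auto simp: rels yang_baxter_def commutes_def\<close>)
  then show "admits_mild_presentation U" by (rule Q.admits_mild)
qed

end

declare One_nat_def [simp del]

section \<open>Pure braid groups\<close>

subsection \<open>Cocycles on the symmetric group\<close>

text \<open>A semidirect product of the symmetric group with the functions on arrangements \<tau>. A
  homomorphism into it over the permutation of a braid is a crossed homomorphism: values in
  \<open>Q\<close> multiply along a path that moves \<tau> to \<tau> composed with \<pi>.\<close>

definition wreath :: "nat \<Rightarrow> ('q, 'x) monoid_scheme \<Rightarrow> ((nat \<Rightarrow> nat) \<times> ((nat \<Rightarrow> nat) \<Rightarrow> 'q)) monoid" where
  "wreath n Q = \<lparr>carrier = {\<pi>. \<pi> permutes {1..n}} \<times> {f. \<forall>\<tau>. f \<tau> \<in> carrier Q},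
     monoid.mult = (\<lambda>(\<pi>, f) (\<rho>, g). (\<pi> \<circ> \<rho>, \<lambda>\<tau>. f \<tau> \<otimes>\<^bsub>Q\<^esub> g (\<tau> \<circ> \<pi>))),
     monoid.one = (id, \<lambda>_. \<one>\<^bsub>Q\<^esub>)\<rparr>"

lemma wreath_simps:
  "(\<pi>, f) \<in> carrier (wreath n Q) \<longleftrightarrow> \<pi> permutes {1..n} \<and> (\<forall>\<tau>. f \<tau> \<in> carrier Q)"
  "(\<pi>, f) \<otimes>\<^bsub>wreath n Q\<^esub> (\<rho>, g) = (\<pi> \<circ> \<rho>, \<lambda>\<tau>. f \<tau> \<otimes>\<^bsub>Q\<^esub> g (\<tau> \<circ> \<pi>))"
  "\<one>\<^bsub>wreath n Q\<^esub> = (id, \<lambda>_. \<one>\<^bsub>Q\<^esub>)"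
  by (simp_all add: wreath_def)

lemma group_wreath:
  assumes "group Q"
  shows "group (wreath n Q)"
proof -
  interpret Q: group Q by (rule assms)
  show ?thesis
  proof (rule groupI)
    fix x assume x: "x \<in> carrier (wreath n Q)"
    obtain \<pi> f where e: "x = (\<pi>, f)" by (cases x)
    then have p: "\<pi> permutes {1..n}" and f: "f \<tau> \<in> carrier Q" for \<tau> using x by (simp_all add: wreath_simps)
    have "(inv_into UNIV \<pi>, \<lambda>\<tau>. inv\<^bsub>Q\<^esub> f (\<tau> \<circ> inv_into UNIV \<pi>)) \<in> carrier (wreath n Q)"
      using permutes_inv[OF p] f by (simp add: wreath_simps)
    moreover have "(inv_into UNIV \<pi>, \<lambda>\<tau>. inv\<^bsub>Q\<^esub> f (\<tau> \<circ> inv_into UNIV \<pi>)) \<otimes>\<^bsub>wreath n Q\<^esub> x = \<one>\<^bsub>wreath n Q\<^esub>"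
      using f by (simp add: e wreath_simps permutes_inv_o[OF p])
    ultimately show "\<exists>y\<in>carrier (wreath n Q). y \<otimes>\<^bsub>wreath n Q\<^esub> x = \<one>\<^bsub>wreath n Q\<^esub>" by blast
  qed (auto simp: wreath_simps permutes_compose permutes_id Q.m_assoc comp_assoc)
qed

locale artin_braids =
  fixes n :: nat
begin

lemma braid_relators_closed: "braid_relators n \<subseteq> carrier (free_group {1..<n})"
  unfolding braid_relators_def by (auto intro!: relator_closed simp: letter_def)

sublocale presentation "{1..<n}" "braid_relators n"
  by unfold_locales (rule braid_relators_closed)

abbreviation "\<sigma> \<equiv> gen"
abbreviation mul_P (infixl "\<cdot>" 70) where "y \<cdot> z \<equiv> y \<otimes>\<^bsub>P\<^esub> z"
abbreviation "s i \<equiv> transpose i (Suc i)"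
abbreviation "PB \<equiv> pure_braid_group n"

lemma P_eq: "braid_group n = P"
  by (simp add: braid_group_def)

lemma sigma_closed: "i \<in> {1..<n} \<Longrightarrow> \<sigma> i \<in> carrier P"
  using gen_closed by auto

lemma far:
  assumes "i \<in> {1..<n}" "j \<in> {1..<n}" "i + 2 \<le> j"
  shows "commutes P (\<sigma> i) (\<sigma> j)"
proof -
  have "relator {1..<n} (letter i @ letter j) (letter j @ letter i) \<in> braid_relators n"
    using assms unfolding braid_relators_def by blast
  from relation[OF this] show ?thesis
    using assms sigma_closed by (simp add: letter_def word_eval_Cons commutes_def)
qed

lemma near:
  assumes "i \<in> {1..<n}" "Suc i \<in> {1..<n}"
  shows "\<sigma> i \<cdot> (\<sigma> (Suc i) \<cdot> \<sigma> i) = \<sigma> (Suc i) \<cdot> (\<sigma> i \<cdot> \<sigma> (Suc i))"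
proof -
  have "relator {1..<n} (letter i @ letter (Suc i) @ letter i) (letter (Suc i) @ letter i @ letter (Suc i))
      \<in> braid_relators n"
    using assms unfolding braid_relators_def by blast
  from relation[OF this] show ?thesis
    using assms sigma_closed by (simp add: letter_def word_eval_Cons)
qed

lemma relators_eval:
  assumes G: "group G" and h: "\<And>i. i \<in> {1..<n} \<Longrightarrow> h i \<in> carrier G"
    and far: "\<And>i j. i \<in> {1..<n} \<Longrightarrow> j \<in> {1..<n} \<Longrightarrow> i + 2 \<le> j \<Longrightarrow> h i \<otimes>\<^bsub>G\<^esub> h j = h j \<otimes>\<^bsub>G\<^esub> h i"
    and near: "\<And>i. i \<in> {1..<n} \<Longrightarrow> Suc i \<in> {1..<n} \<Longrightarrow>
      h i \<otimes>\<^bsub>G\<^esub> (h (Suc i) \<otimes>\<^bsub>G\<^esub> h i) = h (Suc i) \<otimes>\<^bsub>G\<^esub> (h i \<otimes>\<^bsub>G\<^esub> h (Suc i))"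
    and r: "r \<in> braid_relators n"
  shows "word_eval G h r = \<one>\<^bsub>G\<^esub>"
proof -
  interpret G: group G by (rule G)
  have hc: "h \<in> {1..<n} \<rightarrow> carrier G" using h by auto
  show ?thesis
    using r unfolding braid_relators_def
  proof (elim UnE CollectE exE conjE)
    fix i j
    assume e: "r = relator {1..<n} (letter i @ letter j) (letter j @ letter i)"
      and ij: "i \<in> {1..<n}" "j \<in> {1..<n}" "i + 2 \<le> j"
    have "word_eval G h (letter i @ letter j) = word_eval G h (letter j @ letter i)"
      using far[OF ij] h[OF ij(1)] h[OF ij(2)] by (simp add: letter_def word_eval_Cons)
    then show ?thesis
      unfolding e using ij by (subst G.word_eval_relator_iff[OF hc]) (auto simp: letter_def)
  next
    fix i
    assume e: "r = relator {1..<n} (letter i @ letter (Suc i) @ letter i)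
        (letter (Suc i) @ letter i @ letter (Suc i))"
      and i: "i \<in> {1..<n}" "Suc i \<in> {1..<n}"
    have "word_eval G h (letter i @ letter (Suc i) @ letter i) =
        word_eval G h (letter (Suc i) @ letter i @ letter (Suc i))"
      using near[OF i] h[OF i(1)] h[OF i(2)] by (simp add: letter_def word_eval_Cons)
    then show ?thesis
      unfolding e using i by (subst G.word_eval_relator_iff[OF hc]) (auto simp: letter_def)
  qed
qed

lemma s_permutes: "i \<in> {1..<n} \<Longrightarrow> s i permutes {1..n}"
  by (rule permutes_swap_id) auto

lemma s_far: "Suc (Suc i) \<le> j \<Longrightarrow> s i \<circ> s j = s j \<circ> s i"
  by (auto simp: transpose_def fun_eq_iff)

lemma s_near: "s i \<circ> (s (Suc i) \<circ> s i) = s (Suc i) \<circ> (s i \<circ> s (Suc i))"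
  by (auto simp: transpose_def fun_eq_iff)

lemma perm_relators: "r \<in> braid_relators n \<Longrightarrow> word_eval (sym_group n) s r = \<one>\<^bsub>sym_group n\<^esub>"
proof (rule relators_eval[OF sym_group_is_group])
  show "s i \<otimes>\<^bsub>sym_group n\<^esub> s j = s j \<otimes>\<^bsub>sym_group n\<^esub> s i" if "i + 2 \<le> j" for i j
    using s_far[of i j] that by (simp add: sym_group_def)
qed (simp_all add: sym_group_def s_permutes s_near)

lemma perm_closed: "s \<in> {1..<n} \<rightarrow> carrier (sym_group n)"
  using s_permutes by (auto simp: sym_group_def)

lemma braid_perm_eq: "braid_perm n = pres_hom (sym_group n) s"
  by (rule ext) (simp add: braid_perm_def pres_hom_def)

sublocale perm: group_hom P "sym_group n" "braid_perm n"
  unfolding braid_perm_eq group_hom_def group_hom_axioms_def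
  using pres_hom_in_hom[OF sym_group_is_group perm_closed perm_relators] P.is_group sym_group_is_group by blast

lemma perm_sigma: "i \<in> {1..<n} \<Longrightarrow> braid_perm n (\<sigma> i) = s i"
  unfolding braid_perm_eq by (rule pres_hom_gen[OF sym_group_is_group perm_closed perm_relators])

lemma perm_mult: "C \<in> carrier P \<Longrightarrow> C' \<in> carrier P \<Longrightarrow>
    braid_perm n (C \<cdot> C') = braid_perm n C \<circ> braid_perm n C'"
  using perm.hom_mult by (simp add: sym_group_def)

lemma PB_eq: "PB = P\<lparr>carrier := kernel P (sym_group n) (braid_perm n)\<rparr>"
  by (simp add: pure_braid_group_def P_eq)

lemma PB_simps:
  "C \<in> carrier PB \<longleftrightarrow> C \<in> carrier P \<and> braid_perm n C = id"
  "C \<otimes>\<^bsub>PB\<^esub> C' = C \<cdot> C'" "\<one>\<^bsub>PB\<^esub> = \<one>\<^bsub>P\<^esub>"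
  by (simp_all add: PB_eq kernel_def sym_group_def)

lemma group_PB: "group PB"
  unfolding PB_eq by (rule P.subgroup_imp_group[OF perm.subgroup_kernel])

end

text \<open>\<open>d i a b\<close> is the label of the crossing \<sigma>_i when the strands a, b
  stand at positions i and i + 1. The conditions are the two kinds of braid relation for labelled
  strands, so the product of labels depends only on the braid and the starting arrangement.\<close>

locale braid_cocycle = artin_braids + Q: group Q
  for Q :: "('q, 'x) monoid_scheme" (structure) +
  fixes d :: "nat \<Rightarrow> nat \<Rightarrow> nat \<Rightarrow> 'q"
  assumes d_closed [simp]: "d i a b \<in> carrier Q"
    and d_far: "i \<in> {1..<n} \<Longrightarrow> j \<in> {1..<n} \<Longrightarrow> i + 2 \<le> j \<Longrightarrow> d i a b \<otimes> d j a' b' = d j a' b' \<otimes> d i a b"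
    and d_near: "i \<in> {1..<n} \<Longrightarrow> Suc i \<in> {1..<n} \<Longrightarrow> {a, b, c} \<subseteq> {1..n} \<Longrightarrow> distinct [a, b, c] \<Longrightarrow>
      d i a b \<otimes> (d (Suc i) a c \<otimes> d i b c) = d (Suc i) b c \<otimes> (d i a c \<otimes> d (Suc i) a b)"
begin

abbreviation "W \<equiv> wreath n Q"

text \<open>The arrangement \<tau> gives the strand at each position. The default value off
  permutations makes the braid relations hold at every function \<tau>, as \<open>wreath\<close>
  requires.\<close>

definition \<Delta> :: "nat \<Rightarrow> (nat \<Rightarrow> nat) \<Rightarrow> 'q" where
  "\<Delta> i \<tau> = (if \<tau> permutes {1..n} then d i (\<tau> i) (\<tau> (Suc i)) else \<one>)"

lemma Delta_closed [simp]: "\<Delta> i \<tau> \<in> carrier Q"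
  by (simp add: \<Delta>_def)

lemma comp_s_permutes: "i \<in> {1..<n} \<Longrightarrow> \<tau> \<circ> s i permutes {1..n} \<longleftrightarrow> \<tau> permutes {1..n}"
  using permutes_compose[OF s_permutes, of i \<tau>] permutes_compose[OF s_permutes, of i "\<tau> \<circ> s i"]
  by (auto simp: comp_assoc)

sublocale W: group W
  by (rule group_wreath[OF Q.is_group])

lemma Sigma_closed: "i \<in> {1..<n} \<Longrightarrow> (s i, \<Delta> i) \<in> carrier W"
  by (simp add: wreath_simps s_permutes)

lemma Sigma_relators: "r \<in> braid_relators n \<Longrightarrow> word_eval W (\<lambda>i. (s i, \<Delta> i)) r = \<one>\<^bsub>W\<^esub>"
proof (rule relators_eval[OF W.is_group Sigma_closed])
  fix i j assume ij: "i \<in> {1..<n}" "j \<in> {1..<n}" "i + 2 \<le> j"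
  have "\<Delta> i \<tau> \<otimes> \<Delta> j (\<tau> \<circ> s i) = \<Delta> j \<tau> \<otimes> \<Delta> i (\<tau> \<circ> s j)" for \<tau>
    unfolding \<Delta>_def comp_s_permutes[OF ij(1)] comp_s_permutes[OF ij(2)]
    using ij d_far[OF ij] by (auto simp: transpose_def)
  then show "(s i, \<Delta> i) \<otimes>\<^bsub>W\<^esub> (s j, \<Delta> j) = (s j, \<Delta> j) \<otimes>\<^bsub>W\<^esub> (s i, \<Delta> i)"
    using s_far[of i j] ij(3) by (simp add: wreath_simps)
next
  fix i assume i: "i \<in> {1..<n}" "Suc i \<in> {1..<n}"
  let ?j = "Suc i"
  have "\<Delta> i \<tau> \<otimes> (\<Delta> ?j (\<tau> \<circ> s i) \<otimes> \<Delta> i (\<tau> \<circ> s i \<circ> s ?j)) =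
      \<Delta> ?j \<tau> \<otimes> (\<Delta> i (\<tau> \<circ> s ?j) \<otimes> \<Delta> ?j (\<tau> \<circ> s ?j \<circ> s i))" for \<tau>
  proof (cases "\<tau> permutes {1..n}")
    case True
    have "{\<tau> i, \<tau> ?j, \<tau> (Suc ?j)} \<subseteq> {1..n}"
      using permutes_in_image[OF True] i by auto
    moreover have "distinct [\<tau> i, \<tau> ?j, \<tau> (Suc ?j)]"
      using permutes_inj[OF True] by (simp add: inj_eq)
    ultimately show ?thesis
      unfolding \<Delta>_def comp_s_permutes[OF i(1)] comp_s_permutes[OF i(2)]
      using True d_near[OF i] by (simp add: transpose_def)
  next
    case False
    then show ?thesis unfolding \<Delta>_def comp_s_permutes[OF i(1)] comp_s_permutes[OF i(2)] by simp
  qed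
  then show "(s i, \<Delta> i) \<otimes>\<^bsub>W\<^esub> ((s ?j, \<Delta> ?j) \<otimes>\<^bsub>W\<^esub> (s i, \<Delta> i)) =
      (s ?j, \<Delta> ?j) \<otimes>\<^bsub>W\<^esub> ((s i, \<Delta> i) \<otimes>\<^bsub>W\<^esub> (s ?j, \<Delta> ?j))"
    using s_near[of i] by (simp add: wreath_simps)
qed

definition "\<Phi> = pres_hom W (\<lambda>i. (s i, \<Delta> i))"

lemma Sigma_Pi: "(\<lambda>i. (s i, \<Delta> i)) \<in> {1..<n} \<rightarrow> carrier W"
  using Sigma_closed by auto

sublocale \<Phi>: group_hom P W \<Phi>
  unfolding \<Phi>_def group_hom_def group_hom_axioms_def
  using pres_hom_in_hom[OF W.is_group Sigma_Pi Sigma_relators] P.is_group W.is_group by blast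

lemma Phi_sigma: "i \<in> {1..<n} \<Longrightarrow> \<Phi> (\<sigma> i) = (s i, \<Delta> i)"
  unfolding \<Phi>_def by (rule pres_hom_gen[OF W.is_group Sigma_Pi Sigma_relators])

lemma fst_mult: "fst (x \<otimes>\<^bsub>W\<^esub> y) = fst x \<circ> fst y" and snd_mult: "snd (x \<otimes>\<^bsub>W\<^esub> y) \<tau> = snd x \<tau> \<otimes> snd y (\<tau> \<circ> fst x)"
  by (cases x; cases y; simp add: wreath_simps)+

lemma fst_Phi: "C \<in> carrier P \<Longrightarrow> fst (\<Phi> C) = braid_perm n C"
proof (rule hom_unique[OF sym_group_is_group, of "\<lambda>C. fst (\<Phi> C)"])
  show "(\<lambda>C. fst (\<Phi> C)) \<in> hom P (sym_group n)"
  proof (rule homI)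
    show "fst (\<Phi> C) \<in> carrier (sym_group n)" if "C \<in> carrier P" for C
      using \<Phi>.hom_closed[OF that] by (cases "\<Phi> C") (simp add: wreath_simps sym_group_def)
  qed (simp add: fst_mult sym_group_def)
qed (simp_all add: perm.homh Phi_sigma perm_sigma)

text \<open>The product of the labels met along the braid from the arrangement \<tau>. A pure braid
  returns to its arrangement, so \<kappa> at the identity is multiplicative on P_n.\<close>

definition \<kappa> :: "(nat \<Rightarrow> nat) \<Rightarrow> nat gword set \<Rightarrow> 'q" where
  "\<kappa> \<tau> C = snd (\<Phi> C) \<tau>"

lemma kappa_closed [simp]: "C \<in> carrier P \<Longrightarrow> \<kappa> \<tau> C \<in> carrier Q"
  using \<Phi>.hom_closed[of C] by (cases "\<Phi> C") (simp add: wreath_simps \<kappa>_def)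

lemma kappa_sigma: "i \<in> {1..<n} \<Longrightarrow> \<tau> permutes {1..n} \<Longrightarrow> \<kappa> \<tau> (\<sigma> i) = d i (\<tau> i) (\<tau> (Suc i))"
  by (simp add: \<kappa>_def Phi_sigma \<Delta>_def)

lemma kappa_mult: "C \<in> carrier P \<Longrightarrow> C' \<in> carrier P \<Longrightarrow>
    \<kappa> \<tau> (C \<cdot> C') = \<kappa> \<tau> C \<otimes> \<kappa> (\<tau> \<circ> braid_perm n C) C'"
  by (simp add: \<kappa>_def snd_mult fst_Phi)

lemma kappa_step: "i \<in> {1..<n} \<Longrightarrow> C \<in> carrier P \<Longrightarrow> \<tau> permutes {1..n} \<Longrightarrow>
    \<kappa> \<tau> (\<sigma> i \<cdot> C) = d i (\<tau> i) (\<tau> (Suc i)) \<otimes> \<kappa> (\<tau> \<circ> s i) C"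
  by (simp add: kappa_mult sigma_closed kappa_sigma perm_sigma)

lemma kappa_hom: "\<kappa> id \<in> hom PB Q"
  by (rule homI) (simp_all add: PB_simps kappa_mult)

end

section \<open>Linking numbers, and P_n for n at least four\<close>

context artin_braids
begin

text \<open>The signed number of crossings of the two strands in \<open>e\<close>; on pure braids,
  twice their linking number.\<close>

definition linking :: "nat set \<Rightarrow> nat gword set \<Rightarrow> int" where
  "linking e = braid_cocycle.\<kappa> n integer_group (\<lambda>i a b. if {a, b} = e then 1 else 0) id"

lemma linking_cocycle: "braid_cocycle n integer_group (\<lambda>i a b. if {a, b} = e then 1 else 0)"
  by (intro braid_cocycle.intro braid_cocycle_axioms.intro group_integer_group)
    (auto simp: integer_group_def)

lemma linking_mult:
  assumes "C \<in> carrier PB" "C' \<in> carrier PB"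
  shows "linking e (C \<otimes>\<^bsub>PB\<^esub> C') = linking e C + linking e C'"
proof -
  interpret braid_cocycle n integer_group "\<lambda>i a b. if {a, b} = e then 1 else 0" by (rule linking_cocycle)
  show ?thesis using hom_mult[OF kappa_hom assms] by (simp add: linking_def integer_group_def)
qed

lemma four_not_mild:
  assumes n: "4 \<le> n"
  shows "\<not> admits_mild_presentation PB"
proof -
  define a where "a = \<sigma> 1 \<cdot> \<sigma> 1"
  define b where "b = \<sigma> 3 \<cdot> \<sigma> 3"
  \<comment> \<open>The braid that carries the strands 1, 2 as a block across the strands 3, 4. It
    exchanges \<sigma>_1 and \<sigma>_3, so its square commutes with both.\<close>
  define t where "t = \<sigma> 2 \<cdot> (\<sigma> 1 \<cdot> (\<sigma> 3 \<cdot> \<sigma> 2))"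
  define c where "c = t \<cdot> t"
  have gs: "\<sigma> 1 \<in> carrier P" "\<sigma> 2 \<in> carrier P" "\<sigma> 3 \<in> carrier P"
    using n by (auto intro!: sigma_closed)
  have cl: "a \<in> carrier P" "b \<in> carrier P" "t \<in> carrier P" "c \<in> carrier P"
    using gs by (simp_all add: a_def b_def t_def c_def)
  have c13: "\<sigma> 1 \<cdot> \<sigma> 3 = \<sigma> 3 \<cdot> \<sigma> 1"
    using far[of 1 3] n by (simp add: commutes_def)
  have n12: "\<sigma> 1 \<cdot> (\<sigma> 2 \<cdot> \<sigma> 1) = \<sigma> 2 \<cdot> (\<sigma> 1 \<cdot> \<sigma> 2)"
    using near[of 1] n by (simp add: numeral_2_eq_2)
  have n23: "\<sigma> 2 \<cdot> (\<sigma> 3 \<cdot> \<sigma> 2) = \<sigma> 3 \<cdot> (\<sigma> 2 \<cdot> \<sigma> 3)"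
    using near[of 2] n by (simp add: numeral_3_eq_3)
  have t1: "\<sigma> 1 \<cdot> t = t \<cdot> \<sigma> 3"
  proof -
    have "\<sigma> 1 \<cdot> t = \<sigma> 1 \<cdot> (\<sigma> 2 \<cdot> \<sigma> 1) \<cdot> (\<sigma> 3 \<cdot> \<sigma> 2)"
      using gs by (simp add: t_def P.m_assoc)
    also have "\<dots> = \<sigma> 2 \<cdot> \<sigma> 1 \<cdot> (\<sigma> 2 \<cdot> (\<sigma> 3 \<cdot> \<sigma> 2))"
      unfolding n12 using gs by (simp add: P.m_assoc)
    also have "\<dots> = t \<cdot> \<sigma> 3" unfolding n23 using gs by (simp add: t_def P.m_assoc)
    finally show ?thesis .
  qed
  have t3: "\<sigma> 3 \<cdot> t = t \<cdot> \<sigma> 1"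
  proof -
    have "\<sigma> 3 \<cdot> t = \<sigma> 3 \<cdot> \<sigma> 2 \<cdot> (\<sigma> 1 \<cdot> \<sigma> 3) \<cdot> \<sigma> 2"
      using gs by (simp add: t_def P.m_assoc)
    also have "\<dots> = \<sigma> 3 \<cdot> (\<sigma> 2 \<cdot> \<sigma> 3) \<cdot> (\<sigma> 1 \<cdot> \<sigma> 2)"
      unfolding c13 using gs by (simp add: P.m_assoc)
    also have "\<dots> = \<sigma> 2 \<cdot> \<sigma> 3 \<cdot> (\<sigma> 2 \<cdot> (\<sigma> 1 \<cdot> \<sigma> 2))"
      unfolding n23[symmetric] using gs by (simp add: P.m_assoc)
    also have "\<dots> = \<sigma> 2 \<cdot> (\<sigma> 3 \<cdot> \<sigma> 1) \<cdot> (\<sigma> 2 \<cdot> \<sigma> 1)"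
      unfolding n12[symmetric] using gs by (simp add: P.m_assoc)
    also have "\<dots> = t \<cdot> \<sigma> 1" unfolding c13[symmetric] using gs by (simp add: t_def P.m_assoc)
    finally show ?thesis .
  qed
  have comm: "commutes P c (\<sigma> 1)" "commutes P c (\<sigma> 3)"
  proof -
    have "\<sigma> 1 \<cdot> c = c \<cdot> \<sigma> 1" "\<sigma> 3 \<cdot> c = c \<cdot> \<sigma> 3"
      unfolding c_def using gs cl t1 t3 by (simp_all flip: P.m_assoc) (simp_all add: P.m_assoc t1 t3)
    then show "commutes P c (\<sigma> 1)" "commutes P c (\<sigma> 3)" by (simp_all add: commutes_def)
  qed
  have bc: "commutes P c b" and ca: "commutes P c a"
    unfolding a_def b_def using comm gs cl by (simp_all add: P.commutes_mult)
  have "commutes P (\<sigma> 3) a" unfolding a_def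
    using gs c13 by (intro P.commutes_mult) (simp_all add: commutes_def)
  then have ab: "commutes P a b"
    unfolding b_def using gs cl P.commutes_sym by (intro P.commutes_mult) simp_all
  have fours: "1 \<in> {1..<n}" "2 \<in> {1..<n}" "3 \<in> {1..<n}" using n by auto
  have PB: "a \<in> carrier PB" "b \<in> carrier PB" "c \<in> carrier PB"
    using gs cl fours
    by (auto simp: PB_simps a_def b_def c_def t_def perm_mult perm_sigma sym_group_def fun_eq_iff transpose_def)
  \<comment> \<open>On these three pairs of strands the crossing numbers of \<open>a\<close>,
    \<open>b\<close>, \<open>c\<close> form twice the identity matrix.\<close>
  define e where "e i = (if i = 0 then {1, 2} else if i = 1 then {3, 4} else {1, 3 :: nat})" for i :: nat
  define f where "f i C = complex_of_int (linking (e i) C)" for i C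
  have vals: "f 0 a = 2" "f 0 b = 0" "f 1 b = 2" "f 1 a = 0" "f 2 a = 0" "f 2 b = 0" "f 2 c = 2"
  proof -
    have link: "linking e a = (if {1, 2} = e then 2 else 0)" "linking e b = (if {3, 4} = e then 2 else 0)"
      "linking e c = (if {1, 3} = e then 2 else 0) + (if {1, 4} = e then 2 else 0)
        + (if {2, 3} = e then 2 else 0) + (if {2, 4} = e then 2 else 0)" for e
    proof -
      interpret L: braid_cocycle n integer_group "\<lambda>i a b. if {a, b} = e then 1 else 0" by (rule linking_cocycle)
      note step = L.kappa_step[OF fours(1)] L.kappa_step[OF fours(2)] L.kappa_step[OF fours(3)]
        L.kappa_sigma[OF fours(1)] L.kappa_sigma[OF fours(2)] L.kappa_sigma[OF fours(3)]
      note comp = s_permutes[OF fours(1)] s_permutes[OF fours(2)] s_permutes[OF fours(3)] L.comp_s_permutes[OF fours(1)] L.comp_s_permutes[OF fours(2)] L.comp_s_permutes[OF fours(3)]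
      note simps = step[simplified] comp[simplified] permutes_id gs P.m_assoc transpose_def
      show "linking e a = (if {1, 2} = e then 2 else 0)"
        by (simp add: a_def linking_def simps insert_commute)
      show "linking e b = (if {3, 4} = e then 2 else 0)"
        by (simp add: b_def linking_def simps insert_commute)
      show "linking e c = (if {1, 3} = e then 2 else 0) + (if {1, 4} = e then 2 else 0)
        + (if {2, 3} = e then 2 else 0) + (if {2, 4} = e then 2 else 0)"
        by (simp add: c_def t_def linking_def simps insert_commute)
    qed
    show "f 0 a = 2" "f 0 b = 0" "f 1 b = 2" "f 1 a = 0" "f 2 a = 0" "f 2 b = 0" "f 2 c = 2"
      unfolding f_def e_def by (simp_all add: link doubleton_eq_iff)
  qed
  show ?thesis
  proof (rule not_mild[OF group_PB PB, of f])
    show "f i (C \<otimes>\<^bsub>PB\<^esub> C') = f i C + f i C'" if "C \<in> carrier PB" "C' \<in> carrier PB" for i C C'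
      using linking_mult[OF that] by (simp add: f_def)
  qed (use ab bc ca in \<open>simp_all add: vals PB_simps commutes_def\<close>)
qed

end

subsection \<open>At most three strands\<close>

text \<open>Schreier's argument: the union of the cosets of \<open>H\<close> with representatives in
  \<open>T\<close> is stable under right multiplication by generators and their inverses, hence is
  the whole braid group. For a pure braid written as h t, also t is pure, so t is trivial.\<close>

lemma (in artin_braids) cosets_exhaust:
  assumes H: "subgroup H P" "H \<subseteq> carrier PB" and T: "T \<subseteq> carrier P" "\<one>\<^bsub>P\<^esub> \<in> T"
    and T_def: "T = \<tau> ` K"
    and moves: "\<And>i k. i \<in> {1..<n} \<Longrightarrow> k \<in> K \<Longrightarrow>
      \<nu> i k \<in> K \<and> \<nu> i (\<nu> i k) = k \<and> (\<exists>h\<in>H. \<tau> k \<cdot> \<sigma> i = h \<cdot> \<tau> (\<nu> i k))"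
    and faithful: "\<And>t. t \<in> T \<Longrightarrow> braid_perm n t = id \<Longrightarrow> t = \<one>\<^bsub>P\<^esub>"
  shows "carrier PB \<subseteq> H"
proof -
  have step: "\<exists>h\<in>H. \<exists>t'\<in>T. t \<cdot> \<sigma> i = h \<cdot> t'" if i: "i \<in> {1..<n}" and t: "t \<in> T" for i t
  proof -
    obtain k where "k \<in> K" "t = \<tau> k" using t by (auto simp: T_def)
    then show ?thesis using moves[OF i, of k] by (auto simp: T_def)
  qed
  \<comment> \<open>Since \<open>\<nu> i\<close> is an involution, every representative is also
    reached by \<sigma>_i; this handles the inverse generators.\<close>
  have onto: "\<exists>h\<in>H. \<exists>t\<in>T. t \<cdot> \<sigma> i = h \<cdot> t'" if i: "i \<in> {1..<n}" and t: "t' \<in> T" for i t'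
  proof -
    obtain k where k: "k \<in> K" "t' = \<tau> k" using t by (auto simp: T_def)
    have "\<nu> i k \<in> K" "\<nu> i (\<nu> i k) = k" using moves[OF i k(1)] by auto
    then show ?thesis using moves[OF i, of "\<nu> i k"] k(2) by (auto simp: T_def)
  qed
  define good where "good C \<longleftrightarrow> (\<forall>t\<in>T. \<exists>h\<in>H. \<exists>t'\<in>T. t \<cdot> C = h \<cdot> t')" for C
  have Hc: "h \<in> carrier P" if "h \<in> H" for h using subgroup.mem_carrier[OF H(1) that] .
  have Tc: "t \<in> carrier P" if "t \<in> T" for t using T(1) that by auto
  have good_mult: "good (C \<cdot> C')" if C: "C \<in> carrier P" "good C" and C': "C' \<in> carrier P" "good C'" for C C'
    unfolding good_def
  proof
    fix t assume t: "t \<in> T"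
    obtain h t' where 1: "h \<in> H" "t' \<in> T" "t \<cdot> C = h \<cdot> t'" using C(2) t unfolding good_def by blast
    obtain h' t'' where 2: "h' \<in> H" "t'' \<in> T" "t' \<cdot> C' = h' \<cdot> t''"
      using C'(2) 1(2) unfolding good_def by blast
    have "t \<cdot> (C \<cdot> C') = (t \<cdot> C) \<cdot> C'" using Tc[OF t] C(1) C'(1) by (simp add: P.m_assoc)
    also have "\<dots> = h \<cdot> (t' \<cdot> C')"
      unfolding 1(3) using Hc[OF 1(1)] Tc[OF 1(2)] C'(1) by (simp add: P.m_assoc)
    also have "\<dots> = (h \<cdot> h') \<cdot> t''"
      unfolding 2(3) using Hc[OF 1(1)] Hc[OF 2(1)] Tc[OF 2(2)] by (simp add: P.m_assoc)
    finally show "\<exists>h\<in>H. \<exists>t'\<in>T. t \<cdot> (C \<cdot> C') = h \<cdot> t'"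
      using subgroup.m_closed[OF H(1) 1(1) 2(1)] 2(2) by blast
  qed
  have good_one: "good \<one>\<^bsub>P\<^esub>"
    unfolding good_def
  proof
    fix t assume t: "t \<in> T"
    have "t \<cdot> \<one>\<^bsub>P\<^esub> = \<one>\<^bsub>P\<^esub> \<cdot> t" using Tc[OF t] by simp
    then show "\<exists>h\<in>H. \<exists>t'\<in>T. t \<cdot> \<one>\<^bsub>P\<^esub> = h \<cdot> t'"
      using t subgroup.one_closed[OF H(1)] by blast
  qed
  let ?K = "{C \<in> carrier P. good C \<and> good (inv\<^bsub>P\<^esub> C)}"
  have "?K = carrier P"
  proof (rule subgroup_eq_carrier)
    show "subgroup ?K P"
      by (rule P.subgroupI) (use good_one in \<open>auto simp: good_mult P.inv_mult_group\<close>)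
    fix i assume i: "i \<in> {1..<n}"
    have "good (\<sigma> i)" unfolding good_def using step[OF i] by blast
    moreover have "good (inv\<^bsub>P\<^esub> \<sigma> i)"
      unfolding good_def
    proof
      fix t' assume t': "t' \<in> T"
      obtain h t where 1: "h \<in> H" "t \<in> T" "t \<cdot> \<sigma> i = h \<cdot> t'" using onto[OF i t'] by blast
      note c = Hc[OF 1(1)] Tc[OF 1(2)] Tc[OF t'] sigma_closed[OF i]
      have "inv\<^bsub>P\<^esub> h \<cdot> t = inv\<^bsub>P\<^esub> h \<cdot> (t \<cdot> \<sigma> i) \<cdot> inv\<^bsub>P\<^esub> \<sigma> i"
        using c by (simp add: P.m_assoc)
      also have "\<dots> = t' \<cdot> inv\<^bsub>P\<^esub> \<sigma> i" unfolding 1(3) using c by simp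
      finally have "t' \<cdot> inv\<^bsub>P\<^esub> \<sigma> i = inv\<^bsub>P\<^esub> h \<cdot> t" ..
      then show "\<exists>h\<in>H. \<exists>t\<in>T. t' \<cdot> inv\<^bsub>P\<^esub> \<sigma> i = h \<cdot> t"
        using subgroup.m_inv_closed[OF H(1) 1(1)] 1(2) by blast
    qed
    ultimately show "\<sigma> i \<in> ?K" using sigma_closed[OF i] by simp
  qed
  show ?thesis
  proof
    fix C assume C: "C \<in> carrier PB"
    then have "C \<in> ?K" unfolding \<open>?K = carrier P\<close> by (simp add: PB_simps)
    then obtain h t where 1: "h \<in> H" "t \<in> T" "\<one>\<^bsub>P\<^esub> \<cdot> C = h \<cdot> t"
      using T(2) unfolding good_def by blast
    then have e: "C = h \<cdot> t" using C by (simp add: PB_simps)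
    have "braid_perm n h = id" using H(2) 1(1) by (auto simp: PB_simps)
    then have "braid_perm n t = id"
      using C perm_mult[OF Hc[OF 1(1)] Tc[OF 1(2)]] by (simp add: PB_simps e)
    then have "t = \<one>\<^bsub>P\<^esub>" by (rule faithful[OF 1(2)])
    then show "C \<in> H" using e 1(1) Hc by simp
  qed
qed

text \<open>\<kappa> of a cocycle with values in the presented group is the homomorphism back, and
  the coset argument shows that the elements \<open>f s\<close> generate P_n. The condition
  \<open>moves\<close> is stated for every subgroup containing them, so that only membership of
  explicit products has to be checked.\<close>

lemma (in artin_braids) iso_PB:
  assumes S: "presentation S R" and d: "braid_cocycle n (presented_group S R) d"
    and f: "f \<in> S \<rightarrow> carrier PB" and rel: "\<And>r. r \<in> R \<Longrightarrow> word_eval PB f r = \<one>\<^bsub>PB\<^esub>"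
    and kf: "\<And>s. s \<in> S \<Longrightarrow> braid_cocycle.\<kappa> n (presented_group S R) d id (f s) = presented_gen S R s"
    and T: "\<tau> ` K \<subseteq> carrier P" "\<one>\<^bsub>P\<^esub> \<in> \<tau> ` K"
    and moves: "\<And>i k H. subgroup H P \<Longrightarrow> (\<And>s. s \<in> S \<Longrightarrow> f s \<in> H) \<Longrightarrow> i \<in> {1..<n} \<Longrightarrow> k \<in> K \<Longrightarrow>
      \<nu> i k \<in> K \<and> \<nu> i (\<nu> i k) = k \<and> (\<exists>h\<in>H. \<tau> k \<cdot> \<sigma> i = h \<cdot> \<tau> (\<nu> i k))"
    and faithful: "\<And>k. k \<in> K \<Longrightarrow> braid_perm n (\<tau> k) = id \<Longrightarrow> \<tau> k = \<one>\<^bsub>P\<^esub>"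
  shows "PB \<cong> presented_group S R"
proof -
  interpret Q: presentation S R by (rule S)
  interpret D: braid_cocycle n Q.P d by (rule d)
  interpret PB: group PB by (rule group_PB)
  note im = Q.word_eval_image_subgroup[OF group_PB f]
  have sub: "subgroup (word_eval PB f ` carrier Q.F) P"
    using P.incl_subgroup[OF perm.subgroup_kernel] im(1) unfolding PB_eq by blast
  have "carrier PB \<subseteq> word_eval PB f ` carrier Q.F"
  proof (rule cosets_exhaust[OF sub subgroup.subset[OF im(1)] T refl])
    fix i k assume "i \<in> {1..<n}" "k \<in> K"
    then show "\<nu> i k \<in> K \<and> \<nu> i (\<nu> i k) = k \<and>
        (\<exists>h\<in>word_eval PB f ` carrier Q.F. \<tau> k \<cdot> \<sigma> i = h \<cdot> \<tau> (\<nu> i k))"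
      by (intro moves[OF sub im(2)])
  qed (use faithful in auto)
  then show ?thesis
    using Q.iso_presented[OF group_PB f rel D.kappa_hom kf] by blast
qed

text \<open>The element z is the full twist, the square of the half twist a b a. Conjugation by the
  half twist swaps a and b, which makes z central. The next two identities express the conjugates a
  b^2 a^(-1) and b a^2 b^(-1) through z, a^2 and b^2.\<close>

lemma (in group) three_strand_braids:
  assumes c: "a \<in> carrier G" "b \<in> carrier G" and aba: "a \<otimes> (b \<otimes> a) = b \<otimes> (a \<otimes> b)"
    and z: "z = a \<otimes> (b \<otimes> (a \<otimes> (b \<otimes> (a \<otimes> b))))"
  shows "commutes G z a" "commutes G z b"
    and "z \<otimes> inv (b \<otimes> b) \<otimes> inv (a \<otimes> a) = a \<otimes> b \<otimes> b \<otimes> inv a"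
    and "z \<otimes> inv (a \<otimes> a) \<otimes> inv (b \<otimes> b) = b \<otimes> a \<otimes> a \<otimes> inv b"
    and "a \<otimes> (b \<otimes> (a \<otimes> a)) = b \<otimes> (b \<otimes> (a \<otimes> b))"
proof -
  have aba': "a \<otimes> (b \<otimes> (a \<otimes> y)) = b \<otimes> (a \<otimes> (b \<otimes> y))" if "y \<in> carrier G" for y
    using arg_cong[OF aba, of "\<lambda>x. x \<otimes> y"] c that by (simp add: m_assoc)
  have z1: "z = a \<otimes> (b \<otimes> (b \<otimes> (a \<otimes> (b \<otimes> b))))"
    unfolding z using aba'[of b] c by simp
  have z2: "z = b \<otimes> (a \<otimes> (a \<otimes> (b \<otimes> (a \<otimes> a))))"
    unfolding z using aba'[of "b \<otimes> (a \<otimes> b)"] aba aba'[of a] c by simp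
  show "z \<otimes> inv (b \<otimes> b) \<otimes> inv (a \<otimes> a) = a \<otimes> b \<otimes> b \<otimes> inv a"
    unfolding z1 using c by (simp add: m_assoc inv_mult_group)
  show "z \<otimes> inv (a \<otimes> a) \<otimes> inv (b \<otimes> b) = b \<otimes> a \<otimes> a \<otimes> inv b"
    unfolding z2 using c by (simp add: m_assoc inv_mult_group)
  show "a \<otimes> (b \<otimes> (a \<otimes> a)) = b \<otimes> (b \<otimes> (a \<otimes> b))"
    using aba'[of a] aba c by simp
  \<comment> \<open>The half twist.\<close>
  define D where "D = a \<otimes> (b \<otimes> a)"
  have D: "D \<in> carrier G" using c by (simp add: D_def)
  have zD: "z = D \<otimes> D" unfolding z aba[symmetric] D_def using c by (simp add: m_assoc)
  have Da: "D \<otimes> a = b \<otimes> D" using c aba'[of a] by (simp add: D_def m_assoc)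
  have Db: "D \<otimes> b = a \<otimes> D" using c aba[symmetric] by (simp add: D_def m_assoc)
  have "z \<otimes> a = D \<otimes> b \<otimes> D" unfolding zD using c D by (simp add: m_assoc Da)
  also have "\<dots> = a \<otimes> z" unfolding Db zD using c D by (simp add: m_assoc)
  finally show "commutes G z a" by (simp add: commutes_def)
  have "z \<otimes> b = D \<otimes> a \<otimes> D" unfolding zD using c D by (simp add: m_assoc Db)
  also have "\<dots> = b \<otimes> z" unfolding Da zD using c D by (simp add: m_assoc)
  finally show "commutes G z b" by (simp add: commutes_def)
qed

context artin_braids
begin

text \<open>P_3 is presented by \<sigma>_1^2, \<sigma>_2^2 and the full twist, with the full twist
  commuting with the other two; this is the product of F_2 and Z.\<close>

lemma three_mild:
  assumes n: "n = 3"
  shows "admits_mild_presentation PB"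
proof -
  have mem: "1 \<in> {1..<n}" "2 \<in> {1..<n}" using n by simp_all
  define S where "S = {1..3::nat}"
  have S_iff: "s \<in> S \<longleftrightarrow> s = 1 \<or> s = 2 \<or> s = 3" for s
    by (auto simp: S_def)
  interpret Q: commutator_presentation 3 2 S "{1, 2}" "\<lambda>i. Suc i" "\<lambda>_. 3" "\<lambda>i. letter (Suc i)"
  proof
    show "letter (Suc i) \<in> carrier (free_group S)" if "i < 2" for i
      using that by (intro letter_closed) (auto simp: S_iff)
  qed (auto simp: S_iff magnus_degree_one_letter)
  let ?g = "Q.gen"
  have gs: "?g 1 \<in> carrier Q.P" "?g 2 \<in> carrier Q.P" "?g 3 \<in> carrier Q.P"
    using Q.gen_closed by (auto simp: S_iff)
  have g3: "commutes Q.P (?g 3) (?g 1)" "commutes Q.P (?g 3) (?g 2)"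
    using Q.gen_commutes[of 0] Q.gen_commutes[of 1] gs by (simp_all add: Q.P.word_eval_letter flip: One_nat_def)
  let ?i = "m_inv Q.P"
  \<comment> \<open>The labels come from the positive coset representatives. A crossing of strands a
    < b lengthens the representative and gets label one. The strands 3, 1 contribute b a^2 b^(-1) at
    position 1 and a b^2 a^(-1) at position 2, rewritten by
    \<open>three_strand_braids\<close>.\<close>
  define d where "d i a b = (if a < b then \<one>\<^bsub>Q.P\<^esub> else if (a, b) = (2, 1) then ?g 1
    else if (a, b) = (3, 2) then ?g 2 else if i = 1 then ?g 3 \<otimes>\<^bsub>Q.P\<^esub> ?i (?g 1) \<otimes>\<^bsub>Q.P\<^esub> ?i (?g 2)
    else ?g 3 \<otimes>\<^bsub>Q.P\<^esub> ?i (?g 2) \<otimes>\<^bsub>Q.P\<^esub> ?i (?g 1))" for i a b :: nat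
  have move: "?g 1 \<otimes>\<^bsub>Q.P\<^esub> (?g 3 \<otimes>\<^bsub>Q.P\<^esub> y) = ?g 3 \<otimes>\<^bsub>Q.P\<^esub> (?g 1 \<otimes>\<^bsub>Q.P\<^esub> y)"
    "?g 2 \<otimes>\<^bsub>Q.P\<^esub> (?g 3 \<otimes>\<^bsub>Q.P\<^esub> y) = ?g 3 \<otimes>\<^bsub>Q.P\<^esub> (?g 2 \<otimes>\<^bsub>Q.P\<^esub> y)" if "y \<in> carrier Q.P" for y
    using g3 gs that by (simp_all add: commutes_def flip: Q.P.m_assoc)
  have d: "braid_cocycle n Q.P d"
  proof (intro braid_cocycle.intro braid_cocycle_axioms.intro Q.P.is_group)
    show "d i a b \<in> carrier Q.P" for i a b using gs by (simp add: d_def)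
    show "d i a b \<otimes>\<^bsub>Q.P\<^esub> d j a' b' = d j a' b' \<otimes>\<^bsub>Q.P\<^esub> d i a b"
      if "i \<in> {1..<n}" "j \<in> {1..<n}" "i + 2 \<le> j" for i j a b a' b'
      using that n by simp
    show "d i a b \<otimes>\<^bsub>Q.P\<^esub> (d (Suc i) a c \<otimes>\<^bsub>Q.P\<^esub> d i b c) = d (Suc i) b c \<otimes>\<^bsub>Q.P\<^esub> (d i a c \<otimes>\<^bsub>Q.P\<^esub> d (Suc i) a b)"
      if "i \<in> {1..<n}" "Suc i \<in> {1..<n}" "{a, b, c} \<subseteq> {1..n}" "distinct [a, b, c]" for i a b c
    proof -
      have "i = 1" using that(1,2) n by auto
      then show ?thesis
        using three_cases[OF that(3)[unfolded n] that(4)] gs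
        by (elim disjE) (simp_all add: d_def Q.P.m_assoc move)
    qed
  qed
  interpret D: braid_cocycle n Q.P d by (rule d)
  let ?a = "\<sigma> 1" and ?b = "\<sigma> 2"
  define z where "z = ?a \<cdot> (?b \<cdot> (?a \<cdot> (?b \<cdot> (?a \<cdot> ?b))))"
  have c: "?a \<in> carrier P" "?b \<in> carrier P" using mem by (auto intro!: sigma_closed)
  have zc: "z \<in> carrier P" using c by (simp add: z_def)
  have aba: "?a \<cdot> (?b \<cdot> ?a) = ?b \<cdot> (?a \<cdot> ?b)" using near[of 1] n by simp
  note z = P.three_strand_braids[OF c aba z_def]
  define f where "f s = [\<one>\<^bsub>P\<^esub>, ?a \<cdot> ?a, ?b \<cdot> ?b, z] ! s" for s
  have f1: "f 1 = ?a \<cdot> ?a" "f 2 = ?b \<cdot> ?b" "f 3 = z" by (simp_all add: f_def)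
  note perm_simps = PB_simps perm_mult perm_sigma[OF mem(1)] perm_sigma[OF mem(2)] c fun_eq_iff sym_group_def transpose_def
  have fPB: "f 1 \<in> carrier PB" "f 2 \<in> carrier PB" "f 3 \<in> carrier PB"
    unfolding f1 z_def by (auto simp: perm_simps)
  then have f: "f \<in> S \<rightarrow> carrier PB" by (auto simp: S_iff)
  \<comment> \<open>Positive lifts of the six permutations; \<open>\<nu> i\<close> records right
    multiplication by the transposition \<open>s i\<close> on their indices.\<close>
  define \<tau> where "\<tau> k = [\<one>\<^bsub>P\<^esub>, ?a, ?b, ?a \<cdot> ?b, ?b \<cdot> ?a, ?a \<cdot> (?b \<cdot> ?a)] ! k" for k
  define \<nu> where "\<nu> i k = (if i = 1 then [1, 0, 4, 5, 2, 3] else [2, 3, 0, 1, 5, 4 :: nat]) ! k" for i k :: nat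
  have six: "k = 0 \<or> k = 1 \<or> k = 2 \<or> k = 3 \<or> k = 4 \<or> k = 5" if "k \<in> {..<6}" for k :: nat
    using that by auto
  have i12: "i = 1 \<or> i = 2" if "i \<in> {1..<n}" for i using that n by auto
  have moves: "\<exists>h\<in>H. \<tau> k \<cdot> \<sigma> i = h \<cdot> \<tau> (\<nu> i k)"
    if H: "subgroup H P" and fH: "\<And>s. s \<in> S \<Longrightarrow> f s \<in> H" and i: "i \<in> {1..<n}" and k: "k \<in> {..<6}"
    for H i k
  proof -
    have hs: "\<one>\<^bsub>P\<^esub> \<in> H" "?a \<cdot> ?a \<in> H" "?b \<cdot> ?b \<in> H" "z \<in> H"
      using subgroup.one_closed[OF H] fH[of 1] fH[of 2] fH[of 3] by (simp_all add: S_iff f1)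
    have "z \<cdot> inv\<^bsub>P\<^esub> (?b \<cdot> ?b) \<cdot> inv\<^bsub>P\<^esub> (?a \<cdot> ?a) \<in> H"
      "z \<cdot> inv\<^bsub>P\<^esub> (?a \<cdot> ?a) \<cdot> inv\<^bsub>P\<^esub> (?b \<cdot> ?b) \<in> H"
      by (intro subgroup.m_closed[OF H] subgroup.m_inv_closed[OF H] hs(2-4))+
    then have hs': "?a \<cdot> ?b \<cdot> ?b \<cdot> inv\<^bsub>P\<^esub> ?a \<in> H" "?b \<cdot> ?a \<cdot> ?a \<cdot> inv\<^bsub>P\<^esub> ?b \<in> H"
      unfolding z(3,4) .
    have abab: "?a \<cdot> (?b \<cdot> (?a \<cdot> ?b)) = ?a \<cdot> (?a \<cdot> (?b \<cdot> ?a))"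
      unfolding aba ..
    let ?ok = "\<lambda>h. h \<in> H \<and> \<tau> k \<cdot> \<sigma> i = h \<cdot> \<tau> (\<nu> i k)"
    have "?ok \<one>\<^bsub>P\<^esub> \<or> ?ok (?a \<cdot> ?a) \<or> ?ok (?b \<cdot> ?b) \<or> ?ok (?a \<cdot> ?b \<cdot> ?b \<cdot> inv\<^bsub>P\<^esub> ?a)
        \<or> ?ok (?b \<cdot> ?a \<cdot> ?a \<cdot> inv\<^bsub>P\<^esub> ?b)"
      using i12[OF i] six[OF k] hs hs' c
      by (elim disjE) (simp_all add: \<tau>_def \<nu>_def P.m_assoc aba[symmetric] z(5) abab)
    then show ?thesis by blast
  qed
  have "PB \<cong> Q.P"
  proof (rule iso_PB[OF Q.presentation_axioms d f, where \<tau> = \<tau> and K = "{..<6}" and \<nu> = \<nu>])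
    show "word_eval PB f r = \<one>\<^bsub>PB\<^esub>" if "r \<in> set Q.rels" for r
    proof (rule Q.rels_eval[OF group_PB f _ that])
      interpret PB: group PB by (rule group_PB)
      have "commutes P z (?a \<cdot> ?a)" "commutes P z (?b \<cdot> ?b)"
        using z(1,2) c zc by (simp_all add: P.commutes_mult)
      then have "commutes PB (f 3) (f 1)" "commutes PB (f 3) (f 2)"
        by (simp_all add: f1 commutes_def PB_simps)
      moreover fix i :: nat assume "i < 2"
      then have "i = 0 \<or> i = 1" by auto
      ultimately show "commutes PB (f 3) (word_eval PB f (letter (Suc i)))"
        using fPB by (auto simp: PB.word_eval_letter simp flip: One_nat_def)
    qed
    note step = D.kappa_step[OF mem(1), simplified] D.kappa_step[OF mem(2), simplified]
      D.kappa_sigma[OF mem(1), simplified] D.kappa_sigma[OF mem(2), simplified]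
    note comp = s_permutes[OF mem(1), simplified] s_permutes[OF mem(2), simplified]
      D.comp_s_permutes[OF mem(1), simplified] D.comp_s_permutes[OF mem(2), simplified]
    have "D.\<kappa> id (f 1) = ?g 1" "D.\<kappa> id (f 2) = ?g 2"
      unfolding f1 using c gs by (simp_all add: step comp permutes_id transpose_def d_def)
    moreover have "D.\<kappa> id (f 3) = ?g 3"
      unfolding f1 z_def using c gs move(1)
      by (simp add: step comp permutes_id transpose_def d_def Q.P.m_assoc)
    ultimately show "D.\<kappa> id (f s) = ?g s" if "s \<in> S" for s using that by (auto simp: S_iff)
    show "\<tau> ` {..<6} \<subseteq> carrier P" using c six by (fastforce simp: \<tau>_def)
    have "\<one>\<^bsub>P\<^esub> = \<tau> 0" by (simp add: \<tau>_def)
    then show "\<one>\<^bsub>P\<^esub> \<in> \<tau> ` {..<6}" by (rule image_eqI) simp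
    show "\<nu> i k \<in> {..<6} \<and> \<nu> i (\<nu> i k) = k \<and> (\<exists>h\<in>H. \<tau> k \<cdot> \<sigma> i = h \<cdot> \<tau> (\<nu> i k))"
      if H: "subgroup H P" "\<And>s. s \<in> S \<Longrightarrow> f s \<in> H" and i: "i \<in> {1..<n}" and k: "k \<in> {..<6}" for H i k
    proof (intro conjI moves[OF H i k])
      show "\<nu> i k \<in> {..<6}" "\<nu> i (\<nu> i k) = k" using six[OF k] by (elim disjE; simp add: \<nu>_def)+
    qed
    show "\<tau> k = \<one>\<^bsub>P\<^esub>" if k: "k \<in> {..<6}" and p: "braid_perm n (\<tau> k) = id" for k
      using six[OF k] fun_cong[OF p, of 1] fun_cong[OF p, of 2]
      by (elim disjE) (simp_all add: \<tau>_def perm_simps)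
  qed
  then show ?thesis by (rule Q.admits_mild)
qed

lemma two_mild:
  assumes n: "n = 2"
  shows "admits_mild_presentation PB"
proof -
  have mem: "1 \<in> {1..<n}" using n by simp
  define S where "S = {1 :: nat}"
  have S_iff: "s \<in> S \<longleftrightarrow> s = 1" for s by (simp add: S_def)
  interpret Q: commutator_presentation 1 0 S "{}" "\<lambda>_. 0" "\<lambda>_. 0" "\<lambda>_. []"
    by unfold_locales (simp_all add: S_def)
  have g: "Q.gen 1 \<in> carrier Q.P" using Q.gen_closed by (auto simp: S_iff)
  \<comment> \<open>Only the crossing that brings the two strands back contributes, so \<sigma>_1^2
    goes to the generator.\<close>
  define d where "d i a b = (if a < b then \<one>\<^bsub>Q.P\<^esub> else Q.gen 1)" for i a b :: nat
  have d: "braid_cocycle n Q.P d"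
    by (intro braid_cocycle.intro braid_cocycle_axioms.intro Q.P.is_group)
      (use g n in \<open>auto simp: d_def\<close>)
  interpret D: braid_cocycle n Q.P d by (rule d)
  have c: "\<sigma> 1 \<in> carrier P" by (rule sigma_closed[OF mem])
  have fPB: "\<sigma> 1 \<cdot> \<sigma> 1 \<in> carrier PB"
    using c by (auto simp: PB_simps perm_mult perm_sigma[OF mem] sym_group_def fun_eq_iff transpose_def)
  have i1: "i = 1" if "i \<in> {1..<n}" for i using that n by simp
  define \<tau> where "\<tau> k = [\<one>\<^bsub>P\<^esub>, \<sigma> 1] ! k" for k
  have two: "k = 0 \<or> k = 1" if "k \<in> {..<2}" for k :: nat using that by auto
  have "PB \<cong> Q.P"
  proof (rule iso_PB[OF Q.presentation_axioms d, where f = "\<lambda>s. \<sigma> 1 \<cdot> \<sigma> 1" and \<tau> = \<tau>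
        and K = "{..<2}" and \<nu> = "\<lambda>i k. 1 - k"])
    show "(\<lambda>s. \<sigma> 1 \<cdot> \<sigma> 1) \<in> S \<rightarrow> carrier PB" using fPB by simp
    show "word_eval PB (\<lambda>s. \<sigma> 1 \<cdot> \<sigma> 1) r = \<one>\<^bsub>PB\<^esub>" if "r \<in> set Q.rels" for r
      using that by (simp add: Q.rels_def)
    show "D.\<kappa> id (\<sigma> 1 \<cdot> \<sigma> 1) = Q.gen s" if "s \<in> S" for s
      using that c g D.kappa_step[OF mem, simplified] D.kappa_sigma[OF mem, simplified]
        s_permutes[OF mem, simplified]
      by (simp add: S_iff permutes_id transpose_def d_def)
    show "\<tau> ` {..<2} \<subseteq> carrier P" using c two by (fastforce simp: \<tau>_def)
    have "\<one>\<^bsub>P\<^esub> = \<tau> 0" by (simp add: \<tau>_def)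
    then show "\<one>\<^bsub>P\<^esub> \<in> \<tau> ` {..<2}" by (rule image_eqI) simp
    show "1 - k \<in> {..<2} \<and> 1 - (1 - k) = k \<and> (\<exists>h\<in>H. \<tau> k \<cdot> \<sigma> i = h \<cdot> \<tau> (1 - k))"
      if H: "subgroup H P" and fH: "\<And>s. s \<in> S \<Longrightarrow> \<sigma> 1 \<cdot> \<sigma> 1 \<in> H" and i: "i \<in> {1..<n}" and k: "k \<in> {..<2}"
      for H i k
    proof -
      have h: "\<one>\<^bsub>P\<^esub> \<in> H" "\<sigma> 1 \<cdot> \<sigma> 1 \<in> H" using subgroup.one_closed[OF H] fH[of 1] by (simp_all add: S_iff)
      let ?ok = "\<lambda>h. h \<in> H \<and> \<tau> k \<cdot> \<sigma> i = h \<cdot> \<tau> (1 - k)"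
      have "?ok \<one>\<^bsub>P\<^esub> \<or> ?ok (\<sigma> 1 \<cdot> \<sigma> 1)"
        using two[OF k] h c by (elim disjE) (simp_all add: \<tau>_def i1[OF i])
      then show ?thesis using two[OF k] by auto
    qed
    show "\<tau> k = \<one>\<^bsub>P\<^esub>" if k: "k \<in> {..<2}" and p: "braid_perm n (\<tau> k) = id" for k
      using two[OF k] fun_cong[OF p, of 1]
      by (elim disjE) (simp_all add: \<tau>_def perm_sigma[OF mem])
  qed
  then show ?thesis by (rule Q.admits_mild)
qed

lemma one_mild:
  assumes n: "n = 1"
  shows "admits_mild_presentation PB"
proof -
  interpret Q: commutator_presentation 0 0 "{}" "{}" "\<lambda>_. 0" "\<lambda>_. 0" "\<lambda>_. []"
    by unfold_locales simp_all
  have d: "braid_cocycle n Q.P (\<lambda>_ _ _. \<one>\<^bsub>Q.P\<^esub>)"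
    by (intro braid_cocycle.intro braid_cocycle_axioms.intro Q.P.is_group) auto
  have "PB \<cong> Q.P"
    by (rule iso_PB[OF Q.presentation_axioms d, where f = "\<lambda>s. \<one>\<^bsub>P\<^esub>" and \<tau> = "\<lambda>k. \<one>\<^bsub>P\<^esub>"
        and K = "{0 :: nat}" and \<nu> = "\<lambda>i k. k"])
      (use P.one_closed n in \<open>auto simp: Q.rels_def\<close>)
  then show ?thesis by (rule Q.admits_mild)
qed

end

theorem proposition1p1:
  fixes n :: nat
  assumes "n \<ge> 1"
  shows "(admits_mild_presentation (pure_braid_group n) \<longleftrightarrow> n \<le> 3) \<and>
         (admits_mild_presentation (pure_virtual_braid_group n) \<longleftrightarrow> n \<le> 3) \<and>
         (admits_mild_presentation (upper_pure_virtual_braid_group n) \<longleftrightarrow> n \<le> 3)"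
proof -
  interpret B: artin_braids n .
  interpret V: virtual_braids n .
  have V: "pure_virtual_braid_group n = V.P" by (simp add: pure_virtual_braid_group_def)
  have U: "upper_pure_virtual_braid_group n = V.U"
    by (simp add: upper_pure_virtual_braid_group_def V)
  consider "n = 1" | "n = 2" | "n = 3" | "4 \<le> n" using assms by linarith
  then show ?thesis
  proof cases
    case 1
    then show ?thesis unfolding V U using B.one_mild V.one_mild by simp
  next
    case 2
    then show ?thesis unfolding V U using B.two_mild V.two_mild by simp
  next
    case 3
    then show ?thesis unfolding V U using B.three_mild V.three_mild V.three_upper_mild by simp
  next
    case 4
    then show ?thesis unfolding V U using B.four_not_mild V.four_not_mild by simp
  qed
qed

end
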